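(* Let $(C(SG),H_{SG},D_{SG})$ be the spectral triple of the Sierpinski gasket $SG$ defined in the context, with representation $\pi_{SG}$, let $\mathrm{Tr}_\omega$ be a Dixmier trace on $B(H_{SG})$, and let $\tau$ be the functional on $C(SG)$ given by $$\tau(f):=\mathrm{Tr}_\omega\left(\pi_{SG}(f)\,|D_{SG}|^{-\frac{\log3}{\log2}}\right).$$ Let $\mu$ be the Hausdorff probability measure on $SG$ and $\psi(f)=\int_{SG}f\,d\mu$. Then, for any continuous complex-valued function $f$ on $SG$, $$\tau(f)=\frac{4}{\log3}\cdot\zeta\left(\frac{\log3}{\log2}\right)\cdot\int_{SG}f(x)\,d\mu(x)=\frac{4}{\log3}\cdot\zeta\left(\frac{\log3}{\log2}\right)\cdot\psi(f),$$ where $\zeta$ is the Riemann zeta function.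
   Context: The Hausdorff probability measure $\mu$ on $SG$ is the normalization to total mass $1$ of the restriction to $SG$ of the Hausdorff measure of dimension $\log3/\log2$. Dixmier trace (as in Connes' book "Noncommutative Geometry"): $\omega$ is a positive linear form on $\ell^\infty(\mathbb{N})$ with $\omega(1)=1$, vanishing on sequences converging to $0$, and scale invariant, $\omega(\alpha_1,\alpha_1,\alpha_2,\alpha_2,\dots)=\omega(\alpha_1,\alpha_2,\dots)$; for a positive compact operator $T$ with eigenvalues (with multiplicity) $\mu_0(T)\ge\mu_1(T)\ge\cdots$ such that $\frac{1}{\log N}\sum_{j=0}^{N-1}\mu_j(T)$ ($N\ge2$) is bounded, $\mathrm{Tr}_\omega(T)$ is $\omega$ applied to this sequence, and $\mathrm{Tr}_\omega$ is extended by linearity. The Sierpinski gasket: let $SG_0\subset\mathbb{R}^2$ be the boundary (three sides) of an equilateral triangle with side length $2\pi/3$, vertices $v_1,v_2,v_3$, and horizontal bottom edge. Let $F_j(x)=(x+v_j)/2$, $j=1,2,3$. Let $SG_n$ be the union of the $3^n$ triangles $F_{j_1}\circ\cdots\circ F_{j_n}(SG_0)$, each an equilateral triangle (boundary only) of side length $2^{1-n}\pi/3$ and perimeter $2^{1-n}\pi$; number these triangles $\Delta_{n,i}$, $1\le i\le 3^n$. Then $SG$ is the closure of $\bigcup_n SG_n$. For each $n\in\mathbb{N}_0=\{0,1,2,\dots\}$ and $i\in\{1,\dots,3^n\}$ let $r_{n,i}:[-2^{-n}\pi,2^{-n}\pi]\to\Delta_{n,i}$ be the parameterization by arclength (modulo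 $2^{1-n}\pi$), counterclockwise, with $r_{n,i}(0)$ the lower right-hand corner of $\Delta_{n,i}$. Let $H_{n,i}=L^2([-2^{-n}\pi,2^{-n}\pi])$ with respect to normalized Lebesgue measure, let $\pi_{n,i}(f)$, for $f\in C(SG)$, be multiplication by $f\circ r_{n,i}$, and let $D_{n,i}$ be the self-adjoint operator on $H_{n,i}$ with $D_{n,i}\phi_k=2^n(k+\tfrac12)\phi_k$ for $k\in\mathbb{Z}$, where $\phi_k(t)=\exp(i2^nkt)$ is an orthonormal basis of $H_{n,i}$. Then $H_{SG}=\bigoplus_{n,i}H_{n,i}$, $\pi_{SG}=\bigoplus_{n,i}\pi_{n,i}$, $D_{SG}=\bigoplus_{n,i}D_{n,i}$. *)

theory Defs
  imports "HOL-Analysis.Analysis"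
begin

section \<open>Complex Hilbert spaces and the Dixmier trace\<close>

class complex_hilbert_space = real_inner + complete_space +
  fixes scaleC :: "complex \<Rightarrow> 'a \<Rightarrow> 'a"  (infixr "*\<^sub>C" 75)
    and cinner :: "'a \<Rightarrow> 'a \<Rightarrow> complex"
  assumes scaleC_add_right: "c *\<^sub>C (x + y) = c *\<^sub>C x + c *\<^sub>C y"
    and scaleC_add_left: "(c + d) *\<^sub>C x = c *\<^sub>C x + d *\<^sub>C x"
    and scaleC_scaleC: "c *\<^sub>C d *\<^sub>C x = (c * d) *\<^sub>C x"
    and scaleR_eq_scaleC: "r *\<^sub>R x = of_real r *\<^sub>C x"
    and cinner_commute: "cinner x y = cnj (cinner y x)"
    and cinner_add_left: "cinner (x + y) z = cinner x z + cinner y z"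
    and cinner_scaleC_left: "cinner (c *\<^sub>C x) y = c * cinner x y"
    and inner_eq_Re_cinner: "inner x y = Re (cinner x y)"

lemma vector_space_scaleC: "vector_space (scaleC :: complex \<Rightarrow> 'a \<Rightarrow> 'a::complex_hilbert_space)"
proof
  show "1 *\<^sub>C x = x" for x :: 'a
    using scaleR_eq_scaleC[of 1 x] by simp
qed (simp_all add: scaleC_add_right scaleC_add_left scaleC_scaleC)

text \<open>Operators are plain functions; sums and multiples of operators are taken pointwise.\<close>

definition bounded_operator :: "('a \<Rightarrow> 'a::complex_hilbert_space) \<Rightarrow> bool" where
  "bounded_operator T \<longleftrightarrow> bounded_linear T \<and> (\<forall>c x. T (c *\<^sub>C x) = c *\<^sub>C T x)"

definition compact_operator :: "('a \<Rightarrow> 'a::complex_hilbert_space) \<Rightarrow> bool" where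
  "compact_operator T \<longleftrightarrow> bounded_operator T \<and> compact (closure (T ` cball 0 1))"

definition positive_operator :: "('a \<Rightarrow> 'a::complex_hilbert_space) \<Rightarrow> bool" where
  "positive_operator T \<longleftrightarrow> bounded_operator T \<and> (\<forall>x. cinner (T x) x \<in> \<real>\<^sub>\<ge>\<^sub>0)"

text \<open>The eigenvalues \<open>\<mu>\<^sub>0 \<ge> \<mu>\<^sub>1 \<ge> \<dots>\<close> of a positive compact operator, each nonzero one repeated
  according to its (complex) multiplicity.  As usual, the sequence is continued by zeros if there
  are only finitely many nonzero eigenvalues.\<close>

definition eigenvalues :: "('a \<Rightarrow> 'a::complex_hilbert_space) \<Rightarrow> nat \<Rightarrow> real" where
  "eigenvalues T = (THE \<mu>. decseq \<mu> \<and> (\<forall>j. 0 \<le> \<mu> j) \<and>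
     (\<forall>\<nu>>0. finite {j. \<mu> j = \<nu>} \<and>
        card {j. \<mu> j = \<nu>} = vector_space.dim scaleC {x. T x = of_real \<nu> *\<^sub>C x}))"

text \<open>The sequence \<open>(\<Sum>j<N. \<mu>\<^sub>j(T)) / log N\<close>, \<open>N \<ge> 2\<close>.\<close>

definition log_means :: "('a \<Rightarrow> 'a::complex_hilbert_space) \<Rightarrow> nat \<Rightarrow> real" where
  "log_means T n = (\<Sum>j<n + 2. eigenvalues T j) / ln (real (n + 2))"

definition dixmier_positive :: "('a \<Rightarrow> 'a::complex_hilbert_space) \<Rightarrow> bool" where
  "dixmier_positive T \<longleftrightarrow> positive_operator T \<and> compact_operator T \<and> Bseq (log_means T)"

text \<open>The linear forms on \<open>\<ell>\<^sup>\<infinity>(\<nat>)\<close> that define Dixmier traces; the values on unbounded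
  sequences are irrelevant.\<close>

definition dixmier_form :: "((nat \<Rightarrow> complex) \<Rightarrow> complex) \<Rightarrow> bool" where
  "dixmier_form \<omega> \<longleftrightarrow>
     (\<forall>a b c d. Bseq a \<longrightarrow> Bseq b \<longrightarrow> \<omega> (\<lambda>n. c * a n + d * b n) = c * \<omega> a + d * \<omega> b) \<and>
     (\<forall>a. Bseq a \<longrightarrow> (\<forall>n. a n \<in> \<real>\<^sub>\<ge>\<^sub>0) \<longrightarrow> \<omega> a \<in> \<real>\<^sub>\<ge>\<^sub>0) \<and>
     \<omega> (\<lambda>n. 1) = 1 \<and>
     (\<forall>a. a \<longlonglongrightarrow> 0 \<longrightarrow> \<omega> a = 0) \<and>
     (\<forall>a. Bseq a \<longrightarrow> \<omega> (\<lambda>n. a (n div 2)) = \<omega> a)"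

text \<open>The extension by linearity from the positive operators to their complex linear span, which
  consists of the operators \<open>A - B + i (C - D)\<close>.\<close>

definition dixmier_trace ::
    "((nat \<Rightarrow> complex) \<Rightarrow> complex) \<Rightarrow> ('a \<Rightarrow> 'a::complex_hilbert_space) \<Rightarrow> complex" where
  "dixmier_trace \<omega> T = (THE c. \<exists>A B C D.
     dixmier_positive A \<and> dixmier_positive B \<and> dixmier_positive C \<and> dixmier_positive D \<and>
     T = (\<lambda>x. A x - B x + \<i> *\<^sub>C (C x - D x)) \<and>
     c = \<omega> (of_real \<circ> log_means A) - \<omega> (of_real \<circ> log_means B)
         + \<i> * (\<omega> (of_real \<circ> log_means C) - \<omega> (of_real \<circ> log_means D)))"

text \<open>Unbounded operators are given by their graphs.  For a self-adjoint \<open>D\<close> whose eigenvectors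
  span a dense subspace, and a function \<open>g\<close> that is bounded on the eigenvalues, \<open>g(D)\<close> is the
  bounded operator that acts as \<open>g(\<nu>)\<close> on the \<open>\<nu>\<close>-eigenspace of \<open>D\<close>.\<close>

definition functional_calculus ::
    "(real \<Rightarrow> complex) \<Rightarrow> ('a \<times> 'a) set \<Rightarrow> 'a \<Rightarrow> 'a::complex_hilbert_space" where
  "functional_calculus g D = (THE B. bounded_operator B \<and>
     (\<forall>\<nu> x. (x, of_real \<nu> *\<^sub>C x) \<in> D \<longrightarrow> B x = g \<nu> *\<^sub>C x))"


section \<open>Hilbert sums of \<open>L\<^sup>2\<close> spaces\<close>

definition l2_sum :: "('i \<Rightarrow> 'b measure) \<Rightarrow> ('i \<Rightarrow> 'b \<Rightarrow> complex) \<Rightarrow> bool" where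
  "l2_sum M h \<longleftrightarrow>
     (\<forall>i. h i \<in> borel_measurable (M i) \<and> integrable (M i) (\<lambda>t. (cmod (h i t))\<^sup>2)) \<and>
     (\<lambda>i. \<integral>t. (cmod (h i t))\<^sup>2 \<partial>M i) summable_on UNIV"

definition l2_inner ::
    "('i \<Rightarrow> 'b measure) \<Rightarrow> ('i \<Rightarrow> 'b \<Rightarrow> complex) \<Rightarrow> ('i \<Rightarrow> 'b \<Rightarrow> complex) \<Rightarrow> complex" where
  "l2_inner M g h = (\<Sum>\<^sub>\<infinity>i. \<integral>t. g i t * cnj (h i t) \<partial>M i)"

definition l2_eq ::
    "('i \<Rightarrow> 'b measure) \<Rightarrow> ('i \<Rightarrow> 'b \<Rightarrow> complex) \<Rightarrow> ('i \<Rightarrow> 'b \<Rightarrow> complex) \<Rightarrow> bool" where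
  "l2_eq M g h \<longleftrightarrow> l2_sum M g \<and> l2_sum M h \<and> (\<forall>i. AE t in M i. g i t = h i t)"

definition l2_energy :: "('i \<Rightarrow> 'b measure) \<Rightarrow> ('i \<Rightarrow> 'b \<Rightarrow> complex) \<Rightarrow> ennreal" where
  "l2_energy M h = (\<integral>\<^sup>+i. \<integral>\<^sup>+t. ennreal ((cmod (h i t))\<^sup>2) \<partial>M i \<partial>count_space UNIV)"

lemma nn_integral_count_space_ennreal:
  fixes f :: "'i \<Rightarrow> real"
  assumes "\<And>i. 0 \<le> f i"
  shows "f summable_on UNIV \<longleftrightarrow> (\<integral>\<^sup>+i. ennreal (f i) \<partial>count_space UNIV) < \<infinity>"
    and "f summable_on UNIV \<Longrightarrow> (\<integral>\<^sup>+i. ennreal (f i) \<partial>count_space UNIV) = ennreal (infsum f UNIV)"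
proof -
  have eq: "f summable_on UNIV \<longleftrightarrow> integrable (count_space UNIV) f"
    using abs_summable_equivalent[of f UNIV] assms
    by (simp add: Infinite_Set_Sum.abs_summable_on_def)
  show "f summable_on UNIV \<longleftrightarrow> (\<integral>\<^sup>+i. ennreal (f i) \<partial>count_space UNIV) < \<infinity>"
    unfolding eq integrable_iff_bounded using assms by simp
  show "(\<integral>\<^sup>+i. ennreal (f i) \<partial>count_space UNIV) = ennreal (infsum f UNIV)"
    if "f summable_on UNIV"
  proof -
    have "Infinite_Set_Sum.abs_summable_on f UNIV"
      using that eq by (simp add: Infinite_Set_Sum.abs_summable_on_def)
    then have "infsum f UNIV = infsetsum f UNIV"
      by (simp add: infsetsum_infsum)
    then show ?thesis
      using that eq assms by (simp add: infsetsum_def nn_integral_eq_integral)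
  qed
qed

lemma l2_sum_iff:
  "l2_sum M h \<longleftrightarrow> (\<forall>i. h i \<in> borel_measurable (M i)) \<and> l2_energy M h < \<infinity>"
proof
  assume h: "l2_sum M h"
  then have "l2_energy M h = (\<integral>\<^sup>+i. ennreal (\<integral>t. (cmod (h i t))\<^sup>2 \<partial>M i) \<partial>count_space UNIV)"
    unfolding l2_energy_def l2_sum_def by (intro nn_integral_cong nn_integral_eq_integral) auto
  also have "\<dots> < \<infinity>"
    using h nn_integral_count_space_ennreal(1)[of "\<lambda>i. \<integral>t. (cmod (h i t))\<^sup>2 \<partial>M i"]
    by (simp add: l2_sum_def)
  finally show "(\<forall>i. h i \<in> borel_measurable (M i)) \<and> l2_energy M h < \<infinity>"
    using h by (simp add: l2_sum_def)
next
  assume h: "(\<forall>i. h i \<in> borel_measurable (M i)) \<and> l2_energy M h < \<infinity>"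
  then have [measurable]: "h i \<in> borel_measurable (M i)" for i by blast
  have "(\<integral>\<^sup>+t. ennreal ((cmod (h i t))\<^sup>2) \<partial>M i) \<le> l2_energy M h" for i
    unfolding l2_energy_def by (rule nn_integral_ge_point) simp
  then have fin: "(\<integral>\<^sup>+t. ennreal ((cmod (h i t))\<^sup>2) \<partial>M i) < \<infinity>" for i
    using h le_less_trans by blast
  have int: "integrable (M i) (\<lambda>t. (cmod (h i t))\<^sup>2)" for i
    by (rule integrableI_bounded) (use fin[of i] in simp_all)
  have "l2_energy M h = (\<integral>\<^sup>+i. ennreal (\<integral>t. (cmod (h i t))\<^sup>2 \<partial>M i) \<partial>count_space UNIV)"
    unfolding l2_energy_def by (intro nn_integral_cong nn_integral_eq_integral int) auto
  then have "(\<lambda>i. \<integral>t. (cmod (h i t))\<^sup>2 \<partial>M i) summable_on UNIV"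
    using h nn_integral_count_space_ennreal(1)[of "\<lambda>i. \<integral>t. (cmod (h i t))\<^sup>2 \<partial>M i"] by simp
  then show "l2_sum M h" using int by (simp add: l2_sum_def)
qed

lemma l2_sum_measurable: "l2_sum M h \<Longrightarrow> h i \<in> borel_measurable (M i)"
  by (simp add: l2_sum_def)

lemma l2_energy_eq:
  assumes "l2_sum M h"
  shows "l2_energy M h = ennreal (\<Sum>\<^sub>\<infinity>i. \<integral>t. (cmod (h i t))\<^sup>2 \<partial>M i)"
proof -
  have "l2_energy M h = (\<integral>\<^sup>+i. ennreal (\<integral>t. (cmod (h i t))\<^sup>2 \<partial>M i) \<partial>count_space UNIV)"
    using assms
    unfolding l2_energy_def l2_sum_def by (intro nn_integral_cong nn_integral_eq_integral) auto
  also have "\<dots> = ennreal (\<Sum>\<^sub>\<infinity>i. \<integral>t. (cmod (h i t))\<^sup>2 \<partial>M i)"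
    by (rule nn_integral_count_space_ennreal(2)) (use assms in \<open>auto simp: l2_sum_def\<close>)
  finally show ?thesis .
qed

lemma l2_energy_mono:
  assumes "\<And>i t. cmod (g i t) \<le> cmod (h i t)"
  shows "l2_energy M g \<le> l2_energy M h"
  unfolding l2_energy_def
  by (intro nn_integral_mono ennreal_leI power_mono) (use assms in auto)

lemma l2_sum_zero: "l2_sum M (\<lambda>i t. 0)"
  by (simp add: l2_sum_iff l2_energy_def)

lemma cmod_add_square_le: "(cmod (a + b))\<^sup>2 \<le> 2 * (cmod a)\<^sup>2 + 2 * (cmod b)\<^sup>2"
proof -
  have "(cmod (a + b))\<^sup>2 \<le> (cmod a + cmod b)\<^sup>2"
    by (intro power_mono norm_triangle_ineq) simp
  also have "\<dots> \<le> 2 * (cmod a)\<^sup>2 + 2 * (cmod b)\<^sup>2"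
    using sum_squares_bound[of "cmod a" "cmod b"] by (simp add: power2_sum)
  finally show ?thesis .
qed

lemma l2_sum_add:
  assumes "l2_sum M g" "l2_sum M h"
  shows "l2_sum M (\<lambda>i t. g i t + h i t)"
proof -
  have [measurable]: "g i \<in> borel_measurable (M i)" "h i \<in> borel_measurable (M i)" for i
    using assms by (simp_all add: l2_sum_measurable)
  have "l2_energy M (\<lambda>i t. g i t + h i t)
      \<le> (\<integral>\<^sup>+i. \<integral>\<^sup>+t. 2 * ennreal ((cmod (g i t))\<^sup>2) + 2 * ennreal ((cmod (h i t))\<^sup>2) \<partial>M i \<partial>count_space UNIV)"
    unfolding l2_energy_def
  proof (intro nn_integral_mono)
    fix i t
    have "ennreal ((cmod (g i t + h i t))\<^sup>2) \<le> ennreal (2 * (cmod (g i t))\<^sup>2 + 2 * (cmod (h i t))\<^sup>2)"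
      by (intro ennreal_leI cmod_add_square_le)
    then show "ennreal ((cmod (g i t + h i t))\<^sup>2)
        \<le> 2 * ennreal ((cmod (g i t))\<^sup>2) + 2 * ennreal ((cmod (h i t))\<^sup>2)"
      by (simp add: ennreal_plus ennreal_mult)
  qed
  also have "\<dots> = 2 * l2_energy M g + 2 * l2_energy M h"
    unfolding l2_energy_def
    by (subst nn_integral_add) (auto simp: nn_integral_cmult nn_integral_add)
  also have "\<dots> < \<infinity>"
    using assms by (simp add: l2_sum_iff ennreal_mult_less_top)
  finally show ?thesis by (simp add: l2_sum_iff)
qed

lemma l2_energy_scale:
  assumes "\<And>i. h i \<in> borel_measurable (M i)"
  shows "l2_energy M (\<lambda>i t. c * h i t) = ennreal ((cmod c)\<^sup>2) * l2_energy M h"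
proof -
  have [measurable]: "h i \<in> borel_measurable (M i)" for i by fact
  show ?thesis
    unfolding l2_energy_def
    by (simp add: norm_mult power_mult_distrib ennreal_mult nn_integral_cmult)
qed

lemma l2_sum_scale:
  assumes "l2_sum M h"
  shows "l2_sum M (\<lambda>i t. c * h i t)"
proof -
  have [measurable]: "h i \<in> borel_measurable (M i)" for i
    using assms by (simp add: l2_sum_measurable)
  have "l2_energy M (\<lambda>i t. c * h i t) < \<infinity>"
    using assms by (simp add: l2_sum_iff l2_energy_scale ennreal_mult_less_top)
  then show ?thesis by (simp add: l2_sum_iff)
qed

lemma l2_sum_diff:
  assumes "l2_sum M g" "l2_sum M h"
  shows "l2_sum M (\<lambda>i t. g i t - h i t)"
  using l2_sum_add[OF assms(1) l2_sum_scale[OF assms(2), of "-1"]] by simp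

lemma cmod_mult_cnj_le: "cmod (a * cnj b) \<le> (cmod a)\<^sup>2 + (cmod b)\<^sup>2"
proof -
  have "2 * (cmod a * cmod b) \<le> (cmod a)\<^sup>2 + (cmod b)\<^sup>2"
    using sum_squares_bound[of "cmod a" "cmod b"] by simp
  moreover have "0 \<le> cmod a * cmod b" by simp
  ultimately show ?thesis unfolding norm_mult complex_mod_cnj by linarith
qed

lemma l2_inner_integrable:
  assumes "l2_sum M g" "l2_sum M h"
  shows "integrable (M i) (\<lambda>t. g i t * cnj (h i t))"
proof (rule Bochner_Integration.integrable_bound)
  show "integrable (M i) (\<lambda>t. (cmod (g i t))\<^sup>2 + (cmod (h i t))\<^sup>2)"
    using assms by (simp add: l2_sum_def)
  show "(\<lambda>t. g i t * cnj (h i t)) \<in> borel_measurable (M i)"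
  proof -
    have [measurable]: "g i \<in> borel_measurable (M i)" "h i \<in> borel_measurable (M i)"
      using assms by (simp_all add: l2_sum_measurable)
    have [measurable]: "cnj \<in> borel_measurable borel"
      by (intro borel_measurable_continuous_onI continuous_intros)
    show ?thesis by measurable
  qed
qed (use cmod_mult_cnj_le in auto)

lemma l2_inner_summable:
  assumes "l2_sum M g" "l2_sum M h"
  shows "(\<lambda>i. \<integral>t. g i t * cnj (h i t) \<partial>M i) summable_on UNIV"
proof (rule abs_summable_summable, rule summable_on_comparison_test)
  show "(\<lambda>i. (\<integral>t. (cmod (g i t))\<^sup>2 \<partial>M i) + (\<integral>t. (cmod (h i t))\<^sup>2 \<partial>M i)) summable_on UNIV"
    using assms by (intro summable_on_add) (simp_all add: l2_sum_def)
  fix i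
  have int: "integrable (M i) (\<lambda>t. (cmod (g i t))\<^sup>2)" "integrable (M i) (\<lambda>t. (cmod (h i t))\<^sup>2)"
    using assms by (simp_all add: l2_sum_def)
  have "norm (\<integral>t. g i t * cnj (h i t) \<partial>M i) \<le> (\<integral>t. cmod (g i t * cnj (h i t)) \<partial>M i)"
    by simp
  also have "\<dots> \<le> (\<integral>t. (cmod (g i t))\<^sup>2 + (cmod (h i t))\<^sup>2 \<partial>M i)"
    using int l2_inner_integrable[OF assms] cmod_mult_cnj_le
    by (intro integral_mono) auto
  also have "\<dots> = (\<integral>t. (cmod (g i t))\<^sup>2 \<partial>M i) + (\<integral>t. (cmod (h i t))\<^sup>2 \<partial>M i)"
    using int by simp
  finally show "norm (\<integral>t. g i t * cnj (h i t) \<partial>M i)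
      \<le> (\<integral>t. (cmod (g i t))\<^sup>2 \<partial>M i) + (\<integral>t. (cmod (h i t))\<^sup>2 \<partial>M i)" .
qed simp

lemma l2_inner_commute: "l2_inner M g h = cnj (l2_inner M h g)"
proof -
  have "(\<integral>t. g i t * cnj (h i t) \<partial>M i) = cnj (\<integral>t. h i t * cnj (g i t) \<partial>M i)" for i
    using Bochner_Integration.integral_cnj[of "M i" "\<lambda>t. h i t * cnj (g i t)"] by (simp add: mult.commute)
  then show ?thesis
    by (simp add: l2_inner_def infsum_cnj)
qed

lemma l2_inner_add:
  assumes "l2_sum M f" "l2_sum M g" "l2_sum M h"
  shows "l2_inner M (\<lambda>i t. f i t + g i t) h = l2_inner M f h + l2_inner M g h"
proof -
  have "(\<integral>t. (f i t + g i t) * cnj (h i t) \<partial>M i)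
      = (\<integral>t. f i t * cnj (h i t) \<partial>M i) + (\<integral>t. g i t * cnj (h i t) \<partial>M i)" for i
    using l2_inner_integrable[OF assms(1,3)] l2_inner_integrable[OF assms(2,3)]
    by (simp add: distrib_right)
  then show ?thesis
    unfolding l2_inner_def
    using infsum_add[OF l2_inner_summable[OF assms(1,3)] l2_inner_summable[OF assms(2,3)]]
    by simp
qed

lemma l2_inner_scale: "l2_inner M (\<lambda>i t. c * g i t) h = c * l2_inner M g h"
  unfolding l2_inner_def by (simp add: mult.assoc infsum_cmult_right')

lemma l2_inner_self:
  assumes "l2_sum M h"
  shows "l2_inner M h h = of_real (enn2real (l2_energy M h))"
proof -
  have "(\<integral>t. h i t * cnj (h i t) \<partial>M i) = of_real (\<integral>t. (cmod (h i t))\<^sup>2 \<partial>M i)" for i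
    by (simp only: complex_norm_square[symmetric] integral_complex_of_real)
  moreover have "(\<Sum>\<^sub>\<infinity>i. of_real (\<integral>t. (cmod (h i t))\<^sup>2 \<partial>M i)) =
      (of_real (\<Sum>\<^sub>\<infinity>i. \<integral>t. (cmod (h i t))\<^sup>2 \<partial>M i) :: complex)"
    using assms by (intro infsumI has_sum_of_real has_sum_infsum) (simp add: l2_sum_def)
  moreover have "0 \<le> (\<Sum>\<^sub>\<infinity>i. \<integral>t. (cmod (h i t))\<^sup>2 \<partial>M i)"
    by (simp add: infsum_nonneg)
  ultimately show ?thesis
    by (simp add: l2_inner_def l2_energy_eq[OF assms])
qed

lemma l2_energy_eq_0_iff:
  assumes "l2_sum M h"
  shows "l2_energy M h = 0 \<longleftrightarrow> (\<forall>i. AE t in M i. h i t = 0)"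
proof -
  have [measurable]: "h i \<in> borel_measurable (M i)" for i
    using assms by (simp add: l2_sum_measurable)
  have "l2_energy M h = 0 \<longleftrightarrow> (\<forall>i. (\<integral>\<^sup>+t. ennreal ((cmod (h i t))\<^sup>2) \<partial>M i) = 0)"
    unfolding l2_energy_def by (simp add: nn_integral_0_iff_AE AE_count_space)
  also have "\<dots> \<longleftrightarrow> (\<forall>i. AE t in M i. h i t = 0)"
    by (simp add: nn_integral_0_iff_AE)
  finally show ?thesis .
qed

lemma l2_inner_cong:
  assumes "l2_eq M g g'" "l2_eq M h h'"
  shows "l2_inner M g h = l2_inner M g' h'"
proof -
  have "(\<integral>t. g i t * cnj (h i t) \<partial>M i) = (\<integral>t. g' i t * cnj (h' i t) \<partial>M i)" for i
  proof (rule integral_cong_AE)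
    show "(\<lambda>t. g i t * cnj (h i t)) \<in> borel_measurable (M i)"
      "(\<lambda>t. g' i t * cnj (h' i t)) \<in> borel_measurable (M i)"
      using assms by (auto simp: l2_eq_def intro!: borel_measurable_integrable l2_inner_integrable)
    have "AE t in M i. g i t = g' i t" "AE t in M i. h i t = h' i t"
      using assms by (simp_all add: l2_eq_def)
    then show "AE t in M i. g i t * cnj (h i t) = g' i t * cnj (h' i t)"
      by eventually_elim simp
  qed
  then show ?thesis by (simp add: l2_inner_def)
qed

lemma l2_eq_part_equivp: "part_equivp (l2_eq M)"
proof (rule part_equivpI)
  show "\<exists>h. l2_eq M h h" by (intro exI[of _ "\<lambda>i t. 0"]) (simp add: l2_eq_def l2_sum_zero)
  show "symp (l2_eq M)" by (auto simp: symp_def l2_eq_def eq_commute)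
  show "transp (l2_eq M)"
  proof (rule transpI)
    fix f g h assume *: "l2_eq M f g" "l2_eq M g h"
    have "AE t in M i. f i t = h i t" for i
    proof -
      have "AE t in M i. f i t = g i t" "AE t in M i. g i t = h i t"
        using * by (simp_all add: l2_eq_def)
      then show ?thesis by eventually_elim simp
    qed
    with * show "l2_eq M f h" by (simp add: l2_eq_def)
  qed
qed

text \<open>Fatou's lemma, used for the completeness of the Hilbert sum.\<close>

lemma l2_energy_liminf:
  assumes [measurable]: "\<And>k i. u k i \<in> borel_measurable (M i)" "\<And>i. v i \<in> borel_measurable (M i)"
    and lim: "\<And>i. AE t in M i. (\<lambda>k. u k i t) \<longlonglongrightarrow> v i t"
    and le: "\<And>k. k \<ge> K \<Longrightarrow> l2_energy M (u k) \<le> C"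
  shows "l2_energy M v \<le> C"
proof -
  have "l2_energy M v
      \<le> (\<integral>\<^sup>+i. liminf (\<lambda>k. \<integral>\<^sup>+t. ennreal ((cmod (u k i t))\<^sup>2) \<partial>M i) \<partial>count_space UNIV)"
    unfolding l2_energy_def
  proof (rule nn_integral_mono)
    fix i
    have "AE t in M i. ennreal ((cmod (v i t))\<^sup>2) = liminf (\<lambda>k. ennreal ((cmod (u k i t))\<^sup>2))"
      using lim[of i]
    proof eventually_elim
      case (elim t)
      then have "(\<lambda>k. ennreal ((cmod (u k i t))\<^sup>2)) \<longlonglongrightarrow> ennreal ((cmod (v i t))\<^sup>2)"
        by (intro tendsto_ennrealI tendsto_intros)
      then show ?case by (rule lim_imp_Liminf[OF sequentially_bot, symmetric])
    qed
    then have "(\<integral>\<^sup>+t. ennreal ((cmod (v i t))\<^sup>2) \<partial>M i)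
        = (\<integral>\<^sup>+t. liminf (\<lambda>k. ennreal ((cmod (u k i t))\<^sup>2)) \<partial>M i)"
      by (rule nn_integral_cong_AE)
    also have "\<dots> \<le> liminf (\<lambda>k. \<integral>\<^sup>+t. ennreal ((cmod (u k i t))\<^sup>2) \<partial>M i)"
      by (rule nn_integral_liminf) measurable
    finally show "(\<integral>\<^sup>+t. ennreal ((cmod (v i t))\<^sup>2) \<partial>M i)
        \<le> liminf (\<lambda>k. \<integral>\<^sup>+t. ennreal ((cmod (u k i t))\<^sup>2) \<partial>M i)" .
  qed
  also have "\<dots> \<le> liminf (\<lambda>k. l2_energy M (u k))"
    unfolding l2_energy_def by (rule nn_integral_liminf) simp
  also have "\<dots> \<le> C"
    by (rule Liminf_le) (use le in \<open>auto simp: eventually_sequentially\<close>)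
  finally show ?thesis .
qed


section \<open>The Hilbert space of the Sierpinski gasket\<close>

datatype corner = Lower_Left | Lower_Right | Upper

text \<open>The triangles \<open>\<Delta>\<^sub>n\<^sub>,\<^sub>i\<close>, \<open>1 \<le> i \<le> 3\<^sup>n\<close>, are numbered by the words
  \<open>w = j\<^sub>1 \<dots> j\<^sub>n\<close> of length \<open>n\<close> over the three corners, so that the index set of all pairs
  \<open>(n, i)\<close> becomes the set of all words.\<close>

type_synonym word = "corner list"

definition normalized_lebesgue :: "word \<Rightarrow> real measure" where
  "normalized_lebesgue w = uniform_measure lborel {- (pi / 2 ^ length w)..pi / 2 ^ length w}"

text \<open>\<open>H\<^sub>S\<^sub>G\<close>: square-summable families of functions that are square-integrable over
  \<open>[-2\<^sup>-\<^sup>n\<pi>, 2\<^sup>-\<^sup>n\<pi>]\<close>, modulo equality almost everywhere on these intervals.\<close>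

quotient_type hsg = "word \<Rightarrow> real \<Rightarrow> complex" / partial: "l2_eq normalized_lebesgue"
  by (rule l2_eq_part_equivp)

instantiation hsg :: real_inner
begin

lift_definition zero_hsg :: hsg is "\<lambda>w t. 0"
  by (simp add: l2_eq_def l2_sum_zero)

lift_definition plus_hsg :: "hsg \<Rightarrow> hsg \<Rightarrow> hsg" is "\<lambda>g h w t. g w t + h w t"
proof -
  fix g g' h h' :: "word \<Rightarrow> real \<Rightarrow> complex"
  assume *: "l2_eq normalized_lebesgue g g'" "l2_eq normalized_lebesgue h h'"
  have "AE t in normalized_lebesgue w. g w t + h w t = g' w t + h' w t" for w
  proof -
    have "AE t in normalized_lebesgue w. g w t = g' w t" "AE t in normalized_lebesgue w. h w t = h' w t"
      using * by (simp_all add: l2_eq_def)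
    then show ?thesis by eventually_elim simp
  qed
  with * show "l2_eq normalized_lebesgue (\<lambda>w t. g w t + h w t) (\<lambda>w t. g' w t + h' w t)"
    by (simp add: l2_eq_def l2_sum_add)
qed

lift_definition minus_hsg :: "hsg \<Rightarrow> hsg \<Rightarrow> hsg" is "\<lambda>g h w t. g w t - h w t"
proof -
  fix g g' h h' :: "word \<Rightarrow> real \<Rightarrow> complex"
  assume *: "l2_eq normalized_lebesgue g g'" "l2_eq normalized_lebesgue h h'"
  have "AE t in normalized_lebesgue w. g w t - h w t = g' w t - h' w t" for w
  proof -
    have "AE t in normalized_lebesgue w. g w t = g' w t" "AE t in normalized_lebesgue w. h w t = h' w t"
      using * by (simp_all add: l2_eq_def)
    then show ?thesis by eventually_elim simp
  qed
  with * show "l2_eq normalized_lebesgue (\<lambda>w t. g w t - h w t) (\<lambda>w t. g' w t - h' w t)"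
    by (simp add: l2_eq_def l2_sum_diff)
qed

lemma l2_eq_scale:
  assumes "l2_eq M g h"
  shows "l2_eq M (\<lambda>i t. c * g i t) (\<lambda>i t. c * h i t)"
  using assms by (auto simp: l2_eq_def l2_sum_scale elim!: eventually_mono)

lift_definition uminus_hsg :: "hsg \<Rightarrow> hsg" is "\<lambda>h w t. - h w t"
  using l2_eq_scale[of normalized_lebesgue _ _ "-1"] by simp

lift_definition scaleR_hsg :: "real \<Rightarrow> hsg \<Rightarrow> hsg" is "\<lambda>r h w t. of_real r * h w t"
  by (rule l2_eq_scale)

lift_definition inner_hsg :: "hsg \<Rightarrow> hsg \<Rightarrow> real"
  is "\<lambda>g h. Re (l2_inner normalized_lebesgue g h)"
  using l2_inner_cong by fastforce

definition norm_hsg :: "hsg \<Rightarrow> real" where "norm_hsg x = sqrt (inner x x)"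
definition sgn_hsg :: "hsg \<Rightarrow> hsg" where "sgn_hsg x = scaleR (inverse (norm x)) x"
definition dist_hsg :: "hsg \<Rightarrow> hsg \<Rightarrow> real" where "dist_hsg x y = norm (x - y)"
definition uniformity_hsg :: "(hsg \<times> hsg) filter" where
  "uniformity_hsg = (INF e\<in>{0<..}. principal {(x, y). dist x y < e})"
definition open_hsg :: "hsg set \<Rightarrow> bool" where
  "open_hsg U \<longleftrightarrow> (\<forall>x\<in>U. eventually (\<lambda>(x', y). x' = x \<longrightarrow> y \<in> U) uniformity)"

instance
proof
  fix x y z :: hsg and a b r :: real
  show "x + y + z = x + (y + z)"
    by transfer (simp add: l2_eq_def l2_sum_add add.assoc)
  show "x + y = y + x"
    by transfer (simp add: l2_eq_def l2_sum_add add.commute)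
  show "0 + x = x"
    by transfer (simp add: l2_eq_def)
  show "- x + x = 0"
    by transfer (simp add: l2_eq_def l2_sum_zero)
  show "x - y = x + - y"
    by transfer (simp add: l2_eq_def l2_sum_diff)
  show "a *\<^sub>R (x + y) = a *\<^sub>R x + a *\<^sub>R y"
    by transfer (simp add: l2_eq_def l2_sum_add l2_sum_scale distrib_left)
  show "(a + b) *\<^sub>R x = a *\<^sub>R x + b *\<^sub>R x"
    by transfer (simp add: l2_eq_def l2_sum_add l2_sum_scale distrib_right)
  show "a *\<^sub>R b *\<^sub>R x = (a * b) *\<^sub>R x"
    by transfer (simp add: l2_eq_def l2_sum_scale mult.assoc)
  show "1 *\<^sub>R x = x"
    by transfer (simp add: l2_eq_def)
  show "inner x y = inner y x"
    by transfer (metis complex_cnj(1) complex_cnj cnj.simps(1) l2_inner_commute)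
  show "inner (x + y) z = inner x z + inner y z"
    by transfer (simp add: l2_eq_def l2_inner_add)
  show "inner (r *\<^sub>R x) y = r * inner x y"
    by transfer (simp add: l2_inner_scale)
  show "0 \<le> inner x x"
    by transfer (simp add: l2_eq_def l2_inner_self)
  show "inner x x = 0 \<longleftrightarrow> x = 0"
  proof transfer
    fix h :: "word \<Rightarrow> real \<Rightarrow> complex"
    assume "l2_eq normalized_lebesgue h h"
    then have h: "l2_sum normalized_lebesgue h" by (simp add: l2_eq_def)
    then have "l2_energy normalized_lebesgue h \<noteq> top" by (auto simp: l2_sum_iff)
    then show "(Re (l2_inner normalized_lebesgue h h) = 0) = l2_eq normalized_lebesgue h (\<lambda>w t. 0)"
      using h by (simp add: l2_inner_self l2_eq_def l2_sum_zero enn2real_eq_0_iff l2_energy_eq_0_iff)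
  qed
qed (simp_all add: norm_hsg_def sgn_hsg_def dist_hsg_def uniformity_hsg_def open_hsg_def)

end


lemma l2_sum_rep_hsg: "l2_sum normalized_lebesgue (rep_hsg x)"
  using Quotient3_rep_reflp[OF Quotient3_hsg, of x] by (simp add: l2_eq_def)

lemma abs_rep_hsg: "abs_hsg (rep_hsg x) = x"
  by (rule Quotient3_abs_rep[OF Quotient3_hsg])

lemma l2_energy_eq_norm:
  assumes "l2_sum normalized_lebesgue h"
  shows "l2_energy normalized_lebesgue h = ennreal ((norm (abs_hsg h))\<^sup>2)"
proof -
  have "(norm (abs_hsg h))\<^sup>2 = Re (l2_inner normalized_lebesgue h h)"
    using assms by (simp add: power2_norm_eq_inner inner_hsg.abs_eq l2_eq_def)
  with assms show ?thesis
    by (simp add: l2_inner_self ennreal_enn2real l2_sum_iff)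
qed

lemma abs_hsg_diff:
  assumes "l2_sum normalized_lebesgue g" "l2_sum normalized_lebesgue h"
  shows "abs_hsg (\<lambda>w t. g w t - h w t) = abs_hsg g - abs_hsg h"
  using assms by (simp add: minus_hsg.abs_eq l2_eq_def)

lemma abs_hsg_add:
  assumes "l2_sum normalized_lebesgue g" "l2_sum normalized_lebesgue h"
  shows "abs_hsg (\<lambda>w t. g w t + h w t) = abs_hsg g + abs_hsg h"
  using assms by (simp add: plus_hsg.abs_eq l2_eq_def)

instance hsg :: complete_space
proof
  fix X :: "nat \<Rightarrow> hsg"
  assume "Cauchy X"
  let ?M = normalized_lebesgue
  have "\<exists>n0. \<forall>m\<ge>n0. \<forall>n\<ge>n0. dist (X m) (X n) < (1/2) ^ k" for k
    using \<open>Cauchy X\<close> by (simp add: Cauchy_def)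
  then obtain n0 where n0: "\<And>k m n. m \<ge> n0 k \<Longrightarrow> n \<ge> n0 k \<Longrightarrow> dist (X m) (X n) < (1/2) ^ k"
    by metis
  define r where "r k = (\<Sum>j\<le>k. n0 j)" for k
  have r_mono: "r k \<le> r m" if "k \<le> m" for k m
    unfolding r_def by (rule sum_mono2) (use that in auto)
  have r_ge: "n0 k \<le> r k" for k
    unfolding r_def by (rule member_le_sum) auto
  have close: "norm (X m - X (r k)) < (1/2) ^ k" if "m \<ge> r k" for m k
    using n0[of k m "r k"] r_ge[of k] that by (simp add: dist_norm)
  define g where "g k = rep_hsg (X (r k))" for k
  have g_l2: "l2_sum ?M (g k)" and g_abs: "abs_hsg (g k) = X (r k)" for k
    by (simp_all add: g_def l2_sum_rep_hsg abs_rep_hsg)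
  have g_meas [measurable]: "g k w \<in> borel_measurable (?M w)" for k w
    using g_l2 by (rule l2_sum_measurable)
  have diff_energy: "l2_energy ?M (\<lambda>w t. g m w t - g k w t) \<le> ennreal (((1/2) ^ k)\<^sup>2)"
    if "m \<ge> k" for m k
  proof -
    have "(norm (X (r m) - X (r k)))\<^sup>2 \<le> ((1/2) ^ k)\<^sup>2"
      using close[OF r_mono[OF that]] by (intro power_mono) auto
    then show ?thesis
      by (simp add: l2_energy_eq_norm l2_sum_diff g_l2 abs_hsg_diff g_abs)
  qed

  define d where "d k w t = complex_of_real (cmod (g (Suc k) w t - g k w t))"
    for k and w :: word and t :: real
  define G where "G K w t = (\<Sum>k<K. d k w t)" for K and w :: word and t :: real
  have d_meas [measurable]: "d k w \<in> borel_measurable (?M w)" for k w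
    unfolding d_def by measurable
  have d_energy: "l2_energy ?M (d k) \<le> ennreal (((1/2) ^ k)\<^sup>2)" for k
  proof -
    have "l2_energy ?M (d k) = l2_energy ?M (\<lambda>w t. g (Suc k) w t - g k w t)"
      by (simp add: l2_energy_def d_def)
    with diff_energy[of k "Suc k"] show ?thesis by simp
  qed
  have d_l2: "l2_sum ?M (d k)" for k
    unfolding l2_sum_iff using le_less_trans[OF d_energy[of k]] d_meas by simp
  have d_norm: "norm (abs_hsg (d k)) \<le> (1/2) ^ k" for k
  proof -
    have "(norm (abs_hsg (d k)))\<^sup>2 \<le> ((1/2) ^ k)\<^sup>2"
      using d_energy[of k] by (subst (asm) l2_energy_eq_norm[OF d_l2]) simp
    then show ?thesis by (rule power2_le_imp_le) simp
  qed
  have G_l2: "l2_sum ?M (G K)" and G_norm: "norm (abs_hsg (G K)) \<le> (\<Sum>k<K. (1/2) ^ k)" for K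
  proof (induction K)
    case 0
    have G0: "G 0 = (\<lambda>w t. 0)" by (simp add: G_def fun_eq_iff)
    { case 1 show ?case by (simp add: G0 l2_sum_zero) }
    { case 2 show ?case by (simp add: G0 flip: zero_hsg.abs_eq zero_hsg_def) }
  next
    case (Suc K)
    have GS: "G (Suc K) = (\<lambda>w t. G K w t + d K w t)"
      by (simp add: G_def fun_eq_iff)
    { case 1 show ?case unfolding GS by (rule l2_sum_add[OF Suc(1) d_l2]) }
    { case 2 show ?case
        unfolding GS abs_hsg_add[OF Suc(1) d_l2]
        using norm_triangle_ineq[of "abs_hsg (G K)" "abs_hsg (d K)"] Suc(2) d_norm[of K]
        by simp }
  qed
  have G_meas [measurable]: "G K w \<in> borel_measurable (?M w)" for K w
    using G_l2 by (rule l2_sum_measurable)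
  have G_energy: "l2_energy ?M (G K) \<le> ennreal 4" for K
  proof -
    have "(\<Sum>k<K. (1/2::real) ^ k) \<le> 2"
      by (simp add: sum_gp_strict)
    with G_norm[of K] have "(norm (abs_hsg (G K)))\<^sup>2 \<le> 2\<^sup>2"
      by (intro power_mono) auto
    then show ?thesis by (subst l2_energy_eq_norm[OF G_l2], intro ennreal_leI) simp
  qed
  have conv: "AE t in ?M w. convergent (\<lambda>k. g k w t)" for w
  proof -
    let ?S = "\<lambda>K t. ennreal ((cmod (G K w t))\<^sup>2)"
    have G_real: "cmod (G K w t) = (\<Sum>k<K. cmod (g (Suc k) w t - g k w t))" for K t
      unfolding G_def d_def of_real_sum[symmetric] norm_of_real
      by (rule abs_of_nonneg) (simp add: sum_nonneg)
    have inc: "incseq ?S"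
      unfolding incseq_def le_fun_def G_real
      by (intro allI impI ennreal_leI power_mono sum_mono2) (auto intro: sum_nonneg)
    have "(\<integral>\<^sup>+t. (SUP K. ?S K t) \<partial>?M w) = (SUP K. \<integral>\<^sup>+t. ?S K t \<partial>?M w)"
      by (rule nn_integral_monotone_convergence_SUP[OF inc]) measurable
    also have "\<dots> \<le> ennreal 4"
    proof (rule SUP_least)
      fix K
      have "(\<integral>\<^sup>+t. ?S K t \<partial>?M w) \<le> l2_energy ?M (G K)"
        unfolding l2_energy_def by (rule nn_integral_ge_point) simp
      also note G_energy[of K]
      finally show "(\<integral>\<^sup>+t. ?S K t \<partial>?M w) \<le> ennreal 4" .
    qed
    finally have "(\<integral>\<^sup>+t. (SUP K. ?S K t) \<partial>?M w) \<noteq> \<infinity>"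
      using le_less_trans[of _ "ennreal 4" \<infinity>] by fastforce
    then have "AE t in ?M w. (SUP K. ?S K t) \<noteq> \<infinity>"
      by (intro nn_integral_PInf_AE) measurable
    then show ?thesis
    proof eventually_elim
      case (elim t)
      then obtain C where C: "0 \<le> C" "(SUP K. ?S K t) = ennreal C"
        by (cases "SUP K. ?S K t" rule: ennreal_cases) auto
      have "(\<Sum>k<K. cmod (g (Suc k) w t - g k w t)) \<le> sqrt C" for K
      proof -
        have "?S K t \<le> ennreal C" unfolding C(2)[symmetric] by (rule SUP_upper) simp
        then have "(cmod (G K w t))\<^sup>2 \<le> C" using C(1) by simp
        then show ?thesis by (simp add: G_real real_le_rsqrt)
      qed
      then have "(\<Sum>k\<le>n. cmod (g (Suc k) w t - g k w t)) \<le> sqrt C" for n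
        unfolding lessThan_Suc_atMost[symmetric] .
      then have "summable (\<lambda>k. cmod (g (Suc k) w t - g k w t))"
        by (intro bounded_imp_summable[of _ "sqrt C"]) simp_all
      then have "summable (\<lambda>k. g (Suc k) w t - g k w t)"
        by (rule summable_norm_cancel)
      then have "convergent (\<lambda>K. \<Sum>k<K. g (Suc k) w t - g k w t)"
        by (simp add: summable_iff_convergent)
      then have "convergent (\<lambda>K. g K w t - g 0 w t)"
        by (simp add: sum_lessThan_telescope[of "\<lambda>k. g k w t"])
      then show ?case
        by (simp add: convergent_diff_const_right_iff)
    qed
  qed
  define v where "v w t = lim (\<lambda>k. g k w t)" for w t
  have v_meas [measurable]: "v w \<in> borel_measurable (?M w)" for w
    unfolding v_def by (rule borel_measurable_lim_metric) measurable
  have v_energy: "l2_energy ?M (\<lambda>w t. v w t - g k w t) \<le> ennreal (((1/2) ^ k)\<^sup>2)" for k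
  proof (rule l2_energy_liminf[where K = k and u = "\<lambda>m w t. g m w t - g k w t"])
    show "AE t in ?M w. (\<lambda>m. g m w t - g k w t) \<longlonglongrightarrow> v w t - g k w t" for w
      using conv[of w]
      by eventually_elim (auto simp: v_def convergent_LIMSEQ_iff intro!: tendsto_intros)
  qed (use diff_energy in simp_all)
  have v_diff_l2: "l2_sum ?M (\<lambda>w t. v w t - g k w t)" for k
    unfolding l2_sum_iff using le_less_trans[OF v_energy[of k]] by simp
  have v_l2: "l2_sum ?M v"
    using l2_sum_add[OF v_diff_l2[of 0] g_l2[of 0]] by simp
  have lim: "norm (X (r k) - abs_hsg v) \<le> (1/2) ^ k" for k
  proof -
    have "(norm (abs_hsg v - X (r k)))\<^sup>2 \<le> ((1/2) ^ k)\<^sup>2"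
      using v_energy[of k]
      by (simp add: l2_energy_eq_norm[OF v_diff_l2] abs_hsg_diff[OF v_l2 g_l2] g_abs)
    then show ?thesis unfolding norm_minus_commute[of "X (r k)"] by (rule power2_le_imp_le) simp
  qed
  have "X \<longlonglongrightarrow> abs_hsg v"
  proof (rule metric_LIMSEQ_I)
    fix e :: real assume "0 < e"
    then obtain k where k: "(1/2) ^ k < e / 2"
      using real_arch_pow_inv[of "e / 2" "1/2"] by auto
    have "dist (X n) (abs_hsg v) < e" if "n \<ge> r k" for n
      using close[OF that] lim[of k] k norm_triangle_ineq[of "X n - X (r k)" "X (r k) - abs_hsg v"]
      by (simp add: dist_norm)
    then show "\<exists>no. \<forall>n\<ge>no. dist (X n) (abs_hsg v) < e" by blast
  qed
  then show "convergent X" by (rule convergentI)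
qed

instantiation hsg :: complex_hilbert_space
begin

lift_definition scaleC_hsg :: "complex \<Rightarrow> hsg \<Rightarrow> hsg" is "\<lambda>c h w t. c * h w t"
  by (rule l2_eq_scale)

lift_definition cinner_hsg :: "hsg \<Rightarrow> hsg \<Rightarrow> complex" is "l2_inner normalized_lebesgue"
  by (rule l2_inner_cong)

instance
proof
  fix x y z :: hsg and c d :: complex and r :: real
  show "c *\<^sub>C (x + y) = c *\<^sub>C x + c *\<^sub>C y"
    by transfer (simp add: l2_eq_def l2_sum_add l2_sum_scale distrib_left)
  show "(c + d) *\<^sub>C x = c *\<^sub>C x + d *\<^sub>C x"
    by transfer (simp add: l2_eq_def l2_sum_add l2_sum_scale distrib_right)
  show "c *\<^sub>C d *\<^sub>C x = (c * d) *\<^sub>C x"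
    by transfer (simp add: l2_eq_def l2_sum_scale mult.assoc)
  show "r *\<^sub>R x = of_real r *\<^sub>C x"
    by transfer (simp add: l2_eq_def l2_sum_scale)
  show "cinner x y = cnj (cinner y x)"
    by transfer (rule l2_inner_commute)
  show "cinner (x + y) z = cinner x z + cinner y z"
    by transfer (simp add: l2_eq_def l2_inner_add)
  show "cinner (c *\<^sub>C x) y = c * cinner x y"
    by transfer (rule l2_inner_scale)
  show "inner x y = Re (cinner x y)"
    by transfer simp
qed

end


section \<open>The Sierpinski gasket and its spectral triple\<close>

text \<open>The bottom edge of the initial triangle is horizontal; \<open>p\<close> is its lower left-hand corner.\<close>

definition vertex :: "real^2 \<Rightarrow> corner \<Rightarrow> real^2" where
  "vertex p j = (case j of
     Lower_Left \<Rightarrow> p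
   | Lower_Right \<Rightarrow> p + vector [2 * pi / 3, 0]
   | Upper \<Rightarrow> p + vector [pi / 3, pi / sqrt 3])"

definition SG_0 :: "real^2 \<Rightarrow> (real^2) set" where
  "SG_0 p = closed_segment (vertex p Lower_Left) (vertex p Lower_Right)
    \<union> closed_segment (vertex p Lower_Right) (vertex p Upper)
    \<union> closed_segment (vertex p Upper) (vertex p Lower_Left)"

definition F_map :: "real^2 \<Rightarrow> corner \<Rightarrow> real^2 \<Rightarrow> real^2" where
  "F_map p j x = (x + vertex p j) /\<^sub>R 2"

primrec F_word :: "real^2 \<Rightarrow> word \<Rightarrow> real^2 \<Rightarrow> real^2" where
  "F_word p [] = id"
| "F_word p (j # w) = F_map p j \<circ> F_word p w"

definition SG_level :: "real^2 \<Rightarrow> nat \<Rightarrow> (real^2) set" where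
  "SG_level p n = (\<Union>w\<in>{w. length w = n}. F_word p w ` SG_0 p)"

definition SG :: "real^2 \<Rightarrow> (real^2) set" where
  "SG p = closure (\<Union>n. SG_level p n)"

text \<open>The arclength parameterization \<open>r\<^sub>n\<^sub>,\<^sub>i\<close>, extended periodically to the real line.  The maps
  \<open>F\<^sub>w\<close> are homotheties with positive ratio, so the corners of the triangle \<open>\<Delta>\<^sub>w\<close> are the images
  of the corresponding corners of the initial triangle; the perimeter of \<open>\<Delta>\<^sub>w\<close> is
  \<open>2\<^sup>1\<^sup>-\<^sup>n\<pi>\<close>, and \<open>u\<close> is the arclength measured in side lengths.\<close>

definition r_param :: "real^2 \<Rightarrow> word \<Rightarrow> real \<Rightarrow> real^2" where
  "r_param p w t =
    (let A = F_word p w (vertex p Lower_Left);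
         B = F_word p w (vertex p Lower_Right);
         C = F_word p w (vertex p Upper);
         u = 3 * frac (t / (2 * pi / 2 ^ length w))
     in if u \<le> 1 then B + u *\<^sub>R (C - B)
        else if u \<le> 2 then C + (u - 1) *\<^sub>R (A - C)
        else A + (u - 2) *\<^sub>R (B - A))"

text \<open>Multiplication by \<open>f \<circ> r\<^sub>n\<^sub>,\<^sub>i\<close> in each component; for \<open>f\<close> continuous on the gasket
  the class of the product does not depend on the representative \<open>rep_hsg h\<close>.\<close>

definition pi_SG :: "real^2 \<Rightarrow> (real^2 \<Rightarrow> complex) \<Rightarrow> hsg \<Rightarrow> hsg" where
  "pi_SG p f h = abs_hsg (\<lambda>w t. f (r_param p w t) * rep_hsg h w t)"

text \<open>The basis vector \<open>\<phi>\<^sub>k\<close> of the component \<open>H\<^sub>w\<close>, as an element of \<open>H\<^sub>S\<^sub>G\<close>.\<close>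

definition phi_SG :: "word \<Rightarrow> int \<Rightarrow> hsg" where
  "phi_SG w k = abs_hsg (\<lambda>w' t. if w' = w then exp (\<i> * of_real (2 ^ length w * of_int k * t)) else 0)"

text \<open>The graph of the self-adjoint operator \<open>D\<^sub>S\<^sub>G\<close> that is diagonal with respect to the
  orthonormal basis \<open>\<phi>\<^sub>k\<close>: \<open>h\<close> is in its domain if and only if the numbers
  \<open>2\<^sup>n(k + 1/2) \<langle>h, \<phi>\<^sub>k\<rangle>\<close> are the coefficients of some vector \<open>h'\<close>, and then
  \<open>D\<^sub>S\<^sub>G h = h'\<close>.\<close>

definition D_SG :: "(hsg \<times> hsg) set" where
  "D_SG = {(h, h'). \<forall>w k.
     cinner h' (phi_SG w k) = of_real (2 ^ length w * (of_int k + 1 / 2)) * cinner h (phi_SG w k)}"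

definition abs_D_SG_power :: "real \<Rightarrow> hsg \<Rightarrow> hsg" where
  "abs_D_SG_power s = functional_calculus (\<lambda>\<nu>. of_real (\<bar>\<nu>\<bar> powr s)) D_SG"

definition tau_SG :: "((nat \<Rightarrow> complex) \<Rightarrow> complex) \<Rightarrow> real^2 \<Rightarrow> (real^2 \<Rightarrow> complex) \<Rightarrow> complex" where
  "tau_SG \<omega> p f = dixmier_trace \<omega> (pi_SG p f \<circ> abs_D_SG_power (- (ln 3 / ln 2)))"


section \<open>Hausdorff measure and the zeta function\<close>

text \<open>For \<open>s > 0\<close>.  The sets \<open>U i\<close> are required to be bounded because
  \<^const>\<open>diameter\<close> is meaningless for unbounded sets; empty sets contribute \<open>0\<close>.\<close>

definition hausdorff_outer :: "real \<Rightarrow> 'a::metric_space set \<Rightarrow> ennreal" where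
  "hausdorff_outer s A = (SUP \<delta>\<in>{0<..}.
     INF U\<in>{U :: nat \<Rightarrow> 'a set. A \<subseteq> (\<Union>i. U i) \<and> (\<forall>i. bounded (U i) \<and> diameter (U i) \<le> \<delta>)}.
       \<Sum>i. ennreal (diameter (U i) powr s))"

definition hausdorff_measure :: "real \<Rightarrow> 'a::metric_space measure" where
  "hausdorff_measure s = measure_of UNIV (sets borel) (hausdorff_outer s)"

definition mu_SG :: "real^2 \<Rightarrow> (real^2) measure" where
  "mu_SG p = (let H = hausdorff_measure (ln 3 / ln 2)
           in scale_measure (1 / emeasure H (SG p)) (restrict_space H (SG p)))"

definition psi_SG :: "real^2 \<Rightarrow> (real^2 \<Rightarrow> complex) \<Rightarrow> complex" where
  "psi_SG p f = (\<integral>x. f x \<partial>mu_SG p)"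

text \<open>The Riemann zeta function on the half-line \<open>s > 1\<close>.\<close>

definition zeta :: "real \<Rightarrow> real" where
  "zeta s = (\<Sum>n. 1 / real (Suc n) powr s)"

end

theory Submission
  imports Defs "HOL-Real_Asymp.Real_Asymp"
begin

text \<open>Let \<open>s = log 3 / log 2\<close> and \<open>P = |D|\<^sup>-\<^sup>s\<close>.  In the exponential basis \<open>P\<close> is diagonal with entries
  \<open>3\<^sup>-\<^sup>n |k + 1/2|\<^sup>-\<^sup>s\<close>, where \<open>n\<close> is the length of the word.  By Ky Fan's principle the sum of the first
  \<open>N\<close> eigenvalues of a positive compact operator is the largest partial trace over \<open>N\<close> orthonormal
  vectors; with the dilation invariance of \<open>\<omega>\<close> this makes the Dixmier trace additive.  The same
  principle gives the logarithmic growth of the eigenvalue sums of \<open>P\<close> compressed to a set of words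
  \<open>W\<close>: there are \<open>3\<^sup>n\<close> words of length \<open>n\<close>, each contributing \<open>3\<^sup>-\<^sup>n \<Sum>\<^sub>k |k + 1/2|\<^sup>-\<^sup>s = 3\<^sup>-\<^sup>n 4 \<zeta>(s)\<close>, so the
  trace is \<open>4 \<zeta>(s) / log 3\<close> times the density of \<open>W\<close>.  The words with prefix \<open>v\<close> have density
  \<open>3\<^sup>-\<^sup>|\<^sup>v\<^sup>|\<close>, which is also the Hausdorff measure of the cell \<open>F\<^sub>v(SG)\<close>.  By uniform continuity \<open>\<pi>(f)\<close> is
  close in norm to a combination of the projections onto these words, up to finitely many components
  of the Hilbert sum, which have trace zero; polarization writes \<open>M P\<close> as a combination of positive
  operators and bounds its trace by a multiple of the norm of \<open>M\<close>.\<close>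

section \<open>Complex Hilbert spaces\<close>

text \<open>\<open>eigenvalues\<close> and \<open>dixmier_trace\<close> are definite descriptions:
  no value is available before a spectral theorem shows that multiplicities determine the eigenvalue
  sequence, and before additivity shows that the trace does not depend on the chosen decomposition.
  Beyond that the obstacle is that \<pi>(f) and P do not commute, so that \<pi>(f) P is in general
  neither positive nor symmetric. The estimates are therefore made for the positive operators M_g P
  M_g^*, called \<open>sandwich g\<close>, with arbitrary bounded g, while projections onto sets of
  words do commute with P and yield exact values. The constant: k and -k-1 have equal weight, so the
  sum of |k + 1/2|^-s is 2 * 2^s times the sum of m^-s over odd m, which is 2 (2^s - 1) \<zeta>(s),
  and 2^s = 3 makes this 4 \<zeta>(s). Every level of words contributes the same amount, and the N
  largest eigenvalues reach about log N / log 3 levels deep; this is the origin of 1 / log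
  3.\<close>

interpretation complex_vs: vector_space "scaleC :: complex \<Rightarrow> 'a \<Rightarrow> 'a::complex_hilbert_space"
  by (rule vector_space_scaleC)

lemma cinner_add_right: "cinner x (y + z) = cinner x y + cinner x (z::'a::complex_hilbert_space)"
  by (metis cinner_add_left cinner_commute complex_cnj_add)

lemma cinner_scaleC_right: "cinner x (c *\<^sub>C y) = cnj c * cinner x (y::'a::complex_hilbert_space)"
  by (metis cinner_commute cinner_scaleC_left complex_cnj_mult)

lemma additive_cinner_left: "Modules.additive (\<lambda>x. cinner x (y::'a::complex_hilbert_space))"
  by standard (rule cinner_add_left)

lemma additive_cinner_right: "Modules.additive (cinner (x::'a::complex_hilbert_space))"
  by standard (rule cinner_add_right)

lemmas cinner_zero_left [simp] = Modules.additive.zero[OF additive_cinner_left]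
  and cinner_zero_right [simp] = Modules.additive.zero[OF additive_cinner_right]
  and cinner_diff_left = Modules.additive.diff[OF additive_cinner_left]
  and cinner_diff_right = Modules.additive.diff[OF additive_cinner_right]
  and cinner_sum_left = Modules.additive.sum[OF additive_cinner_left]
  and cinner_sum_right = Modules.additive.sum[OF additive_cinner_right]

lemma cinner_self: "cinner x x = of_real ((norm (x::'a::complex_hilbert_space))\<^sup>2)"
proof -
  have "Im (cinner x x) = 0"
    using cinner_commute[of x x] by (metis complex_cnj_cancel_iff Reals_cnj_iff complex_is_Real_iff)
  moreover have "Re (cinner x x) = (norm x)\<^sup>2"
    by (simp add: power2_norm_eq_inner inner_eq_Re_cinner)
  ultimately show ?thesis by (simp add: complex_eq_iff)
qed

lemma norm_scaleC: "norm (c *\<^sub>C x) = cmod c * norm (x::'a::complex_hilbert_space)"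
proof -
  have "cinner (c *\<^sub>C x) (c *\<^sub>C x) = of_real ((cmod c)\<^sup>2 * (norm x)\<^sup>2)"
    unfolding cinner_scaleC_left cinner_scaleC_right cinner_self[of x]
    using complex_norm_square[of c] by (simp add: mult.commute)
  then have "(norm (c *\<^sub>C x))\<^sup>2 = (cmod c * norm x)\<^sup>2"
    unfolding cinner_self of_real_eq_iff by (simp add: power_mult_distrib)
  then show ?thesis by (simp add: power2_eq_iff_nonneg)
qed

text \<open>The real Cauchy-Schwarz inequality suffices: the phase \<open>c\<close> rotates
  \<open>x\<close> so that the complex inner product becomes real and nonnegative, hence equal to
  the real one.\<close>

lemma cmod_cinner_le: "cmod (cinner x y) \<le> norm x * norm (y::'a::complex_hilbert_space)"
proof (cases "cinner x y = 0")
  case False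
  define c where "c = cnj (cinner x y) / cmod (cinner x y)"
  have c: "cmod c = 1" using False by (simp add: c_def norm_divide)
  have "cinner (c *\<^sub>C x) y = cmod (cinner x y)"
    using False complex_norm_square[of "cinner x y"]
    by (simp add: c_def cinner_scaleC_left field_simps power2_eq_square)
  then have "cmod (cinner x y) = inner (c *\<^sub>C x) y"
    by (simp add: inner_eq_Re_cinner)
  also have "\<dots> \<le> norm (c *\<^sub>C x) * norm y" by (rule norm_cauchy_schwarz)
  finally show ?thesis by (simp add: norm_scaleC c)
qed simp

lemma cinner_commute_eq_0: "cinner x y = 0 \<longleftrightarrow> cinner y (x::'a::complex_hilbert_space) = 0"
  by (metis cinner_commute complex_cnj_zero)

lemma cmod_cinner_commute: "cmod (cinner x y) = cmod (cinner y (x::'a::complex_hilbert_space))"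
  by (metis cinner_commute complex_mod_cnj)

lemma bounded_linear_cinner_left: "bounded_linear (\<lambda>x. cinner x (y::'a::complex_hilbert_space))"
proof (rule bounded_linear_intro[where K = "norm y"])
  show "cinner (r *\<^sub>R x) y = r *\<^sub>R cinner x y" for r x
    unfolding scaleR_eq_scaleC cinner_scaleC_left scaleR_conv_of_real ..
qed (auto simp: cinner_add_left cmod_cinner_le)

lemma bounded_linear_scaleC_right: "bounded_linear (scaleC c :: 'a \<Rightarrow> 'a::complex_hilbert_space)"
proof (rule bounded_linear_intro[where K = "cmod c"])
  show "c *\<^sub>C r *\<^sub>R x = r *\<^sub>R c *\<^sub>C x" for r and x :: 'a
    by (simp add: scaleR_eq_scaleC scaleC_scaleC mult.commute)
qed (auto simp: scaleC_add_right norm_scaleC)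

lemma bounded_linear_scaleC_left: "bounded_linear (\<lambda>c. c *\<^sub>C (x::'a::complex_hilbert_space))"
proof (rule bounded_linear_intro[where K = "norm x"])
  show "(r *\<^sub>R c) *\<^sub>C x = r *\<^sub>R c *\<^sub>C x" for r c
    unfolding scaleR_eq_scaleC scaleC_scaleC scaleR_conv_of_real ..
qed (auto simp: scaleC_add_left norm_scaleC)

section \<open>Orthogonal decompositions, Bessel's inequality, Gram-Schmidt\<close>

definition orthonormal :: "('a::complex_hilbert_space) set \<Rightarrow> bool" where
  "orthonormal E \<longleftrightarrow> (\<forall>x\<in>E. norm x = 1) \<and> (\<forall>x\<in>E. \<forall>y\<in>E. x \<noteq> y \<longrightarrow> cinner x y = 0)"

lemma norm_sum_orthogonal:
  fixes u :: "'i \<Rightarrow> 'a::complex_hilbert_space"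
  assumes "finite I" "\<And>i j. i \<in> I \<Longrightarrow> j \<in> I \<Longrightarrow> i \<noteq> j \<Longrightarrow> cinner (u i) (u j) = 0"
  shows "(norm (\<Sum>i\<in>I. u i))\<^sup>2 = (\<Sum>i\<in>I. (norm (u i))\<^sup>2)"
proof -
  have "cinner (\<Sum>i\<in>I. u i) (\<Sum>i\<in>I. u i) = (\<Sum>i\<in>I. \<Sum>j\<in>I. cinner (u i) (u j))"
    unfolding cinner_sum_left by (simp add: cinner_sum_right)
  also have "\<dots> = (\<Sum>i\<in>I. cinner (u i) (u i))"
  proof (rule sum.cong[OF refl])
    fix i assume "i \<in> I"
    then show "(\<Sum>j\<in>I. cinner (u i) (u j)) = cinner (u i) (u i)"
      using assms by (subst sum.remove[of _ i]) (auto intro!: sum.neutral)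
  qed
  finally show ?thesis unfolding cinner_self of_real_sum[symmetric] of_real_eq_iff .
qed

lemma orthogonal_remainder:
  fixes u :: "'i \<Rightarrow> 'a::complex_hilbert_space"
  assumes "finite I" "\<And>i j. i \<in> I \<Longrightarrow> j \<in> I \<Longrightarrow> i \<noteq> j \<Longrightarrow> cinner (u i) (u j) = 0"
    and "\<And>i. i \<in> I \<Longrightarrow> norm (u i) = 1 \<or> u i = 0" and "k \<in> I"
  shows "cinner (x - (\<Sum>i\<in>I. cinner x (u i) *\<^sub>C u i)) (u k) = 0"
proof -
  have "cinner (\<Sum>i\<in>I. cinner x (u i) *\<^sub>C u i) (u k) = (\<Sum>i\<in>I. cinner x (u i) * cinner (u i) (u k))"
    by (simp add: cinner_sum_left cinner_scaleC_left)
  also have "\<dots> = cinner x (u k) * cinner (u k) (u k)"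
    using assms by (subst sum.remove[of _ k]) (auto intro!: sum.neutral)
  also have "\<dots> = cinner x (u k)" using assms(3)[OF assms(4)] by (auto simp: cinner_self)
  finally show ?thesis by (simp add: cinner_diff_left)
qed

text \<open>Vanishing vectors are admitted because the eigenvectors of an operator of finite rank will be
  continued by zeros.\<close>

lemma norm_orthogonal_decomposition:
  fixes u :: "'i \<Rightarrow> 'a::complex_hilbert_space"
  assumes fin: "finite I" and orth: "\<And>i j. i \<in> I \<Longrightarrow> j \<in> I \<Longrightarrow> i \<noteq> j \<Longrightarrow> cinner (u i) (u j) = 0"
    and nrm: "\<And>i. i \<in> I \<Longrightarrow> norm (u i) = 1 \<or> u i = 0"
  shows "(norm x)\<^sup>2 = (\<Sum>i\<in>I. (cmod (cinner x (u i)))\<^sup>2)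
    + (norm (x - (\<Sum>i\<in>I. cinner x (u i) *\<^sub>C u i)))\<^sup>2"
proof -
  define p where "p = (\<Sum>i\<in>I. cinner x (u i) *\<^sub>C u i)"
  have *: "cinner (x - p) (u k) = 0" if "k \<in> I" for k
    unfolding p_def by (rule orthogonal_remainder[OF assms that])
  have orth_p: "cinner (x - p) p = 0"
    by (subst (2) p_def) (simp add: cinner_sum_right cinner_scaleC_right *)
  have "(norm p)\<^sup>2 = (\<Sum>i\<in>I. (norm (cinner x (u i) *\<^sub>C u i))\<^sup>2)"
    unfolding p_def using orth
    by (intro norm_sum_orthogonal fin) (auto simp: cinner_scaleC_left cinner_scaleC_right)
  also have "\<dots> = (\<Sum>i\<in>I. (cmod (cinner x (u i)))\<^sup>2)"
    by (intro sum.cong) (use nrm in \<open>force simp: norm_scaleC\<close>)+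
  finally have p: "(norm p)\<^sup>2 = (\<Sum>i\<in>I. (cmod (cinner x (u i)))\<^sup>2)" .
  have "inner (x - p) p = 0" using orth_p by (simp add: inner_eq_Re_cinner)
  then have "(norm ((x - p) + p))\<^sup>2 = (norm (x - p))\<^sup>2 + (norm p)\<^sup>2"
    unfolding power2_norm_eq_inner inner_add_left inner_add_right by (simp add: inner_commute)
  then show ?thesis using p by (simp add: p_def)
qed

lemma bessel_inequality:
  fixes u :: "'i \<Rightarrow> 'a::complex_hilbert_space"
  assumes "finite I" "\<And>i j. i \<in> I \<Longrightarrow> j \<in> I \<Longrightarrow> i \<noteq> j \<Longrightarrow> cinner (u i) (u j) = 0"
    and "\<And>i. i \<in> I \<Longrightarrow> norm (u i) = 1 \<or> u i = 0"
  shows "(\<Sum>i\<in>I. (cmod (cinner x (u i)))\<^sup>2) \<le> (norm x)\<^sup>2"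
  using norm_orthogonal_decomposition[OF assms, where x = x] by simp

lemma bessel_orthonormal:
  assumes "finite E" "orthonormal E"
  shows "(\<Sum>e\<in>E. (cmod (cinner x e))\<^sup>2) \<le> (norm x)\<^sup>2"
  using bessel_inequality[where I = E and u = "\<lambda>e. e" and x = x] assms by (auto simp: orthonormal_def)

text \<open>Gram-Schmidt, one vector at a time. Membership in the span of \<open>E\<close> is
  expressed by the expansion itself, since the attainment half of Ky Fan's principle needs
  Parseval's identity for the vectors of \<open>F\<close>; the bound on \<open>card E\<close> counts
  the test vectors.\<close>

lemma orthonormal_span_exists:
  fixes F :: "'a::complex_hilbert_space set"
  assumes "finite F"
  shows "\<exists>E. finite E \<and> card E \<le> card F \<and> orthonormal E \<and> (\<forall>f\<in>F. f = (\<Sum>e\<in>E. cinner f e *\<^sub>C e))"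
  using assms
proof (induction F rule: finite_induct)
  case empty
  show ?case by (intro exI[of _ "{}"]) (auto simp: orthonormal_def)
next
  case (insert x F)
  then obtain E where E: "finite E" "card E \<le> card F" "orthonormal E"
    "\<And>f. f \<in> F \<Longrightarrow> f = (\<Sum>e\<in>E. cinner f e *\<^sub>C e)" by blast
  define y where "y = x - (\<Sum>e\<in>E. cinner x e *\<^sub>C e)"
  have y_orth: "cinner y e = 0" if "e \<in> E" for e
    unfolding y_def using orthogonal_remainder[where I = E and u = "\<lambda>e. e" and k = e and x = x] E that by (auto simp: orthonormal_def)
  show ?case
  proof (cases "y = 0")
    case True
    then show ?thesis using E insert.hyps by (intro exI[of _ E]) (auto simp: y_def)
  next
    case False
    define z where "z = (1 / norm y) *\<^sub>R y"
    have z: "norm z = 1" using False by (simp add: z_def)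
    have z_orth: "cinner z e = 0" "cinner e z = 0" if "e \<in> E" for e
      using y_orth[OF that] cinner_commute_eq_0[of e z]
      by (simp_all add: z_def scaleR_eq_scaleC cinner_scaleC_left)
    have "z \<notin> E" using z z_orth(1)[of z] by (auto simp: cinner_self)
    have Fz: "cinner f z = 0" if "f \<in> F" for f
    proof -
      have "cinner (\<Sum>e\<in>E. cinner f e *\<^sub>C e) z = 0"
        by (simp add: cinner_sum_left cinner_scaleC_left z_orth)
      then show ?thesis using E(4)[OF that] by simp
    qed
    have xz: "cinner x z *\<^sub>C z = y"
    proof -
      have "cinner x z = cinner y z"
      proof -
        have "cinner (\<Sum>e\<in>E. cinner x e *\<^sub>C e) z = 0"
          by (simp add: cinner_sum_left cinner_scaleC_left z_orth)
        then show ?thesis by (simp add: y_def cinner_diff_left)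
      qed
      also have "\<dots> = of_real (norm y)"
        using False by (simp add: z_def scaleR_eq_scaleC cinner_scaleC_right cinner_self power2_eq_square)
      finally show ?thesis using False
        by (simp add: z_def scaleR_eq_scaleC scaleC_scaleC del: of_real_divide flip: of_real_mult)
    qed
    have "orthonormal (insert z E)"
      using E(3) z z_orth by (auto simp: orthonormal_def)
    moreover have "\<forall>f\<in>insert x F. f = (\<Sum>e\<in>insert z E. cinner f e *\<^sub>C e)"
      using E(1) \<open>z \<notin> E\<close> E(4) Fz xz by (auto simp: y_def)
    ultimately show ?thesis
      using E insert.hyps \<open>z \<notin> E\<close> by (intro exI[of _ "insert z E"]) auto
  qed
qed

section \<open>Bounded, compact and positive operators\<close>

lemma bounded_operator_bounded_linear: "bounded_operator T \<Longrightarrow> bounded_linear T"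
  and bounded_operator_scaleC: "bounded_operator T \<Longrightarrow> T (c *\<^sub>C x) = c *\<^sub>C T x"
  by (auto simp: bounded_operator_def)

lemma bounded_operator_add_vec: "bounded_operator T \<Longrightarrow> T (x + y) = T x + T y"
  and bounded_operator_diff_vec: "bounded_operator T \<Longrightarrow> T (x - y) = T x - T y"
  and bounded_operator_zero_vec: "bounded_operator T \<Longrightarrow> T 0 = 0"
  and bounded_operator_sum_vec: "bounded_operator T \<Longrightarrow> T (\<Sum>i\<in>I. u i) = (\<Sum>i\<in>I. T (u i))"
  by (auto dest!: bounded_operator_bounded_linear
      simp: linear_add linear_diff linear_0 linear_sum bounded_linear.linear)

lemma bounded_operatorI:
  assumes "\<And>x y. T (x + y) = T x + T y" "\<And>c x. T (c *\<^sub>C x) = c *\<^sub>C T x"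
    and "\<And>x. norm (T x) \<le> K * norm x"
  shows "bounded_operator T"
  unfolding bounded_operator_def
proof
  show "bounded_linear T"
    by (rule bounded_linear_intro[where K = K]) (auto simp: assms scaleR_eq_scaleC mult.commute)
qed (use assms in blast)

lemma bounded_operator_add:
  assumes "bounded_operator S" "bounded_operator T"
  shows "bounded_operator (\<lambda>x. S x + T x)"
  using assms by (auto simp: bounded_operator_def bounded_linear_add scaleC_add_right)

lemma bounded_operator_scale:
  assumes "bounded_operator T"
  shows "bounded_operator (\<lambda>x. c *\<^sub>C T x)"
  using assms bounded_linear_compose[OF bounded_linear_scaleC_right, of T c]
  by (auto simp: bounded_operator_def scaleC_scaleC mult.commute)

lemma bounded_operator_compose:
  assumes "bounded_operator S" "bounded_operator T"
  shows "bounded_operator (\<lambda>x. S (T x))"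
  using assms by (auto simp: bounded_operator_def bounded_linear_compose)

lemma bounded_operator_zero: "bounded_operator (\<lambda>x. 0)"
  by (auto simp: bounded_operator_def bounded_linear_zero)

lemma compact_imageI:
  assumes "compact K" "S \<subseteq> K"
  shows "compact (closure (S::'b::metric_space set))"
proof -
  have "closure S \<subseteq> K" using assms by (simp add: closure_minimal compact_imp_closed)
  then show ?thesis using compact_Int_closed[OF assms(1) closed_closure[of S]] by (simp add: inf_absorb2)
qed

lemma compact_operatorI:
  assumes "bounded_operator T" "compact K" "T ` cball 0 1 \<subseteq> K"
  shows "compact_operator T"
  unfolding compact_operator_def using assms compact_imageI by blast

lemma compact_operator_add:
  assumes S: "compact_operator S" and T: "compact_operator T"
  shows "compact_operator (\<lambda>x. S x + T x)"
proof (rule compact_operatorI)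
  show "compact {x + y | x y. x \<in> closure (S ` cball 0 1) \<and> y \<in> closure (T ` cball 0 1)}"
    by (rule compact_sums) (use assms in \<open>simp_all add: compact_operator_def\<close>)
  show "(\<lambda>x. S x + T x) ` cball 0 1 \<subseteq> {x + y | x y. x \<in> closure (S ` cball 0 1) \<and> y \<in> closure (T ` cball 0 1)}"
    using closure_subset[of "S ` cball 0 1"] closure_subset[of "T ` cball 0 1"] by blast
qed (use assms in \<open>auto simp: compact_operator_def bounded_operator_add\<close>)

lemma compact_operator_compose_left:
  assumes S: "bounded_operator S" and T: "compact_operator T"
  shows "compact_operator (\<lambda>x. S (T x))"
proof (rule compact_operatorI)
  show "compact (S ` closure (T ` cball 0 1))"
  proof (rule compact_continuous_image)
    show "continuous_on (closure (T ` cball 0 1)) S"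
      using S by (intro linear_continuous_on bounded_operator_bounded_linear)
  qed (use T in \<open>simp add: compact_operator_def\<close>)
  show "(\<lambda>x. S (T x)) ` cball 0 1 \<subseteq> S ` closure (T ` cball 0 1)"
    using closure_subset[of "T ` cball 0 1"] by blast
qed (use assms in \<open>auto simp: compact_operator_def bounded_operator_compose\<close>)

lemma compact_operator_scale:
  assumes "compact_operator T"
  shows "compact_operator (\<lambda>x. c *\<^sub>C T x)"
  by (rule compact_operator_compose_left[OF _ assms])
    (auto simp: bounded_operator_def bounded_linear_scaleC_right scaleC_scaleC mult.commute)

lemma compact_operator_compose_right:
  assumes S: "compact_operator S" and T: "bounded_operator T"
  shows "compact_operator (\<lambda>x. S (T x))"
proof -
  obtain K where K: "K > 0" "\<And>x. norm (T x) \<le> norm x * K"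
    using T bounded_linear.pos_bounded unfolding bounded_operator_def by blast
  show ?thesis
  proof (rule compact_operatorI)
    show "compact ((\<lambda>x. K *\<^sub>R x) ` closure (S ` cball 0 1))"
      by (rule compact_scaling) (use S in \<open>simp add: compact_operator_def\<close>)
    show "(\<lambda>x. S (T x)) ` cball 0 1 \<subseteq> (\<lambda>x. K *\<^sub>R x) ` closure (S ` cball 0 1)"
    proof
      fix y assume "y \<in> (\<lambda>x. S (T x)) ` cball 0 1"
      then obtain x where x: "norm x \<le> 1" "y = S (T x)" by auto
      have "norm (T x) \<le> K" using K(2)[of x] K(1) x(1)
        by (smt (verit) mult_left_le_one_le mult_right_mono norm_ge_zero)
      then have "(1 / K) *\<^sub>R T x \<in> cball 0 1" using K(1) by (simp add: divide_simps)
      then have "S ((1 / K) *\<^sub>R T x) \<in> closure (S ` cball 0 1)" using closure_subset[of "S ` cball 0 1"] by blast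
      moreover have "y = K *\<^sub>R S ((1 / K) *\<^sub>R T x)"
        using S K(1) x(2) unfolding compact_operator_def
        by (auto simp: linear_scale bounded_operator_def bounded_linear.linear)
      ultimately show "y \<in> (\<lambda>x. K *\<^sub>R x) ` closure (S ` cball 0 1)" by blast
    qed
  qed (use assms in \<open>auto simp: compact_operator_def bounded_operator_compose\<close>)
qed

lemma compact_operator_zero: "compact_operator (\<lambda>x. 0)"
  by (rule compact_operatorI[of _ "{0}"]) (auto simp: bounded_operator_zero)

text \<open>A finite \<epsilon>/4-net for the image of the unit ball under \<open>S\<close> is an
  \<epsilon>/2-net for the image under \<open>T\<close>. The closed balls of radius \<epsilon>/2
  also cover the closure, so the latter is totally bounded, and it is complete as a closed
  set.\<close>

lemma compact_operator_approx:
  fixes T :: "'a \<Rightarrow> 'a::complex_hilbert_space"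
  assumes T: "bounded_operator T"
    and approx: "\<And>\<epsilon>. \<epsilon> > 0 \<Longrightarrow> \<exists>S. compact_operator S \<and> (\<forall>x. norm (T x - S x) \<le> \<epsilon> * norm x)"
  shows "compact_operator T"
proof -
  have "compact (closure (T ` cball 0 1))"
    unfolding compact_eq_totally_bounded
  proof (intro conjI allI impI)
    show "complete (closure (T ` cball 0 1))"
      by (simp add: complete_eq_closed)
    fix \<epsilon> :: real assume "\<epsilon> > 0"
    then obtain S where S: "compact_operator S" "\<And>x. norm (T x - S x) \<le> \<epsilon> / 4 * norm x"
      using approx[of "\<epsilon> / 4"] by auto
    then obtain k where k: "finite k" "closure (S ` cball 0 1) \<subseteq> (\<Union>x\<in>k. ball x (\<epsilon> / 4))"
      unfolding compact_operator_def compact_eq_totally_bounded using \<open>\<epsilon> > 0\<close>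
      by (meson divide_pos_pos zero_less_numeral)
    have "T ` cball 0 1 \<subseteq> (\<Union>x\<in>k. cball x (\<epsilon> / 2))"
    proof
      fix y assume "y \<in> T ` cball 0 1"
      then obtain x where x: "norm x \<le> 1" "y = T x" by auto
      then have "S x \<in> closure (S ` cball 0 1)" using closure_subset[of "S ` cball 0 1"] by auto
      then obtain z where z: "z \<in> k" "dist z (S x) < \<epsilon> / 4" using k(2) by auto
      have "norm (T x - S x) \<le> \<epsilon> / 4" using S(2)[of x] x(1) \<open>\<epsilon> > 0\<close>
        by (smt (verit) mult_left_le mult_nonneg_nonneg divide_pos_pos)
      then have "dist z (T x) \<le> \<epsilon> / 2"
        using z(2) dist_triangle[of z "T x" "S x"] by (simp add: dist_norm norm_minus_commute)
      then show "y \<in> (\<Union>x\<in>k. cball x (\<epsilon> / 2))" using z(1) x(2) by auto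
    qed
    then have "closure (T ` cball 0 1) \<subseteq> (\<Union>x\<in>k. cball x (\<epsilon> / 2))"
      using k(1) by (intro closure_minimal closed_UN) auto
    also have "\<dots> \<subseteq> (\<Union>x\<in>k. ball x \<epsilon>)" using \<open>\<epsilon> > 0\<close> by auto
    finally show "\<exists>k. finite k \<and> closure (T ` cball 0 1) \<subseteq> (\<Union>x\<in>k. ball x \<epsilon>)" using k(1) by blast
  qed
  with T show ?thesis by (simp add: compact_operator_def)
qed

lemma positive_operator_nonneg:
  assumes "positive_operator T"
  shows "Re (cinner (T x) x) \<ge> 0" "Im (cinner (T x) x) = 0"
  using assms by (auto simp: positive_operator_def complex_nonneg_Reals_iff)

text \<open>Over the complex numbers a real quadratic form forces symmetry: its values at
  \<open>x + y\<close> and at \<open>x + \<i> *\<^sub>C y\<close> show that the two mixed terms are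
  conjugate to each other.\<close>

lemma positive_operator_symmetric:
  assumes "positive_operator T"
  shows "cinner (T x) y = cinner x (T y)"
proof -
  have T: "bounded_operator T" using assms by (simp add: positive_operator_def)
  note * = positive_operator_nonneg(2)[OF assms]
  note expand = bounded_operator_add_vec[OF T] bounded_operator_scaleC[OF T]
    cinner_add_left cinner_add_right cinner_scaleC_left cinner_scaleC_right
  have "Im (cinner (T x) y + cinner (T y) x) = 0"
    using *[of "x + y"] *[of x] *[of y] unfolding expand by simp
  moreover have "Re (cinner (T y) x - cinner (T x) y) = 0"
    using *[of "x + \<i> *\<^sub>C y"] *[of x] *[of y] unfolding expand by simp
  ultimately have "cinner (T y) x = cnj (cinner (T x) y)" by (simp add: complex_eq_iff)
  then show ?thesis using cinner_commute[of x "T y"] by simp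
qed

lemma positive_operator_add:
  assumes "positive_operator S" "positive_operator T"
  shows "positive_operator (\<lambda>x. S x + T x)"
  unfolding positive_operator_def cinner_add_left
proof (intro conjI allI nonneg_Reals_add_I)
  show "bounded_operator (\<lambda>x. S x + T x)"
    by (rule bounded_operator_add) (use assms in \<open>simp_all add: positive_operator_def\<close>)
qed (use assms in \<open>simp_all add: positive_operator_def\<close>)

lemma positive_operator_scale:
  assumes "0 \<le> r" "positive_operator T"
  shows "positive_operator (\<lambda>x. of_real r *\<^sub>C T x)"
  unfolding positive_operator_def cinner_scaleC_left
proof (intro conjI allI nonneg_Reals_mult_I)
  show "bounded_operator (\<lambda>x. of_real r *\<^sub>C T x)"
    by (rule bounded_operator_scale) (use assms in \<open>simp_all add: positive_operator_def\<close>)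
qed (use assms in \<open>simp_all add: positive_operator_def\<close>)

section \<open>The spectral theorem for positive compact operators\<close>

text \<open>Inductive step of the spectral theorem: the quadratic form is maximized over the unit
  ball of the orthogonal complement \<open>V\<close> of the eigenvectors found so far.
  \<open>V\<close> is invariant because \<open>T\<close> is symmetric, and compactness yields a
  maximizer, which is an eigenvector for the maximum \<open>m\<close>. If \<open>m = 0\<close>, the
  zero vector is returned, so that the construction never stops.\<close>

lemma compact_positive_eigenvector:
  fixes T :: "'a::complex_hilbert_space \<Rightarrow> 'a"
  assumes T: "positive_operator T" "compact_operator T"
    and F: "\<And>f. f \<in> F \<Longrightarrow> \<exists>\<nu>::real. T f = of_real \<nu> *\<^sub>C f"
  shows "\<exists>u m. 0 \<le> m \<and> T u = of_real m *\<^sub>C u \<and> (\<forall>f\<in>F. cinner u f = 0) \<and>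
    norm u = (if m = 0 then 0 else 1) \<and>
    (\<forall>y. (\<forall>f\<in>F. cinner y f = 0) \<longrightarrow> Re (cinner (T y) y) \<le> m * (norm y)\<^sup>2)"
proof -
  have bT: "bounded_operator T" using T by (simp add: positive_operator_def)
  note lin = bounded_operator_bounded_linear[OF bT]
  define V where "V = {x. \<forall>f\<in>F. cinner x f = 0}"
  have TV: "T x \<in> V" if "x \<in> V" for x
    unfolding V_def
  proof safe
    fix f assume f: "f \<in> F"
    then obtain \<nu> :: real where "T f = of_real \<nu> *\<^sub>C f" using F by blast
    then show "cinner (T x) f = 0"
      using that f by (simp add: V_def positive_operator_symmetric[OF T(1)] cinner_scaleC_right)
  qed
  define q where "q x = Re (cinner (T x) x)" for x
  obtain K where K: "K > 0" "\<And>x. norm (T x) \<le> norm x * K"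
    using bounded_linear.pos_bounded[OF lin] by blast
  have q_le: "q x \<le> K * (norm x)\<^sup>2" for x
  proof -
    have "q x \<le> norm (T x) * norm x"
      using cmod_cinner_le[of "T x" x] complex_Re_le_cmod[of "cinner (T x) x"] unfolding q_def by linarith
    also have "\<dots> \<le> norm x * K * norm x" by (intro mult_right_mono K) simp
    finally show ?thesis by (simp add: power2_eq_square mult_ac)
  qed
  have q_scale: "q (r *\<^sub>R x) = r\<^sup>2 * q x" for r x
    by (simp add: q_def bounded_operator_scaleC[OF bT] scaleR_eq_scaleC
        cinner_scaleC_left cinner_scaleC_right power2_eq_square)
  have "0 \<in> V" by (simp add: V_def)
  define m where "m = (SUP x\<in>V \<inter> cball 0 1. q x)"
  have bdd: "bdd_above (q ` (V \<inter> cball 0 1))"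
  proof (rule bdd_aboveI2)
    fix x assume "x \<in> V \<inter> cball 0 1"
    then have "(norm x)\<^sup>2 \<le> 1" by (simp add: power_le_one)
    then show "q x \<le> K" using q_le[of x] K(1) by (smt (verit) mult_left_le)
  qed
  have q_le_m: "q x \<le> m" if "x \<in> V" "norm x \<le> 1" for x
    unfolding m_def by (rule cSUP_upper[OF _ bdd]) (use that in auto)
  have "q 0 = 0" by (simp add: q_def)
  then have m0: "0 \<le> m" using q_le_m[OF \<open>0 \<in> V\<close>] by simp
  have q_le': "q y \<le> m * (norm y)\<^sup>2" if "y \<in> V" for y
  proof (cases "y = 0")
    case True then show ?thesis using \<open>q 0 = 0\<close> by simp
  next
    case False
    have "(1 / norm y) *\<^sub>R y \<in> V"
      using that by (simp add: V_def scaleR_eq_scaleC cinner_scaleC_left)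
    then have "q ((1 / norm y) *\<^sub>R y) \<le> m" by (rule q_le_m) simp
    then show ?thesis using False by (simp add: q_scale power_divide divide_simps)
  qed
  show ?thesis
  proof (cases "m = 0")
    case True
    then show ?thesis using q_le' bounded_operator_zero_vec[OF bT]
      by (intro exI[of _ 0]) (auto simp: V_def q_def)
  next
    case False
    with m0 have m: "m > 0" by simp
    have "\<exists>x. x \<in> V \<and> norm x \<le> 1 \<and> m - 1 / Suc n < q x" for n
    proof (rule ccontr)
      assume "\<not> ?thesis"
      then have "m \<le> m - 1 / Suc n"
        unfolding m_def by (intro cSUP_least) (use \<open>0 \<in> V\<close> in \<open>auto simp: not_less\<close>)
      then show False by simp
    qed
    then obtain x where x: "\<And>n. x n \<in> V" "\<And>n. norm (x n) \<le> 1" "\<And>n. m - 1 / Suc n < q (x n)"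
      by metis
    \<comment> \<open>On \<open>V\<close> the bound by \<open>m\<close> improves to T^2 \<le> m T:
      nonnegativity of \<open>q\<close> at \<open>y - (1 / m) *\<^sub>R T y\<close> is expanded, and
      its last term is bounded through
      \<open>q (T y) \<le> m * (norm (T y))\<^sup>2\<close>.\<close>
    have norm_T: "(norm (T y))\<^sup>2 \<le> m * q y" if "y \<in> V" for y
    proof -
      let ?z = "y - (1 / m) *\<^sub>R T y"
      have exp: "q (y - t *\<^sub>R T y) = q y - 2 * t * (norm (T y))\<^sup>2 + t\<^sup>2 * q (T y)" for t
      proof -
        have "cinner (T (T y)) y = cinner (T y) (T y)"
          by (rule positive_operator_symmetric[OF T(1)])
        then show ?thesis
          by (simp add: q_def bounded_operator_diff_vec[OF bT] bounded_operator_scaleC[OF bT] scaleR_eq_scaleC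
            cinner_diff_left cinner_diff_right cinner_scaleC_left cinner_scaleC_right cinner_self
            power2_eq_square algebra_simps)
      qed
      have "0 \<le> q ?z" using positive_operator_nonneg(1)[OF T(1)] by (simp add: q_def)
      also have "\<dots> = q y - 2 / m * (norm (T y))\<^sup>2 + q (T y) / m\<^sup>2"
        unfolding exp by (simp add: power_divide)
      also have "\<dots> \<le> q y - 2 / m * (norm (T y))\<^sup>2 + m * (norm (T y))\<^sup>2 / m\<^sup>2"
        using q_le'[OF TV[OF that]] by (intro add_left_mono divide_right_mono) auto
      also have "\<dots> = q y - (norm (T y))\<^sup>2 / m"
        using m by (simp add: field_simps power2_eq_square)
      finally show ?thesis using m by (simp add: field_simps)
    qed
    \<comment> \<open>A maximizing sequence consists of approximate eigenvectors: the square expands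
      to at most \<open>m * (m - q (x n))\<close>.\<close>
    have est: "(norm (T (x n) - m *\<^sub>R x n))\<^sup>2 \<le> m * (1 / Suc n)" for n
    proof -
      have "(norm (T (x n) - m *\<^sub>R x n))\<^sup>2 = (norm (T (x n)))\<^sup>2 - 2 * m * q (x n) + m\<^sup>2 * (norm (x n))\<^sup>2"
        unfolding power2_norm_eq_inner q_def inner_eq_Re_cinner[symmetric]
        by (simp add: inner_diff_left inner_diff_right inner_commute power2_eq_square)
      also have "\<dots> \<le> m * q (x n) - 2 * m * q (x n) + m\<^sup>2 * 1"
        using norm_T[OF x(1)] x(2)[of n] m by (intro add_mono diff_mono mult_left_mono power_le_one) auto
      also have "\<dots> = m * (m - q (x n))" by (simp add: algebra_simps power2_eq_square)
      also have "\<dots> \<le> m * (1 / Suc n)" using x(3)[of n] m by (intro mult_left_mono) auto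
      finally show ?thesis .
    qed
    have "compact (closure (T ` cball 0 1))" using T(2) by (simp add: compact_operator_def)
    moreover have "\<forall>n. T (x n) \<in> closure (T ` cball 0 1)"
      using x(2) closure_subset[of "T ` cball 0 1"] by auto
    ultimately obtain l r where r: "strict_mono r" "((\<lambda>n. T (x n)) \<circ> r) \<longlonglongrightarrow> l"
      unfolding compact_def by metis
    have "(\<lambda>n. T (x n) - m *\<^sub>R x n) \<longlonglongrightarrow> 0"
    proof (rule tendsto_norm_zero_cancel, rule Lim_null_comparison)
      show "\<forall>\<^sub>F n in sequentially. norm (norm (T (x n) - m *\<^sub>R x n)) \<le> sqrt (m * (1 / Suc n))"
        using est by (intro always_eventually allI) (simp add: real_le_rsqrt)
      show "(\<lambda>n. sqrt (m * (1 / Suc n))) \<longlonglongrightarrow> 0" using m by real_asymp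
    qed
    \<comment> \<open>Compactness gives convergence of the images only; since their distance to
      \<open>m *\<^sub>R x (r n)\<close> tends to 0 and \<open>m > 0\<close>, the vectors
      \<open>x (r n)\<close> converge as well.\<close>
    then have "(\<lambda>n. T (x (r n)) - m *\<^sub>R x (r n)) \<longlonglongrightarrow> 0"
      using LIMSEQ_subseq_LIMSEQ[OF _ r(1)] by (auto simp: o_def)
    then have "(\<lambda>n. (1 / m) *\<^sub>R (T (x (r n)) - (T (x (r n)) - m *\<^sub>R x (r n)))) \<longlonglongrightarrow> (1 / m) *\<^sub>R (l - 0)"
      using r(2) by (intro tendsto_intros) (auto simp: o_def)
    then have u: "(\<lambda>n. x (r n)) \<longlonglongrightarrow> (1 / m) *\<^sub>R l" (is "_ \<longlonglongrightarrow> ?u") using m by simp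
    have Tu: "T ?u = m *\<^sub>R ?u"
    proof -
      have "(\<lambda>n. T (x (r n))) \<longlonglongrightarrow> T ?u" by (rule bounded_linear.tendsto[OF lin u])
      moreover have "(\<lambda>n. T (x (r n))) \<longlonglongrightarrow> l" using r(2) by (simp add: o_def)
      ultimately show ?thesis using m LIMSEQ_unique by fastforce
    qed
    have uV: "cinner ?u f = 0" if "f \<in> F" for f
    proof -
      have "(\<lambda>n. cinner (x (r n)) f) \<longlonglongrightarrow> cinner ?u f"
        by (rule bounded_linear.tendsto[OF bounded_linear_cinner_left u])
      moreover have "(\<lambda>n. cinner (x (r n)) f) = (\<lambda>n. 0)" using x(1) that by (auto simp: V_def)
      ultimately show ?thesis by (simp add: LIMSEQ_const_iff)
    qed
    have qT: "(\<lambda>n. q (x (r n))) \<longlonglongrightarrow> q ?u"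
      unfolding q_def inner_eq_Re_cinner[symmetric]
      by (intro tendsto_intros u bounded_linear.tendsto[OF lin u])
    have "m \<le> q ?u"
    proof (rule LIMSEQ_le[OF _ qT])
      have "(\<lambda>n. m - 1 / Suc n) \<longlonglongrightarrow> m" by real_asymp
      then show "(\<lambda>n. m - 1 / Suc (r n)) \<longlonglongrightarrow> m"
        using LIMSEQ_subseq_LIMSEQ[OF _ r(1)] by (auto simp: o_def)
      show "\<exists>N. \<forall>n\<ge>N. m - 1 / Suc (r n) \<le> q (x (r n))" using x(3) less_imp_le by blast
    qed
    also have "q v = m * (norm v)\<^sup>2" if "T v = m *\<^sub>R v" for v
      by (simp add: q_def that scaleR_eq_scaleC cinner_scaleC_left cinner_self)
    note this[OF Tu]
    finally have "1 \<le> (norm ?u)\<^sup>2" using m by simp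
    then have "1 \<le> norm ?u"
      by (metis abs_norm_cancel one_power2 power2_le_iff_abs_le zero_le_one abs_one abs_le_square_iff)
    moreover have "norm ?u \<le> 1"
      by (rule LIMSEQ_le_const2[OF tendsto_norm[OF u]]) (use x(2) in auto)
    ultimately have "norm ?u = 1" by (meson order_antisym)
    with Tu uV obtain v where "T v = m *\<^sub>R v" "norm v = 1" "\<And>f. f \<in> F \<Longrightarrow> cinner v f = 0" by blast
    then show ?thesis
      using m q_le' by (intro exI[of _ v] exI[of _ m]) (auto simp: scaleR_eq_scaleC V_def q_def)
  qed
qed

text \<open>Eigenvectors for the eigenvalue 0 are replaced by the zero vector, so that finite rank
  is no special case. The last clause, the variational bound on the complement of the first
  \<open>N\<close> vectors, stands in for completeness of the eigenvectors.\<close>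

definition spectral_sequence ::
    "('a \<Rightarrow> 'a::complex_hilbert_space) \<Rightarrow> (nat \<Rightarrow> 'a) \<Rightarrow> (nat \<Rightarrow> real) \<Rightarrow> bool" where
  "spectral_sequence T u \<mu> \<longleftrightarrow> decseq \<mu> \<and> (\<forall>j. 0 \<le> \<mu> j \<and> T (u j) = of_real (\<mu> j) *\<^sub>C u j \<and>
      norm (u j) = (if \<mu> j = 0 then 0 else 1)) \<and>
    (\<forall>i j. i \<noteq> j \<longrightarrow> cinner (u i) (u j) = 0) \<and>
    (\<forall>N y. (\<forall>j<N. cinner y (u j) = 0) \<longrightarrow> Re (cinner (T y) y) \<le> \<mu> N * (norm y)\<^sup>2)"

lemma spectral_sequence_unit:
  "spectral_sequence T u \<mu> \<Longrightarrow> norm (u j) = 1 \<or> u j = 0"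
  unfolding spectral_sequence_def by (metis norm_eq_zero)

text \<open>Dependent choice: \<open>P f n r\<close> says that the pair \<open>r\<close> is a top
  eigenvector and eigenvalue on the complement of the vectors chosen before
  \<open>n\<close>.\<close>

lemma spectral_sequence_exists:
  fixes T :: "'a::complex_hilbert_space \<Rightarrow> 'a"
  assumes T: "positive_operator T" "compact_operator T"
  shows "\<exists>u \<mu>. spectral_sequence T u \<mu>"
proof -
  define P where "P f n r \<longleftrightarrow> (0 \<le> snd r \<and> T (fst r) = of_real (snd r) *\<^sub>C fst r \<and>
      (\<forall>j<n. cinner (fst r) (fst (f j)) = 0) \<and> norm (fst r) = (if snd r = 0 then 0 else 1) \<and>
      (\<forall>y. (\<forall>j<n. cinner y (fst (f j)) = 0) \<longrightarrow> Re (cinner (T y) y) \<le> snd r * (norm y)\<^sup>2))"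
    for f :: "nat \<Rightarrow> 'a \<times> real" and n :: nat and r
  have "\<exists>f. \<forall>n. P f n (f n)"
  proof (rule dependent_wellorder_choice)
    fix r and f g :: "nat \<Rightarrow> 'a \<times> real" and n
    assume "\<And>y. y < n \<Longrightarrow> f y = g y"
    then show "P f n r = P g n r" by (simp add: P_def)
  next
    fix n and f :: "nat \<Rightarrow> 'a \<times> real"
    assume "\<And>j. j < n \<Longrightarrow> P f j (f j)"
    then have "\<And>v. v \<in> (\<lambda>j. fst (f j)) ` {..<n} \<Longrightarrow> \<exists>\<nu>::real. T v = of_real \<nu> *\<^sub>C v"
      by (force simp: P_def)
    from compact_positive_eigenvector[where F = "(\<lambda>j. fst (f j)) ` {..<n}", OF T this] obtain u m where um: "0 \<le> m" "T u = of_real m *\<^sub>C u"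
        "\<forall>v\<in>(\<lambda>j. fst (f j)) ` {..<n}. cinner u v = 0" "norm u = (if m = 0 then 0 else 1)"
        "\<forall>y. (\<forall>v\<in>(\<lambda>j. fst (f j)) ` {..<n}. cinner y v = 0) \<longrightarrow> Re (cinner (T y) y) \<le> m * (norm y)\<^sup>2"
      by blast
    have "P f n (u, m)" unfolding P_def fst_conv snd_conv
      by (intro conjI allI impI um(1,2,4)) (use um(3,5) in auto)
    then show "\<exists>r. P f n r" ..
  qed
  then obtain f where f: "\<And>n. P f n (f n)" by blast
  define u \<mu> where "u = (\<lambda>n. fst (f n))" and "\<mu> = (\<lambda>n. snd (f n))"
  have *: "0 \<le> \<mu> n" "T (u n) = of_real (\<mu> n) *\<^sub>C u n" "\<And>j. j < n \<Longrightarrow> cinner (u n) (u j) = 0"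
    "norm (u n) = (if \<mu> n = 0 then 0 else 1)"
    "\<And>y. (\<And>j. j < n \<Longrightarrow> cinner y (u j) = 0) \<Longrightarrow> Re (cinner (T y) y) \<le> \<mu> n * (norm y)\<^sup>2" for n
    using f[of n] by (auto simp: P_def u_def \<mu>_def)
  \<comment> \<open>The vector \<open>u (Suc n)\<close> is also orthogonal to the first
    \<open>n\<close> vectors, hence a competitor in the bound by \<open>\<mu> n\<close>.\<close>
  have "\<mu> (Suc n) \<le> \<mu> n" for n
  proof (cases "\<mu> (Suc n) = 0")
    case False
    have "Re (cinner (T (u (Suc n))) (u (Suc n))) \<le> \<mu> n * (norm (u (Suc n)))\<^sup>2"
      by (rule *(5)) (simp add: *(3))
    then show ?thesis using False *(4)[of "Suc n"] by (simp add: *(2) cinner_scaleC_left cinner_self)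
  qed (simp add: *(1))
  moreover have "cinner (u i) (u j) = 0" if "i \<noteq> j" for i j
    using that *(3)[of j i] *(3)[of i j] cinner_commute_eq_0[of "u i" "u j"] by (cases "i < j") auto
  ultimately have "spectral_sequence T u \<mu>"
    unfolding spectral_sequence_def using * by (auto simp: decseq_Suc_iff)
  then show ?thesis by blast
qed

text \<open>Orthonormal eigenvectors with eigenvalues at least \<nu> have images at mutual distance
  at least \<nu>, which leaves no convergent subsequence.\<close>

lemma spectral_sequence_finite:
  fixes T :: "'a::complex_hilbert_space \<Rightarrow> 'a"
  assumes T: "compact_operator T" and S: "spectral_sequence T u \<mu>" and \<nu>: "\<nu> > 0"
  shows "finite {j. \<nu> \<le> \<mu> j}"
proof (rule ccontr)
  assume "infinite {j. \<nu> \<le> \<mu> j}"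
  from infinite_enumerate[OF this] obtain r :: "nat \<Rightarrow> nat"
    where r: "strict_mono r" "\<And>n. \<nu> \<le> \<mu> (r n)" by blast
  have n1: "norm (u (r n)) = 1" for n
    using S r(2)[of n] \<nu> by (auto simp: spectral_sequence_def)
  have "compact (closure (T ` cball 0 1))" using T by (simp add: compact_operator_def)
  moreover have "\<forall>n. T (u (r n)) \<in> closure (T ` cball 0 1)"
    using n1 closure_subset[of "T ` cball 0 1"] by auto
  ultimately obtain l s where s: "strict_mono s" "((\<lambda>n. T (u (r n))) \<circ> s) \<longlonglongrightarrow> l"
    unfolding compact_def by metis
  then have "Cauchy ((\<lambda>n. T (u (r n))) \<circ> s)" using LIMSEQ_imp_Cauchy by blast
  then obtain M where M: "\<And>m n. m \<ge> M \<Longrightarrow> n \<ge> M \<Longrightarrow> dist (T (u (r (s m)))) (T (u (r (s n)))) < \<nu>"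
    unfolding Cauchy_def o_def using \<nu> by meson
  define i j where "i = r (s M)" and "j = r (s (Suc M))"
  have "i \<noteq> j"
    using s(1) r(1) unfolding i_def j_def by (metis lessI less_irrefl strict_mono_less)
  have ij: "cinner (u i) (u j) = 0" "norm (u i) = 1" "norm (u j) = 1" "\<nu> \<le> \<mu> i" "\<nu> \<le> \<mu> j"
    using S \<open>i \<noteq> j\<close> n1 r(2) by (auto simp: spectral_sequence_def i_def j_def)
  have Tu: "T (u k) = of_real (\<mu> k) *\<^sub>C u k" for k using S by (simp add: spectral_sequence_def)
  have "cinner (T (u i) - T (u j)) (u i) = of_real (\<mu> i)"
    using ij cinner_commute_eq_0[of "u i" "u j"]
    by (simp add: Tu cinner_diff_left cinner_scaleC_left cinner_self)
  then have "\<mu> i \<le> norm (T (u i) - T (u j))"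
    using cmod_cinner_le[of "T (u i) - T (u j)" "u i"] ij by simp
  then show False using M[of M "Suc M"] ij(4) by (simp add: i_def j_def dist_norm)
qed

text \<open>The vectors \<open>u j\<close> with \<open>\<mu> j = \<nu>\<close> form a basis of the
  eigenspace. They span it because an eigenvector, after removal of its components along the first
  \<open>N\<close> vectors with \<open>\<mu> N < \<nu>\<close>, is still an eigenvector for \<nu>
  and would violate the variational bound at \<open>N\<close> unless it vanishes.\<close>

lemma spectral_sequence_eigenspace_dim:
  fixes T :: "'a::complex_hilbert_space \<Rightarrow> 'a"
  assumes T: "positive_operator T" "compact_operator T" and S: "spectral_sequence T u \<mu>" and \<nu>: "\<nu> > 0"
  shows "complex_vs.dim {x. T x = of_real \<nu> *\<^sub>C x} = card {j. \<mu> j = \<nu>}"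
proof -
  note symm = positive_operator_symmetric[OF T(1)]
  have bT: "bounded_operator T" using T by (simp add: positive_operator_def)
  have S': "decseq \<mu>" "\<And>j. 0 \<le> \<mu> j" "\<And>j. T (u j) = of_real (\<mu> j) *\<^sub>C u j"
      "\<And>j. norm (u j) = (if \<mu> j = 0 then 0 else 1)" "\<And>i j. i \<noteq> j \<Longrightarrow> cinner (u i) (u j) = 0"
      "\<And>N y. (\<And>j. j < N \<Longrightarrow> cinner y (u j) = 0) \<Longrightarrow> Re (cinner (T y) y) \<le> \<mu> N * (norm y)\<^sup>2"
    using S by (auto simp: spectral_sequence_def)
  let ?V = "{x. T x = of_real \<nu> *\<^sub>C x}" and ?B = "u ` {j. \<mu> j = \<nu>}"
  have inj: "inj_on u {j. \<mu> j = \<nu>}"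
  proof (rule inj_onI, rule ccontr)
    fix i j assume "i \<in> {j. \<mu> j = \<nu>}" "j \<in> {j. \<mu> j = \<nu>}" "u i = u j" "i \<noteq> j"
    then show False using S'(5)[of i j] S'(4)[of j] \<nu> by (auto simp: cinner_self)
  qed
  have indep: "complex_vs.independent ?B"
    unfolding complex_vs.dependent_def
  proof
    assume "\<exists>a\<in>?B. a \<in> complex_vs.span (?B - {a})"
    then obtain i where i: "\<mu> i = \<nu>" "u i \<in> complex_vs.span (?B - {u i})" by auto
    have "cinner x (u i) = 0" if "x \<in> complex_vs.span (?B - {u i})" for x
      using that
    proof (rule complex_vs.span_induct)
      show "complex_vs.subspace {a. cinner a (u i) = 0}"
        by (auto simp: complex_vs.subspace_def cinner_add_left cinner_scaleC_left)
      fix a assume "a \<in> ?B - {u i}"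
      then obtain j where "a = u j" "j \<noteq> i" by auto
      then show "cinner a (u i) = 0" using S'(5) by simp
    qed
    from this[OF i(2)] show False using i(1) \<nu> S'(4)[of i] by (simp add: cinner_self)
  qed
  have "?V \<subseteq> complex_vs.span ?B"
  proof safe
    fix x assume x: "T x = of_real \<nu> *\<^sub>C x"
    have "{j. \<nu> \<le> \<mu> j} \<noteq> UNIV" using spectral_sequence_finite[OF T(2) S \<nu>] by force
    then obtain N where N: "\<mu> N < \<nu>" by (metis (mono_tags) UNIV_eq_I mem_Collect_eq not_le)
    have zero: "cinner x (u j) = 0" if "\<mu> j \<noteq> \<nu>" for j
      using symm[of x "u j"] that by (simp add: x S'(3) cinner_scaleC_left cinner_scaleC_right)
    define y where "y = x - (\<Sum>j<N. cinner x (u j) *\<^sub>C u j)"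
    have y_orth: "cinner y (u j) = 0" if "j < N" for j
      unfolding y_def
      by (rule orthogonal_remainder) (use S'(5) spectral_sequence_unit[OF S] that in simp_all)
    have "T (\<Sum>j<N. cinner x (u j) *\<^sub>C u j) = (\<Sum>j<N. of_real \<nu> *\<^sub>C cinner x (u j) *\<^sub>C u j)"
      unfolding bounded_operator_sum_vec[OF bT]
    proof (rule sum.cong[OF refl])
      fix j
      show "T (cinner x (u j) *\<^sub>C u j) = of_real \<nu> *\<^sub>C cinner x (u j) *\<^sub>C u j"
        using zero[of j] by (cases "\<mu> j = \<nu>")
          (auto simp: bounded_operator_scaleC[OF bT] S'(3) scaleC_scaleC mult.commute bounded_operator_zero_vec[OF bT])
    qed
    then have "T y = of_real \<nu> *\<^sub>C y"
      unfolding y_def bounded_operator_diff_vec[OF bT] x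
      by (simp add: complex_vs.scale_right_diff_distrib complex_vs.scale_sum_right)
    then have "\<nu> * (norm y)\<^sup>2 \<le> \<mu> N * (norm y)\<^sup>2"
      using S'(6)[OF y_orth, of N] by (simp add: cinner_scaleC_left cinner_self)
    then have "y = 0" using N by (simp add: mult_le_cancel_right)
    then have "x = (\<Sum>j<N. cinner x (u j) *\<^sub>C u j)" by (simp add: y_def)
    also have "\<dots> \<in> complex_vs.span ?B"
    proof (rule complex_vs.span_sum)
      fix j
      show "cinner x (u j) *\<^sub>C u j \<in> complex_vs.span ?B"
        using zero[of j]
        by (cases "\<mu> j = \<nu>") (auto intro: complex_vs.span_scale complex_vs.span_base complex_vs.span_zero)
    qed
    finally show "x \<in> complex_vs.span ?B" .
  qed
  moreover have "?B \<subseteq> complex_vs.span ?V" using S'(3) by (auto intro!: complex_vs.span_base)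
  ultimately have "complex_vs.span ?B = complex_vs.span ?V"
    by (simp add: complex_vs.span_eq)
  from complex_vs.dim_eq_card[OF this indep] show ?thesis
    using card_image[OF inj] by simp
qed

text \<open>Gives uniqueness in the description of \<open>eigenvalues\<close>. At a first index
  \<open>j\<close> with \<open>\<alpha> j > \<beta> j\<close>, every index where \<beta> takes the
  value \<open>\<alpha> j\<close> lies below \<open>j\<close>, where the sequences agree; so
  \<alpha> takes this value at one index more, namely \<open>j\<close>, against equal finite
  multiplicities.\<close>

lemma multiplicities_determine_decseq:
  fixes \<mu> \<mu>' :: "nat \<Rightarrow> real"
  assumes "decseq \<mu>" "decseq \<mu>'" "\<And>j. 0 \<le> \<mu> j" "\<And>j. 0 \<le> \<mu>' j"
    and fin: "\<And>\<nu>. \<nu> > 0 \<Longrightarrow> finite {j. \<mu> j = \<nu>}" "\<And>\<nu>. \<nu> > 0 \<Longrightarrow> finite {j. \<mu>' j = \<nu>}"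
    and card: "\<And>\<nu>. \<nu> > 0 \<Longrightarrow> card {j. \<mu> j = \<nu>} = card {j. \<mu>' j = \<nu>}"
  shows "\<mu> = \<mu>'"
proof -
  have aux: "\<not> \<alpha> j > \<beta> j" if "decseq \<beta>" "\<And>j. 0 \<le> \<beta> j" "\<And>i. i < j \<Longrightarrow> \<alpha> i = \<beta> i"
     "\<And>\<nu>. \<nu> > 0 \<Longrightarrow> finite {j. \<alpha> j = \<nu>}" "\<And>\<nu>. \<nu> > 0 \<Longrightarrow> card {j. \<alpha> j = \<nu>} = card {j. \<beta> j = \<nu>}"
    for \<alpha> \<beta> :: "nat \<Rightarrow> real" and j
  proof
    assume gt: "\<alpha> j > \<beta> j"
    then have pos: "\<alpha> j > 0" using that(2)[of j] by linarith
    have "{i. \<beta> i = \<alpha> j} \<subset> {i. \<alpha> i = \<alpha> j}"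
    proof (rule psubsetI)
      show "{i. \<beta> i = \<alpha> j} \<subseteq> {i. \<alpha> i = \<alpha> j}"
      proof safe
        fix i assume i: "\<beta> i = \<alpha> j"
        then have "i < j" using gt decseqD[OF that(1), of j i] by (cases "i < j") auto
        then show "\<alpha> i = \<alpha> j" using that(3) i by simp
      qed
      have "j \<in> {i. \<alpha> i = \<alpha> j}" "j \<notin> {i. \<beta> i = \<alpha> j}" using gt by simp_all
      then show "{i. \<beta> i = \<alpha> j} \<noteq> {i. \<alpha> i = \<alpha> j}" by metis
    qed
    from psubset_card_mono[OF that(4)[OF pos] this] that(5)[OF pos] show False by simp
  qed
  have "\<mu> j = \<mu>' j" for j
  proof (induction j rule: less_induct)
    case (less j)
    have "\<not> \<mu> j > \<mu>' j" by (rule aux) (use assms less in auto)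
    moreover have "\<not> \<mu>' j > \<mu> j" by (rule aux) (use assms less in auto)
    ultimately show ?case by simp
  qed
  then show ?thesis by blast
qed

lemma eigenvalues_eq:
  fixes T :: "'a::complex_hilbert_space \<Rightarrow> 'a"
  assumes T: "positive_operator T" "compact_operator T" and S: "spectral_sequence T u \<mu>"
  shows "eigenvalues T = \<mu>"
  unfolding eigenvalues_def
proof (rule the_equality)
  have fin: "finite {j. \<mu> j = \<nu>}" if "\<nu> > 0" for \<nu>
    by (rule finite_subset[OF _ spectral_sequence_finite[OF T(2) S that]]) auto
  show *: "decseq \<mu> \<and> (\<forall>j. 0 \<le> \<mu> j) \<and> (\<forall>\<nu>>0. finite {j. \<mu> j = \<nu>} \<and>
        card {j. \<mu> j = \<nu>} = complex_vs.dim {x. T x = of_real \<nu> *\<^sub>C x})"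
  proof (intro conjI allI impI)
    show "decseq \<mu>" "0 \<le> \<mu> j" for j using S by (simp_all add: spectral_sequence_def)
    fix \<nu> :: real assume "\<nu> > 0"
    then show "finite {j. \<mu> j = \<nu>}"
        "card {j. \<mu> j = \<nu>} = complex_vs.dim {x. T x = of_real \<nu> *\<^sub>C x}"
      by (simp_all only: fin spectral_sequence_eigenspace_dim[OF T S])
  qed
  fix \<mu>' assume **: "decseq \<mu>' \<and> (\<forall>j. 0 \<le> \<mu>' j) \<and> (\<forall>\<nu>>0. finite {j. \<mu>' j = \<nu>} \<and>
        card {j. \<mu>' j = \<nu>} = complex_vs.dim {x. T x = of_real \<nu> *\<^sub>C x})"
  show "\<mu>' = \<mu>"
  proof (rule multiplicities_determine_decseq)
    fix \<nu> :: real assume "\<nu> > 0"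
    then show "finite {j. \<mu>' j = \<nu>}" "finite {j. \<mu> j = \<nu>}" "card {j. \<mu>' j = \<nu>} = card {j. \<mu> j = \<nu>}"
      using * ** by presburger+
  qed (use * ** in presburger)+
qed

lemma eigenvalues_spectral_sequence:
  fixes T :: "'a::complex_hilbert_space \<Rightarrow> 'a"
  assumes T: "positive_operator T" "compact_operator T"
  obtains u where "spectral_sequence T u (eigenvalues T)"
  using spectral_sequence_exists[OF assms] eigenvalues_eq[OF assms] by metis

lemma eigenvalues_nonneg:
  assumes T: "positive_operator T" "compact_operator T"
  shows "0 \<le> eigenvalues T j"
  using eigenvalues_spectral_sequence[OF assms] unfolding spectral_sequence_def by metis

lemma decseq_eigenvalues:
  assumes T: "positive_operator T" "compact_operator T"
  shows "decseq (eigenvalues T)"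
  using eigenvalues_spectral_sequence[OF assms] unfolding spectral_sequence_def by metis

section \<open>Ky Fan's maximum principle\<close>

lemma spectral_sequence_quadratic_form:
  fixes T :: "'a::complex_hilbert_space \<Rightarrow> 'a"
  assumes T: "positive_operator T" and S: "spectral_sequence T u \<mu>"
  defines "r N x \<equiv> x - (\<Sum>j<N. cinner x (u j) *\<^sub>C u j)"
  shows "Re (cinner (T x) x) = (\<Sum>j<N. \<mu> j * (cmod (cinner x (u j)))\<^sup>2) + Re (cinner (T (r N x)) (r N x))"
proof -
  have bT: "bounded_operator T" using T by (simp add: positive_operator_def)
  have S': "\<And>j. T (u j) = of_real (\<mu> j) *\<^sub>C u j"
      "\<And>j. norm (u j) = (if \<mu> j = 0 then 0 else 1)" "\<And>i j. i \<noteq> j \<Longrightarrow> cinner (u i) (u j) = 0"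
    using S by (auto simp: spectral_sequence_def)
  define p where "p = (\<Sum>j<N. cinner x (u j) *\<^sub>C u j)"
  let ?y = "r N x"
  have x: "x = p + ?y" by (simp add: r_def p_def)
  have y_orth: "cinner ?y (u j) = 0" if "j < N" for j
    unfolding r_def by (rule orthogonal_remainder) (use S'(3) spectral_sequence_unit[OF S] that in simp_all)
  have Tp: "T p = (\<Sum>j<N. (of_real (\<mu> j) * cinner x (u j)) *\<^sub>C u j)"
    by (simp add: p_def bounded_operator_sum_vec[OF bT] bounded_operator_scaleC[OF bT] S'(1) scaleC_scaleC mult.commute)
  \<comment> \<open>\<open>T\<close> maps the span of the first \<open>N\<close> eigenvectors into
    itself, so no cross terms arise.\<close>
  have "cinner ?y (T p) = 0"
    by (simp add: Tp cinner_sum_right cinner_scaleC_right y_orth)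
  then have cross: "cinner (T ?y) p = 0" "cinner (T p) ?y = 0"
    using positive_operator_symmetric[OF T, of ?y p] cinner_commute_eq_0[of ?y "T p"] by simp_all
  have "cinner (T x) x = cinner (T p) p + cinner (T ?y) ?y"
    by (subst (1 2) x) (simp add: bounded_operator_add_vec[OF bT] cinner_add_left cinner_add_right cross)
  moreover have "cinner (T p) p = of_real (\<Sum>j<N. \<mu> j * (cmod (cinner x (u j)))\<^sup>2)"
  proof -
    have "cinner (u j) p = cnj (cinner x (u j))" if "j < N" for j
    proof -
      have "cinner (u j) ?y = 0" using y_orth[OF that] cinner_commute_eq_0 by blast
      then have "cinner (u j) x = cinner (u j) p" by (subst x) (simp add: cinner_add_right)
      then show ?thesis using cinner_commute[of "u j" x] by simp
    qed
    then have "cinner (T p) p = (\<Sum>j<N. of_real (\<mu> j) * (cinner x (u j) * cnj (cinner x (u j))))"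
      by (simp add: Tp cinner_sum_left cinner_scaleC_left mult.assoc)
    then show ?thesis by (simp add: complex_norm_square flip: of_real_power)
  qed
  ultimately show ?thesis by simp
qed

text \<open>Once the component beyond the first \<open>N\<close> eigenvectors is bounded by
  \<open>\<mu> N\<close>, the \<open>j\<close>-th coefficient enters with the nonnegative weight
  \<open>\<mu> j - \<mu> N\<close>. Bessel's inequality, now for the expansion of \<open>u j\<close>
  along \<open>E\<close>, bounds each coefficient sum by 1, and \<open>card E \<le> N\<close>
  handles the remaining constant.\<close>

lemma ky_fan_le:
  fixes T :: "'a::complex_hilbert_space \<Rightarrow> 'a"
  assumes T: "positive_operator T" "compact_operator T"
    and E: "finite E" "orthonormal E" "card E \<le> N"
  shows "(\<Sum>e\<in>E. Re (cinner (T e) e)) \<le> (\<Sum>j<N. eigenvalues T j)"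
proof -
  define \<mu> where "\<mu> = eigenvalues T"
  obtain u where S: "spectral_sequence T u \<mu>"
    using eigenvalues_spectral_sequence[OF T] unfolding \<mu>_def by blast
  have S': "decseq \<mu>" "\<And>j. 0 \<le> \<mu> j"
      "\<And>j. norm (u j) = (if \<mu> j = 0 then 0 else 1)" "\<And>i j. i \<noteq> j \<Longrightarrow> cinner (u i) (u j) = 0"
      "\<And>N y. (\<And>j. j < N \<Longrightarrow> cinner y (u j) = 0) \<Longrightarrow> Re (cinner (T y) y) \<le> \<mu> N * (norm y)\<^sup>2"
    using S by (auto simp: spectral_sequence_def)
  have "Re (cinner (T e) e) \<le> (\<Sum>j<N. (\<mu> j - \<mu> N) * (cmod (cinner e (u j)))\<^sup>2) + \<mu> N" if "e \<in> E" for e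
  proof -
    let ?y = "e - (\<Sum>j<N. cinner e (u j) *\<^sub>C u j)"
    have "Re (cinner (T e) e) = (\<Sum>j<N. \<mu> j * (cmod (cinner e (u j)))\<^sup>2) + Re (cinner (T ?y) ?y)"
      by (rule spectral_sequence_quadratic_form[OF T(1) S])
    also have "Re (cinner (T ?y) ?y) \<le> \<mu> N * (norm ?y)\<^sup>2"
      by (intro S'(5) orthogonal_remainder) (use S'(4) spectral_sequence_unit[OF S] in simp_all)
    also have "(norm ?y)\<^sup>2 = 1 - (\<Sum>j<N. (cmod (cinner e (u j)))\<^sup>2)"
      using norm_orthogonal_decomposition[where I = "{..<N}" and u = u and x = e]
        S'(4) spectral_sequence_unit[OF S] E(2) that by (simp add: orthonormal_def)
    finally show ?thesis
      by (simp add: algebra_simps sum_subtractf sum_distrib_left)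
  qed
  then have "(\<Sum>e\<in>E. Re (cinner (T e) e)) \<le> (\<Sum>e\<in>E. (\<Sum>j<N. (\<mu> j - \<mu> N) * (cmod (cinner e (u j)))\<^sup>2) + \<mu> N)"
    by (rule sum_mono)
  also have "\<dots> = (\<Sum>j<N. (\<mu> j - \<mu> N) * (\<Sum>e\<in>E. (cmod (cinner (u j) e))\<^sup>2)) + card E * \<mu> N"
    unfolding sum.distrib sum_distrib_left
    by (subst sum.swap) (simp add: cmod_cinner_commute)
  also have "\<dots> \<le> (\<Sum>j<N. (\<mu> j - \<mu> N) * 1) + N * \<mu> N"
  proof (intro add_mono sum_mono mult_left_mono mult_right_mono)
    fix j assume "j \<in> {..<N}"
    then show "0 \<le> \<mu> j - \<mu> N" using decseqD[OF S'(1), of j N] by simp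
    have "(\<Sum>e\<in>E. (cmod (cinner (u j) e))\<^sup>2) \<le> (norm (u j))\<^sup>2" by (rule bessel_orthonormal[OF E(1,2)])
    then show "(\<Sum>e\<in>E. (cmod (cinner (u j) e))\<^sup>2) \<le> 1" using S'(3)[of j] by (auto split: if_splits)
  qed (use E S' in auto)
  also have "\<dots> = (\<Sum>j<N. \<mu> j)" by (simp add: sum_subtractf)
  finally show ?thesis unfolding \<mu>_def .
qed

text \<open>The supremum is reached on the first \<open>N\<close> eigenvectors \<open>F\<close>, but
  the bound is stated for every \<open>E\<close> whose span contains \<open>F\<close>: a single
  system can then serve two operators at the same time.\<close>

lemma ky_fan_attained:
  fixes T :: "'a::complex_hilbert_space \<Rightarrow> 'a"
  assumes T: "positive_operator T" "compact_operator T"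
  obtains F where "finite F" "card F \<le> N"
    "\<And>E. finite E \<Longrightarrow> orthonormal E \<Longrightarrow> (\<And>f. f \<in> F \<Longrightarrow> f = (\<Sum>e\<in>E. cinner f e *\<^sub>C e)) \<Longrightarrow>
       (\<Sum>j<N. eigenvalues T j) \<le> (\<Sum>e\<in>E. Re (cinner (T e) e))"
proof -
  define \<mu> where "\<mu> = eigenvalues T"
  obtain u where S: "spectral_sequence T u \<mu>"
    using eigenvalues_spectral_sequence[OF T] unfolding \<mu>_def by blast
  have S': "\<And>j. 0 \<le> \<mu> j" "\<And>j. norm (u j) = (if \<mu> j = 0 then 0 else 1)"
    using S by (auto simp: spectral_sequence_def)
  show ?thesis
  proof (rule that[of "u ` {..<N}"])
    show "finite (u ` {..<N})" "card (u ` {..<N}) \<le> N" using card_image_le[of "{..<N}" u] by auto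
    fix E assume E: "finite E" "orthonormal E" "\<And>f. f \<in> u ` {..<N} \<Longrightarrow> f = (\<Sum>e\<in>E. cinner f e *\<^sub>C e)"
    have "(\<Sum>j<N. \<mu> j) = (\<Sum>j<N. \<mu> j * (\<Sum>e\<in>E. (cmod (cinner (u j) e))\<^sup>2))"
    proof (rule sum.cong[OF refl])
      fix j assume j: "j \<in> {..<N}"
      have "(norm (u j))\<^sup>2 = (\<Sum>e\<in>E. (cmod (cinner (u j) e))\<^sup>2)"
        using norm_orthogonal_decomposition[where I = E and u = "\<lambda>e. e" and x = "u j"] E(1,2) E(3)[of "u j"] j
        by (auto simp: orthonormal_def)
      then show "\<mu> j = \<mu> j * (\<Sum>e\<in>E. (cmod (cinner (u j) e))\<^sup>2)"
        using S'(2)[of j] by (auto split: if_splits)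
    qed
    also have "\<dots> = (\<Sum>e\<in>E. \<Sum>j<N. \<mu> j * (cmod (cinner e (u j)))\<^sup>2)"
      unfolding sum_distrib_left by (subst sum.swap) (simp add: cmod_cinner_commute)
    also have "\<dots> \<le> (\<Sum>e\<in>E. Re (cinner (T e) e))"
    proof (rule sum_mono)
      fix e
      show "(\<Sum>j<N. \<mu> j * (cmod (cinner e (u j)))\<^sup>2) \<le> Re (cinner (T e) e)"
        using spectral_sequence_quadratic_form[OF T(1) S, of e N]
          positive_operator_nonneg(1)[OF T(1)] by simp
    qed
    finally show "(\<Sum>j<N. eigenvalues T j) \<le> (\<Sum>e\<in>E. Re (cinner (T e) e))" unfolding \<mu>_def .
  qed
qed

text \<open>Bounds for partial traces over arbitrary orthonormal systems carry over to eigenvalue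
  sums; the later upper estimates are obtained in this way, without knowing any eigenvector.\<close>

lemma sum_eigenvalues_le:
  fixes T :: "'a::complex_hilbert_space \<Rightarrow> 'a"
  assumes T: "positive_operator T" "compact_operator T"
    and le: "\<And>E. finite E \<Longrightarrow> orthonormal E \<Longrightarrow> card E \<le> N \<Longrightarrow> (\<Sum>e\<in>E. Re (cinner (T e) e)) \<le> c"
  shows "(\<Sum>j<N. eigenvalues T j) \<le> c"
proof -
  obtain F where F: "finite F" "card F \<le> N"
    "\<And>E. finite E \<Longrightarrow> orthonormal E \<Longrightarrow> (\<And>f. f \<in> F \<Longrightarrow> f = (\<Sum>e\<in>E. cinner f e *\<^sub>C e)) \<Longrightarrow>
       (\<Sum>j<N. eigenvalues T j) \<le> (\<Sum>e\<in>E. Re (cinner (T e) e))"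
    by (rule ky_fan_attained[OF T, of N]) blast
  obtain E where E: "finite E" "card E \<le> card F" "orthonormal E" "\<forall>f\<in>F. f = (\<Sum>e\<in>E. cinner f e *\<^sub>C e)"
    using orthonormal_span_exists[OF F(1)] by blast
  have "(\<Sum>j<N. eigenvalues T j) \<le> (\<Sum>e\<in>E. Re (cinner (T e) e))"
    using E by (intro F(3)) auto
  also have "\<dots> \<le> c" using E F(2) by (intro le) auto
  finally show ?thesis .
qed

section \<open>Additivity of Dixmier traces\<close>

lemma sum_eigenvalues_add_le:
  fixes S T :: "'a::complex_hilbert_space \<Rightarrow> 'a"
  assumes S: "positive_operator S" "compact_operator S" and T: "positive_operator T" "compact_operator T"
  shows "(\<Sum>j<N. eigenvalues (\<lambda>x. S x + T x) j) \<le> (\<Sum>j<N. eigenvalues S j) + (\<Sum>j<N. eigenvalues T j)"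
proof (rule sum_eigenvalues_le)
  show "positive_operator (\<lambda>x. S x + T x)" by (rule positive_operator_add[OF S(1) T(1)])
  show "compact_operator (\<lambda>x. S x + T x)" by (rule compact_operator_add[OF S(2) T(2)])
  fix E :: "'a set" assume E: "finite E" "orthonormal E" "card E \<le> N"
  show "(\<Sum>e\<in>E. Re (cinner (S e + T e) e)) \<le> (\<Sum>j<N. eigenvalues S j) + (\<Sum>j<N. eigenvalues T j)"
    using ky_fan_le[OF S E] ky_fan_le[OF T E] by (simp add: cinner_add_left sum.distrib)
qed

text \<open>The factor 2 is a dimension count: the optimal vectors of \<open>S\<close> and of
  \<open>T\<close> together span at most \<open>2 * N\<close> dimensions, and a common orthonormal
  system for this span serves both operators.\<close>

lemma sum_eigenvalues_add_ge:
  fixes S T :: "'a::complex_hilbert_space \<Rightarrow> 'a"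
  assumes S: "positive_operator S" "compact_operator S" and T: "positive_operator T" "compact_operator T"
  shows "(\<Sum>j<N. eigenvalues S j) + (\<Sum>j<N. eigenvalues T j) \<le> (\<Sum>j<2 * N. eigenvalues (\<lambda>x. S x + T x) j)"
proof -
  obtain F where F: "finite F" "card F \<le> N"
    "\<And>E. finite E \<Longrightarrow> orthonormal E \<Longrightarrow> (\<And>f. f \<in> F \<Longrightarrow> f = (\<Sum>e\<in>E. cinner f e *\<^sub>C e)) \<Longrightarrow>
       (\<Sum>j<N. eigenvalues S j) \<le> (\<Sum>e\<in>E. Re (cinner (S e) e))"
    by (rule ky_fan_attained[OF S, of N]) blast
  obtain G where G: "finite G" "card G \<le> N"
    "\<And>E. finite E \<Longrightarrow> orthonormal E \<Longrightarrow> (\<And>f. f \<in> G \<Longrightarrow> f = (\<Sum>e\<in>E. cinner f e *\<^sub>C e)) \<Longrightarrow>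
       (\<Sum>j<N. eigenvalues T j) \<le> (\<Sum>e\<in>E. Re (cinner (T e) e))"
    by (rule ky_fan_attained[OF T, of N]) blast
  obtain E where E: "finite E" "card E \<le> card (F \<union> G)" "orthonormal E"
      "\<forall>f\<in>F \<union> G. f = (\<Sum>e\<in>E. cinner f e *\<^sub>C e)"
    using orthonormal_span_exists[of "F \<union> G"] F G by auto
  have "card E \<le> 2 * N" using E(2) card_Un_le[of F G] F(2) G(2) by linarith
  have "(\<Sum>j<N. eigenvalues S j) + (\<Sum>j<N. eigenvalues T j)
      \<le> (\<Sum>e\<in>E. Re (cinner (S e) e)) + (\<Sum>e\<in>E. Re (cinner (T e) e))"
    using E by (intro add_mono F(3) G(3)) auto
  also have "\<dots> = (\<Sum>e\<in>E. Re (cinner (S e + T e) e))"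
    by (simp add: cinner_add_left sum.distrib)
  also have "\<dots> \<le> (\<Sum>j<2 * N. eigenvalues (\<lambda>x. S x + T x) j)"
    using ky_fan_le[OF positive_operator_add[OF S(1) T(1)] compact_operator_add[OF S(2) T(2)] E(1,3)
        \<open>card E \<le> 2 * N\<close>] .
  finally show ?thesis .
qed

lemma sum_eigenvalues_mono:
  fixes S T :: "'a::complex_hilbert_space \<Rightarrow> 'a"
  assumes S: "positive_operator S" "compact_operator S" and T: "positive_operator T" "compact_operator T"
    and le: "\<And>x. Re (cinner (S x) x) \<le> Re (cinner (T x) x)"
  shows "(\<Sum>j<N. eigenvalues S j) \<le> (\<Sum>j<N. eigenvalues T j)"
proof (rule sum_eigenvalues_le[OF S])
  fix E :: "'a set" assume E: "finite E" "orthonormal E" "card E \<le> N"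
  have "(\<Sum>e\<in>E. Re (cinner (S e) e)) \<le> (\<Sum>e\<in>E. Re (cinner (T e) e))" by (intro sum_mono le)
  also have "\<dots> \<le> (\<Sum>j<N. eigenvalues T j)" by (rule ky_fan_le[OF T E])
  finally show "(\<Sum>e\<in>E. Re (cinner (S e) e)) \<le> (\<Sum>j<N. eigenvalues T j)" .
qed

lemma sum_eigenvalues_scale:
  fixes T :: "'a::complex_hilbert_space \<Rightarrow> 'a"
  assumes T: "positive_operator T" "compact_operator T" and r: "0 \<le> r"
  shows "(\<Sum>j<N. eigenvalues (\<lambda>x. of_real r *\<^sub>C T x) j) = r * (\<Sum>j<N. eigenvalues T j)"
proof -
  note rT = positive_operator_scale[OF r T(1)] compact_operator_scale[OF T(2), of "of_real r"]
  have le: "(\<Sum>j<N. eigenvalues (\<lambda>x. of_real r *\<^sub>C T x) j) \<le> r * (\<Sum>j<N. eigenvalues T j)"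
  proof (rule sum_eigenvalues_le[OF rT])
    fix E :: "'a set" assume E: "finite E" "orthonormal E" "card E \<le> N"
    show "(\<Sum>e\<in>E. Re (cinner (of_real r *\<^sub>C T e) e)) \<le> r * (\<Sum>j<N. eigenvalues T j)"
      using mult_left_mono[OF ky_fan_le[OF T E] r] by (simp add: cinner_scaleC_left sum_distrib_left)
  qed
  show ?thesis
  proof (cases "r = 0")
    case True
    have "0 \<le> (\<Sum>j<N. eigenvalues (\<lambda>x. of_real r *\<^sub>C T x) j)"
      by (intro sum_nonneg eigenvalues_nonneg rT)
    with le True show ?thesis by simp
  next
    case False
    have "(\<Sum>j<N. eigenvalues T j) \<le> (\<Sum>j<N. eigenvalues (\<lambda>x. of_real r *\<^sub>C T x) j) / r"
    proof (rule sum_eigenvalues_le[OF T])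
      fix E :: "'a set" assume E: "finite E" "orthonormal E" "card E \<le> N"
      show "(\<Sum>e\<in>E. Re (cinner (T e) e)) \<le> (\<Sum>j<N. eigenvalues (\<lambda>x. of_real r *\<^sub>C T x) j) / r"
        using ky_fan_le[OF rT E] r False by (simp add: cinner_scaleC_left flip: sum_distrib_left) (simp add: field_simps)
    qed
    with le r False show ?thesis by (simp add: field_simps)
  qed
qed

section \<open>Dixmier forms and the trace of positive operators\<close>

lemma log_means_nonneg:
  assumes "positive_operator T" "compact_operator T"
  shows "0 \<le> log_means T n"
  unfolding log_means_def using eigenvalues_nonneg[OF assms]
  by (intro divide_nonneg_nonneg sum_nonneg ln_ge_zero) auto

lemma dixmier_positive_imp:
  assumes "dixmier_positive T"
  shows "positive_operator T" "compact_operator T" "Bseq (log_means T)"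
    "Bseq (\<lambda>n. complex_of_real (log_means T n))"
  using assms by (auto simp: dixmier_positive_def Bseq_def)

lemma Bseq_plus:
  fixes a b :: "nat \<Rightarrow> 'a::real_normed_vector"
  assumes "Bseq a" "Bseq b"
  shows "Bseq (\<lambda>n. a n + b n)"
proof -
  obtain K L where "\<And>n. norm (a n) \<le> K" "\<And>n. norm (b n) \<le> L"
    using assms unfolding Bseq_def by blast
  then show ?thesis by (intro BseqI'[of _ "K + L"]) (meson add_mono norm_triangle_le)
qed

lemma Bseq_dominated:
  fixes a :: "nat \<Rightarrow> real"
  assumes "Bseq b" "\<And>n. 0 \<le> a n" "\<And>n. a n \<le> b n"
  shows "Bseq a"
proof -
  obtain K where "\<And>n. norm (b n) \<le> K" using assms(1) unfolding Bseq_def by blast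
  then show ?thesis
    by (intro BseqI'[of _ K]) (metis abs_of_nonneg assms(2,3) order_trans real_norm_def)
qed

locale dixmier =
  fixes \<omega> :: "(nat \<Rightarrow> complex) \<Rightarrow> complex"
  assumes form: "dixmier_form \<omega>"
begin

lemma form_linear: "Bseq a \<Longrightarrow> Bseq b \<Longrightarrow> \<omega> (\<lambda>n. c * a n + d * b n) = c * \<omega> a + d * \<omega> b"
  and form_nonneg: "Bseq a \<Longrightarrow> (\<And>n. a n \<in> \<real>\<^sub>\<ge>\<^sub>0) \<Longrightarrow> \<omega> a \<in> \<real>\<^sub>\<ge>\<^sub>0"
  and form_one: "\<omega> (\<lambda>n. 1) = 1"
  and form_null: "a \<longlonglongrightarrow> 0 \<Longrightarrow> \<omega> a = 0"
  and form_dilation: "Bseq a \<Longrightarrow> \<omega> (\<lambda>n. a (n div 2)) = \<omega> a"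
  using form unfolding dixmier_form_def by blast+

lemma form_add: "Bseq a \<Longrightarrow> Bseq b \<Longrightarrow> \<omega> (\<lambda>n. a n + b n) = \<omega> a + \<omega> b"
  using form_linear[of a b 1 1] by simp

lemma form_diff: "Bseq a \<Longrightarrow> Bseq b \<Longrightarrow> \<omega> (\<lambda>n. a n - b n) = \<omega> a - \<omega> b"
  using form_linear[of a b 1 "-1"] by simp

lemma form_scale: "Bseq a \<Longrightarrow> \<omega> (\<lambda>n. c * a n) = c * \<omega> a"
  using form_linear[of a a c 0] by simp

lemma form_lim:
  assumes "a \<longlonglongrightarrow> L"
  shows "\<omega> a = L"
proof -
  have a: "Bseq a" using assms by (meson convergentI convergent_imp_Bseq)
  have "(\<lambda>n. a n - L) \<longlonglongrightarrow> 0" using assms by (simp add: LIM_zero)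
  then have "\<omega> (\<lambda>n. 1 * a n + (- L) * 1) = 0" using form_null by simp
  moreover have "Bseq (\<lambda>n. 1::complex)" by (rule convergent_imp_Bseq[OF convergent_const])
  ultimately show ?thesis using form_linear[OF a, of "\<lambda>n. 1" 1 "- L"] form_one by simp
qed

lemma form_mono:
  fixes a b :: "nat \<Rightarrow> real"
  assumes "Bseq a" "Bseq b" "\<And>n. a n \<le> b n"
  shows "\<omega> (\<lambda>n. of_real (b n)) - \<omega> (\<lambda>n. of_real (a n)) \<in> \<real>\<^sub>\<ge>\<^sub>0"
proof -
  have *: "Bseq (\<lambda>n. complex_of_real (a n))" "Bseq (\<lambda>n. complex_of_real (b n))"
    using assms by (simp_all add: Bseq_def)
  have "\<omega> (\<lambda>n. of_real (b n) - of_real (a n)) \<in> \<real>\<^sub>\<ge>\<^sub>0"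
  proof (rule form_nonneg)
    show "Bseq (\<lambda>n. complex_of_real (b n) - complex_of_real (a n))"
      using Bseq_plus[OF *(2), of "\<lambda>n. - complex_of_real (a n)"] *(1)
      by (simp add: Bseq_minus_iff)
    show "complex_of_real (b n) - complex_of_real (a n) \<in> \<real>\<^sub>\<ge>\<^sub>0" for n
      using assms(3)[of n] by (simp flip: of_real_diff)
  qed
  then show ?thesis by (simp add: form_diff *)
qed

definition trace_of :: "('a \<Rightarrow> 'a::complex_hilbert_space) \<Rightarrow> complex" where
  "trace_of T = \<omega> (of_real \<circ> log_means T)"

lemma trace_of_nonneg:
  assumes "dixmier_positive T"
  shows "trace_of T \<in> \<real>\<^sub>\<ge>\<^sub>0"
  unfolding trace_of_def o_def using dixmier_positive_imp[OF assms]
  by (intro form_nonneg) (auto simp: log_means_nonneg)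

lemma trace_of_lim:
  assumes "log_means T \<longlonglongrightarrow> L"
  shows "trace_of T = of_real L"
  unfolding trace_of_def o_def by (intro form_lim tendsto_intros assms)

lemma trace_of_le:
  assumes T: "dixmier_positive T" and le: "\<And>n. log_means T n \<le> b n" and b: "b \<longlonglongrightarrow> K"
  shows "cmod (trace_of T) \<le> K"
proof -
  have "Bseq b" using b by (meson convergentI convergent_imp_Bseq)
  from form_mono[OF dixmier_positive_imp(3)[OF T] this le]
  have "of_real K - trace_of T \<in> \<real>\<^sub>\<ge>\<^sub>0"
    unfolding trace_of_def o_def using form_lim[OF tendsto_of_real[OF b]] by simp
  moreover have "trace_of T \<in> \<real>\<^sub>\<ge>\<^sub>0" by (rule trace_of_nonneg[OF T])
  ultimately show ?thesis by (auto elim!: nonneg_Reals_cases simp flip: of_real_diff)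
qed

text \<open>One inequality is subadditivity of eigenvalue sums. In the other one the sum for
  \<open>S + T\<close> extends over twice as many indices but is divided by the same logarithm;
  \<open>e\<close> is this larger sequence. Since log (2 N) ~ log N, the difference between
  \<open>e (n div 2)\<close> and the means \<open>c n\<close> of \<open>S + T\<close> tends to 0,
  and dilation invariance gives \<open>e\<close> and \<open>c\<close> the same value under
  \<omega>.\<close>

lemma dixmier_positive_add:
  assumes S: "dixmier_positive S" and T: "dixmier_positive T"
  shows "dixmier_positive (\<lambda>x. S x + T x)" "trace_of (\<lambda>x. S x + T x) = trace_of S + trace_of T"
proof -
  let ?U = "\<lambda>x. S x + T x"
  note S' = dixmier_positive_imp[OF S] and T' = dixmier_positive_imp[OF T]
  have U': "positive_operator ?U" "compact_operator ?U"
    using S' T' positive_operator_add compact_operator_add by blast+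
  define \<sigma> where "\<sigma> N = (\<Sum>j<N. eigenvalues ?U j)" for N
  define a b c where "a = log_means S" "b = log_means T" "c = log_means ?U"
  have c: "c n = \<sigma> (n + 2) / ln (real (n + 2))" for n by (simp add: a_b_c_def log_means_def \<sigma>_def)
  have lnpos: "ln (real (n + 2)) > 0" for n by (rule ln_gt_zero) simp
  have c_le: "c n \<le> a n + b n" for n
    using sum_eigenvalues_add_le[OF S'(1,2) T'(1,2), of "n + 2"] lnpos[of n]
    by (simp add: a_b_c_def log_means_def divide_right_mono flip: add_divide_distrib)
  have c0: "0 \<le> c n" for n unfolding a_b_c_def by (rule log_means_nonneg[OF U'])
  have ab: "Bseq a" "Bseq b" "Bseq (\<lambda>n. a n + b n)"
    using S'(3) T'(3) by (simp_all add: a_b_c_def Bseq_plus)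
  have cB: "Bseq c"
    by (rule Bseq_dominated[OF ab(3) c0 c_le])
  show "dixmier_positive ?U" using U' cB by (simp add: dixmier_positive_def a_b_c_def)
  have \<sigma>_mono: "\<sigma> M \<le> \<sigma> N" if "M \<le> N" for M N
    unfolding \<sigma>_def using that eigenvalues_nonneg[OF U'] by (intro sum_mono2) auto
  have \<sigma>0: "0 \<le> \<sigma> N" for N unfolding \<sigma>_def by (intro sum_nonneg eigenvalues_nonneg[OF U'])
  define e where "e n = \<sigma> (2 * n + 4) / ln (real (n + 2))" for n
  have ab_e: "a n + b n \<le> e n" for n
  proof -
    have "2 * n + 4 = 2 * (n + 2)" by simp
    then show ?thesis
      unfolding a_b_c_def log_means_def e_def \<sigma>_def add_divide_distrib[symmetric]
      using lnpos[of n] sum_eigenvalues_add_ge[OF S'(1,2) T'(1,2), of "n + 2"]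
      by (intro divide_right_mono) (simp_all only: less_imp_le)
  qed
  define \<mu>0 where "\<mu>0 = eigenvalues ?U 0"
  have \<mu>_le: "eigenvalues ?U j \<le> \<mu>0" for j
    unfolding \<mu>0_def using decseqD[OF decseq_eigenvalues[OF U']] by simp
  \<comment> \<open>Halving rounds down, so the index \<open>2 * (n div 2) + 4\<close> is
    \<open>n + 3\<close> or \<open>n + 4\<close>: at most two further eigenvalues are
    involved.\<close>
  have step: "\<sigma> (2 * (n div 2) + 4) - \<sigma> (n + 2) \<le> 2 * \<mu>0" for n
  proof -
    have "\<sigma> (2 * (n div 2) + 4) \<le> \<sigma> (n + 4)" by (rule \<sigma>_mono) simp
    also have "\<sigma> (n + 4) = \<sigma> (n + 2) + eigenvalues ?U (n + 2) + eigenvalues ?U (n + 3)"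
      by (simp add: \<sigma>_def eval_nat_numeral)
    finally show ?thesis using \<mu>_le[of "n + 2"] \<mu>_le[of "n + 3"] by simp
  qed
  obtain K where K: "\<And>n. c n \<le> K" "K > 0"
    using cB unfolding Bseq_def by (metis abs_le_D1 real_norm_def)
  have d_c: "(\<lambda>n. e (n div 2) - c n) \<longlonglongrightarrow> 0"
  proof (rule tendsto_sandwich)
    let ?l = "\<lambda>n. ln ((real n + 3) / 2)"
    have ln_le: "?l n \<le> ln (real (n div 2 + 2))" "0 < ?l n" for n
    proof -
      have "(real n + 3) / 2 \<le> real (n div 2 + 2)" by (cases "even n") (auto elim!: evenE oddE)
      then show "?l n \<le> ln (real (n div 2 + 2))" by (intro ln_mono) auto
      show "0 < ?l n" by (rule ln_gt_zero) simp
    qed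
    have lo: "0 \<le> e (n div 2) - c n" for n
    proof -
      have "ln (real (n div 2 + 2)) \<le> ln (real (n + 2))" by (intro ln_mono) auto
      moreover have "\<sigma> (n + 2) \<le> \<sigma> (2 * (n div 2) + 4)" by (rule \<sigma>_mono) presburger
      ultimately show ?thesis unfolding e_def c
        using lnpos[of "n div 2"] \<sigma>0 by (simp add: frac_le)
    qed
    then show "\<forall>\<^sub>F n in sequentially. 0 \<le> e (n div 2) - c n" by (intro always_eventually allI)
    have hi: "e (n div 2) - c n \<le> 2 * \<mu>0 / ?l n + K * (ln (real (n + 2)) / ?l n - 1)" for n
    proof -
      have "e (n div 2) \<le> \<sigma> (2 * (n div 2) + 4) / ?l n"
        unfolding e_def using ln_le[of n] \<sigma>0 by (intro divide_left_mono) auto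
      also have "\<dots> \<le> (2 * \<mu>0 + \<sigma> (n + 2)) / ?l n"
        using step[of n] ln_le[of n] by (intro divide_right_mono) auto
      also have "\<sigma> (n + 2) = c n * ln (real (n + 2))" unfolding c using lnpos[of n] by simp
      finally have "e (n div 2) - c n \<le> 2 * \<mu>0 / ?l n + c n * (ln (real (n + 2)) / ?l n - 1)"
        by (simp add: field_simps)
      also have "\<dots> \<le> 2 * \<mu>0 / ?l n + K * (ln (real (n + 2)) / ?l n - 1)"
      proof -
        have "?l n \<le> ln (real (n + 2))" by (intro ln_mono) auto
        then have "1 \<le> ln (real (n + 2)) / ?l n" using ln_le(2)[of n] by simp
        then show ?thesis using K(1)[of n] by (intro add_left_mono mult_right_mono) auto
      qed
      finally show ?thesis .
    qed
    then show "\<forall>\<^sub>F n in sequentially. e (n div 2) - c n \<le> 2 * \<mu>0 / ?l n + K * (ln (real (n + 2)) / ?l n - 1)"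
      by (intro always_eventually allI)
    have "(\<lambda>n. 2 * \<mu>0 / ?l n) \<longlonglongrightarrow> 0" by real_asymp
    moreover have "(\<lambda>n. ln (real (n + 2)) / ?l n - 1) \<longlonglongrightarrow> 0" by real_asymp
    ultimately show "(\<lambda>n. 2 * \<mu>0 / ?l n + K * (ln (real (n + 2)) / ?l n - 1)) \<longlonglongrightarrow> 0"
      using tendsto_add[OF _ tendsto_mult_left[where c = K]] by fastforce
  qed simp_all
  have dB: "Bseq (\<lambda>n. e (n div 2))"
    using Bseq_plus[OF convergent_imp_Bseq[OF convergentI[OF d_c]] cB] by simp
  \<comment> \<open>Every \<open>e n\<close> is the term with index \<open>2 * n\<close> of the
    sequence already known to be bounded.\<close>
  have eB: "Bseq e"
  proof -
    from dB obtain K where "\<And>n. norm (e (n div 2)) \<le> K" unfolding Bseq_def by blast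
    from this[of "2 * n" for n] show ?thesis by (intro BseqI'[of _ K]) simp
  qed
  have cc: "Bseq (\<lambda>n. complex_of_real (x n))" if "Bseq x" for x :: "nat \<Rightarrow> real"
    using that by (simp add: Bseq_def)
  have "\<omega> (\<lambda>n. of_real (e n)) = \<omega> (\<lambda>n. of_real (e (n div 2)))"
    using form_dilation[OF cc[OF eB]] by simp
  also have "\<dots> = \<omega> (\<lambda>n. of_real (c n))"
    using form_null[OF tendsto_of_real[OF d_c, where ?'a = complex, simplified]]
      form_diff[OF cc[OF dB] cc[OF cB]] by simp
  finally have ec: "\<omega> (\<lambda>n. of_real (e n)) = \<omega> (\<lambda>n. of_real (c n))" .
  have sum_ab: "\<omega> (\<lambda>n. of_real (a n + b n)) = \<omega> (\<lambda>n. of_real (a n)) + \<omega> (\<lambda>n. of_real (b n))"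
    using form_add[OF cc[OF ab(1)] cc[OF ab(2)]] by simp
  define z where "z = \<omega> (\<lambda>n. of_real (a n + b n)) - \<omega> (\<lambda>n. of_real (c n))"
  have "z \<in> \<real>\<^sub>\<ge>\<^sub>0" unfolding z_def by (rule form_mono[OF cB ab(3) c_le])
  moreover have "- z \<in> \<real>\<^sub>\<ge>\<^sub>0"
    unfolding z_def using form_mono[OF ab(3) eB ab_e] by (simp add: ec)
  ultimately have "z = 0" by (auto simp: complex_nonneg_Reals_iff complex_eq_iff)
  then show "trace_of ?U = trace_of S + trace_of T"
    unfolding trace_of_def o_def z_def sum_ab by (simp add: a_b_c_def)
qed

lemma log_means_scale:
  assumes "positive_operator T" "compact_operator T" "0 \<le> r"
  shows "log_means (\<lambda>x. of_real r *\<^sub>C T x) = (\<lambda>n. r * log_means T n)"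
  unfolding log_means_def sum_eigenvalues_scale[OF assms] by simp

lemma dixmier_positive_scale:
  assumes T: "dixmier_positive T" and r: "0 \<le> r"
  shows "dixmier_positive (\<lambda>x. of_real r *\<^sub>C T x)" "trace_of (\<lambda>x. of_real r *\<^sub>C T x) = of_real r * trace_of T"
proof -
  note T' = dixmier_positive_imp[OF T]
  note eq = log_means_scale[OF T'(1,2) r]
  have "Bseq (\<lambda>n. r * log_means T n)" using T'(3) by (rule Bseq_mult[OF convergent_imp_Bseq[OF convergent_const]])
  then show "dixmier_positive (\<lambda>x. of_real r *\<^sub>C T x)"
    using T' positive_operator_scale[OF r] compact_operator_scale by (auto simp: dixmier_positive_def eq)
  show "trace_of (\<lambda>x. of_real r *\<^sub>C T x) = of_real r * trace_of T"
    unfolding trace_of_def o_def eq using form_scale[OF T'(4)] by simp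
qed

section \<open>The linear extension of the trace\<close>

definition has_trace :: "('a \<Rightarrow> 'a::complex_hilbert_space) \<Rightarrow> complex \<Rightarrow> bool" where
  "has_trace T c \<longleftrightarrow> (\<exists>A B C D.
     dixmier_positive A \<and> dixmier_positive B \<and> dixmier_positive C \<and> dixmier_positive D \<and>
     T = (\<lambda>x. A x - B x + \<i> *\<^sub>C (C x - D x)) \<and>
     c = trace_of A - trace_of B + \<i> * (trace_of C - trace_of D))"

lemma has_traceI:
  assumes "dixmier_positive A" "dixmier_positive B" "dixmier_positive C" "dixmier_positive D"
    and "\<And>x. T x = A x - B x + \<i> *\<^sub>C (C x - D x)"
    and "c = trace_of A - trace_of B + \<i> * (trace_of C - trace_of D)"
  shows "has_trace T c"
  unfolding has_trace_def using assms by (intro exI[of _ A] exI[of _ B] exI[of _ C] exI[of _ D]) auto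

text \<open>By Ky Fan's principle eigenvalue sums depend only on the quadratic form. Moving the
  subtracted operators to the other side turns the comparison into one between sums of positive
  operators, where additivity applies.\<close>

lemma trace_of_sum_cong:
  assumes A: "dixmier_positive A" "dixmier_positive B'" and B: "dixmier_positive A'" "dixmier_positive B"
    and eq: "\<And>x. Re (cinner (A x - B x) x) = Re (cinner (A' x - B' x) x)"
  shows "trace_of A - trace_of B = trace_of A' - trace_of B'"
proof -
  let ?S = "\<lambda>x. A x + B' x" and ?T = "\<lambda>x. A' x + B x"
  note S = dixmier_positive_add[OF A] and T = dixmier_positive_add[OF B]
  have q: "Re (cinner (?S x) x) = Re (cinner (?T x) x)" for x
    using eq[of x] by (simp add: cinner_add_left cinner_diff_left)
  have "log_means ?S = log_means ?T"
    unfolding log_means_def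
    by (intro ext arg_cong2[where f = "(/)"] order_antisym sum_eigenvalues_mono refl
        dixmier_positive_imp[OF S(1)] dixmier_positive_imp[OF T(1)]) (simp_all add: q)
  then have "trace_of ?S = trace_of ?T" by (simp add: trace_of_def)
  then show ?thesis using S(2) T(2) by (simp add: algebra_simps)
qed

text \<open>All four quadratic forms are real, so that of \<open>T\<close> has its real part from
  \<open>A - B\<close> and its imaginary part from \<open>C - D\<close>; the two differences can be
  compared separately. This is what makes \<open>dixmier_trace\<close> well defined.\<close>

lemma has_trace_unique:
  assumes "has_trace T c" "has_trace T c'"
  shows "c = c'"
proof -
  obtain A B C D where 1: "dixmier_positive A" "dixmier_positive B" "dixmier_positive C" "dixmier_positive D"
     "T = (\<lambda>x. A x - B x + \<i> *\<^sub>C (C x - D x))"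
     "c = trace_of A - trace_of B + \<i> * (trace_of C - trace_of D)"
    using assms(1) unfolding has_trace_def by blast
  obtain A' B' C' D' where 2: "dixmier_positive A'" "dixmier_positive B'" "dixmier_positive C'" "dixmier_positive D'"
     "T = (\<lambda>x. A' x - B' x + \<i> *\<^sub>C (C' x - D' x))"
     "c' = trace_of A' - trace_of B' + \<i> * (trace_of C' - trace_of D')"
    using assms(2) unfolding has_trace_def by blast
  have Im0: "Im (cinner (S x) x) = 0" if "dixmier_positive S" for S x
    using positive_operator_nonneg(2)[OF dixmier_positive_imp(1)[OF that]] .
  have *: "cinner (A x - B x + \<i> *\<^sub>C (C x - D x)) x = cinner (A' x - B' x + \<i> *\<^sub>C (C' x - D' x)) x" for x
    using 1(5) 2(5) by metis
  have "Re (cinner (A x - B x) x) = Re (cinner (A' x - B' x) x)"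
    "Re (cinner (C x - D x) x) = Re (cinner (C' x - D' x) x)" for x
    using arg_cong[OF *[of x], of Re] arg_cong[OF *[of x], of Im] 1(1-4) 2(1-4)
    by (simp_all add: cinner_add_left cinner_diff_left cinner_scaleC_left Im0)
  then have "trace_of A - trace_of B = trace_of A' - trace_of B'"
    "trace_of C - trace_of D = trace_of C' - trace_of D'"
    using 1 2 by (intro trace_of_sum_cong; simp)+
  then show ?thesis using 1(6) 2(6) by simp
qed

lemma dixmier_trace_eq:
  assumes "has_trace T c"
  shows "dixmier_trace \<omega> T = c"
proof -
  have "dixmier_trace \<omega> T = (THE c. has_trace T c)"
    by (simp add: dixmier_trace_def has_trace_def trace_of_def)
  then show ?thesis using assms has_trace_unique by (metis the_equality)
qed

lemma has_trace_add:
  assumes "has_trace S c" "has_trace T d"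
  shows "has_trace (\<lambda>x. S x + T x) (c + d)"
proof -
  obtain A B C D where 1: "dixmier_positive A" "dixmier_positive B" "dixmier_positive C" "dixmier_positive D"
     "S = (\<lambda>x. A x - B x + \<i> *\<^sub>C (C x - D x))"
     "c = trace_of A - trace_of B + \<i> * (trace_of C - trace_of D)"
    using assms(1) unfolding has_trace_def by blast
  obtain A' B' C' D' where 2: "dixmier_positive A'" "dixmier_positive B'" "dixmier_positive C'" "dixmier_positive D'"
     "T = (\<lambda>x. A' x - B' x + \<i> *\<^sub>C (C' x - D' x))"
     "d = trace_of A' - trace_of B' + \<i> * (trace_of C' - trace_of D')"
    using assms(2) unfolding has_trace_def by blast
  note * = dixmier_positive_add[OF 1(1) 2(1)] dixmier_positive_add[OF 1(2) 2(2)]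
    dixmier_positive_add[OF 1(3) 2(3)] dixmier_positive_add[OF 1(4) 2(4)]
  show ?thesis
  proof (rule has_traceI[OF *(1,3,5,7)])
    show "S x + T x = A x + A' x - (B x + B' x) + \<i> *\<^sub>C (C x + C' x - (D x + D' x))" for x
      unfolding 1(5) 2(5) by (simp add: scaleC_add_right complex_vs.scale_right_diff_distrib algebra_simps)
    show "c + d = trace_of (\<lambda>x. A x + A' x) - trace_of (\<lambda>x. B x + B' x)
        + \<i> * (trace_of (\<lambda>x. C x + C' x) - trace_of (\<lambda>x. D x + D' x))"
      unfolding * 1(6) 2(6) by (simp add: algebra_simps)
  qed
qed

lemma has_trace_scale_real:
  assumes "has_trace T c" "0 \<le> r"
  shows "has_trace (\<lambda>x. of_real r *\<^sub>C T x) (of_real r * c)"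
proof -
  obtain A B C D where 1: "dixmier_positive A" "dixmier_positive B" "dixmier_positive C" "dixmier_positive D"
     "T = (\<lambda>x. A x - B x + \<i> *\<^sub>C (C x - D x))"
     "c = trace_of A - trace_of B + \<i> * (trace_of C - trace_of D)"
    using assms(1) unfolding has_trace_def by blast
  note * = dixmier_positive_scale[OF 1(1) assms(2)] dixmier_positive_scale[OF 1(2) assms(2)]
    dixmier_positive_scale[OF 1(3) assms(2)] dixmier_positive_scale[OF 1(4) assms(2)]
  show ?thesis
  proof (rule has_traceI[OF *(1,3,5,7)])
    show "of_real r *\<^sub>C T x = of_real r *\<^sub>C A x - of_real r *\<^sub>C B x
        + \<i> *\<^sub>C (of_real r *\<^sub>C C x - of_real r *\<^sub>C D x)" for x
      unfolding 1(5)
      by (simp add: scaleC_add_right complex_vs.scale_right_diff_distrib scaleC_scaleC mult.commute)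
    show "of_real r * c = trace_of (\<lambda>x. of_real r *\<^sub>C A x) - trace_of (\<lambda>x. of_real r *\<^sub>C B x)
        + \<i> * (trace_of (\<lambda>x. of_real r *\<^sub>C C x) - trace_of (\<lambda>x. of_real r *\<^sub>C D x))"
      unfolding * 1(6) by (simp add: algebra_simps)
  qed
qed

text \<open>Multiplication by \<i> permutes the four parts: \<open>C - D\<close> moves to the real
  part with opposite sign, \<open>A - B\<close> to the imaginary part.\<close>

lemma has_trace_scale_ii:
  assumes "has_trace T c"
  shows "has_trace (\<lambda>x. \<i> *\<^sub>C T x) (\<i> * c)"
proof -
  obtain A B C D where 1: "dixmier_positive A" "dixmier_positive B" "dixmier_positive C" "dixmier_positive D"
     "T = (\<lambda>x. A x - B x + \<i> *\<^sub>C (C x - D x))"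
     "c = trace_of A - trace_of B + \<i> * (trace_of C - trace_of D)"
    using assms(1) unfolding has_trace_def by blast
  show ?thesis
  proof (rule has_traceI[OF 1(4,3,1,2)])
    show "\<i> *\<^sub>C T x = D x - C x + \<i> *\<^sub>C (A x - B x)" for x
      unfolding 1(5) by (simp add: scaleC_add_right complex_vs.scale_right_diff_distrib scaleC_scaleC algebra_simps)
  qed (simp add: 1(6) algebra_simps)
qed

lemma has_trace_scale:
  assumes "has_trace T c"
  shows "has_trace (\<lambda>x. k *\<^sub>C T x) (k * c)"
proof -
  note ii = has_trace_scale_ii
  have neg: "has_trace (\<lambda>x. - S x) (- d)" if "has_trace S d" for S :: "'a \<Rightarrow> 'a" and d
    using ii[OF ii[OF that]] by (simp add: scaleC_scaleC mult.assoc[symmetric])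
  have re: "has_trace (\<lambda>x. of_real r *\<^sub>C S x) (of_real r * d)" if "has_trace S d" for r and S :: "'a \<Rightarrow> 'a" and d
  proof (cases "0 \<le> r")
    case False
    then show ?thesis using neg[OF has_trace_scale_real[OF that, of "- r"]] by simp
  qed (rule has_trace_scale_real[OF that])
  have "has_trace (\<lambda>x. of_real (Re k) *\<^sub>C T x + \<i> *\<^sub>C of_real (Im k) *\<^sub>C T x)
      (of_real (Re k) * c + \<i> * (of_real (Im k) * c))"
    by (intro has_trace_add re ii assms)
  moreover have "(\<lambda>x. of_real (Re k) *\<^sub>C T x + \<i> *\<^sub>C of_real (Im k) *\<^sub>C T x) = (\<lambda>x. k *\<^sub>C T x)"
    by (simp add: scaleC_scaleC flip: scaleC_add_left complex_eq)
  moreover have "of_real (Re k) * c + \<i> * (of_real (Im k) * c) = k * c"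
    by (subst (3) complex_eq) (simp add: algebra_simps)
  ultimately show ?thesis by simp
qed

lemma has_trace_sum:
  fixes T :: "'i \<Rightarrow> 'a::complex_hilbert_space \<Rightarrow> 'a"
  assumes "finite I" "I \<noteq> {}" "\<And>i. i \<in> I \<Longrightarrow> has_trace (T i) (c i)"
  shows "has_trace (\<lambda>x. \<Sum>i\<in>I. T i x) (\<Sum>i\<in>I. c i)"
  using assms
  by (induction I rule: finite_ne_induct) (auto intro: has_trace_add)

end

section \<open>Diagonal operators\<close>

text \<open>By Pythagoras the distances between finite partial sums are governed by the tails of the
  sum of squares, so the net of partial sums is Cauchy.\<close>

lemma summable_on_orthogonal:
  fixes v :: "'i \<Rightarrow> 'a::complex_hilbert_space"
  assumes orth: "\<And>i j. i \<noteq> j \<Longrightarrow> cinner (v i) (v j) = 0"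
    and sq: "(\<lambda>i. (norm (v i))\<^sup>2) summable_on UNIV"
  shows "v summable_on UNIV"
proof -
  let ?a = "\<lambda>i. (norm (v i))\<^sup>2"
  have "\<exists>P. eventually P (finite_subsets_at_top UNIV) \<and>
      (\<forall>F G. P F \<and> P G \<longrightarrow> dist (sum v F) (sum v G) < \<epsilon>)" if \<epsilon>: "\<epsilon> > 0" for \<epsilon>
  proof -
    obtain F0 where F0: "finite F0" "infsum ?a UNIV - (\<epsilon> / 2)\<^sup>2 < sum ?a F0"
    proof -
      have "(sum ?a \<longlongrightarrow> infsum ?a UNIV) (finite_subsets_at_top UNIV)"
        using has_sum_infsum[OF sq] by (simp add: has_sum_def)
      then have "\<forall>\<^sub>F F in finite_subsets_at_top UNIV. infsum ?a UNIV - (\<epsilon> / 2)\<^sup>2 < sum ?a F"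
        by (rule order_tendstoD(1)) (use \<epsilon> in simp)
      then show ?thesis using that by (auto simp: eventually_finite_subsets_at_top)
    qed
    define P where "P F \<longleftrightarrow> finite F \<and> F0 \<subseteq> F" for F
    have "eventually P (finite_subsets_at_top UNIV)"
      unfolding eventually_finite_subsets_at_top P_def using F0(1) by auto
    moreover have close: "norm (sum v F - sum v F0) < \<epsilon> / 2" if "P F" for F
    proof -
      have F: "finite F" "F0 \<subseteq> F" using that by (auto simp: P_def)
      have "(norm (sum v F - sum v F0))\<^sup>2 = (norm (sum v (F - F0)))\<^sup>2"
        using F F0 by (simp add: sum_diff)
      also have "\<dots> = sum ?a (F - F0)" using F orth by (intro norm_sum_orthogonal) auto
      also have "\<dots> = sum ?a F - sum ?a F0" using F F0 by (simp add: sum_diff)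
      also have "\<dots> < (\<epsilon> / 2)\<^sup>2"
        using F0(2) finite_sum_le_infsum[OF sq F(1)] by force
      finally show ?thesis by (rule power2_less_imp_less) (use \<epsilon> in simp)
    qed
    moreover have "dist (sum v F) (sum v G) < \<epsilon>" if "P F" "P G" for F G
      using close[OF that(1)] close[OF that(2)] norm_triangle_ineq4[of "sum v F - sum v F0" "sum v G - sum v F0"]
      by (simp add: dist_norm)
    ultimately show ?thesis by blast
  qed
  then have "cauchy_filter (filtermap (sum v) (finite_subsets_at_top UNIV))"
    by (simp add: cauchy_filter_metric_filtermap)
  moreover have "complete (UNIV :: 'a set)" by (rule complete_UNIV)
  ultimately obtain L where "(sum v \<longlongrightarrow> L) (finite_subsets_at_top UNIV)"
    using complete_uniform[where S=UNIV] by (force simp add: filterlim_def)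
  then show ?thesis using summable_on_def has_sum_def by blast
qed

definition orthonormal_family :: "('i \<Rightarrow> 'a::complex_hilbert_space) \<Rightarrow> bool" where
  "orthonormal_family e \<longleftrightarrow> (\<forall>i j. cinner (e i) (e j) = (if i = j then 1 else 0))"

definition diagonal_operator :: "('i \<Rightarrow> 'a) \<Rightarrow> ('i \<Rightarrow> real) \<Rightarrow> 'a \<Rightarrow> 'a::complex_hilbert_space" where
  "diagonal_operator e d x = (\<Sum>\<^sub>\<infinity>i. (of_real (d i) * cinner x (e i)) *\<^sub>C e i)"

lemma orthonormal_family_norm: "orthonormal_family e \<Longrightarrow> norm (e i) = 1"
  using cinner_self[of "e i"] unfolding orthonormal_family_def
  by (metis norm_ge_zero of_real_1 of_real_eq_iff power2_eq_1_iff order.asym neg_less_0_iff_less zero_less_one not_le)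

lemma orthonormal_family_bessel:
  assumes "orthonormal_family e" "finite I"
  shows "(\<Sum>i\<in>I. (cmod (cinner x (e i)))\<^sup>2) \<le> (norm x)\<^sup>2"
  using assms orthonormal_family_norm[OF assms(1)]
  by (intro bessel_inequality) (auto simp: orthonormal_family_def)

lemma orthonormal_image:
  assumes "orthonormal_family e"
  shows "orthonormal (e ` I)" "inj_on e I"
  using assms orthonormal_family_norm[OF assms]
  by (auto simp: orthonormal_def orthonormal_family_def inj_on_def) (metis zero_neq_one)

locale bounded_diagonal =
  fixes e :: "'i \<Rightarrow> 'a::complex_hilbert_space" and d :: "'i \<Rightarrow> real" and K :: real
  assumes family: "orthonormal_family e" and bound: "\<And>i. \<bar>d i\<bar> \<le> K"
begin

lemma coeff_square_le:
  assumes "finite I"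
  shows "(\<Sum>i\<in>I. (norm ((of_real (d i) * cinner x (e i)) *\<^sub>C e i))\<^sup>2) \<le> (K * norm x)\<^sup>2"
proof -
  have "(\<Sum>i\<in>I. (norm ((of_real (d i) * cinner x (e i)) *\<^sub>C e i))\<^sup>2)
      \<le> (\<Sum>i\<in>I. K\<^sup>2 * (cmod (cinner x (e i)))\<^sup>2)"
  proof (rule sum_mono)
    fix i
    have "(d i)\<^sup>2 \<le> K\<^sup>2" using bound[of i] by (metis abs_ge_zero order_trans power2_abs power_mono)
    then show "(norm ((of_real (d i) * cinner x (e i)) *\<^sub>C e i))\<^sup>2 \<le> K\<^sup>2 * (cmod (cinner x (e i)))\<^sup>2"
      by (simp add: norm_scaleC orthonormal_family_norm[OF family] norm_mult power_mult_distrib mult_right_mono)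
  qed
  also have "\<dots> \<le> K\<^sup>2 * (norm x)\<^sup>2"
    unfolding sum_distrib_left[symmetric]
    by (intro mult_left_mono orthonormal_family_bessel family assms) simp
  finally show ?thesis by (simp add: power_mult_distrib)
qed

lemma orthogonal_terms:
  "i \<noteq> j \<Longrightarrow> cinner ((of_real (d i) * cinner x (e i)) *\<^sub>C e i) ((of_real (d j) * cinner x (e j)) *\<^sub>C e j) = 0"
  using family by (simp add: orthonormal_family_def cinner_scaleC_left cinner_scaleC_right)

lemma has_sum_diagonal: "((\<lambda>i. (of_real (d i) * cinner x (e i)) *\<^sub>C e i) has_sum diagonal_operator e d x) UNIV"
  unfolding diagonal_operator_def
proof (intro has_sum_infsum summable_on_orthogonal orthogonal_terms)
  show "(\<lambda>i. (norm ((of_real (d i) * cinner x (e i)) *\<^sub>C e i))\<^sup>2) summable_on UNIV"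
    by (rule nonneg_bdd_above_summable_on) (auto intro!: bdd_aboveI2 coeff_square_le)
qed

lemma has_sum_cinner_diagonal:
  "((\<lambda>i. of_real (d i) * cinner x (e i) * cinner (e i) y) has_sum cinner (diagonal_operator e d x) y) UNIV"
  using has_sum_bounded_linear[OF bounded_linear_cinner_left has_sum_diagonal]
  by (simp add: cinner_scaleC_left o_def)

lemma cinner_diagonal: "cinner (diagonal_operator e d x) (e j) = of_real (d j) * cinner x (e j)"
proof (rule has_sum_unique[OF has_sum_cinner_diagonal])
  have "((\<lambda>i. of_real (d i) * cinner x (e i) * cinner (e i) (e j)) has_sum
      of_real (d j) * cinner x (e j)) {j}"
    using family by (intro has_sum_finiteI) (auto simp: orthonormal_family_def)
  then show "((\<lambda>i. of_real (d i) * cinner x (e i) * cinner (e i) (e j)) has_sum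
      of_real (d j) * cinner x (e j)) UNIV"
    by (rule has_sum_cong_neutral[THEN iffD1, rotated -1])
       (use family in \<open>auto simp: orthonormal_family_def\<close>)
qed

lemma norm_diagonal_le: "norm (diagonal_operator e d x) \<le> K * norm x"
proof (rule tendsto_upperbound)
  show "((\<lambda>I. norm (\<Sum>i\<in>I. (of_real (d i) * cinner x (e i)) *\<^sub>C e i)) \<longlongrightarrow> norm (diagonal_operator e d x))
      (finite_subsets_at_top UNIV)"
    using has_sum_diagonal[of x] unfolding has_sum_def by (rule tendsto_norm)
  have "0 \<le> K" using bound[of undefined] by linarith
  have "norm (\<Sum>i\<in>I. (of_real (d i) * cinner x (e i)) *\<^sub>C e i) \<le> K * norm x" if "finite I" for I
  proof (rule power2_le_imp_le)
    show "(norm (\<Sum>i\<in>I. (of_real (d i) * cinner x (e i)) *\<^sub>C e i))\<^sup>2 \<le> (K * norm x)\<^sup>2"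
      using coeff_square_le[OF that, of x] by (subst norm_sum_orthogonal[OF that orthogonal_terms])
  qed (use \<open>0 \<le> K\<close> in simp)
  then show "\<forall>\<^sub>F I in finite_subsets_at_top UNIV.
      norm (\<Sum>i\<in>I. (of_real (d i) * cinner x (e i)) *\<^sub>C e i) \<le> K * norm x"
    by (intro eventually_finite_subsets_at_top_weakI) auto
qed simp

lemma bounded_operator_diagonal: "bounded_operator (diagonal_operator e d)"
proof (rule bounded_operatorI[OF _ _ norm_diagonal_le])
  fix x y c
  have "((\<lambda>i. (of_real (d i) * cinner (x + y) (e i)) *\<^sub>C e i) has_sum
      diagonal_operator e d x + diagonal_operator e d y) UNIV"
    using has_sum_add[OF has_sum_diagonal[of x] has_sum_diagonal[of y]]
    by (simp add: cinner_add_left distrib_left scaleC_add_left)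
  then show "diagonal_operator e d (x + y) = diagonal_operator e d x + diagonal_operator e d y"
    using has_sum_diagonal has_sum_unique by blast
  have "((\<lambda>i. (of_real (d i) * cinner (c *\<^sub>C x) (e i)) *\<^sub>C e i) has_sum c *\<^sub>C diagonal_operator e d x) UNIV"
    using has_sum_bounded_linear[OF bounded_linear_scaleC_right has_sum_diagonal, of c x]
    by (simp add: o_def cinner_scaleC_left scaleC_scaleC mult.left_commute)
  then show "diagonal_operator e d (c *\<^sub>C x) = c *\<^sub>C diagonal_operator e d x"
    using has_sum_diagonal has_sum_unique by blast
qed

lemma has_sum_quadratic_diagonal:
  "((\<lambda>i. d i * (cmod (cinner x (e i)))\<^sup>2) has_sum Re (cinner (diagonal_operator e d x) x)) UNIV"
  and Im_quadratic_diagonal: "Im (cinner (diagonal_operator e d x) x) = 0"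
proof -
  have eq: "of_real (d i) * cinner x (e i) * cinner (e i) x = of_real (d i * (cmod (cinner x (e i)))\<^sup>2)" for i
    using complex_norm_square[of "cinner x (e i)"] cinner_commute[of "e i" x] by simp
  have *: "((\<lambda>i. complex_of_real (d i * (cmod (cinner x (e i)))\<^sup>2)) has_sum cinner (diagonal_operator e d x) x) UNIV"
    using has_sum_cinner_diagonal[of x x] unfolding eq .
  show "((\<lambda>i. d i * (cmod (cinner x (e i)))\<^sup>2) has_sum Re (cinner (diagonal_operator e d x) x)) UNIV"
    using has_sum_bounded_linear[OF bounded_linear_Re *] by (simp add: o_def)
  have "((\<lambda>i::'i. 0) has_sum Im (cinner (diagonal_operator e d x) x)) UNIV"
    using has_sum_bounded_linear[OF bounded_linear_Im *] by (simp add: o_def)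
  then show "Im (cinner (diagonal_operator e d x) x) = 0"
    using infsumI by fastforce
qed

lemma positive_operator_diagonal:
  assumes "\<And>i. 0 \<le> d i"
  shows "positive_operator (diagonal_operator e d)"
  unfolding positive_operator_def complex_nonneg_Reals_iff
proof (intro conjI allI bounded_operator_diagonal Im_quadratic_diagonal)
  show "0 \<le> Re (cinner (diagonal_operator e d x) x)" for x
    by (rule has_sum_nonneg[OF has_sum_quadratic_diagonal]) (use assms in simp)
qed

end

lemma compact_operator_rank_one: "compact_operator (\<lambda>x. (k * cinner x f) *\<^sub>C (f::'a::complex_hilbert_space))"
proof (rule compact_operatorI)
  show "bounded_operator (\<lambda>x. (k * cinner x f) *\<^sub>C f)"
  proof (rule bounded_operatorI)
    show "norm ((k * cinner x f) *\<^sub>C f) \<le> (cmod k * norm f * norm f) * norm x" for x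
      using mult_left_mono[OF cmod_cinner_le[of x f], of "cmod k * norm f"]
      by (simp add: norm_scaleC norm_mult mult_ac)
  qed (simp_all add: cinner_add_left distrib_left scaleC_add_left cinner_scaleC_left scaleC_scaleC mult.left_commute)
  show "compact ((\<lambda>c. c *\<^sub>C f) ` cball 0 (cmod k * norm f))"
    by (intro compact_continuous_image linear_continuous_on bounded_linear_scaleC_left compact_cball)
  show "(\<lambda>x. (k * cinner x f) *\<^sub>C f) ` cball 0 1 \<subseteq> (\<lambda>c. c *\<^sub>C f) ` cball 0 (cmod k * norm f)"
  proof clarify
    fix x :: 'a assume "x \<in> cball 0 1"
    then have "cmod (cinner x f) \<le> norm f"
      using cmod_cinner_le[of x f] mult_right_mono[of "norm x" 1 "norm f"] by simp
    then have "k * cinner x f \<in> cball 0 (cmod k * norm f)"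
      by (simp add: norm_mult mult_left_mono)
    then show "(k * cinner x f) *\<^sub>C f \<in> (\<lambda>c. c *\<^sub>C f) ` cball 0 (cmod k * norm f)" by blast
  qed
qed

lemma compact_operator_sum:
  fixes T :: "'i \<Rightarrow> 'a::complex_hilbert_space \<Rightarrow> 'a"
  assumes "finite I" "\<And>i. i \<in> I \<Longrightarrow> compact_operator (T i)"
  shows "compact_operator (\<lambda>x. \<Sum>i\<in>I. T i x)"
  using assms by (induction I rule: finite_induct) (auto intro: compact_operator_zero compact_operator_add)

text \<open>The entries above \<epsilon> form a finite sum of rank one operators; the rest is a
  diagonal operator of norm at most \<epsilon>.\<close>

lemma compact_operator_diagonal:
  fixes e :: "'i \<Rightarrow> 'a::complex_hilbert_space"
  assumes family: "orthonormal_family e" and d: "\<And>i. 0 \<le> d i"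
    and fin: "\<And>\<epsilon>. \<epsilon> > 0 \<Longrightarrow> finite {i. d i > \<epsilon>}" and bound: "\<And>i. d i \<le> K"
  shows "compact_operator (diagonal_operator e d)"
proof (rule compact_operator_approx)
  interpret D: bounded_diagonal e d K
    by standard (use family d bound in auto)
  show "bounded_operator (diagonal_operator e d)" by (rule D.bounded_operator_diagonal)
  fix \<epsilon> :: real assume \<epsilon>: "\<epsilon> > 0"
  define d' where "d' i = (if d i > \<epsilon> then 0 else d i)" for i
  interpret D': bounded_diagonal e d' \<epsilon>
    by standard (use family d \<epsilon> in \<open>auto simp: d'_def\<close>)
  define S where "S x = (\<Sum>i\<in>{i. d i > \<epsilon>}. (of_real (d i) * cinner x (e i)) *\<^sub>C e i)" for x
  have "diagonal_operator e d x - S x = diagonal_operator e d' x" for x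
  proof (rule has_sum_unique[OF _ D'.has_sum_diagonal])
    have "((\<lambda>i. if d i > \<epsilon> then (of_real (d i) * cinner x (e i)) *\<^sub>C e i else 0) has_sum S x) UNIV"
    proof (rule has_sum_cong_neutral[THEN iffD1])
      show "((\<lambda>i. (of_real (d i) * cinner x (e i)) *\<^sub>C e i) has_sum S x) {i. d i > \<epsilon>}"
        unfolding S_def by (rule has_sum_finite[OF fin[OF \<epsilon>]])
    qed auto
    then have "((\<lambda>i. - (if d i > \<epsilon> then (of_real (d i) * cinner x (e i)) *\<^sub>C e i else 0)) has_sum - S x) UNIV"
      by (simp add: has_sum_uminus)
    from has_sum_add[OF D.has_sum_diagonal[of x] this]
    have "((\<lambda>i. (of_real (d i) * cinner x (e i)) *\<^sub>C e i
        + - (if d i > \<epsilon> then (of_real (d i) * cinner x (e i)) *\<^sub>C e i else 0)) has_sum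
        diagonal_operator e d x - S x) UNIV" by simp
    moreover have "(\<lambda>i. (of_real (d i) * cinner x (e i)) *\<^sub>C e i
        + - (if d i > \<epsilon> then (of_real (d i) * cinner x (e i)) *\<^sub>C e i else 0))
        = (\<lambda>i. (of_real (d' i) * cinner x (e i)) *\<^sub>C e i)" by (auto simp: d'_def)
    ultimately show "((\<lambda>i. (of_real (d' i) * cinner x (e i)) *\<^sub>C e i) has_sum diagonal_operator e d x - S x) UNIV"
      by (simp only:)
  qed
  moreover have "compact_operator S"
    unfolding S_def by (intro compact_operator_sum fin \<epsilon> compact_operator_rank_one)
  ultimately show "\<exists>S. compact_operator S \<and> (\<forall>x. norm (diagonal_operator e d x - S x) \<le> \<epsilon> * norm x)"
    using D'.norm_diagonal_le by (intro exI[of _ S]) auto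
qed

text \<open>The diagonal operator with all entries 1 preserves every coefficient, and totality makes
  it the identity.\<close>

lemma orthonormal_expansion:
  fixes e :: "'i \<Rightarrow> 'a::complex_hilbert_space"
  assumes family: "orthonormal_family e" and total: "\<And>x. (\<And>i. cinner x (e i) = 0) \<Longrightarrow> x = 0"
  shows "((\<lambda>i. cinner x (e i) *\<^sub>C e i) has_sum x) UNIV"
proof -
  interpret D: bounded_diagonal e "\<lambda>i. 1" 1
    by standard (use family in auto)
  have "diagonal_operator e (\<lambda>i. 1) x - x = 0"
    by (rule total) (simp add: cinner_diff_left D.cinner_diagonal)
  then show ?thesis using D.has_sum_diagonal[of x] by simp
qed

lemma diagonal_operator_unique:
  fixes e :: "'i \<Rightarrow> 'a::complex_hilbert_space"
  assumes family: "orthonormal_family e" and total: "\<And>x. (\<And>i. cinner x (e i) = 0) \<Longrightarrow> x = 0"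
    and B: "bounded_operator B" "\<And>i. B (e i) = of_real (d i) *\<^sub>C e i"
  shows "B = diagonal_operator e d"
proof
  fix x
  have "((\<lambda>i. B (cinner x (e i) *\<^sub>C e i)) has_sum B x) UNIV"
    using has_sum_bounded_linear[OF bounded_operator_bounded_linear[OF B(1)] orthonormal_expansion[OF family total, of x]]
    by (simp add: o_def)
  then have "((\<lambda>i. (of_real (d i) * cinner x (e i)) *\<^sub>C e i) has_sum B x) UNIV"
    by (simp add: bounded_operator_scaleC[OF B(1)] B(2) scaleC_scaleC mult.commute)
  then show "B x = diagonal_operator e d x"
    unfolding diagonal_operator_def by (rule infsumI[symmetric])
qed

section \<open>Hausdorff measure\<close>

definition hausdorff_pre :: "real \<Rightarrow> real \<Rightarrow> 'a::metric_space set \<Rightarrow> ennreal" where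
  "hausdorff_pre s \<delta> A =
    (INF U\<in>{U :: nat \<Rightarrow> 'a set. A \<subseteq> (\<Union>i. U i) \<and> (\<forall>i. bounded (U i) \<and> diameter (U i) \<le> \<delta>)}.
       \<Sum>i. ennreal (diameter (U i) powr s))"

lemma hausdorff_outer_eq: "hausdorff_outer s A = (SUP \<delta>\<in>{0<..}. hausdorff_pre s \<delta> A)"
  by (simp add: hausdorff_outer_def hausdorff_pre_def)

lemma hausdorff_pre_le:
  assumes "A \<subseteq> (\<Union>i. U i)" "\<And>i. bounded (U i)" "\<And>i. diameter (U i) \<le> \<delta>"
  shows "hausdorff_pre s \<delta> A \<le> (\<Sum>i. ennreal (diameter (U i) powr s))"
  unfolding hausdorff_pre_def by (rule INF_lower) (use assms in auto)

lemma hausdorff_pre_greatest: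
  assumes "\<And>U. A \<subseteq> (\<Union>i. U i) \<Longrightarrow> (\<And>i. bounded (U i)) \<Longrightarrow> (\<And>i. diameter (U i) \<le> \<delta>) \<Longrightarrow>
    c \<le> (\<Sum>i. ennreal (diameter (U i) powr s))"
  shows "c \<le> hausdorff_pre s \<delta> A"
  unfolding hausdorff_pre_def by (rule INF_greatest) (use assms in auto)

lemma hausdorff_pre_le_outer: "\<delta> > 0 \<Longrightarrow> hausdorff_pre s \<delta> A \<le> hausdorff_outer s A"
  unfolding hausdorff_outer_eq by (rule SUP_upper) simp

lemma hausdorff_pre_mono: "A \<subseteq> B \<Longrightarrow> hausdorff_pre s \<delta> A \<le> hausdorff_pre s \<delta> B"
  by (rule hausdorff_pre_greatest, rule hausdorff_pre_le) auto

lemma hausdorff_pre_antimono: "\<delta> \<le> \<delta>' \<Longrightarrow> hausdorff_pre s \<delta>' A \<le> hausdorff_pre s \<delta> A"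
  by (rule hausdorff_pre_greatest, rule hausdorff_pre_le) (auto intro: order_trans)

lemma hausdorff_outer_mono: "A \<subseteq> B \<Longrightarrow> hausdorff_outer s A \<le> hausdorff_outer s B"
  unfolding hausdorff_outer_eq by (intro SUP_mono') (rule hausdorff_pre_mono)

lemma hausdorff_outer_empty: "hausdorff_outer s {} = 0"
proof -
  have "hausdorff_pre s \<delta> ({}::'a set) \<le> (\<Sum>i::nat. 0)" if "\<delta> > 0" for \<delta>
    using hausdorff_pre_le[of "{}::'a set" "\<lambda>i. {}" \<delta> s] that by simp
  then show ?thesis unfolding hausdorff_outer_eq by (simp add: SUP_eq_iff)
qed

lemma hausdorff_pre_countably_subadditive:
  fixes A :: "nat \<Rightarrow> 'a::metric_space set"
  shows "hausdorff_pre s \<delta> (\<Union>n. A n) \<le> (\<Sum>n. hausdorff_pre s \<delta> (A n))"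
proof (rule ennreal_le_epsilon)
  fix \<epsilon> :: real assume fin: "(\<Sum>n. hausdorff_pre s \<delta> (A n)) < top" and \<epsilon>: "0 < \<epsilon>"
  have "\<exists>U. A n \<subseteq> (\<Union>i. U i) \<and> (\<forall>i. bounded (U i) \<and> diameter (U i) \<le> \<delta>) \<and>
      (\<Sum>i. ennreal (diameter (U i) powr s)) \<le> hausdorff_pre s \<delta> (A n) + ennreal (\<epsilon> * (1/2) ^ Suc n)" for n
  proof (rule ccontr)
    assume no: "\<not> ?thesis"
    have "hausdorff_pre s \<delta> (A n) \<le> (\<Sum>n. hausdorff_pre s \<delta> (A n))"
      using sum_le_suminf[of "\<lambda>n. hausdorff_pre s \<delta> (A n)" "{n}"] by simp
    then have fin': "hausdorff_pre s \<delta> (A n) < top" using fin by (rule le_less_trans)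
    have "hausdorff_pre s \<delta> (A n) + ennreal (\<epsilon> * (1/2) ^ Suc n) \<le> hausdorff_pre s \<delta> (A n)"
      by (rule hausdorff_pre_greatest) (use no in \<open>metis less_imp_le not_le\<close>)
    moreover obtain r where "hausdorff_pre s \<delta> (A n) = ennreal r" "0 \<le> r"
      using fin' by (cases "hausdorff_pre s \<delta> (A n)") auto
    moreover have "\<epsilon> * (1/2) ^ Suc n > 0" using \<epsilon> by simp
    ultimately show False by (simp add: not_le del: power_Suc flip: ennreal_plus)
  qed
  then obtain U where U: "\<And>n. A n \<subseteq> (\<Union>i. U n i)" "\<And>n i. bounded (U n i)" "\<And>n i. diameter (U n i) \<le> \<delta>"
      "\<And>n. (\<Sum>i. ennreal (diameter (U n i) powr s)) \<le> hausdorff_pre s \<delta> (A n) + ennreal (\<epsilon> * (1/2) ^ Suc n)"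
    by metis
  define V where "V k = case_prod U (prod_decode k)" for k
  have "hausdorff_pre s \<delta> (\<Union>n. A n) \<le> (\<Sum>k. ennreal (diameter (V k) powr s))"
  proof (rule hausdorff_pre_le)
    show "(\<Union>n. A n) \<subseteq> (\<Union>k. V k)"
    proof
      fix x assume "x \<in> (\<Union>n. A n)"
      then obtain n i where "x \<in> U n i" using U(1) by blast
      then have "x \<in> V (prod_encode (n, i))" by (simp add: V_def)
      then show "x \<in> (\<Union>k. V k)" by blast
    qed
  qed (use U in \<open>simp_all add: V_def split: prod.split\<close>)
  also have "\<dots> = (\<Sum>k. (\<lambda>(n, i). ennreal (diameter (U n i) powr s)) (prod_decode k))"
    by (simp add: V_def case_prod_unfold)
  also have "\<dots> = (\<Sum>n. \<Sum>i. ennreal (diameter (U n i) powr s))"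
    by (rule suminf_ennreal_2dimen) simp
  also have "\<dots> \<le> (\<Sum>n. hausdorff_pre s \<delta> (A n) + ennreal (\<epsilon> * (1/2) ^ Suc n))"
    by (intro suminf_le U) auto
  also have "\<dots> = (\<Sum>n. hausdorff_pre s \<delta> (A n)) + (\<Sum>n. ennreal (\<epsilon> * (1/2) ^ Suc n))"
    by (rule suminf_add[symmetric]) auto
  also have "(\<Sum>n. ennreal (\<epsilon> * (1/2) ^ Suc n)) = ennreal \<epsilon>"
  proof (rule suminf_ennreal_eq)
    show "(\<lambda>n. \<epsilon> * (1/2) ^ Suc n) sums \<epsilon>" using sums_mult[OF power_half_series, of \<epsilon>] by simp
  qed (use \<epsilon> in simp)
  finally show "hausdorff_pre s \<delta> (\<Union>n. A n) \<le> (\<Sum>n. hausdorff_pre s \<delta> (A n)) + ennreal \<epsilon>" .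
qed

lemma hausdorff_outer_countably_subadditive:
  fixes A :: "nat \<Rightarrow> 'a::metric_space set"
  shows "hausdorff_outer s (\<Union>n. A n) \<le> (\<Sum>n. hausdorff_outer s (A n))"
  unfolding hausdorff_outer_eq[of s "\<Union>n. A n"]
proof (rule SUP_least)
  fix \<delta> :: real assume "\<delta> \<in> {0<..}"
  then have "(\<Sum>n. hausdorff_pre s \<delta> (A n)) \<le> (\<Sum>n. hausdorff_outer s (A n))"
    by (intro suminf_le hausdorff_pre_le_outer) auto
  with hausdorff_pre_countably_subadditive show "hausdorff_pre s \<delta> (\<Union>n. A n) \<le> (\<Sum>n. hausdorff_outer s (A n))"
    by (rule order_trans)
qed

section \<open>Metric outer measures and Caratheodory's criterion\<close>

lemma hausdorff_outer_subadditive: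
  "hausdorff_outer s (A \<union> B) \<le> hausdorff_outer s A + hausdorff_outer s (B::'a::metric_space set)"
proof -
  have "hausdorff_outer s (\<Union>n. binaryset A B n) \<le> (\<Sum>n. hausdorff_outer s (binaryset A B n))"
    by (rule hausdorff_outer_countably_subadditive)
  then show ?thesis
    using suminf_binaryset_eq[of "hausdorff_outer s" A B] by (simp add: UN_binaryset_eq hausdorff_outer_empty)
qed

text \<open>A set of diameter below the separation \<open>\<delta>0\<close> meets at most one of
  \<open>A\<close> and \<open>B\<close>, so every fine cover of the union splits into a cover of
  \<open>A\<close> and one of \<open>B\<close>.\<close>

lemma hausdorff_outer_metric:
  fixes A B :: "'a::metric_space set"
  assumes \<delta>0: "\<delta>0 > 0" and sep: "\<And>x y. x \<in> A \<Longrightarrow> y \<in> B \<Longrightarrow> \<delta>0 \<le> dist x y"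
  shows "hausdorff_outer s A + hausdorff_outer s B \<le> hausdorff_outer s (A \<union> B)"
proof -
  have pre: "hausdorff_pre s \<delta> A + hausdorff_pre s \<delta> B \<le> hausdorff_pre s \<delta> (A \<union> B)" if "0 < \<delta>" "\<delta> < \<delta>0" for \<delta>
  proof (rule hausdorff_pre_greatest)
    fix U :: "nat \<Rightarrow> 'a set"
    assume U: "A \<union> B \<subseteq> (\<Union>i. U i)" "\<And>i. bounded (U i)" "\<And>i. diameter (U i) \<le> \<delta>"
    \<comment> \<open>Members that miss \<open>S\<close> are replaced by the empty set, which costs
      nothing since \<open>diameter {} = 0\<close> and \<open>0 powr s = 0\<close>.\<close>
    define V where "V S i = (if U i \<inter> S = {} then {} else U i)" for S i
    have V: "hausdorff_pre s \<delta> S \<le> (\<Sum>i. ennreal (diameter (V S i) powr s))" if "S \<subseteq> A \<union> B" for S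
    proof (rule hausdorff_pre_le)
      show "S \<subseteq> (\<Union>i. V S i)"
      proof
        fix x assume x: "x \<in> S"
        with that U(1) have "x \<in> (\<Union>i. U i)" by blast
        then obtain i where "x \<in> U i" by blast
        with x have "x \<in> V S i" by (auto simp: V_def)
        then show "x \<in> (\<Union>i. V S i)" by blast
      qed
    qed (use U \<open>0 < \<delta>\<close> in \<open>auto simp: V_def\<close>)
    have disj: "V A i = {} \<or> V B i = {}" for i
    proof (rule ccontr)
      assume "\<not> ?thesis"
      then obtain x y where "x \<in> U i" "x \<in> A" "y \<in> U i" "y \<in> B" by (auto simp: V_def split: if_splits)
      then show False
        using sep[of x y] diameter_bounded_bound[OF U(2), of x i y] U(3)[of i] \<open>\<delta> < \<delta>0\<close> by simp
    qed
    have "ennreal (diameter (V A i) powr s) + ennreal (diameter (V B i) powr s) \<le> ennreal (diameter (U i) powr s)" for i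
      using disj[of i] by (auto simp: V_def split: if_splits)
    then have "(\<Sum>i. ennreal (diameter (V A i) powr s) + ennreal (diameter (V B i) powr s))
        \<le> (\<Sum>i. ennreal (diameter (U i) powr s))"
      by (intro suminf_le) auto
    then have "(\<Sum>i. ennreal (diameter (V A i) powr s)) + (\<Sum>i. ennreal (diameter (V B i) powr s))
        \<le> (\<Sum>i. ennreal (diameter (U i) powr s))"
      by (subst suminf_add) auto
    with V[of A] V[of B]
    show "hausdorff_pre s \<delta> A + hausdorff_pre s \<delta> B \<le> (\<Sum>i. ennreal (diameter (U i) powr s))"
      by (meson Un_upper1 Un_upper2 add_mono order_trans)
  qed
  \<comment> \<open>The two terms get separate meshes, so that the suprema over them can be taken
    one after the other.\<close>
  have *: "hausdorff_pre s \<delta>1 A + hausdorff_pre s \<delta>2 B \<le> hausdorff_outer s (A \<union> B)" if "\<delta>1 > 0" "\<delta>2 > 0" for \<delta>1 \<delta>2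
  proof -
    define \<delta> where "\<delta> = min (\<delta>0 / 2) (min \<delta>1 \<delta>2)"
    have \<delta>: "0 < \<delta>" "\<delta> < \<delta>0" "\<delta> \<le> \<delta>1" "\<delta> \<le> \<delta>2" using that \<delta>0 by (auto simp: \<delta>_def)
    have "hausdorff_pre s \<delta>1 A + hausdorff_pre s \<delta>2 B \<le> hausdorff_pre s \<delta> A + hausdorff_pre s \<delta> B"
      by (intro add_mono hausdorff_pre_antimono \<delta>)
    also have "\<dots> \<le> hausdorff_pre s \<delta> (A \<union> B)" by (rule pre[OF \<delta>(1,2)])
    also have "\<dots> \<le> hausdorff_outer s (A \<union> B)" by (rule hausdorff_pre_le_outer[OF \<delta>(1)])
    finally show ?thesis .
  qed
  have "hausdorff_outer s A + hausdorff_pre s \<delta>2 B \<le> hausdorff_outer s (A \<union> B)" if "\<delta>2 > 0" for \<delta>2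
    unfolding hausdorff_outer_eq[of s A]
    by (subst ennreal_SUP_add_left[symmetric]) (auto intro!: SUP_least * that)
  then show ?thesis
    unfolding hausdorff_outer_eq[of s B]
    by (subst ennreal_SUP_add_right) (auto intro!: SUP_least)
qed

lemma hausdorff_outer_metric_sum:
  fixes R :: "nat \<Rightarrow> 'a::metric_space set"
  assumes sep: "\<And>i j. i < j \<Longrightarrow> \<exists>\<delta>>0. \<forall>x\<in>R i. \<forall>y\<in>R j. \<delta> \<le> dist x y"
  shows "(\<Sum>i<n. hausdorff_outer s (R i)) \<le> hausdorff_outer s (\<Union>i<n. R i)"
proof (induction n)
  case (Suc n)
  have "\<exists>\<delta>>0. \<forall>i<n. \<forall>x\<in>R i. \<forall>y\<in>R n. \<delta> \<le> dist x y"
  proof -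
    obtain \<delta> where \<delta>: "\<And>i. i < n \<Longrightarrow> \<delta> i > 0" "\<And>i x y. i < n \<Longrightarrow> x \<in> R i \<Longrightarrow> y \<in> R n \<Longrightarrow> \<delta> i \<le> dist x y"
    proof -
      have "\<forall>i. \<exists>\<delta>. i < n \<longrightarrow> \<delta> > 0 \<and> (\<forall>x\<in>R i. \<forall>y\<in>R n. \<delta> \<le> dist x y)" using sep by blast
      from choice[OF this] show ?thesis using that by blast
    qed
    have "0 < Min (insert 1 (\<delta> ` {..<n}))" using \<delta>(1) by (subst Min_gr_iff) auto
    moreover have "Min (insert 1 (\<delta> ` {..<n})) \<le> \<delta> i" if "i < n" for i by (rule Min_le) (use that in auto)
    ultimately show ?thesis using \<delta>(2) by (meson order_trans)
  qed
  then obtain \<delta> where \<delta>: "\<delta> > 0" "\<And>i x y. i < n \<Longrightarrow> x \<in> R i \<Longrightarrow> y \<in> R n \<Longrightarrow> \<delta> \<le> dist x y" by blast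
  have "(\<Sum>i<Suc n. hausdorff_outer s (R i)) \<le> hausdorff_outer s (\<Union>i<n. R i) + hausdorff_outer s (R n)"
    using Suc by (simp add: add_right_mono)
  also have "\<dots> \<le> hausdorff_outer s ((\<Union>i<n. R i) \<union> R n)"
    by (rule hausdorff_outer_metric[OF \<delta>(1)]) (use \<delta>(2) in auto)
  also have "(\<Union>i<n. R i) \<union> R n = (\<Union>i<Suc n. R i)" by (auto simp: less_Suc_eq)
  finally show ?case .
qed simp

lemma ennreal_suminf_tail:
  fixes f :: "nat \<Rightarrow> ennreal"
  assumes "(\<Sum>n. f n) < top" "\<epsilon> > 0"
  obtains k where "(\<Sum>n. f (n + k)) \<le> ennreal \<epsilon>"
proof -
  define r where "r n = enn2real (f n)" for n
  have f: "f n = ennreal (r n)" for n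
    unfolding r_def using ennreal_suminf_lessD[OF assms(1)] by (simp add: less_top)
  have r0: "0 \<le> r n" for n by (simp add: r_def)
  have "summable r"
    by (rule summable_suminf_not_top) (use assms r0 in \<open>simp_all add: f[symmetric]\<close>)
  from suminf_exist_split[OF assms(2) this] obtain k where k: "norm (\<Sum>i. r (i + k)) < \<epsilon>" by blast
  have "(\<Sum>n. f (n + k)) = ennreal (\<Sum>n. r (n + k))"
    unfolding f using r0 \<open>summable r\<close> by (intro suminf_ennreal2 summable_ignore_initial_segment) auto
  also have "\<dots> \<le> ennreal \<epsilon>" using k by (intro ennreal_leI) simp
  finally show ?thesis by (rule that)
qed

text \<open>\<open>A k\<close> is the part of \<open>X\<close> at distance at least 1/(k+1) from
  \<open>C\<close>, so the metric property applies to \<open>X \<inter> C\<close> and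
  \<open>A k\<close>. The rest of \<open>X - C\<close> is covered by the shells \<open>R\<close>,
  the increments of \<open>A\<close>; their outer measures have a finite sum, hence negligible
  tails.\<close>

lemma hausdorff_outer_closed_caratheodory:
  fixes C X :: "'a::metric_space set"
  assumes "closed C"
  shows "hausdorff_outer s (X \<inter> C) + hausdorff_outer s (X - C) \<le> hausdorff_outer s X"
proof (cases "C = {} \<or> hausdorff_outer s X = top")
  case True
  then show ?thesis by (auto simp: hausdorff_outer_empty)
next
  case False
  then have C: "C \<noteq> {}" and fin: "hausdorff_outer s X < top" by (auto simp: less_top)
  define A where "A k = {x \<in> X. 1 / Suc k \<le> infdist x C}" for k
  define R where "R k = A (Suc k) - A k" for k
  have infdist_le: "infdist x C \<le> dist x y + infdist y C" for x y
    using infdist_triangle[of x C y] by simp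
  have C0: "infdist x C = 0" if "x \<in> C" for x using that by simp
  have A_C: "hausdorff_outer s (X \<inter> C) + hausdorff_outer s (A k) \<le> hausdorff_outer s X" for k
  proof -
    have "hausdorff_outer s (X \<inter> C) + hausdorff_outer s (A k) \<le> hausdorff_outer s ((X \<inter> C) \<union> A k)"
    proof (rule hausdorff_outer_metric)
      fix x y assume "x \<in> X \<inter> C" "y \<in> A k"
      then show "1 / Suc k \<le> dist x y"
        using infdist_le[of y x] C0[of x] by (simp add: A_def dist_commute)
    qed simp
    also have "\<dots> \<le> hausdorff_outer s X" by (rule hausdorff_outer_mono) (auto simp: A_def)
    finally show ?thesis .
  qed
  \<comment> \<open>Adjacent shells may touch, but shells two or more steps apart are separated;
    hence only every second index is taken.\<close>
  have sub: "(\<Sum>i<n. hausdorff_outer s (R (2 * i + b))) \<le> hausdorff_outer s X" for n b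
  proof -
    have "(\<Sum>i<n. hausdorff_outer s (R (2 * i + b))) \<le> hausdorff_outer s (\<Union>i<n. R (2 * i + b))"
    proof (rule hausdorff_outer_metric_sum)
      fix i j :: nat assume "i < j"
      let ?\<delta> = "1 / Suc (Suc (2 * i + b)) - 1 / Suc (Suc (Suc (2 * i + b)))"
      have "?\<delta> > 0" by (simp add: frac_less2)
      moreover have "?\<delta> \<le> dist x y" if "x \<in> R (2 * i + b)" "y \<in> R (2 * j + b)" for x y
      proof -
        have "1 / Suc (Suc (2 * i + b)) \<le> infdist x C" using that(1) by (simp add: R_def A_def)
        moreover have "infdist y C < 1 / Suc (2 * j + b)" using that(2) by (auto simp: R_def A_def)
        moreover have "1 / Suc (2 * j + b) \<le> 1 / Suc (Suc (Suc (2 * i + b)))"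
          using \<open>i < j\<close> by (intro divide_left_mono) auto
        ultimately show ?thesis using infdist_le[of x y] by linarith
      qed
      ultimately show "\<exists>\<delta>>0. \<forall>x\<in>R (2 * i + b). \<forall>y\<in>R (2 * j + b). \<delta> \<le> dist x y" by blast
    qed
    also have "\<dots> \<le> hausdorff_outer s X" by (rule hausdorff_outer_mono) (auto simp: R_def A_def)
    finally show ?thesis .
  qed
  have sums: "(\<Sum>i<2 * n. hausdorff_outer s (R i)) \<le> 2 * hausdorff_outer s X" for n
  proof -
    have "(\<Sum>i<2 * n. hausdorff_outer s (R i)) =
        (\<Sum>i<n. hausdorff_outer s (R (2 * i + 0))) + (\<Sum>i<n. hausdorff_outer s (R (2 * i + 1)))"
      by (induction n) (simp_all add: add_ac)
    also have "\<dots> \<le> 2 * hausdorff_outer s X" unfolding mult_2[of "hausdorff_outer s X"] by (intro add_mono sub)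
    finally show ?thesis .
  qed
  have "(\<Sum>i. hausdorff_outer s (R i)) \<le> 2 * hausdorff_outer s X"
  proof (rule suminf_le_const)
    fix n
    have "(\<Sum>i<n. hausdorff_outer s (R i)) \<le> (\<Sum>i<2 * n. hausdorff_outer s (R i))"
      by (rule sum_mono2) auto
    with sums[of n] show "(\<Sum>i<n. hausdorff_outer s (R i)) \<le> 2 * hausdorff_outer s X" by (rule order_trans[rotated])
  qed simp
  also have "\<dots> < top" using fin by (simp add: ennreal_mult_less_top)
  finally have R_fin: "(\<Sum>i. hausdorff_outer s (R i)) < top" .
  show ?thesis
  proof (rule ennreal_le_epsilon)
    fix \<epsilon> :: real assume "\<epsilon> > 0"
    obtain k where k: "(\<Sum>n. hausdorff_outer s (R (n + k))) \<le> ennreal \<epsilon>"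
      by (rule ennreal_suminf_tail[OF R_fin \<open>\<epsilon> > 0\<close>])
    have "X - C \<subseteq> A k \<union> (\<Union>n. R (n + k))"
    proof
      fix x assume x: "x \<in> X - C"
      have "infdist x C > 0"
        using x infdist_pos_not_in_closed[OF assms C] by simp
      then obtain m where "inverse (real (Suc m)) < infdist x C" using reals_Archimedean by blast
      then have m: "x \<in> A m" using x by (simp add: A_def inverse_eq_divide)
      show "x \<in> A k \<union> (\<Union>n. R (n + k))"
      proof (cases "x \<in> A k")
        case False
        define l where "l = (LEAST l. x \<in> A l)"
        have l: "x \<in> A l" "\<And>j. j < l \<Longrightarrow> x \<notin> A j"
          unfolding l_def using m by (auto intro: LeastI dest: not_less_Least)
        have "\<not> l \<le> k"
        proof
          assume "l \<le> k"
          then have "1 / Suc k \<le> 1 / Suc l" by (intro divide_left_mono) auto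
          then show False using l(1) False by (auto simp: A_def)
        qed
        \<comment> \<open>By minimality of \<open>l\<close> the point lies in the shell
          \<open>R (l - 1)\<close>; since \<open>l > k\<close>, the subtraction of natural numbers
          loses nothing.\<close>
        then have "x \<in> R (l - 1 - k + k)" using l(1) l(2)[of "l - 1"] by (simp add: R_def)
        then show ?thesis by blast
      qed simp
    qed
    then have "hausdorff_outer s (X - C) \<le> hausdorff_outer s (A k \<union> (\<Union>n. R (n + k)))"
      by (rule hausdorff_outer_mono)
    also have "\<dots> \<le> hausdorff_outer s (A k) + hausdorff_outer s (\<Union>n. R (n + k))"
      by (rule hausdorff_outer_subadditive)
    also have "hausdorff_outer s (\<Union>n. R (n + k)) \<le> ennreal \<epsilon>"
      using hausdorff_outer_countably_subadditive[of s "\<lambda>n. R (n + k)"] k by (rule order_trans)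
    finally have "hausdorff_outer s (X \<inter> C) + hausdorff_outer s (X - C)
        \<le> hausdorff_outer s (X \<inter> C) + hausdorff_outer s (A k) + ennreal \<epsilon>"
      by (simp add: add_left_mono add.assoc)
    also have "\<dots> \<le> hausdorff_outer s X + ennreal \<epsilon>"
      by (intro add_right_mono A_C)
    finally show "hausdorff_outer s (X \<inter> C) + hausdorff_outer s (X - C) \<le> hausdorff_outer s X + ennreal \<epsilon>" .
  qed
qed

text \<open>Needed to evaluate \<open>hausdorff_measure\<close>: \<open>measure_of\<close> keeps the
  given values only if they form a measure on the sigma algebra. Closed sets satisfy Caratheodory's
  criterion and generate the Borel sets.\<close>

lemma measure_space_hausdorff_outer:
  "measure_space (UNIV :: 'a::metric_space set) (sets borel) (hausdorff_outer s)"
proof -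
  interpret P: sigma_algebra "UNIV :: 'a set" "Pow UNIV" by (rule sigma_algebra_Pow)
  let ?L = "lambda_system (UNIV :: 'a set) (Pow UNIV) (hausdorff_outer s)"
  have "outer_measure_space (Pow (UNIV :: 'a set)) (hausdorff_outer s)"
    unfolding outer_measure_space_def positive_def increasing_def countably_subadditive_def
    by (intro conjI ballI allI impI hausdorff_outer_empty hausdorff_outer_mono hausdorff_outer_countably_subadditive)
  then have L: "measure_space UNIV ?L (hausdorff_outer s)"
    by (rule P.caratheodory_lemma)
  have closed: "C \<in> ?L" if "closed C" for C :: "'a set"
    unfolding lambda_system_def
  proof safe
    fix X :: "'a set"
    have "hausdorff_outer s X \<le> hausdorff_outer s (C \<inter> X) + hausdorff_outer s ((UNIV - C) \<inter> X)"
      using hausdorff_outer_subadditive[of s "C \<inter> X" "(UNIV - C) \<inter> X"]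
      by (simp add: Int_Un_distrib2[symmetric])
    moreover have "hausdorff_outer s (C \<inter> X) + hausdorff_outer s ((UNIV - C) \<inter> X) \<le> hausdorff_outer s X"
      using hausdorff_outer_closed_caratheodory[OF that, of s X]
      by (simp add: Int_commute Diff_eq)
    ultimately show "hausdorff_outer s (C \<inter> X) + hausdorff_outer s ((UNIV - C) \<inter> X) = hausdorff_outer s X"
      by simp
  qed simp
  interpret L: sigma_algebra UNIV ?L using L by (simp add: measure_space_def)
  have "sets (borel :: 'a measure) \<subseteq> ?L"
  proof -
    have "sigma_sets UNIV (Collect closed) \<subseteq> ?L"
      by (rule L.sigma_sets_subset) (use closed in blast)
    then show ?thesis unfolding borel_eq_closed by simp
  qed
  moreover have "sigma_algebra UNIV (sets (borel :: 'a measure))"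
    using sets.sigma_algebra_axioms[of "borel :: 'a measure"] by simp
  ultimately show ?thesis by (intro measure_down[OF L])
qed

section \<open>Hausdorff measure on Borel sets and under homotheties\<close>

lemma sets_hausdorff_measure [simp]: "sets (hausdorff_measure s) = sets borel"
  and space_hausdorff_measure [simp]: "space (hausdorff_measure s) = UNIV"
  unfolding hausdorff_measure_def using sets.sigma_sets_eq[of borel]
  by (simp_all add: sets_measure_of space_measure_of)

lemma emeasure_hausdorff_measure:
  "A \<in> sets borel \<Longrightarrow> emeasure (hausdorff_measure s) A = hausdorff_outer s A"
  unfolding hausdorff_measure_def
  using measure_space_hausdorff_outer[of s] unfolding measure_space_def
  by (intro emeasure_measure_of_sigma) auto

text \<open>Covers are transported by the map. One inequality is enough, since the reverse one is
  this estimate for the inverse homothety.\<close>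

lemma hausdorff_outer_homothety_le:
  fixes A :: "'a::real_normed_vector set"
  assumes c: "c > 0" and s: "0 \<le> s"
  shows "hausdorff_outer s ((\<lambda>x. c *\<^sub>R x + b) ` A) \<le> ennreal (c powr s) * hausdorff_outer s A"
  unfolding hausdorff_outer_eq[of s "(\<lambda>x. c *\<^sub>R x + b) ` A"]
proof (rule SUP_least)
  let ?g = "\<lambda>x. c *\<^sub>R x + b"
  fix \<delta> :: real assume "\<delta> \<in> {0<..}"
  then have \<delta>: "\<delta> / c > 0" using c by simp
  have "hausdorff_pre s \<delta> (?g ` A) / ennreal (c powr s) \<le> hausdorff_pre s (\<delta> / c) A"
  proof (rule hausdorff_pre_greatest)
    fix U :: "nat \<Rightarrow> 'a set"
    assume U: "A \<subseteq> (\<Union>i. U i)" "\<And>i. bounded (U i)" "\<And>i. diameter (U i) \<le> \<delta> / c"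
    have bdd: "bounded (?g ` U i)" for i
      using bounded_translation[OF bounded_scaling[OF U(2)[of i], of c], of b]
      by (simp add: image_image add.commute)
    have diam: "diameter (?g ` U i) \<le> c * diameter (U i)" for i
    proof (rule diameter_le)
      fix x y assume "x \<in> ?g ` U i" "y \<in> ?g ` U i"
      then obtain x' y' where *: "x' \<in> U i" "y' \<in> U i" "x = ?g x'" "y = ?g y'" by auto
      have "norm (x - y) = c * dist x' y'"
        using c by (simp add: *(3,4) dist_norm flip: scaleR_diff_right)
      also have "\<dots> \<le> c * diameter (U i)"
        using diameter_bounded_bound[OF U(2) *(1,2)] c by simp
      finally show "norm (x - y) \<le> c * diameter (U i)" .
    qed (use c diameter_ge_0[OF U(2)] in auto)
    have "hausdorff_pre s \<delta> (?g ` A) \<le> (\<Sum>i. ennreal (diameter (?g ` U i) powr s))"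
    proof (rule hausdorff_pre_le)
      show "diameter (?g ` U i) \<le> \<delta>" for i
        using diam[of i] U(3)[of i] c by (simp add: field_simps)
      show "?g ` A \<subseteq> (\<Union>i. ?g ` U i)" using image_mono[OF U(1), of ?g] by (simp only: image_UN)
    qed (rule bdd)
    also have "\<dots> \<le> (\<Sum>i. ennreal (c powr s) * ennreal (diameter (U i) powr s))"
    proof (intro suminf_le)
      fix i
      show "ennreal (diameter (?g ` U i) powr s) \<le> ennreal (c powr s) * ennreal (diameter (U i) powr s)"
        using powr_mono2[OF s diameter_ge_0[OF bdd] diam[of i]] c diameter_ge_0[OF U(2)[of i]]
        by (simp add: powr_mult ennreal_leI flip: ennreal_mult)
    qed auto
    also have "\<dots> = ennreal (c powr s) * (\<Sum>i. ennreal (diameter (U i) powr s))" by simp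
    finally show "hausdorff_pre s \<delta> (?g ` A) / ennreal (c powr s) \<le> (\<Sum>i. ennreal (diameter (U i) powr s))"
      using c by (simp add: divide_le_posI_ennreal ennreal_zero_less_divide mult.commute)
  qed
  also have "\<dots> \<le> hausdorff_outer s A" by (rule hausdorff_pre_le_outer[OF \<delta>])
  finally show "hausdorff_pre s \<delta> (?g ` A) \<le> ennreal (c powr s) * hausdorff_outer s A"
  proof -
    assume le: "hausdorff_pre s \<delta> (?g ` A) / ennreal (c powr s) \<le> hausdorff_outer s A"
    have "hausdorff_pre s \<delta> (?g ` A) = hausdorff_pre s \<delta> (?g ` A) / ennreal (c powr s) * ennreal (c powr s)"
      using c by (simp add: ennreal_divide_times ennreal_divide_self)
    also have "\<dots> \<le> hausdorff_outer s A * ennreal (c powr s)" by (rule mult_right_mono[OF le]) simp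
    finally show ?thesis by (simp add: mult.commute)
  qed
qed

section \<open>Self-similarity of the gasket\<close>

lemma UNIV_corner: "UNIV = {Lower_Left, Lower_Right, Upper}"
  using corner.exhaust by auto

lemma finite_UNIV_corner [simp]: "finite (UNIV :: corner set)"
  by (simp add: UNIV_corner)

lemma card_UNIV_corner: "card (UNIV :: corner set) = 3"
  by (simp add: UNIV_corner)

lemma finite_words [simp]: "finite {w :: word. length w = n}"
  using finite_lists_length_eq[OF finite_UNIV_corner, of n] by simp

lemma card_words: "card {w :: word. length w = n} = 3 ^ n"
  using card_lists_length_eq[OF finite_UNIV_corner, of n] by (simp add: card_UNIV_corner)

abbreviation (input) "gasket_dim \<equiv> ln 3 / ln 2 :: real"

lemma two_powr_gasket_dim: "2 powr gasket_dim = 3"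
  by (simp add: powr_def)

lemma gasket_dim_gt_1: "gasket_dim > 1"
  by simp

lemma half_power_powr_gasket_dim: "((1/2) ^ n) powr gasket_dim = (1/3) ^ n"
proof (induction n)
  case (Suc n)
  have "((1/2 :: real) ^ Suc n) powr gasket_dim = (1/2) powr gasket_dim * ((1/2) ^ n) powr gasket_dim"
    unfolding power_Suc by (rule powr_mult)
  also have "(1/2 :: real) powr gasket_dim = 1/3"
    using powr_divide[of 1 2 gasket_dim] two_powr_gasket_dim by simp
  finally show ?case by (simp only: Suc power_Suc)
qed simp

lemma F_word_append: "F_word p (v @ u) = F_word p v \<circ> F_word p u"
  by (induction v) auto

lemma F_word_affine: "F_word p w x = (1/2) ^ length w *\<^sub>R x + F_word p w 0"
proof (induction w arbitrary: x)
  case (Cons j w)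
  have "F_word p (j # w) x = F_map p j (F_word p w x)" by simp
  also have "F_word p w x = (1/2) ^ length w *\<^sub>R x + F_word p w 0" by (rule Cons)
  also have "F_map p j \<dots> = (1/2) ^ length (j # w) *\<^sub>R x + F_map p j (F_word p w 0)"
    by (simp add: F_map_def scaleR_right_distrib inverse_eq_divide)
  finally show ?case by simp
qed simp

lemma F_word_diff: "F_word p w x - F_word p w y = (1/2) ^ length w *\<^sub>R (x - y)"
  using F_word_affine[of p w x] F_word_affine[of p w y] by (simp add: scaleR_diff_right)

definition gasket_union :: "real^2 \<Rightarrow> (real^2) set" where
  "gasket_union p = (\<Union>n. SG_level p n)"

lemma UN_words_Suc:
  "(\<Union>w\<in>{w :: word. length w = Suc n}. g w) = (\<Union>j. \<Union>w\<in>{w. length w = n}. g (j # w))"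
  by (force simp: length_Suc_conv)

lemma SG_level_Suc: "SG_level p (Suc n) = (\<Union>j. F_map p j ` SG_level p n)"
  unfolding SG_level_def UN_words_Suc image_UN by (simp add: image_comp)

text \<open>\<open>F_map p i\<close> contracts by 1/2 towards vertex \<open>i\<close>, so the half
  of a side next to a vertex is the image of the whole side under the map of that vertex.\<close>

lemma segment_halves:
  "closed_segment (vertex p i) (vertex p j)
    \<subseteq> F_map p i ` closed_segment (vertex p i) (vertex p j) \<union> F_map p j ` closed_segment (vertex p i) (vertex p j)"
proof
  fix x assume "x \<in> closed_segment (vertex p i) (vertex p j)"
  then obtain u where u: "0 \<le> u" "u \<le> 1" "x = (1 - u) *\<^sub>R vertex p i + u *\<^sub>R vertex p j"
    by (auto simp: in_segment)
  show "x \<in> F_map p i ` closed_segment (vertex p i) (vertex p j) \<union> F_map p j ` closed_segment (vertex p i) (vertex p j)"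
  proof (cases "u \<le> 1/2")
    case True
    have "x = F_map p i ((1 - 2 * u) *\<^sub>R vertex p i + (2 * u) *\<^sub>R vertex p j)"
      by (rule vec_eq_iff[THEN iffD2], rule allI) (simp add: u(3) F_map_def field_simps)
    moreover have "(1 - 2 * u) *\<^sub>R vertex p i + (2 * u) *\<^sub>R vertex p j \<in> closed_segment (vertex p i) (vertex p j)"
      unfolding in_segment using u True by (intro exI[of _ "2 * u"]) simp
    ultimately show ?thesis by blast
  next
    case False
    have "x = F_map p j ((1 - (2 * u - 1)) *\<^sub>R vertex p i + (2 * u - 1) *\<^sub>R vertex p j)"
      by (rule vec_eq_iff[THEN iffD2], rule allI) (simp add: u(3) F_map_def field_simps)
    moreover have "(1 - (2 * u - 1)) *\<^sub>R vertex p i + (2 * u - 1) *\<^sub>R vertex p j \<in> closed_segment (vertex p i) (vertex p j)"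
      unfolding in_segment using u False by (intro exI[of _ "2 * u - 1"]) simp
    ultimately show ?thesis by blast
  qed
qed

lemma SG_level_0: "SG_level p 0 = SG_0 p"
  by (simp add: SG_level_def)

text \<open>The levels from 1 on are images of the preceding level by construction; only level 0
  needs an argument, and its sides are recovered from their halves.\<close>

lemma gasket_union_eq: "gasket_union p = (\<Union>j. F_map p j ` gasket_union p)"
proof
  have level: "SG_level p n \<subseteq> gasket_union p" for n
    unfolding gasket_union_def by (rule UN_upper) simp
  have F_sub: "F_map p l ` S \<subseteq> (\<Union>j. F_map p j ` gasket_union p)" if "S \<subseteq> gasket_union p" for l S
  proof -
    have "F_map p l ` S \<subseteq> F_map p l ` gasket_union p" by (rule image_mono[OF that])
    also have "\<dots> \<subseteq> (\<Union>j. F_map p j ` gasket_union p)" by (rule UN_upper) simp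
    finally show ?thesis .
  qed
  have seg: "closed_segment (vertex p i) (vertex p j) \<subseteq> (\<Union>j. F_map p j ` gasket_union p)"
    if "closed_segment (vertex p i) (vertex p j) \<subseteq> gasket_union p" for i j
    by (rule order_trans[OF segment_halves]) (intro Un_least F_sub that)
  have "SG_level p 0 \<subseteq> (\<Union>j. F_map p j ` gasket_union p)"
    using level[of 0] unfolding SG_level_0 SG_0_def Un_subset_iff by (simp add: seg)
  moreover have "SG_level p (Suc n) \<subseteq> (\<Union>j. F_map p j ` gasket_union p)" for n
    unfolding SG_level_Suc by (intro UN_mono image_mono level order_refl)
  ultimately have "SG_level p n \<subseteq> (\<Union>j. F_map p j ` gasket_union p)" for n
    by (cases n) simp_all
  then show "gasket_union p \<subseteq> (\<Union>j. F_map p j ` gasket_union p)"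
    by (subst gasket_union_def) (rule UN_least)
  have "F_map p j ` SG_level p n \<subseteq> gasket_union p" for j n
  proof -
    have "F_map p j ` SG_level p n \<subseteq> SG_level p (Suc n)" unfolding SG_level_Suc by (rule UN_upper) simp
    also note level
    finally show ?thesis .
  qed
  then show "(\<Union>j. F_map p j ` gasket_union p) \<subseteq> gasket_union p"
    unfolding gasket_union_def[of p] image_UN by (intro UN_least)
qed

lemma SG_closure: "SG p = closure (gasket_union p)"
  by (simp add: SG_def gasket_union_def)

lemma F_map_image: "F_map p j ` S = (\<lambda>x. (1/2) *\<^sub>R vertex p j + x) ` (\<lambda>x. (1/2) *\<^sub>R x) ` S"
proof -
  have "F_map p j = (\<lambda>x. (1/2) *\<^sub>R vertex p j + (1/2) *\<^sub>R x)"
    by (rule ext) (simp add: F_map_def scaleR_right_distrib inverse_eq_divide add.commute)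
  then show ?thesis by (simp add: image_image)
qed

lemma SG_self_similar: "SG p = (\<Union>j. F_map p j ` SG p)"
proof -
  have F: "closure (F_map p j ` S) = F_map p j ` closure S" for j S
    unfolding F_map_image closure_translation closure_scaleR[symmetric] ..
  have "SG p = closure (\<Union>j. F_map p j ` gasket_union p)" by (simp only: SG_closure flip: gasket_union_eq)
  also have "\<dots> = (\<Union>j. F_map p j ` SG p)"
    by (simp add: UNIV_corner F flip: SG_closure)
  finally show ?thesis .
qed

lemma SG_words: "SG p = (\<Union>w\<in>{w. length w = n}. F_word p w ` SG p)"
proof (induction n)
  case (Suc n)
  have "(\<Union>w\<in>{w. length w = Suc n}. F_word p w ` SG p) = (\<Union>j. F_map p j ` (\<Union>w\<in>{w. length w = n}. F_word p w ` SG p))"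
    unfolding UN_words_Suc image_UN by (simp add: image_comp)
  then show ?case using Suc SG_self_similar[of p] by simp
qed simp

lemma F_word_SG_subset: "F_word p w ` SG p \<subseteq> SG p"
  using SG_words[of p "length w"] by blast

lemma SG_0_subset: "SG_0 p \<subseteq> SG p"
  using closure_subset[of "gasket_union p"] unfolding SG_closure gasket_union_def SG_level_0[symmetric] by blast

lemma vertex_in_SG: "vertex p j \<in> SG p"
  by (rule subsetD[OF SG_0_subset]) (cases j; auto simp: SG_0_def)

lemma SG_subset_hull: "SG p \<subseteq> convex hull (range (vertex p))"
proof -
  let ?T = "convex hull (range (vertex p))"
  have v: "vertex p j \<in> ?T" for j by (rule hull_inc) simp
  have seg: "closed_segment (vertex p i) (vertex p j) \<subseteq> ?T" for i j
    by (rule closed_segment_subset) (auto simp: v)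
  have F: "F_map p j x \<in> ?T" if "x \<in> ?T" for j x
  proof -
    have "F_map p j x = (1/2) *\<^sub>R x + (1/2) *\<^sub>R vertex p j" by (simp add: F_map_def algebra_simps)
    also have "\<dots> \<in> ?T" by (rule convexD) (use that v in auto)
    finally show ?thesis .
  qed
  have "SG_level p n \<subseteq> ?T" for n
  proof (induction n)
    case 0
    then show ?case unfolding SG_level_0 SG_0_def using seg by blast
  next
    case (Suc n)
    then show ?case unfolding SG_level_Suc using F by blast
  qed
  moreover have "closed ?T"
    by (intro compact_imp_closed finite_imp_compact_convex_hull finite_imageI finite_UNIV_corner)
  ultimately show ?thesis unfolding SG_def by (intro closure_minimal) blast+
qed

lemma compact_SG: "compact (SG p)"
proof -
  have "compact (convex hull (range (vertex p)))"
    by (intro finite_imp_compact_convex_hull finite_imageI finite_UNIV_corner)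
  then show ?thesis
    using SG_subset_hull[of p] unfolding SG_closure
    by (meson bounded_subset closed_closure compact_eq_bounded_closed)
qed

lemma closed_F_word_SG: "compact (F_word p w ` SG p)"
proof -
  have "continuous_on (SG p) (\<lambda>x. (1/2) ^ length w *\<^sub>R x + F_word p w 0)" by (intro continuous_intros)
  then show ?thesis
    using compact_continuous_image[OF _ compact_SG] by (simp flip: F_word_affine)
qed

lemma dist_F_word_SG:
  assumes "x \<in> F_word p w ` SG p" "y \<in> F_word p w ` SG p"
  shows "dist x y \<le> (1/2) ^ length w * diameter (SG p)"
proof -
  obtain x' y' where *: "x' \<in> SG p" "y' \<in> SG p" "x = F_word p w x'" "y = F_word p w y'" using assms by auto
  have "dist x y = (1/2) ^ length w * dist x' y'"
    unfolding *(3,4) dist_norm F_word_diff by simp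
  then show ?thesis
    using diameter_bounded_bound[OF compact_imp_bounded[OF compact_SG] *(1,2)] by (simp add: mult_left_mono)
qed

lemma hausdorff_outer_F_word:
  "hausdorff_outer gasket_dim (F_word p w ` A) = ennreal ((1/3) ^ length w) * hausdorff_outer gasket_dim A"
proof (rule antisym)
  let ?c = "(1/2 :: real) ^ length w" and ?b = "F_word p w 0"
  have img: "F_word p w ` A = (\<lambda>x. ?c *\<^sub>R x + ?b) ` A" by (simp flip: F_word_affine)
  have s: "0 \<le> gasket_dim" by simp
  show "hausdorff_outer gasket_dim (F_word p w ` A) \<le> ennreal ((1/3) ^ length w) * hausdorff_outer gasket_dim A"
    unfolding img using hausdorff_outer_homothety_le[of ?c gasket_dim ?b A] s
    by (simp only: half_power_powr_gasket_dim) simp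
  have inv: "(\<lambda>x. 2 ^ length w *\<^sub>R x + - (2 ^ length w *\<^sub>R ?b)) ` F_word p w ` A = A"
    unfolding img image_image by (simp add: scaleR_add_right power_mult_distrib[symmetric])
  have "hausdorff_outer gasket_dim A \<le> ennreal ((2 ^ length w) powr gasket_dim) * hausdorff_outer gasket_dim (F_word p w ` A)"
    using hausdorff_outer_homothety_le[of "2 ^ length w" gasket_dim "- (2 ^ length w *\<^sub>R ?b)" "F_word p w ` A"] s
    unfolding inv by simp
  also have "(2 ^ length w) powr gasket_dim = 1 / (1/3) ^ length w"
  proof -
    have "(2 ^ length w) powr gasket_dim = 1 / ((1/2) ^ length w) powr gasket_dim"
      by (simp add: power_one_over powr_divide)
    then show ?thesis by (simp only: half_power_powr_gasket_dim)
  qed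
  finally have "ennreal ((1/3) ^ length w) * hausdorff_outer gasket_dim A
      \<le> ennreal ((1/3) ^ length w) * (ennreal (1 / (1/3) ^ length w) * hausdorff_outer gasket_dim (F_word p w ` A))"
    by (rule mult_left_mono) simp
  also have "\<dots> = hausdorff_outer gasket_dim (F_word p w ` A)"
    by (simp add: mult.assoc[symmetric] power_one_over flip: ennreal_mult)
  finally show "ennreal ((1/3) ^ length w) * hausdorff_outer gasket_dim A \<le> hausdorff_outer gasket_dim (F_word p w ` A)" .
qed

section \<open>Finiteness of the measure of the gasket\<close>

lemma hausdorff_pre_diameter:
  assumes "bounded A" "diameter A \<le> \<delta>" "0 \<le> \<delta>"
  shows "hausdorff_pre s \<delta> A \<le> ennreal (diameter A powr s)"
proof -
  define U where "U i = (if i = (0::nat) then A else {})" for i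
  have "hausdorff_pre s \<delta> A \<le> (\<Sum>i. ennreal (diameter (U i) powr s))"
    by (rule hausdorff_pre_le) (use assms in \<open>auto simp: U_def intro!: exI[of _ 0]\<close>)
  also have "\<dots> = (\<Sum>i\<in>{0}. ennreal (diameter (U i) powr s))"
    by (rule suminf_finite) (auto simp: U_def)
  finally show ?thesis by (simp add: U_def)
qed

lemma hausdorff_pre_finite_UN:
  assumes "finite I" "0 \<le> \<delta>"
  shows "hausdorff_pre s \<delta> (\<Union>i\<in>I. A i) \<le> (\<Sum>i\<in>I. hausdorff_pre s \<delta> (A i :: 'a::metric_space set))"
  using assms(1)
proof (induction I rule: finite_induct)
  case empty
  show ?case using hausdorff_pre_diameter[of "{}::'a set" \<delta> s] assms(2) by simp
next
  case (insert j I)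
  have "hausdorff_pre s \<delta> (\<Union>n. binaryset (A j) (\<Union>i\<in>I. A i) n) \<le> (\<Sum>n. hausdorff_pre s \<delta> (binaryset (A j) (\<Union>i\<in>I. A i) n))"
    by (rule hausdorff_pre_countably_subadditive)
  moreover have "hausdorff_pre s \<delta> ({}::'a set) = 0"
    using hausdorff_pre_diameter[of "{}::'a set" \<delta> s] assms(2) by simp
  ultimately have "hausdorff_pre s \<delta> (A j \<union> (\<Union>i\<in>I. A i)) \<le> hausdorff_pre s \<delta> (A j) + hausdorff_pre s \<delta> (\<Union>i\<in>I. A i)"
    using suminf_binaryset_eq[of "hausdorff_pre s \<delta>" "A j" "\<Union>i\<in>I. A i"] by (simp add: UN_binaryset_eq)
  also have "\<dots> \<le> hausdorff_pre s \<delta> (A j) + (\<Sum>i\<in>I. hausdorff_pre s \<delta> (A i))"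
    by (rule add_left_mono[OF insert.IH])
  finally show ?case using insert.hyps by simp
qed

text \<open>The \<open>3 ^ n\<close> cells of level \<open>n\<close> have diameter at most
  \<open>(1/2) ^ n\<close> times that of the gasket, and the choice of the exponent makes the
  resulting bound for the cost of this cover independent of \<open>n\<close>.\<close>

lemma hausdorff_outer_SG_finite: "hausdorff_outer gasket_dim (SG p) < top"
proof -
  let ?D = "diameter (SG p)"
  have D0: "0 \<le> ?D" by (rule diameter_ge_0[OF compact_imp_bounded[OF compact_SG]])
  have "hausdorff_pre gasket_dim \<delta> (SG p) \<le> ennreal (?D powr gasket_dim)" if \<delta>: "\<delta> > 0" for \<delta>
  proof -
    \<comment> \<open>The summand 1 keeps the denominator positive without a lower bound on the
      diameter.\<close>
    obtain n where n: "(1/2) ^ n < \<delta> / (?D + 1)"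
      using real_arch_pow_inv[of "\<delta> / (?D + 1)" "1/2"] \<delta> D0 by auto
    have nD: "(1/2) ^ n * ?D \<le> \<delta>"
    proof -
      have "(1/2) ^ n * ?D \<le> (1/2) ^ n * (?D + 1)" by (intro mult_left_mono) auto
      also have "\<dots> \<le> \<delta>" using n D0 by (simp add: field_simps)
      finally show ?thesis .
    qed
    have "hausdorff_pre gasket_dim \<delta> (SG p)
        = hausdorff_pre gasket_dim \<delta> (\<Union>w\<in>{w. length w = n}. F_word p w ` SG p)"
      by (subst SG_words[of p n]) (rule refl)
    also have "\<dots> \<le> (\<Sum>w\<in>{w. length w = n}. hausdorff_pre gasket_dim \<delta> (F_word p w ` SG p))"
      using \<delta> by (intro hausdorff_pre_finite_UN) auto
    also have "\<dots> \<le> (\<Sum>w\<in>{w :: word. length w = n}. ennreal ((1/3) ^ n * ?D powr gasket_dim))"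
    proof (rule sum_mono)
      fix w :: word assume w: "w \<in> {w. length w = n}"
      have bdd: "bounded (F_word p w ` SG p)" by (rule compact_imp_bounded[OF closed_F_word_SG])
      have diam: "diameter (F_word p w ` SG p) \<le> (1/2) ^ n * ?D"
        using dist_F_word_SG[of _ p w] w D0 by (intro diameter_le) (auto simp flip: dist_norm)
      have "hausdorff_pre gasket_dim \<delta> (F_word p w ` SG p) \<le> ennreal (diameter (F_word p w ` SG p) powr gasket_dim)"
        using bdd diam nD \<delta> by (intro hausdorff_pre_diameter) auto
      also have "\<dots> \<le> ennreal (((1/2) ^ n * ?D) powr gasket_dim)"
        by (intro ennreal_leI powr_mono2 diam diameter_ge_0 bdd) simp
      also have "((1/2) ^ n * ?D) powr gasket_dim = (1/3) ^ n * ?D powr gasket_dim"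
        by (simp only: powr_mult half_power_powr_gasket_dim)
      finally show "hausdorff_pre gasket_dim \<delta> (F_word p w ` SG p) \<le> ennreal ((1/3) ^ n * ?D powr gasket_dim)" .
    qed
    also have "\<dots> = ennreal (3 ^ n) * ennreal ((1/3) ^ n * ?D powr gasket_dim)"
      by (simp add: card_words flip: ennreal_power)
    also have "\<dots> = ennreal (?D powr gasket_dim)"
      by (simp add: power_one_over flip: ennreal_mult)
    finally show ?thesis .
  qed
  then have "hausdorff_outer gasket_dim (SG p) \<le> ennreal (?D powr gasket_dim)"
    unfolding hausdorff_outer_eq by (intro SUP_least) auto
  also have "\<dots> < top" by simp
  finally show ?thesis .
qed

section \<open>The measure of the cells\<close>

text \<open>A word is read as a binary number with digit 1 at the occurrences of \<open>c\<close>,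
  most significant digit first because the first letter selects the largest cell. For the two
  corners other than \<open>Lower_Left\<close> these are the lattice coordinates of the lower left
  corner of the cell, in units of its side.\<close>

primrec coord :: "corner \<Rightarrow> word \<Rightarrow> nat" where
  "coord c [] = 0"
| "coord c (j # w) = (if j = c then 2 ^ length w else 0) + coord c w"

lemma coord_less: "coord c w < 2 ^ length w"
  by (induction w) auto

lemma coord_inject:
  assumes "length w = length w'" "coord Lower_Right w = coord Lower_Right w'" "coord Upper w = coord Upper w'"
  shows "w = w'"
  using assms
proof (induction w w' rule: list_induct2)
  case (Cons j w j' w')
  have len: "length w' = length w" using Cons.hyps by simp
  have less: "coord c w < 2 ^ length w" "coord c w' < 2 ^ length w" for c
    using coord_less[of c w] coord_less[of c w'] len by simp_all
  have "j = j'"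
    using Cons.prems less[of Lower_Right] less[of Upper] unfolding coord.simps len
    by (cases j; cases j') auto
  with Cons.prems have "coord Lower_Right w = coord Lower_Right w'" "coord Upper w = coord Upper w'"
    by (auto simp: len split: if_splits)
  from Cons.IH[OF this] \<open>j = j'\<close> show ?case by simp
qed simp

text \<open>Oblique coordinates with respect to the edge vectors from \<open>Lower_Left\<close> to
  the other two corners; every argument \<open>c\<close> other than \<open>Upper\<close> gives the
  one belonging to \<open>Lower_Right\<close>.\<close>

definition lattice_coord :: "corner \<Rightarrow> real^2 \<Rightarrow> real" where
  "lattice_coord c y = (if c = Upper then y $ 2 * sqrt 3 / pi else (y $ 1 - y $ 2 / sqrt 3) * (3 / (2 * pi)))"

lemma lattice_coord_add: "lattice_coord c (x + y) = lattice_coord c x + lattice_coord c y"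
  and lattice_coord_scaleR: "lattice_coord c (r *\<^sub>R x) = r * lattice_coord c x"
  by (auto simp: lattice_coord_def algebra_simps add_divide_distrib)

lemma lattice_coord_diff: "lattice_coord c (x - y) = lattice_coord c x - lattice_coord c y"
  using lattice_coord_add[of c x "(-1) *\<^sub>R y"] lattice_coord_scaleR[of c "-1" y] by simp

lemma lattice_coord_vertex:
  assumes "c \<noteq> Lower_Left"
  shows "lattice_coord c (vertex p j - p) = (if j = c then 1 else 0)"
proof -
  have "sqrt 3 * sqrt 3 = 3" by simp
  then show ?thesis
    using assms by (cases c; cases j) (auto simp: lattice_coord_def vertex_def field_simps)
qed

lemma lattice_coord_F_word:
  assumes "c \<noteq> Lower_Left"
  shows "2 ^ length w * lattice_coord c (F_word p w x - p) = lattice_coord c (x - p) + coord c w"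
proof (induction w)
  case (Cons j w)
  have "F_word p (j # w) x - p = (1/2) *\<^sub>R ((F_word p w x - p) + (vertex p j - p))"
    by (rule vec_eq_iff[THEN iffD2], rule allI) (simp add: F_map_def field_simps)
  then have "lattice_coord c (F_word p (j # w) x - p) = (1/2) * (lattice_coord c (F_word p w x - p) + (if j = c then 1 else 0))"
    by (simp only: lattice_coord_scaleR lattice_coord_add lattice_coord_vertex[OF assms])
  then show ?case using Cons by (simp add: algebra_simps)
qed simp

lemma lattice_coord_SG:
  assumes "c \<noteq> Lower_Left" "x \<in> SG p"
  shows "lattice_coord c (x - p) \<in> {0..1}"
proof -
  let ?S = "{x. lattice_coord c (x - p) \<in> {0..1}}"
  have "convex hull (range (vertex p)) \<subseteq> ?S"
  proof (rule hull_minimal)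
    show "range (vertex p) \<subseteq> ?S" by (auto simp: lattice_coord_vertex[OF assms(1)])
    show "convex ?S"
    proof (rule convexI)
      fix x y and u v :: real assume *: "x \<in> ?S" "y \<in> ?S" "0 \<le> u" "0 \<le> v" "u + v = 1"
      have p: "u *\<^sub>R p + v *\<^sub>R p = p" using *(5) by (metis scaleR_left_distrib scaleR_one)
      have "u *\<^sub>R x + v *\<^sub>R y - (u *\<^sub>R p + v *\<^sub>R p) = u *\<^sub>R (x - p) + v *\<^sub>R (y - p)"
        by (simp add: algebra_simps)
      then have eq: "lattice_coord c (u *\<^sub>R x + v *\<^sub>R y - p) = u * lattice_coord c (x - p) + v * lattice_coord c (y - p)"
        unfolding p by (simp only: lattice_coord_add lattice_coord_scaleR)
      have "0 \<le> u * lattice_coord c (x - p)" "0 \<le> v * lattice_coord c (y - p)"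
        "u * lattice_coord c (x - p) \<le> u * 1" "v * lattice_coord c (y - p) \<le> v * 1"
        using * by (simp_all add: mult_left_le)
      then show "u *\<^sub>R x + v *\<^sub>R y \<in> ?S" using *(5) unfolding mem_Collect_eq eq by auto
    qed
  qed
  then show ?thesis using SG_subset_hull assms(2) by blast
qed

text \<open>The factor is sqrt 3 / \<pi> for \<open>Upper\<close>; otherwise 3 / (2 \<pi>) is
  applied to at most twice the norm. Both are controlled by \<pi> > 3, so a displacement shifts
  lattice coordinates by no more than its length.\<close>

lemma abs_lattice_coord_le: "\<bar>lattice_coord c y\<bar> \<le> norm y"
proof -
  have 1: "\<bar>y $ 1\<bar> \<le> norm y" and 2: "\<bar>y $ 2\<bar> \<le> norm y" by (rule component_le_norm_cart)+
  have s3: "1 \<le> sqrt 3" "sqrt 3 \<le> 3" by (auto intro: real_le_lsqrt)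
  have pi3: "3 < pi" by (rule pi_gt3)
  show ?thesis
  proof (cases "c = Upper")
    case True
    have "\<bar>y $ 2\<bar> * sqrt 3 \<le> norm y * pi" using 2 s3 pi3 by (intro mult_mono) auto
    then show ?thesis using True by (simp add: lattice_coord_def abs_mult divide_simps)
  next
    case False
    have "\<bar>y $ 2 / sqrt 3\<bar> \<le> \<bar>y $ 2\<bar>" using s3 by (simp add: abs_divide divide_le_eq mult_le_cancel_left1)
    then have "\<bar>y $ 1 - y $ 2 / sqrt 3\<bar> \<le> 2 * norm y" using 1 2 by linarith
    then have "\<bar>y $ 1 - y $ 2 / sqrt 3\<bar> * (3 / (2 * pi)) \<le> 2 * norm y * (3 / (2 * pi))"
      by (rule mult_right_mono) simp
    also have "\<dots> = norm y * (3 / pi)" by simp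
    also have "\<dots> \<le> norm y * 1" using pi3 by (intro mult_left_mono) auto
    also have "\<bar>y $ 1 - y $ 2 / sqrt 3\<bar> * (3 / (2 * pi)) = \<bar>lattice_coord c y\<bar>"
      using abs_mult[of "y $ 1 - y $ 2 / sqrt 3" "3 / (2 * pi)"] False
      by (simp only: lattice_coord_def if_False) simp
    finally show ?thesis by simp
  qed
qed

section \<open>The lower bound for the measure of the gasket\<close>

definition words_meeting :: "real^2 \<Rightarrow> (real^2) set \<Rightarrow> nat \<Rightarrow> word set" where
  "words_meeting p V n = {w. length w = n \<and> F_word p w ` SG p \<inter> V \<noteq> {}}"

lemma finite_words_meeting [simp]: "finite (words_meeting p V n)"
  unfolding words_meeting_def by (rule finite_subset[OF _ finite_words[of n]]) auto

text \<open>A word is determined by its two integer coordinates, and each of them is confined to a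
  window with at most four integers, whence 16 = 4 * 4.\<close>

lemma card_words_meeting_small:
  assumes V: "\<And>x y. x \<in> V \<Longrightarrow> y \<in> V \<Longrightarrow> dist x y \<le> (1/2) ^ k"
  shows "card (words_meeting p V k) \<le> 16"
proof (cases "V = {}")
  case True
  then show ?thesis by (simp add: words_meeting_def)
next
  case False
  then obtain x0 where x0: "x0 \<in> V" by blast
  define T where "T c = 2 ^ k * lattice_coord c (x0 - p)" for c
  \<comment> \<open>Scaled by \<open>2 ^ k\<close>, the coordinates of a point of \<open>V\<close>
    deviate from those of \<open>x0\<close> by at most 1, and the position inside the cell
    contributes between 0 and 1; hence the asymmetric window from \<open>T c - 2\<close> to
    \<open>T c + 1\<close>.\<close>
  define J where "J c = {\<lceil>T c - 2\<rceil>..\<lfloor>T c + 1\<rfloor>}" for c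
  have card_J: "card (J c) \<le> 4" for c
  proof -
    have "\<lfloor>T c + 1\<rfloor> - \<lceil>T c - 2\<rceil> \<le> 3" by linarith
    then show ?thesis using floor_le_ceiling[of "T c"] by (simp add: J_def nat_le_iff)
  qed
  have mem: "int (coord c w) \<in> J c" if w: "w \<in> words_meeting p V k" and c: "c \<noteq> Lower_Left" for w c
  proof -
    obtain y where y: "y \<in> SG p" "F_word p w y \<in> V" and len: "length w = k"
      using w by (auto simp: words_meeting_def)
    have "\<bar>lattice_coord c (F_word p w y - p) - lattice_coord c (x0 - p)\<bar> \<le> dist (F_word p w y) x0"
      using abs_lattice_coord_le[of c "F_word p w y - x0"] by (simp add: lattice_coord_diff dist_norm)
    also have "\<dots> \<le> (1/2) ^ k" by (rule V[OF y(2) x0])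
    finally have "2 ^ k * \<bar>lattice_coord c (F_word p w y - p) - lattice_coord c (x0 - p)\<bar> \<le> 2 ^ k * (1/2) ^ k"
      by (rule mult_left_mono) simp
    then have "\<bar>2 ^ k * lattice_coord c (F_word p w y - p) - T c\<bar> \<le> 1"
      by (simp add: T_def power_one_over abs_mult flip: right_diff_distrib)
    then have "\<bar>lattice_coord c (y - p) + coord c w - T c\<bar> \<le> 1"
      using lattice_coord_F_word[OF c, of w p y] len by simp
    moreover have "lattice_coord c (y - p) \<in> {0..1}" by (rule lattice_coord_SG[OF c y(1)])
    ultimately have "T c - 2 \<le> real (coord c w)" "real (coord c w) \<le> T c + 1" by auto
    then show ?thesis unfolding J_def atLeastAtMost_iff by linarith
  qed
  have "card (words_meeting p V k) \<le> card (J Lower_Right \<times> J Upper)"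
  proof (rule card_inj_on_le)
    show "inj_on (\<lambda>w. (int (coord Lower_Right w), int (coord Upper w))) (words_meeting p V k)"
      by (rule inj_onI) (auto simp: words_meeting_def intro: coord_inject)
    show "(\<lambda>w. (int (coord Lower_Right w), int (coord Upper w))) ` words_meeting p V k \<subseteq> J Lower_Right \<times> J Upper"
      using mem by auto
    show "finite (J Lower_Right \<times> J Upper)" by (simp add: J_def)
  qed
  also have "\<dots> = card (J Lower_Right) * card (J Upper)" by (rule card_cartesian_product)
  also have "\<dots> \<le> 4 * 4" by (intro mult_le_mono card_J)
  finally show ?thesis by simp
qed

lemma half_powers_bracket:
  assumes "0 < d" "d < (1::real)"
  obtains k where "(1/2) ^ Suc k < d" "d \<le> (1/2) ^ k"
proof -
  define m where "m = (LEAST m. (1/2) ^ m < d)"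
  have "\<exists>m. (1/2) ^ m < d" using real_arch_pow_inv[of d "1/2"] assms by auto
  then have m: "(1/2) ^ m < d" unfolding m_def by (rule LeastI_ex)
  then have "m \<noteq> 0" using assms by (cases m) auto
  then obtain k where k: "m = Suc k" by (cases m) auto
  have "\<not> (1/2) ^ k < d" using not_less_Least[of k "\<lambda>m. (1/2) ^ m < d"] k by (simp add: m_def)
  then show ?thesis using that[of k] m k by simp
qed

text \<open>For d < 1, at most 16 words meet \<open>V\<close> at the level \<open>k\<close> with
  (1/2)^(k+1) < d \<le> (1/2)^k, and each has 3^(n-k) extensions to length \<open>n\<close>. Passing
  from (1/3)^k to (1/3)^(k+1) supplies the factor 3 in 48 = 16 * 3.\<close>

lemma card_words_meeting:
  assumes d: "0 < d" and V: "\<And>x y. x \<in> V \<Longrightarrow> y \<in> V \<Longrightarrow> dist x y \<le> d"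
  shows "\<exists>n0. \<forall>n\<ge>n0. real (card (words_meeting p V n)) \<le> 48 * 3 ^ n * d powr gasket_dim"
proof (cases "d < 1")
  case False
  have "real (card (words_meeting p V n)) \<le> 48 * 3 ^ n * d powr gasket_dim" for n
  proof -
    have "card (words_meeting p V n) \<le> card {w :: word. length w = n}"
      by (intro card_mono) (auto simp: words_meeting_def)
    then have "real (card (words_meeting p V n)) \<le> 3 ^ n"
      unfolding card_words by (metis of_nat_le_iff of_nat_numeral of_nat_power)
    also have "\<dots> \<le> 48 * 3 ^ n * 1" by simp
    also have "1 \<le> d powr gasket_dim" using False by (intro ge_one_powr_ge_zero) auto
    finally show ?thesis by simp
  qed
  then show ?thesis by blast
next
  case True
  obtain k where k: "(1/2) ^ Suc k < d" "d \<le> (1/2) ^ k" by (rule half_powers_bracket[OF d True])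
  have "real (card (words_meeting p V n)) \<le> 48 * 3 ^ n * d powr gasket_dim" if n: "n \<ge> k" for n
  proof -
    let ?B = "words_meeting p V k \<times> {u :: word. length u = n - k}"
    have "words_meeting p V n \<subseteq> (\<lambda>(v, u). v @ u) ` ?B"
    proof
      fix w assume w: "w \<in> words_meeting p V n"
      have "F_word p w ` SG p = F_word p (take k w) ` F_word p (drop k w) ` SG p"
        using F_word_append[of p "take k w" "drop k w"] by (simp add: image_comp)
      also have "\<dots> \<subseteq> F_word p (take k w) ` SG p" by (intro image_mono F_word_SG_subset)
      finally have "take k w \<in> words_meeting p V k"
        using w n by (auto simp: words_meeting_def)
      then have "(take k w, drop k w) \<in> ?B" using w by (simp add: words_meeting_def)
      then show "w \<in> (\<lambda>(v, u). v @ u) ` ?B" by (metis (no_types, lifting) append_take_drop_id case_prod_conv image_eqI)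
    qed
    then have "card (words_meeting p V n) \<le> card ?B"
      by (intro surj_card_le finite_cartesian_product finite_words_meeting finite_words)
    also have "\<dots> \<le> 16 * 3 ^ (n - k)"
      unfolding card_cartesian_product card_words
      using V k(2) by (intro mult_le_mono1 card_words_meeting_small) (meson order_trans)
    finally have "real (card (words_meeting p V n)) \<le> real (16 * 3 ^ (n - k))" by (rule of_nat_mono)
    also have "\<dots> = 48 * 3 ^ n * (1/3) ^ Suc k"
    proof -
      have "(3::real) ^ n = 3 ^ k * 3 ^ (n - k)" using n by (simp flip: power_add)
      then show ?thesis by (simp add: power_one_over)
    qed
    also have "(1/3 :: real) ^ Suc k = ((1/2) ^ Suc k) powr gasket_dim"
      by (rule half_power_powr_gasket_dim[symmetric])
    also have "\<dots> \<le> d powr gasket_dim" using k(1) by (intro powr_mono2) auto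
    finally show ?thesis by simp
  qed
  then show ?thesis by blast
qed

text \<open>Mass distribution principle with the counting of words in the role of the measure: at a
  large level \<open>n\<close> every word meets some member of the cover, while a member of diameter
  \<open>d\<close> meets at most 48 * 3^n * d^s words. Every cover therefore costs at least
  1/48.\<close>

lemma hausdorff_outer_SG_pos: "hausdorff_outer gasket_dim (SG p) > 0"
proof -
  have "ennreal (1/48) \<le> hausdorff_pre gasket_dim 1 (SG p)"
  proof (rule hausdorff_pre_greatest)
    fix U :: "nat \<Rightarrow> (real^2) set"
    assume U: "SG p \<subseteq> (\<Union>i. U i)" "\<And>i. bounded (U i)" "\<And>i. diameter (U i) \<le> 1"
    let ?D = "\<lambda>i. diameter (U i)"
    have D0: "0 \<le> ?D i" for i by (rule diameter_ge_0[OF U(2)])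
    show "ennreal (1/48) \<le> (\<Sum>i. ennreal (?D i powr gasket_dim))"
    proof (rule ennreal_le_epsilon)
      fix \<eta> :: real assume \<eta>: "0 < \<eta>"
      \<comment> \<open>Thickening the members to open sets lets compactness reduce the cover to a
        finite one; the \<open>i\<close>-th member may add to the cost a share of \<eta>, and these
        shares sum to \<eta>.\<close>
      have "\<exists>\<rho>>0. (?D i + 2 * \<rho>) powr gasket_dim < ?D i powr gasket_dim + \<eta> * (1/2) ^ Suc i" for i
      proof -
        have "(\<lambda>m. ?D i + 2 * (1 / Suc m)) \<longlonglongrightarrow> ?D i + 2 * 0"
          by (intro tendsto_intros LIMSEQ_inverse_real_of_nat[unfolded inverse_eq_divide])
        then have "(\<lambda>m. (?D i + 2 * (1 / Suc m)) powr gasket_dim) \<longlonglongrightarrow> (?D i + 2 * 0) powr gasket_dim"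
          by (rule tendsto_powr2[OF _ tendsto_const]) (use D0[of i] in auto)
        then have "\<forall>\<^sub>F m in sequentially. (?D i + 2 * (1 / Suc m)) powr gasket_dim < ?D i powr gasket_dim + \<eta> * (1/2) ^ Suc i"
          by (rule order_tendstoD(2)) (use \<eta> in simp)
        then obtain m where "(?D i + 2 * (1 / Suc m)) powr gasket_dim < ?D i powr gasket_dim + \<eta> * (1/2) ^ Suc i"
          using eventually_happens'[OF sequentially_bot] by blast
        then show ?thesis by (intro exI[of _ "1 / Suc m"]) auto
      qed
      then obtain \<rho> where \<rho>: "\<And>i. \<rho> i > 0"
        "\<And>i. (?D i + 2 * \<rho> i) powr gasket_dim < ?D i powr gasket_dim + \<eta> * (1/2) ^ Suc i" by metis
      define d where "d i = ?D i + 2 * \<rho> i" for i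
      define V where "V i = (\<Union>y\<in>U i. ball y (\<rho> i))" for i
      have V_dist: "dist x y \<le> d i" if xy: "x \<in> V i" "y \<in> V i" for i x y
      proof -
        obtain x' y' where *: "x' \<in> U i" "y' \<in> U i" "dist x' x < \<rho> i" "dist y' y < \<rho> i"
          using xy by (auto simp: V_def)
        have "dist x y \<le> dist x' x + dist x' y' + dist y' y"
          using dist_triangle[of x y x'] dist_triangle[of x' y y'] by (simp add: dist_commute)
        then show ?thesis
          using * diameter_bounded_bound[OF U(2) *(1,2)] by (simp add: d_def)
      qed
      have "SG p \<subseteq> (\<Union>i. V i)"
        using U(1) \<rho>(1) by (force simp: V_def)
      then obtain I where I: "finite I" "SG p \<subseteq> (\<Union>i\<in>I. V i)"
      proof -
        assume *: "SG p \<subseteq> (\<Union>i. V i)"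
        have "open (V i)" for i by (auto simp: V_def)
        then obtain I where "finite I" "SG p \<subseteq> (\<Union>i\<in>I. V i)"
          by (rule compactE_image[OF compact_SG _ *])
        then show ?thesis by (rule that)
      qed
      have "\<forall>i. \<exists>n0. \<forall>n\<ge>n0. real (card (words_meeting p (V i) n)) \<le> 48 * 3 ^ n * d i powr gasket_dim"
        using card_words_meeting[OF _ V_dist] \<rho>(1) D0 by (auto simp: d_def add_nonneg_pos)
      then obtain n0 where n0: "\<And>i n. n \<ge> n0 i \<Longrightarrow> real (card (words_meeting p (V i) n)) \<le> 48 * 3 ^ n * d i powr gasket_dim"
        by metis
      \<comment> \<open>The counting bound starts at a level depending on the member; the finite
        subcover admits a common one.\<close>
      define n where "n = Max (insert 0 (n0 ` I))"
      have n: "n0 i \<le> n" if "i \<in> I" for i unfolding n_def using I(1) that by (intro Max_ge) auto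
      have "{w :: word. length w = n} \<subseteq> (\<Union>i\<in>I. words_meeting p (V i) n)"
      proof
        fix w :: word assume w: "w \<in> {w. length w = n}"
        have x: "F_word p w (vertex p Upper) \<in> F_word p w ` SG p" using vertex_in_SG by blast
        then have "F_word p w (vertex p Upper) \<in> SG p" using F_word_SG_subset by blast
        then obtain i where "i \<in> I" "F_word p w (vertex p Upper) \<in> V i" using I(2) by blast
        then show "w \<in> (\<Union>i\<in>I. words_meeting p (V i) n)" using x w by (auto simp: words_meeting_def)
      qed
      then have "card {w :: word. length w = n} \<le> card (\<Union>i\<in>I. words_meeting p (V i) n)"
        by (intro card_mono finite_UN_I I(1)) auto
      also have "\<dots> \<le> (\<Sum>i\<in>I. card (words_meeting p (V i) n))" by (rule card_UN_le[OF I(1)])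
      finally have "real (3 ^ n) \<le> real (\<Sum>i\<in>I. card (words_meeting p (V i) n))"
        unfolding card_words by (rule of_nat_mono)
      also have "\<dots> \<le> (\<Sum>i\<in>I. 48 * 3 ^ n * d i powr gasket_dim)"
        unfolding of_nat_sum by (intro sum_mono n0 n)
      also have "\<dots> = 3 ^ n * (48 * (\<Sum>i\<in>I. d i powr gasket_dim))"
        by (simp add: sum_distrib_left mult_ac)
      finally have "1/48 \<le> (\<Sum>i\<in>I. d i powr gasket_dim)" by simp
      also have "\<dots> \<le> (\<Sum>i\<in>I. ?D i powr gasket_dim + \<eta> * (1/2) ^ Suc i)"
        unfolding d_def using \<rho>(2) by (intro sum_mono less_imp_le)
      finally have "ennreal (1/48) \<le> ennreal (\<Sum>i\<in>I. ?D i powr gasket_dim + \<eta> * (1/2) ^ Suc i)"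
        by (rule ennreal_leI)
      also have "\<dots> = (\<Sum>i\<in>I. ennreal (?D i powr gasket_dim)) + (\<Sum>i\<in>I. ennreal (\<eta> * (1/2) ^ Suc i))"
        using \<eta> by (simp add: sum.distrib sum_nonneg ennreal_plus sum_ennreal[symmetric] flip: sum_ennreal)
      also have "\<dots> \<le> (\<Sum>i. ennreal (?D i powr gasket_dim)) + (\<Sum>i. ennreal (\<eta> * (1/2) ^ Suc i))"
        by (intro add_mono sum_le_suminf I(1)) auto
      also have "(\<Sum>i. ennreal (\<eta> * (1/2) ^ Suc i)) = ennreal \<eta>"
      proof (rule suminf_ennreal_eq)
        show "(\<lambda>n. \<eta> * (1/2) ^ Suc n) sums \<eta>" using sums_mult[OF power_half_series, of \<eta>] by simp
      qed (use \<eta> in simp)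
      finally show "ennreal (1/48) \<le> (\<Sum>i. ennreal (?D i powr gasket_dim)) + ennreal \<eta>" .
    qed
  qed
  also have "\<dots> \<le> hausdorff_outer gasket_dim (SG p)" by (rule hausdorff_pre_le_outer) simp
  finally show ?thesis by (rule less_le_trans[rotated]) simp
qed

section \<open>The normalized measure and its integrals\<close>

lemma space_mu_SG [simp]: "space (mu_SG p) = SG p"
  by (simp add: mu_SG_def Let_def space_scale_measure space_restrict_space)

lemma sets_mu_SG: "sets (mu_SG p) = sets (restrict_space borel (SG p))"
  by (simp add: mu_SG_def Let_def sets_scale_measure sets_restrict_space)

lemma closed_in_mu_SG: "compact A \<Longrightarrow> A \<subseteq> SG p \<Longrightarrow> A \<in> sets (mu_SG p)"
  unfolding sets_mu_SG sets_restrict_space by (auto intro: compact_imp_closed borel_closed)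

lemma emeasure_mu_SG:
  assumes "compact A" "A \<subseteq> SG p"
  shows "emeasure (mu_SG p) A = hausdorff_outer gasket_dim A / hausdorff_outer gasket_dim (SG p)"
proof -
  have borel: "SG p \<in> sets borel" "A \<in> sets borel"
    using compact_SG assms(1) by (auto intro: borel_closed compact_imp_closed)
  show ?thesis
    using assms(2) borel
    by (simp add: mu_SG_def Let_def emeasure_restrict_space emeasure_hausdorff_measure ennreal_divide_times
        divide_ennreal_def mult.commute)
qed

lemma emeasure_mu_SG_space: "emeasure (mu_SG p) (SG p) = 1"
  using emeasure_mu_SG[OF compact_SG order_refl, of p] hausdorff_outer_SG_pos[of p] hausdorff_outer_SG_finite[of p]
  by (simp add: ennreal_divide_self)

lemma emeasure_mu_SG_cell: "emeasure (mu_SG p) (F_word p w ` SG p) = ennreal ((1/3) ^ length w)"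
proof -
  have "emeasure (mu_SG p) (F_word p w ` SG p)
      = ennreal ((1/3) ^ length w) * (hausdorff_outer gasket_dim (SG p) / hausdorff_outer gasket_dim (SG p))"
    unfolding emeasure_mu_SG[OF closed_F_word_SG F_word_SG_subset] hausdorff_outer_F_word
    by (simp add: divide_ennreal_def mult.assoc)
  then show ?thesis
    using hausdorff_outer_SG_pos[of p] hausdorff_outer_SG_finite[of p] by (simp add: ennreal_divide_self)
qed

text \<open>The cells of level \<open>n\<close> cover the gasket and their measures add up to its measure, so they
  overlap in a null set.\<close>

lemma AE_unique_cell:
  "AE x in mu_SG p. (\<Sum>w\<in>{w. length w = n}. indicator (F_word p w ` SG p) x) = (1::real)"
proof -
  interpret finite_measure "mu_SG p" by (rule finite_measureI) (simp add: emeasure_mu_SG_space)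
  let ?g = "\<lambda>x. (\<Sum>w\<in>{w. length w = n}. indicator (F_word p w ` SG p) x) :: real"
  have cell: "F_word p w ` SG p \<in> sets (mu_SG p)" for w
    by (rule closed_in_mu_SG[OF closed_F_word_SG F_word_SG_subset])
  have ind: "integrable (mu_SG p) (indicator (F_word p w ` SG p) :: _ \<Rightarrow> real)" for w
    using cell by (simp add: integrable_indicator_iff emeasure_mu_SG_cell Int_absorb2[OF F_word_SG_subset])
  have int: "integrable (mu_SG p) (\<lambda>x. ?g x - 1)"
    by (intro Bochner_Integration.integrable_diff Bochner_Integration.integrable_sum ind) simp
  have ge: "1 \<le> ?g x" if x: "x \<in> SG p" for x
  proof -
    obtain w where "length w = n" "x \<in> F_word p w ` SG p"
      using subsetD[OF equalityD1[OF SG_words[of p n]] x] by blast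
    then have "indicator (F_word p w ` SG p) x \<le> ?g x"
      by (intro member_le_sum) auto
    then show ?thesis using \<open>x \<in> F_word p w ` SG p\<close> by simp
  qed
  have meas: "measure (mu_SG p) (F_word p w ` SG p) = (1/3) ^ length w" for w
    by (simp add: measure_def emeasure_mu_SG_cell)
  have "(\<integral>x. ?g x \<partial>mu_SG p) = (\<Sum>w\<in>{w. length w = n}. \<integral>x. indicator (F_word p w ` SG p) x \<partial>mu_SG p)"
    by (rule Bochner_Integration.integral_sum[OF ind])
  also have "\<dots> = (\<Sum>w\<in>{w :: word. length w = n}. (1/3) ^ n)"
    by (intro sum.cong) (auto simp: Int_absorb2[OF F_word_SG_subset] meas)
  also have "\<dots> = 1" by (simp add: card_words power_one_over)
  finally have "(\<integral>x. ?g x \<partial>mu_SG p) = 1" .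
  moreover have "measure (mu_SG p) (SG p) = 1" by (simp add: measure_def emeasure_mu_SG_space)
  moreover have "integrable (mu_SG p) ?g" by (intro Bochner_Integration.integrable_sum ind)
  ultimately have "(\<integral>x. ?g x - 1 \<partial>mu_SG p) = 0" by simp
  then have "AE x in mu_SG p. ?g x - 1 = 0"
    by (subst integral_nonneg_eq_0_iff_AE[symmetric]) (auto intro!: int AE_I2 ge)
  then show ?thesis by simp
qed

text \<open>Almost every point lies in exactly one cell of level \<open>n\<close>, so the step
  function with value \<open>a w\<close> on the cell of \<open>w\<close> is within \<epsilon> of
  \<open>f\<close> almost everywhere.\<close>

lemma integral_mu_SG_approx:
  fixes f :: "real^2 \<Rightarrow> complex"
  assumes f: "continuous_on (SG p) f"
    and a: "\<And>w x. length w = n \<Longrightarrow> x \<in> F_word p w ` SG p \<Longrightarrow> cmod (f x - a w) \<le> \<epsilon>"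
  shows "cmod ((\<integral>x. f x \<partial>mu_SG p) - (\<Sum>w\<in>{w. length w = n}. of_real ((1/3) ^ n) * a w)) \<le> \<epsilon>"
proof -
  interpret finite_measure "mu_SG p" by (rule finite_measureI) (simp add: emeasure_mu_SG_space)
  have f_meas: "f \<in> borel_measurable (mu_SG p)"
    using borel_measurable_continuous_on_restrict[OF f] measurable_cong_sets[OF sets_mu_SG refl] by blast
  have "compact (f ` SG p)" by (rule compact_continuous_image[OF f compact_SG])
  then obtain K where K: "\<And>x. x \<in> SG p \<Longrightarrow> cmod (f x) \<le> K"
    using compact_imp_bounded[THEN bounded_iff[THEN iffD1]] by (metis imageI)
  have f_int: "integrable (mu_SG p) f"
    by (rule integrable_const_bound[where B = K]) (use K f_meas in \<open>auto intro!: AE_I2\<close>)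
  have cell: "F_word p w ` SG p \<in> sets (mu_SG p)" for w
    by (rule closed_in_mu_SG[OF closed_F_word_SG F_word_SG_subset])
  let ?W = "{w :: word. length w = n}" and ?I = "\<lambda>w. indicator (F_word p w ` SG p) :: real^2 \<Rightarrow> real"
  let ?s = "\<lambda>x. \<Sum>w\<in>?W. ?I w x *\<^sub>R a w"
  have ind: "integrable (mu_SG p) (\<lambda>x. ?I w x *\<^sub>R a w)" for w
    using cell by (intro integrable_scaleR_left) (simp add: integrable_indicator_iff emeasure_mu_SG_cell Int_absorb2[OF F_word_SG_subset])
  have "measure (mu_SG p) (F_word p w ` SG p) = (1/3) ^ length w" for w
    by (simp add: measure_def emeasure_mu_SG_cell)
  then have s: "(\<integral>x. ?s x \<partial>mu_SG p) = (\<Sum>w\<in>?W. of_real ((1/3) ^ n) * a w)"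
  proof -
    assume meas: "\<And>w. measure (mu_SG p) (F_word p w ` SG p) = (1/3) ^ length w"
    have "(\<integral>x. ?I w x *\<^sub>R a w \<partial>mu_SG p) = (1/3) ^ length w *\<^sub>R a w" for w
      using cell by (subst integral_scaleR_left)
        (simp_all add: integrable_indicator_iff emeasure_mu_SG_cell Int_absorb2[OF F_word_SG_subset] meas)
    then show ?thesis
      unfolding Bochner_Integration.integral_sum[OF ind] by (intro sum.cong) (auto simp: scaleR_conv_of_real)
  qed
  have "0 \<le> \<epsilon>"
    using a[of "replicate n Upper" "F_word p (replicate n Upper) (vertex p Upper)"] vertex_in_SG[of p Upper]
    by (metis imageI length_replicate norm_ge_zero order_trans)
  have "(\<integral>x. f x \<partial>mu_SG p) - (\<Sum>w\<in>?W. of_real ((1/3) ^ n) * a w) = (\<integral>x. f x - ?s x \<partial>mu_SG p)"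
    unfolding s[symmetric] by (intro Bochner_Integration.integral_diff[symmetric] f_int Bochner_Integration.integrable_sum ind)
  also have "cmod \<dots> \<le> (\<integral>x. cmod (f x - ?s x) \<partial>mu_SG p)" by simp
  also have "\<dots> \<le> (\<integral>x. \<epsilon> \<partial>mu_SG p)"
  proof (rule integral_mono_AE)
    show "integrable (mu_SG p) (\<lambda>x. cmod (f x - ?s x))"
      by (intro integrable_norm Bochner_Integration.integrable_diff f_int Bochner_Integration.integrable_sum ind)
    show "AE x in mu_SG p. cmod (f x - ?s x) \<le> \<epsilon>"
      using AE_unique_cell[of p n]
    proof eventually_elim
      case (elim x)
      have "f x - ?s x = (\<Sum>w\<in>?W. ?I w x) *\<^sub>R f x - ?s x" unfolding elim by simp
      also have "\<dots> = (\<Sum>w\<in>?W. ?I w x *\<^sub>R (f x - a w))"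
        by (simp add: scaleR_sum_left sum_subtractf scaleR_diff_right)
      also have "cmod \<dots> \<le> (\<Sum>w\<in>?W. ?I w x * \<epsilon>)"
        by (rule sum_norm_le) (auto simp: indicator_def intro!: a)
      also have "\<dots> = \<epsilon>" unfolding sum_distrib_right[symmetric] elim by simp
      finally show ?case .
    qed
  qed simp
  also have "\<dots> = \<epsilon>" by (simp add: measure_def emeasure_mu_SG_space)
  finally show ?thesis .
qed

section \<open>The parameterization of the triangles\<close>

lemma r_param_in_cell: "r_param p w t \<in> F_word p w ` SG p"
proof -
  let ?F = "F_word p w"
  have seg: "?F (vertex p i) + u *\<^sub>R (?F (vertex p j) - ?F (vertex p i)) \<in> ?F ` SG p"
    if u: "0 \<le> u" "u \<le> 1" and ij: "closed_segment (vertex p i) (vertex p j) \<subseteq> SG_0 p" for i j u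
  proof -
    let ?y = "(1 - u) *\<^sub>R vertex p i + u *\<^sub>R vertex p j"
    have "?y \<in> closed_segment (vertex p i) (vertex p j)" unfolding in_segment using u by blast
    then have "?y \<in> SG p" using ij SG_0_subset by blast
    moreover have "?F ?y = ?F (vertex p i) + u *\<^sub>R (?F (vertex p j) - ?F (vertex p i))"
    proof -
      have "?F ?y = ?F (vertex p i) + (?F ?y - ?F (vertex p i))" by simp
      also have "?F ?y - ?F (vertex p i) = u *\<^sub>R (?F (vertex p j) - ?F (vertex p i))"
        unfolding F_word_diff by (simp add: algebra_simps)
      finally show ?thesis .
    qed
    ultimately show ?thesis by (metis imageI)
  qed
  define u where "u = 3 * frac (t / (2 * pi / 2 ^ length w))"
  have u: "0 \<le> u" "u < 3" unfolding u_def by (simp_all add: frac_lt_1)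
  have sub: "closed_segment (vertex p Lower_Right) (vertex p Upper) \<subseteq> SG_0 p"
    "closed_segment (vertex p Upper) (vertex p Lower_Left) \<subseteq> SG_0 p"
    "closed_segment (vertex p Lower_Left) (vertex p Lower_Right) \<subseteq> SG_0 p"
    by (auto simp: SG_0_def)
  have r: "r_param p w t =
      (if u \<le> 1 then ?F (vertex p Lower_Right) + u *\<^sub>R (?F (vertex p Upper) - ?F (vertex p Lower_Right))
       else if u \<le> 2 then ?F (vertex p Upper) + (u - 1) *\<^sub>R (?F (vertex p Lower_Left) - ?F (vertex p Upper))
       else ?F (vertex p Lower_Left) + (u - 2) *\<^sub>R (?F (vertex p Lower_Right) - ?F (vertex p Lower_Left)))"
    unfolding r_param_def Let_def u_def ..
  consider "u \<le> 1" | "u > 1" "u \<le> 2" | "u > 2" by linarith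
  then show ?thesis
  proof cases
    case 1
    then show ?thesis using seg[of u Lower_Right Upper] u sub by (simp add: r)
  next
    case 2
    then show ?thesis using seg[of "u - 1" Upper Lower_Left] sub by (simp add: r)
  next
    case 3
    then show ?thesis using seg[of "u - 2" Lower_Left Lower_Right] u sub by (simp add: r)
  qed
qed

lemma measurable_r_param [measurable]: "r_param p w \<in> borel_measurable borel"
  unfolding r_param_def[abs_def] Let_def frac_def by measurable

text \<open>\<open>f\<close> is controlled on the gasket only; its extension by zero is Borel, and
  the curve \<open>r_param p w\<close> stays inside the gasket, where the two agree.\<close>

lemma measurable_on_cell:
  fixes f :: "real^2 \<Rightarrow> complex"
  assumes "continuous_on (SG p) f"
  shows "(\<lambda>t. f (r_param p w t)) \<in> borel_measurable borel"
proof -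
  have "SG p \<in> sets borel" using compact_SG by (auto intro: borel_closed compact_imp_closed)
  from borel_measurable_continuous_on_indicator[OF this assms]
  have [measurable]: "(\<lambda>x. indicator (SG p) x *\<^sub>R f x) \<in> borel_measurable borel" .
  have "f (r_param p w t) = indicator (SG p) (r_param p w t) *\<^sub>R f (r_param p w t)" for t
    using r_param_in_cell[of p w t] F_word_SG_subset[of p w] by (auto simp: indicator_def)
  then have "(\<lambda>t. f (r_param p w t)) = (\<lambda>t. indicator (SG p) (r_param p w t) *\<^sub>R f (r_param p w t))" by blast
  also have "\<dots> \<in> borel_measurable borel" by measurable
  finally show ?thesis .
qed

section \<open>Multiplication operators and the exponential basis\<close>

abbreviation "NL \<equiv> normalized_lebesgue"

definition half_width :: "word \<Rightarrow> real" where "half_width w = pi / 2 ^ length w"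

lemma half_width_pos: "half_width w > 0" by (simp add: half_width_def)

lemma NL_density:
  "NL w = density lborel (\<lambda>t. ennreal (indicator {- half_width w..half_width w} t / (2 * half_width w)))"
proof -
  have "indicator {- half_width w..half_width w} t / emeasure lborel {- half_width w..half_width w}
      = ennreal (indicator {- half_width w..half_width w} t / (2 * half_width w))" for t :: real
    using half_width_pos[of w] by (simp add: divide_ennreal indicator_def flip: ennreal_1 split del: if_split)
  then show ?thesis
    unfolding normalized_lebesgue_def uniform_measure_def half_width_def by simp
qed

lemma sets_NL [measurable_cong, simp]: "sets (NL w) = sets borel"
  by (simp add: normalized_lebesgue_def)

lemma space_NL [simp]: "space (NL w) = UNIV"
  by (simp add: normalized_lebesgue_def)

lemma emeasure_NL_UNIV: "emeasure (NL w) UNIV = 1"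
proof -
  have "emeasure (NL w) UNIV = emeasure lborel {- half_width w..half_width w} / emeasure lborel {- half_width w..half_width w}"
    unfolding normalized_lebesgue_def half_width_def by (subst emeasure_uniform_measure) auto
  also have "\<dots> = 1" using half_width_pos[of w] by (simp add: divide_ennreal)
  finally show ?thesis .
qed

lemma finite_measure_NL: "finite_measure (NL w)"
  by (rule finite_measureI) (simp add: emeasure_NL_UNIV)

lemma integral_NL:
  fixes f :: "real \<Rightarrow> complex"
  assumes [measurable]: "f \<in> borel_measurable borel"
  shows "(\<integral>t. f t \<partial>NL w) = (\<integral>t. indicator {- half_width w..half_width w} t *\<^sub>R f t \<partial>lborel) / (2 * half_width w)"
proof -
  have "(\<integral>t. f t \<partial>NL w) = (\<integral>t. (indicator {- half_width w..half_width w} t / (2 * half_width w)) *\<^sub>R f t \<partial>lborel)"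
    unfolding NL_density using half_width_pos[of w] by (subst integral_density) auto
  also have "\<dots> = (\<integral>t. (1 / (2 * half_width w)) *\<^sub>R (indicator {- half_width w..half_width w} t *\<^sub>R f t) \<partial>lborel)"
    by (intro Bochner_Integration.integral_cong) auto
  also have "\<dots> = (1 / (2 * half_width w)) *\<^sub>R (\<integral>t. indicator {- half_width w..half_width w} t *\<^sub>R f t \<partial>lborel)"
    by (rule integral_scaleR_right)
  finally show ?thesis by (simp add: scaleR_conv_of_real)
qed

lemma AE_NL_interior: "AE t in NL w. t \<in> {- half_width w<..<half_width w}"
proof -
  have "AE t in lborel. t \<noteq> - half_width w" "AE t in lborel. t \<noteq> half_width w"
    by (rule AE_lborel_singleton)+
  then have "AE t in lborel. t \<in> {- half_width w..half_width w} \<longrightarrow> t \<in> {- half_width w<..<half_width w}"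
    by eventually_elim auto
  then show ?thesis unfolding NL_density
    by (subst AE_density) (auto simp: indicator_def elim!: eventually_mono split: if_splits)
qed

text \<open>The bound is required at every real \<open>t\<close>, not just on the interval of the
  component; the periodic curve \<open>r_param\<close> never leaves the gasket, so functions on the
  gasket satisfy it.\<close>

definition multiplier :: "(word \<Rightarrow> real \<Rightarrow> complex) \<Rightarrow> real \<Rightarrow> bool" where
  "multiplier h K \<longleftrightarrow> (\<forall>w. h w \<in> borel_measurable borel) \<and> (\<forall>w t. cmod (h w t) \<le> K)"

text \<open>Extends \<open>pi_SG\<close> from functions on the gasket to arbitrary families, so that
  projections onto sets of words and pieces of \<pi>(f) that do not come from functions on the
  gasket are operators of the same kind.\<close>

definition mult_op :: "(word \<Rightarrow> real \<Rightarrow> complex) \<Rightarrow> hsg \<Rightarrow> hsg" where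
  "mult_op h x = abs_hsg (\<lambda>w t. h w t * rep_hsg x w t)"

lemma l2_eq_refl: "l2_sum M h \<Longrightarrow> l2_eq M h h" by (simp add: l2_eq_def)

lemma l2_sum_NL_measurable: "l2_sum NL g \<Longrightarrow> g w \<in> borel_measurable borel"
  using l2_sum_measurable[of NL g w] by (simp cong: measurable_cong_sets)

lemma l2_sum_mult:
  assumes h: "multiplier h K" and g: "l2_sum NL g"
  shows "l2_sum NL (\<lambda>w t. h w t * g w t)"
    "l2_energy NL (\<lambda>w t. h w t * g w t) \<le> ennreal (K\<^sup>2) * l2_energy NL g"
proof -
  have [measurable]: "h w \<in> borel_measurable borel" "g w \<in> borel_measurable borel" for w
    using h l2_sum_NL_measurable[OF g] by (auto simp: multiplier_def)
  have "0 \<le> K" using h unfolding multiplier_def by (meson norm_ge_zero order_trans)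
  have "l2_energy NL (\<lambda>w t. h w t * g w t) \<le> l2_energy NL (\<lambda>w t. of_real K * g w t)"
    using h \<open>0 \<le> K\<close> by (intro l2_energy_mono) (auto simp: norm_mult multiplier_def mult_right_mono)
  also have "\<dots> = ennreal (K\<^sup>2) * l2_energy NL g"
    by (subst l2_energy_scale) (use g in \<open>auto simp: l2_sum_measurable\<close>)
  finally show le: "l2_energy NL (\<lambda>w t. h w t * g w t) \<le> ennreal (K\<^sup>2) * l2_energy NL g" .
  have "(\<lambda>t. h w t * g w t) \<in> borel_measurable (NL w)" for w by measurable
  moreover have "ennreal (K\<^sup>2) * l2_energy NL g < \<infinity>" using g by (simp add: l2_sum_iff ennreal_mult_less_top)
  ultimately show "l2_sum NL (\<lambda>w t. h w t * g w t)"
    unfolding l2_sum_iff using le le_less_trans by blast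
qed

lemma abs_hsg_eqI: "l2_eq NL g h \<Longrightarrow> abs_hsg g = abs_hsg h"
  using Quotient3_rel[OF Quotient3_hsg, of g h] by blast

lemma hsg_cases:
  obtains g where "l2_sum NL g" "x = abs_hsg g"
  using l2_sum_rep_hsg[of x] abs_rep_hsg[of x] by metis

text \<open>Representatives that agree almost everywhere have products that agree almost everywhere;
  later computations can thus choose a representative instead of using
  \<open>rep_hsg\<close>.\<close>

lemma mult_op_abs:
  assumes h: "multiplier h K" and g: "l2_sum NL g"
  shows "mult_op h (abs_hsg g) = abs_hsg (\<lambda>w t. h w t * g w t)"
  unfolding mult_op_def
proof (rule abs_hsg_eqI)
  have "l2_eq NL (rep_hsg (abs_hsg g)) g"
    using Quotient3_rep_abs[OF Quotient3_hsg, OF l2_eq_refl[OF g]] .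
  then have *: "AE t in NL w. rep_hsg (abs_hsg g) w t = g w t" for w by (simp add: l2_eq_def)
  have "AE t in NL w. h w t * rep_hsg (abs_hsg g) w t = h w t * g w t" for w
    using *[of w] by eventually_elim simp
  then show "l2_eq NL (\<lambda>w t. h w t * rep_hsg (abs_hsg g) w t) (\<lambda>w t. h w t * g w t)"
    unfolding l2_eq_def using l2_sum_mult(1)[OF h] l2_sum_rep_hsg g by blast
qed

lemma abs_hsg_scaleC: "l2_sum NL g \<Longrightarrow> c *\<^sub>C abs_hsg g = abs_hsg (\<lambda>w t. c * g w t)"
  by (simp add: scaleC_hsg.abs_eq l2_eq_refl)

lemma cinner_abs_hsg: "l2_sum NL g \<Longrightarrow> l2_sum NL h \<Longrightarrow> cinner (abs_hsg g) (abs_hsg h) = l2_inner NL g h"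
  by (simp add: cinner_hsg.abs_eq l2_eq_refl)

lemma norm_mult_op_le:
  assumes h: "multiplier h K"
  shows "norm (mult_op h x) \<le> K * norm x"
proof -
  have "0 \<le> K" using h unfolding multiplier_def by (meson norm_ge_zero order_trans)
  obtain g where g: "l2_sum NL g" "x = abs_hsg g" by (rule hsg_cases)
  have "ennreal ((norm (mult_op h x))\<^sup>2) \<le> ennreal ((K * norm x)\<^sup>2)"
    using l2_sum_mult[OF h g(1)] unfolding g(2) mult_op_abs[OF h g(1)]
    by (simp add: l2_energy_eq_norm g(1) power_mult_distrib ennreal_mult)
  then have "(norm (mult_op h x))\<^sup>2 \<le> (K * norm x)\<^sup>2" by (simp add: ennreal_le_iff)
  then show ?thesis by (rule power2_le_imp_le) (simp add: \<open>0 \<le> K\<close>)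
qed

lemma bounded_operator_mult_op:
  assumes h: "multiplier h K"
  shows "bounded_operator (mult_op h)"
proof (rule bounded_operatorI[OF _ _ norm_mult_op_le[OF h]])
  fix x y :: hsg and c
  obtain f where f: "l2_sum NL f" "x = abs_hsg f" by (rule hsg_cases)
  obtain g where g: "l2_sum NL g" "y = abs_hsg g" by (rule hsg_cases)
  show "mult_op h (x + y) = mult_op h x + mult_op h y"
    unfolding f(2) g(2) abs_hsg_add[OF f(1) g(1), symmetric] mult_op_abs[OF h f(1)] mult_op_abs[OF h g(1)]
      mult_op_abs[OF h l2_sum_add[OF f(1) g(1)]]
    by (simp add: distrib_left abs_hsg_add l2_sum_mult(1)[OF h] f(1) g(1))
  show "mult_op h (c *\<^sub>C x) = c *\<^sub>C mult_op h x"
    unfolding f(2) abs_hsg_scaleC[OF f(1)] mult_op_abs[OF h f(1)] mult_op_abs[OF h l2_sum_scale[OF f(1)]]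
      abs_hsg_scaleC[OF l2_sum_mult(1)[OF h f(1)]]
    by (simp add: mult.left_commute)
qed

lemma cinner_mult_op:
  assumes h: "multiplier h K"
  shows "cinner (mult_op h x) y = cinner x (mult_op (\<lambda>w t. cnj (h w t)) y)"
proof -
  have h': "multiplier (\<lambda>w t. cnj (h w t)) K"
    using h by (auto simp: multiplier_def intro!: borel_measurable_continuous_on[of cnj] continuous_intros)
  obtain f where f: "l2_sum NL f" "x = abs_hsg f" by (rule hsg_cases)
  obtain g where g: "l2_sum NL g" "y = abs_hsg g" by (rule hsg_cases)
  show ?thesis
    unfolding f(2) g(2) mult_op_abs[OF h f(1)] mult_op_abs[OF h' g(1)]
      cinner_abs_hsg[OF l2_sum_mult(1)[OF h f(1)] g(1)] cinner_abs_hsg[OF f(1) l2_sum_mult(1)[OF h' g(1)]]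
    by (simp add: l2_inner_def mult_ac)
qed

lemma multiplier_cnj: "multiplier h K \<Longrightarrow> multiplier (\<lambda>w t. cnj (h w t)) K"
  by (auto simp: multiplier_def intro!: borel_measurable_continuous_on[of cnj] continuous_intros)

lemma multiplier_add: "multiplier a K \<Longrightarrow> multiplier b L \<Longrightarrow> multiplier (\<lambda>w t. a w t + b w t) (K + L)"
  by (auto simp: multiplier_def intro!: norm_triangle_mono borel_measurable_add)

lemma multiplier_scale: "multiplier a K \<Longrightarrow> multiplier (\<lambda>w t. c * a w t) (cmod c * K)"
  by (auto simp: multiplier_def norm_mult intro!: mult_left_mono borel_measurable_times)

lemma mult_op_mult:
  assumes a: "multiplier a K" and b: "multiplier b L"
  shows "mult_op a (mult_op b x) = mult_op (\<lambda>w t. a w t * b w t) x"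
proof -
  have "0 \<le> K" using a unfolding multiplier_def by (meson norm_ge_zero order_trans)
  then have ab: "multiplier (\<lambda>w t. a w t * b w t) (K * L)"
    using a b by (auto simp: multiplier_def norm_mult intro!: mult_mono borel_measurable_times)
  obtain f where f: "l2_sum NL f" "x = abs_hsg f" by (rule hsg_cases)
  show ?thesis
    unfolding f(2) mult_op_abs[OF b f(1)] mult_op_abs[OF a l2_sum_mult(1)[OF b f(1)]] mult_op_abs[OF ab f(1)]
    by (simp add: mult.assoc)
qed

lemma mult_op_add:
  assumes a: "multiplier a K" and b: "multiplier b L"
  shows "mult_op (\<lambda>w t. a w t + b w t) x = mult_op a x + mult_op b x"
proof -
  obtain f where f: "l2_sum NL f" "x = abs_hsg f" by (rule hsg_cases)
  show ?thesis
    unfolding f(2) mult_op_abs[OF b f(1)] mult_op_abs[OF a f(1)] mult_op_abs[OF multiplier_add[OF a b] f(1)]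
    by (simp add: distrib_right abs_hsg_add l2_sum_mult(1)[OF a] l2_sum_mult(1)[OF b] f(1))
qed

lemma mult_op_scale:
  assumes a: "multiplier a K"
  shows "mult_op (\<lambda>w t. c * a w t) x = c *\<^sub>C mult_op a x"
proof -
  obtain f where f: "l2_sum NL f" "x = abs_hsg f" by (rule hsg_cases)
  show ?thesis
    unfolding f(2) mult_op_abs[OF a f(1)] mult_op_abs[OF multiplier_scale[OF a] f(1)]
    by (simp add: abs_hsg_scaleC l2_sum_mult(1)[OF a] f(1) mult.assoc)
qed

section \<open>The exponentials as an orthonormal family\<close>

definition phi_fun :: "word \<Rightarrow> int \<Rightarrow> word \<Rightarrow> real \<Rightarrow> complex" where
  "phi_fun w k w' t = (if w' = w then exp (\<i> * of_real (2 ^ length w * of_int k * t)) else 0)"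

definition phi :: "word \<times> int \<Rightarrow> hsg" where "phi = (\<lambda>(w, k). phi_SG w k)"

lemma phi_SG_eq: "phi_SG w k = abs_hsg (phi_fun w k)"
  by (simp add: phi_SG_def phi_fun_def[abs_def])

lemma measurable_exp_i [measurable]: "(\<lambda>t. exp (\<i> * of_real (c * t))) \<in> borel_measurable borel"
  by (intro borel_measurable_continuous_onI continuous_intros)

lemma measurable_phi_fun [measurable]: "phi_fun w k w' \<in> borel_measurable borel"
  unfolding phi_fun_def by (cases "w' = w") simp_all

lemma l2_sum_phi_fun: "l2_sum NL (phi_fun w k)"
proof -
  have "l2_energy NL (phi_fun w k) = (\<integral>\<^sup>+w'. indicator {w} w' \<partial>count_space UNIV)"
    unfolding l2_energy_def
  proof (rule nn_integral_cong)
    fix w'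
    show "(\<integral>\<^sup>+t. ennreal ((cmod (phi_fun w k w' t))\<^sup>2) \<partial>NL w') = indicator {w} w'"
      by (cases "w' = w") (simp_all add: phi_fun_def emeasure_NL_UNIV)
  qed
  also have "\<dots> = 1" by simp
  finally show ?thesis by (simp add: l2_sum_iff)
qed

lemma cinner_phi:
  assumes g: "l2_sum NL g"
  shows "cinner (abs_hsg g) (phi_SG w k) = (\<integral>t. g w t * exp (\<i> * of_real (- (2 ^ length w * of_int k) * t)) \<partial>NL w)"
proof -
  have "cinner (abs_hsg g) (phi_SG w k) = (\<Sum>\<^sub>\<infinity>w'. \<integral>t. g w' t * cnj (phi_fun w k w' t) \<partial>NL w')"
    unfolding phi_SG_eq cinner_abs_hsg[OF g l2_sum_phi_fun] l2_inner_def ..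
  also have "\<dots> = (\<integral>t. g w t * cnj (phi_fun w k w t) \<partial>NL w)"
  proof -
    have "(\<Sum>\<^sub>\<infinity>w'. \<integral>t. g w' t * cnj (phi_fun w k w' t) \<partial>NL w')
        = (\<Sum>\<^sub>\<infinity>w'\<in>{w}. \<integral>t. g w' t * cnj (phi_fun w k w' t) \<partial>NL w')"
      by (rule infsum_cong_neutral) (auto simp: phi_fun_def)
    then show ?thesis by simp
  qed
  also have "\<dots> = (\<integral>t. g w t * exp (\<i> * of_real (- (2 ^ length w * of_int k) * t)) \<partial>NL w)"
    by (simp add: phi_fun_def exp_cnj)
  finally show ?thesis .
qed

lemma integral_exp_NL:
  fixes j :: int
  shows "(\<integral>t. exp (\<i> * of_real (2 ^ length w * of_int j * t)) \<partial>NL w) = (if j = 0 then 1 else 0)"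
proof (cases "j = 0")
  case True
  then show ?thesis using emeasure_NL_UNIV[of w] by (simp add: measure_def)
next
  case False
  define a where "a = (2 ^ length w * of_int j :: real)"
  have a0: "a \<noteq> 0" using False by (simp add: a_def)
  define F where "F t = exp (\<i> * of_real (a * t)) / (\<i> * of_real a)" for t :: real
  have per: "F (half_width w) = F (- half_width w)"
  proof -
    have "a * half_width w = of_int j * pi" by (simp add: a_def half_width_def)
    then have "exp (\<i> * of_real (a * half_width w)) = exp (\<i> * of_real (a * - half_width w))"
      unfolding exp_eq by (intro exI[of _ j]) (simp add: algebra_simps)
    then show ?thesis by (simp add: F_def)
  qed
  have "(\<integral>t. indicator {- half_width w..half_width w} t *\<^sub>R exp (\<i> * of_real (a * t)) \<partial>lborel) = F (half_width w) - F (- half_width w)"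
  proof (rule integral_FTC_atLeastAtMost)
    show "- half_width w \<le> half_width w" using half_width_pos[of w] by simp
    show "continuous_on {- half_width w..half_width w} (\<lambda>t. exp (\<i> * of_real (a * t)))"
      by (intro continuous_intros)
    show "(F has_vector_derivative exp (\<i> * of_real (a * x))) (at x within {- half_width w..half_width w})" for x
    proof -
      have "((\<lambda>z. exp (\<i> * of_real a * z) / (\<i> * of_real a)) has_field_derivative
          exp (\<i> * of_real a * of_real x)) (at (of_real x))"
        using a0 by (auto intro!: derivative_eq_intros)
      from has_vector_derivative_real_field[OF this] show ?thesis
        by (simp add: F_def[abs_def] mult.assoc)
    qed
  qed
  then show ?thesis using False per
    by (subst integral_NL) (auto simp: a_def)
qed

lemma orthonormal_family_phi: "orthonormal_family phi"
  unfolding orthonormal_family_def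
proof (intro allI)
  fix i j :: "word \<times> int"
  obtain w k w' l where ij: "i = (w, k)" "j = (w', l)" by (metis prod.exhaust)
  have "cinner (phi i) (phi j) = (\<integral>t. phi_fun w k w' t * exp (\<i> * of_real (- (2 ^ length w' * of_int l) * t)) \<partial>NL w')"
    unfolding ij phi_def prod.case phi_SG_eq[of w k] cinner_phi[OF l2_sum_phi_fun] ..
  also have "\<dots> = (if w' = w then \<integral>t. exp (\<i> * of_real (2 ^ length w * of_int (k - l) * t)) \<partial>NL w else 0)"
    by (simp add: phi_fun_def flip: exp_add) (simp add: algebra_simps)
  also have "\<dots> = (if w' = w then if k - l = 0 then 1 else 0 else 0)"
    unfolding integral_exp_NL ..
  finally show "cinner (phi i) (phi j) = (if i = j then 1 else 0)"
    by (auto simp: ij)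
qed

section \<open>Completeness of the exponentials and powers of the Dirac operator\<close>

text \<open>\<open>z\<close> wraps the interval onto the unit circle. Polynomials in the coordinates
  of \<open>z\<close>, then by Stone-Weierstrass continuous functions of \<open>z\<close>, then
  indicators of closed sets, and by a Dynkin argument indicators of all Borel sets integrate to 0
  against \<open>h\<close>.\<close>

lemma fourier_coefficients_zero:
  fixes h :: "real \<Rightarrow> complex"
  assumes int: "integrable (NL w) h"
    and zero: "\<And>k::int. (\<integral>t. h t * exp (\<i> * of_real (2 ^ length w * of_int k * t)) \<partial>NL w) = 0"
  shows "AE t in NL w. h t = 0"
proof -
  interpret finite_measure "NL w" by (rule finite_measure_NL)
  define E where "E k t = exp (\<i> * of_real (2 ^ length w * of_int k * t))" for k :: int and t :: real
  define z where "z t = exp (\<i> * of_real (2 ^ length w * t))" for t :: real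
  have [measurable]: "h \<in> borel_measurable borel"
    using borel_measurable_integrable[OF int] by (simp cong: measurable_cong_sets)
  have [measurable]: "h \<in> borel_measurable (NL w)" by (rule borel_measurable_integrable[OF int])
  have E_meas [measurable]: "E k \<in> borel_measurable borel" for k
    unfolding E_def by measurable
  have E_norm: "cmod (E k t) = 1" for k t by (simp add: E_def)
  have E_add: "E (j + k) t = E j t * E k t" for j k t
    by (simp add: E_def algebra_simps flip: exp_add)
  have E1: "E 1 t = z t" and Em1: "E (-1) t = cnj (z t)" for t by (simp_all add: E_def z_def exp_cnj)
  have z_sphere: "z t \<in> sphere 0 1" for t by (simp add: z_def)
  have z_cont: "continuous_on S z" for S unfolding z_def by (intro continuous_intros)
  have hu: "integrable (NL w) (\<lambda>t. h t * u t)"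
    if [measurable]: "u \<in> borel_measurable borel" and K: "\<And>t. cmod (u t) \<le> K" for u K
  proof (rule Bochner_Integration.integrable_bound)
    have "K \<ge> 0" using K by (meson norm_ge_zero order_trans)
    show "integrable (NL w) (\<lambda>t. K *\<^sub>R h t)" using int by simp
    show "(\<lambda>t. h t * u t) \<in> borel_measurable (NL w)" by measurable
    show "AE t in NL w. norm (h t * u t) \<le> norm (K *\<^sub>R h t)"
      using K \<open>K \<ge> 0\<close> by (intro AE_I2) (simp add: norm_mult mult.commute[of "cmod (h _)"] mult_right_mono)
  qed
  \<comment> \<open>All the factors \<open>E k\<close> are built in, which makes the class stable
    under multiplication by exponentials and lets the induction over polynomials pass through
    products.\<close>
  define B where "B u \<longleftrightarrow> u \<in> borel_measurable borel \<and> (\<exists>K. \<forall>t. cmod (u t) \<le> K) \<and>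
      (\<forall>k. (\<integral>t. h t * (u t * E k t) \<partial>NL w) = 0)" for u
  have B_int: "integrable (NL w) (\<lambda>t. h t * (u t * E k t))" if Bu: "B u" for u k
  proof -
    have [measurable]: "u \<in> borel_measurable borel" using Bu by (simp add: B_def)
    obtain K where "\<And>t. cmod (u t) \<le> K" using Bu by (auto simp: B_def)
    then show ?thesis by (intro hu[where K = K]) (auto simp: norm_mult E_norm)
  qed
  have B_1: "B (\<lambda>t. 1)" using zero by (auto simp: B_def E_def intro!: exI[of _ 1])
  have B_add: "B (\<lambda>t. u t + v t)" if Bu: "B u" "B v" for u v
  proof -
    obtain K L where "\<And>t. cmod (u t) \<le> K" "\<And>t. cmod (v t) \<le> L" using Bu by (auto simp: B_def)
    then have "\<forall>t. cmod (u t + v t) \<le> K + L" by (meson add_mono norm_triangle_le)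
    moreover have "(\<integral>t. h t * ((u t + v t) * E k t) \<partial>NL w) = 0" for k
      using that B_int[OF that(1), of k] B_int[OF that(2), of k] by (simp add: B_def algebra_simps)
    ultimately show ?thesis using Bu by (auto simp: B_def)
  qed
  have B_scale: "B (\<lambda>t. c * u t)" if Bu: "B u" for c u
  proof -
    obtain K where "\<And>t. cmod (u t) \<le> K" using Bu by (auto simp: B_def)
    then have "\<forall>t. cmod (c * u t) \<le> cmod c * K" by (simp add: norm_mult mult_left_mono)
    moreover have "(\<integral>t. h t * ((c * u t) * E k t) \<partial>NL w) = 0" for k
    proof -
      have "(\<integral>t. h t * ((c * u t) * E k t) \<partial>NL w) = (\<integral>t. c * (h t * (u t * E k t)) \<partial>NL w)"
        by (simp add: mult_ac)
      then show ?thesis using Bu by (simp add: B_def)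
    qed
    ultimately show ?thesis using Bu by (auto simp: B_def)
  qed
  have B_shift: "B (\<lambda>t. E j t * u t)" if Bu: "B u" for j u
  proof -
    have "(\<integral>t. h t * ((E j t * u t) * E k t) \<partial>NL w) = (\<integral>t. h t * (u t * E (j + k) t) \<partial>NL w)" for k
      by (simp add: E_add mult_ac)
    then show ?thesis using that by (auto simp: B_def norm_mult E_norm)
  qed
  have poly: "B (\<lambda>t. of_real (g (z t)) * u t)" if "real_polynomial_function g" "B u" for g :: "complex \<Rightarrow> real" and u
    using that
  proof (induction g arbitrary: u rule: real_polynomial_function.induct)
    case (linear f)
    \<comment> \<open>A real linear functional of \<open>z\<close> is a combination of
      \<open>z\<close> and its conjugate, that is, of \<open>E 1\<close> and
      \<open>E (-1)\<close>.\<close>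
    have eq: "of_real (f (z t)) * u t = ((f 1 - \<i> * f \<i>) / 2) * (E 1 t * u t) + ((f 1 + \<i> * f \<i>) / 2) * (E (-1) t * u t)" for t
    proof -
      have "z t = Re (z t) *\<^sub>R 1 + Im (z t) *\<^sub>R \<i>" by (simp add: complex_eq_iff)
      then have "f (z t) = f (Re (z t) *\<^sub>R 1 + Im (z t) *\<^sub>R \<i>)" by (rule arg_cong)
      also have "\<dots> = Re (z t) * f 1 + Im (z t) * f \<i>"
        using linear.hyps[THEN bounded_linear.linear]
        by (simp only: linear_add linear_scale real_scaleR_def)
      finally have "f (z t) = Re (z t) * f 1 + Im (z t) * f \<i>" .
      then show ?thesis
        by (simp add: E1 Em1 complex_eq_iff field_simps)
    qed
    show ?case unfolding eq by (intro B_add B_scale B_shift linear.prems)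
  next
    case (const c)
    then show ?case by (rule B_scale)
  next
    case (add f g)
    then show ?case using B_add[of "\<lambda>t. of_real (f (z t)) * u t" "\<lambda>t. of_real (g (z t)) * u t"]
      by (simp add: distrib_right)
  next
    case (mult f g)
    from mult.IH(1)[OF mult.IH(2)[OF mult.prems]] show ?case by (simp add: mult.assoc)
  qed
  have cont: "(\<integral>t. h t * of_real (q (z t)) \<partial>NL w) = 0" if q: "continuous_on UNIV q" for q :: "complex \<Rightarrow> real"
  proof -
    have [measurable]: "(\<lambda>t. q (z t)) \<in> borel_measurable borel"
      using continuous_on_compose2[OF q z_cont] by (intro borel_measurable_continuous_onI) auto
    have "compact (q ` sphere 0 1)"
      by (intro compact_continuous_image continuous_on_subset[OF q]) auto
    then obtain K where K: "\<And>x. x \<in> sphere 0 1 \<Longrightarrow> \<bar>q x\<bar> \<le> K"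
      using compact_imp_bounded[THEN bounded_iff[THEN iffD1]] by (metis imageI real_norm_def)
    have hq: "integrable (NL w) (\<lambda>t. h t * of_real (q (z t)))"
      by (rule hu[where K = K]) (use K[OF z_sphere] in auto)
    have "cmod (\<integral>t. h t * of_real (q (z t)) \<partial>NL w) \<le> \<epsilon> * (\<integral>t. cmod (h t) \<partial>NL w)" if \<epsilon>: "\<epsilon> > 0" for \<epsilon>
    proof -
      obtain g where g: "real_polynomial_function g" "\<And>x. x \<in> sphere 0 1 \<Longrightarrow> \<bar>q x - g x\<bar> < \<epsilon>"
        using Stone_Weierstrass_real_polynomial_function[OF _ continuous_on_subset[OF q] \<epsilon>, of "sphere 0 1"] by auto
      have Bg: "B (\<lambda>t. of_real (g (z t)) * 1)" by (rule poly[OF g(1) B_1])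
      have g0: "(\<integral>t. h t * of_real (g (z t)) \<partial>NL w) = 0" and gi: "integrable (NL w) (\<lambda>t. h t * of_real (g (z t)))"
        using Bg B_int[OF Bg, of 0] by (auto simp: B_def E_def dest!: spec[of _ 0])
      have "(\<integral>t. h t * of_real (q (z t)) \<partial>NL w) = (\<integral>t. h t * of_real (q (z t)) - h t * of_real (g (z t)) \<partial>NL w)"
        using hq gi g0 by simp
      also have "cmod \<dots> \<le> (\<integral>t. cmod (h t * of_real (q (z t)) - h t * of_real (g (z t))) \<partial>NL w)"
        by simp
      also have "\<dots> \<le> (\<integral>t. \<epsilon> * cmod (h t) \<partial>NL w)"
      proof (rule integral_mono)
        fix t
        have "cmod (h t * of_real (q (z t)) - h t * of_real (g (z t))) = cmod (h t) * \<bar>q (z t) - g (z t)\<bar>"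
          by (simp add: norm_mult flip: right_diff_distrib of_real_diff)
        also have "\<dots> \<le> cmod (h t) * \<epsilon>" using g(2)[OF z_sphere, of t] by (intro mult_left_mono) auto
        finally show "cmod (h t * of_real (q (z t)) - h t * of_real (g (z t))) \<le> \<epsilon> * cmod (h t)"
          by (simp add: mult.commute)
      qed (use hq gi int in auto)
      finally show ?thesis by simp
    qed
    then have "cmod (\<integral>t. h t * of_real (q (z t)) \<partial>NL w) \<le> 0 * (\<integral>t. cmod (h t) \<partial>NL w)"
      by (intro tendsto_lowerbound[where F = "at_right 0" and f = "\<lambda>\<epsilon>. \<epsilon> * (\<integral>t. cmod (h t) \<partial>NL w)"])
        (auto intro!: tendsto_eq_intros simp: eventually_at_filter)
    then show ?thesis by simp
  qed
  \<comment> \<open>The two endpoints have the same image on the circle, so one of the points is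
    taken in the open interval, where almost every point lies.\<close>
  have z_inj: "s = t" if "z s = z t" "s \<in> {- half_width w..half_width w}" "t \<in> {- half_width w<..<half_width w}" for s t
  proof -
    have "\<exists>n::int. \<i> * of_real (2 ^ length w * s) = \<i> * of_real (2 ^ length w * t) + of_real (2 * n * pi) * \<i>"
      using that(1) unfolding z_def exp_eq by simp
    then obtain n :: int where "2 ^ length w * s = 2 ^ length w * t + 2 * n * pi"
      by (auto simp: complex_eq_iff)
    then have n: "s - t = 2 * n * half_width w" by (simp add: half_width_def field_simps)
    have "\<bar>s - t\<bar> < 2 * half_width w" using that(2,3) by auto
    then have "\<bar>real_of_int n\<bar> < 1" using half_width_pos[of w] by (simp add: n abs_mult)
    then have "n = 0" by linarith
    then show ?thesis using n by simp
  qed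
  have closed: "(\<integral>t. indicator A t *\<^sub>R h t \<partial>NL w) = 0" if "closed A" for A
  proof (cases "A \<inter> {- half_width w..half_width w} = {}")
    case True
    have [measurable]: "A \<in> sets borel" using that by simp
    have "AE t in NL w. indicator A t *\<^sub>R h t = 0"
      using AE_NL_interior by eventually_elim (use True in \<open>auto simp: indicator_def\<close>)
    moreover have "(\<lambda>t. indicator A t *\<^sub>R h t) \<in> borel_measurable (NL w)" by measurable
    ultimately show ?thesis by (simp add: integral_eq_zero_AE)
  next
    case False
    define C where "C = z ` (A \<inter> {- half_width w..half_width w})"
    have "compact C" unfolding C_def
      using that by (intro compact_continuous_image z_cont closed_Int_compact) auto
    then have C: "closed C" "C \<noteq> {}" using False by (auto simp: C_def compact_imp_closed)
    \<comment> \<open>Continuous functions decreasing to the indicator of the compact set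
      \<open>C\<close>; dominated convergence carries the vanishing over to this indicator.\<close>
    define q where "q m x = max 0 (1 - real m * infdist x C)" for m :: nat and x
    have q_cont: "continuous_on UNIV (q m)" for m unfolding q_def by (intro continuous_intros)
    have q01: "\<bar>q m x\<bar> \<le> 1" for m x by (auto simp: q_def infdist_nonneg)
    have q_lim: "(\<lambda>m. q m x) \<longlonglongrightarrow> indicator C x" for x
    proof (cases "x \<in> C")
      case False
      then have "infdist x C > 0" using infdist_pos_not_in_closed[OF C False] by simp
      then have "(\<lambda>m. q m x) \<longlonglongrightarrow> 0" unfolding q_def by real_asymp
      then show ?thesis using False by simp
    qed (simp add: q_def)
    have [measurable]: "(\<lambda>t. q m (z t)) \<in> borel_measurable borel" for m
      using continuous_on_compose2[OF q_cont z_cont] by (intro borel_measurable_continuous_onI) auto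
    have [measurable]: "A \<in> sets borel" "C \<in> sets borel" "z \<in> borel_measurable borel"
      using that C z_cont by (auto intro: borel_measurable_continuous_onI)
    have "(\<lambda>m. \<integral>t. h t * of_real (q m (z t)) \<partial>NL w) \<longlonglongrightarrow> (\<integral>t. h t * of_real (indicator C (z t)) \<partial>NL w)"
    proof (rule integral_dominated_convergence[where w = "\<lambda>t. cmod (h t)"])
      show "AE t in NL w. norm (h t * of_real (q m (z t))) \<le> cmod (h t)" for m
        using q01 by (intro AE_I2) (simp add: norm_mult mult_left_le)
      show "AE t in NL w. (\<lambda>m. h t * of_real (q m (z t))) \<longlonglongrightarrow> h t * of_real (indicator C (z t))"
        by (intro AE_I2 tendsto_intros q_lim)
    qed (use int in auto)
    then have "(\<integral>t. h t * of_real (indicator C (z t)) \<partial>NL w) = 0"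
      by (simp add: cont[OF q_cont] LIMSEQ_const_iff)
    moreover have "(\<integral>t. h t * of_real (indicator C (z t)) \<partial>NL w) = (\<integral>t. indicator A t *\<^sub>R h t \<partial>NL w)"
    proof (rule integral_cong_AE)
      show "AE t in NL w. h t * of_real (indicator C (z t)) = indicator A t *\<^sub>R h t"
        using AE_NL_interior
      proof eventually_elim
        case (elim t)
        have "z t \<in> C \<longleftrightarrow> t \<in> A"
        proof
          assume "z t \<in> C"
          then obtain s where "s \<in> A" "s \<in> {- half_width w..half_width w}" "z s = z t" by (auto simp: C_def)
          then show "t \<in> A" using z_inj elim by blast
        next
          assume "t \<in> A"
          moreover have "t \<in> {- half_width w..half_width w}" using elim by auto
          ultimately show "z t \<in> C" by (auto simp: C_def)
        qed
        then show ?case by (simp add: indicator_def)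
      qed
    qed measurable
    ultimately show ?thesis by simp
  qed
  have "(\<integral>t. indicator A t *\<^sub>R h t \<partial>NL w) = 0" if "A \<in> sigma_sets UNIV (Collect closed)" for A
  proof (rule sigma_sets_induct_disjoint[where G = "Collect closed" and \<Omega> = UNIV and A = A])
    show "Int_stable (Collect closed :: real set set)" by (auto simp: Int_stable_def)
    show "A \<in> sigma_sets UNIV (Collect closed)" by fact
    fix A :: "real set" assume "A \<in> Collect closed" then show "(\<integral>t. indicator A t *\<^sub>R h t \<partial>NL w) = 0" using closed by blast
  next
    fix A :: "real set" assume A: "A \<in> sigma_sets UNIV (Collect closed)" and 0: "(\<integral>t. indicator A t *\<^sub>R h t \<partial>NL w) = 0"
    then have [measurable]: "A \<in> sets borel" by (simp add: borel_eq_closed)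
    have "integrable (NL w) (\<lambda>t. indicator A t *\<^sub>R h t)"
      using int by (intro integrable_mult_indicator) auto
    moreover have "(\<integral>t. h t \<partial>NL w) = 0" using zero[of 0] by simp
    moreover have "(\<integral>t. indicator (UNIV - A) t *\<^sub>R h t \<partial>NL w) = (\<integral>t. h t - indicator A t *\<^sub>R h t \<partial>NL w)"
      by (intro Bochner_Integration.integral_cong) (auto simp: indicator_def)
    ultimately show "(\<integral>t. indicator (UNIV - A) t *\<^sub>R h t \<partial>NL w) = 0" using 0 int by simp
  next
    fix A :: "nat \<Rightarrow> real set"
    assume A: "disjoint_family A" "range A \<subseteq> sigma_sets UNIV (Collect closed)"
      and 0: "\<And>i. (\<integral>t. indicator (A i) t *\<^sub>R h t \<partial>NL w) = 0"
    have A': "A i \<in> sets (NL w)" for i using A(2) by (auto simp: borel_eq_closed)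
    have "set_lebesgue_integral (NL w) (\<Union>i. A i) h = (\<Sum>i. set_lebesgue_integral (NL w) (A i) h)"
    proof (rule lebesgue_integral_countable_add)
      show "set_integrable (NL w) (\<Union>i. A i) h"
        unfolding set_integrable_def using A' int by (intro integrable_mult_indicator sets.countable_UN) auto
    qed (use A' A(1) in \<open>auto simp: disjoint_family_on_def\<close>)
    then show "(\<integral>t. indicator (\<Union>i. A i) t *\<^sub>R h t \<partial>NL w) = 0" by (simp add: set_lebesgue_integral_def 0)
  qed auto
  then have "set_lebesgue_integral (NL w) A h = 0" if "A \<in> sets (NL w)" for A
    using that by (simp add: set_lebesgue_integral_def borel_eq_closed)
  then show ?thesis by (rule density_zero[OF int])
qed

lemma phi_total:
  assumes "\<And>i. cinner x (phi i) = 0"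
  shows "x = 0"
proof -
  obtain g where g: "l2_sum NL g" "x = abs_hsg g" by (rule hsg_cases)
  have "AE t in NL w. g w t = 0" for w
  proof (rule fourier_coefficients_zero)
    have "integrable (NL w) (\<lambda>t. g w t * cnj (phi_fun w 0 w t))"
      by (rule l2_inner_integrable[OF g(1) l2_sum_phi_fun])
    then show "integrable (NL w) (g w)" by (simp add: phi_fun_def)
    show "(\<integral>t. g w t * exp (\<i> * of_real (2 ^ length w * of_int k * t)) \<partial>NL w) = 0" for k
      using assms[of "(w, - k)"] cinner_phi[OF g(1), of w "- k"] by (simp add: phi_def g(2))
  qed
  then have "l2_eq NL g (\<lambda>w t. 0)" by (simp add: l2_eq_def g(1) l2_sum_zero)
  then show ?thesis using abs_hsg_eqI g(2) by (simp add: zero_hsg_def)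
qed

section \<open>Negative powers of |D|\<close>

definition dirac_eigenvalue :: "word \<times> int \<Rightarrow> real" where
  "dirac_eigenvalue = (\<lambda>(w, k). 2 ^ length w * (of_int k + 1 / 2))"

text \<open>The shift by 1/2 keeps the spectrum away from 0; negative powers of |D| are therefore
  bounded.\<close>

lemma abs_dirac_eigenvalue_ge: "1 / 2 \<le> \<bar>dirac_eigenvalue i\<bar>"
proof -
  obtain w k where i: "i = (w, k)" by (cases i)
  have "1 / 2 \<le> \<bar>of_int k + 1 / 2 :: real\<bar>" by (cases "k \<ge> 0") auto
  also have "\<dots> \<le> 2 ^ length w * \<bar>of_int k + 1 / 2 :: real\<bar>" by (simp add: mult_le_cancel_right1)
  finally show ?thesis by (simp add: i dirac_eigenvalue_def abs_mult)
qed

text \<open>Evaluates the description in \<open>functional_calculus\<close>. An eigenvector of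
  \<open>D_SG\<close> has nonzero coefficients only at indices whose eigenvalue is its own, which
  gives existence; the basis vectors are themselves eigenvectors and are total, which gives
  uniqueness.\<close>

lemma abs_D_SG_power_eq:
  assumes s: "s \<le> 0"
  shows "abs_D_SG_power s = diagonal_operator phi (\<lambda>i. \<bar>dirac_eigenvalue i\<bar> powr s)"
  unfolding abs_D_SG_power_def functional_calculus_def
proof (rule the_equality)
  let ?d = "\<lambda>i. \<bar>dirac_eigenvalue i\<bar> powr s"
  interpret D: bounded_diagonal phi ?d "(1/2) powr s"
    by standard (use orthonormal_family_phi s in \<open>auto intro!: powr_mono2' abs_dirac_eigenvalue_ge\<close>)
  have D_iff: "(x, y) \<in> D_SG \<longleftrightarrow> (\<forall>i. cinner y (phi i) = of_real (dirac_eigenvalue i) * cinner x (phi i))" for x y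
    by (simp add: D_SG_def phi_def dirac_eigenvalue_def)
  show "bounded_operator (diagonal_operator phi ?d) \<and> (\<forall>\<nu> x. (x, complex_of_real \<nu> *\<^sub>C x) \<in> D_SG \<longrightarrow>
      diagonal_operator phi ?d x = complex_of_real (\<bar>\<nu>\<bar> powr s) *\<^sub>C x)"
  proof (intro conjI allI impI D.bounded_operator_diagonal)
    fix \<nu> x assume x: "(x, complex_of_real \<nu> *\<^sub>C x) \<in> D_SG"
    have "diagonal_operator phi ?d x - complex_of_real (\<bar>\<nu>\<bar> powr s) *\<^sub>C x = 0"
    proof (rule phi_total)
      fix i
      have "of_real \<nu> * cinner x (phi i) = of_real (dirac_eigenvalue i) * cinner x (phi i)"
        using x[unfolded D_iff, rule_format, of i] by (simp only: cinner_scaleC_left)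
      then have "cinner x (phi i) = 0 \<or> \<nu> = dirac_eigenvalue i" by auto
      then show "cinner (diagonal_operator phi ?d x - complex_of_real (\<bar>\<nu>\<bar> powr s) *\<^sub>C x) (phi i) = 0"
        by (auto simp: cinner_diff_left cinner_scaleC_left D.cinner_diagonal)
    qed
    then show "diagonal_operator phi ?d x = complex_of_real (\<bar>\<nu>\<bar> powr s) *\<^sub>C x" by simp
  qed
  fix B assume B: "bounded_operator B \<and> (\<forall>\<nu> x. (x, complex_of_real \<nu> *\<^sub>C x) \<in> D_SG \<longrightarrow>
      B x = complex_of_real (\<bar>\<nu>\<bar> powr s) *\<^sub>C x)"
  show "B = diagonal_operator phi ?d"
  proof (rule diagonal_operator_unique[OF orthonormal_family_phi phi_total])
    fix i
    have "(phi i, complex_of_real (dirac_eigenvalue i) *\<^sub>C phi i) \<in> D_SG"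
      unfolding D_iff
    proof
      fix j
      have "i = j \<or> cinner (phi i) (phi j) = 0"
        using orthonormal_family_phi unfolding orthonormal_family_def by metis
      then show "cinner (complex_of_real (dirac_eigenvalue i) *\<^sub>C phi i) (phi j)
          = complex_of_real (dirac_eigenvalue j) * cinner (phi i) (phi j)"
        by (auto simp: cinner_scaleC_left)
    qed
    then show "B (phi i) = of_real (?d i) *\<^sub>C phi i" using B by blast
  qed (use B in auto)
qed

section \<open>Partial traces of sandwiched Dirac powers\<close>

definition half_integer_weight :: "int \<Rightarrow> real" where
  "half_integer_weight k = \<bar>of_int k + 1/2\<bar> powr (- gasket_dim)"

definition dirac_weight :: "word \<times> int \<Rightarrow> real" where
  "dirac_weight i = \<bar>dirac_eigenvalue i\<bar> powr (- gasket_dim)"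

lemma dirac_weight_eq: "dirac_weight (w, k) = (1/3) ^ length w * half_integer_weight k"
proof -
  have "(2 ^ length w :: real) powr (- gasket_dim) = ((1/2) ^ length w) powr gasket_dim"
    by (simp add: power_one_over powr_minus_divide powr_divide)
  then have "(2 ^ length w :: real) powr (- gasket_dim) = (1/3) ^ length w"
    by (simp only: half_power_powr_gasket_dim)
  then show ?thesis
    by (simp add: dirac_weight_def half_integer_weight_def dirac_eigenvalue_def abs_mult powr_mult)
qed

lemma half_integer_weight_nonneg: "0 \<le> half_integer_weight k"
  by (simp add: half_integer_weight_def)

lemma half_integer_weight_le: "half_integer_weight k \<le> 3"
proof -
  have "1/2 \<le> \<bar>of_int k + 1 / 2 :: real\<bar>" by (cases "k \<ge> 0") auto
  then have "half_integer_weight k \<le> (1/2) powr (- gasket_dim)"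
    unfolding half_integer_weight_def by (intro powr_mono2') auto
  also have "\<dots> = 3"
    using half_power_powr_gasket_dim[of 1] by (simp only: powr_minus_divide power_one_right) simp
  finally show ?thesis .
qed

lemma dirac_weight_nonneg: "0 \<le> dirac_weight i"
  by (simp add: dirac_weight_def)

lemma dirac_weight_le: "dirac_weight (w, k) \<le> 3 * (1/3) ^ length w"
  unfolding dirac_weight_eq using half_integer_weight_le[of k] by (simp add: mult.commute mult_right_mono)

lemma dirac_weight_le_3: "dirac_weight i \<le> 3"
proof -
  obtain w k where "i = (w, k)" by (cases i)
  then have "dirac_weight i \<le> 3 * (1/3) ^ length w" using dirac_weight_le by simp
  also have "\<dots> \<le> 3 * 1" by (intro mult_left_mono power_le_one) auto
  finally show ?thesis by simp
qed

text \<open>The indices \<open>k\<close> and \<open>- k - 1\<close> carry equal weight and |k + 1/2|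
  is half an odd number, so the sum is 6 = 2 * 2^s times the sum over odd integers. The latter is
  the zeta series minus its even part, which is 2^-s = 1/3 of it.\<close>

lemma sum_half_integer_weight_tendsto:
  "(\<lambda>K. \<Sum>k\<in>{- int K..<int K}. half_integer_weight k) \<longlonglongrightarrow> 4 * zeta gasket_dim"
proof -
  define z where "z n = 1 / real (Suc n) powr gasket_dim" for n
  have "summable (\<lambda>n. real n powr (- gasket_dim))"
    by (subst summable_real_powr_iff) (use gasket_dim_gt_1 in linarith)
  then have "summable (\<lambda>n. real (Suc n) powr (- gasket_dim))" by (subst summable_Suc_iff)
  then have "summable z" by (simp add: z_def[abs_def] powr_minus_divide)
  then have z: "(\<lambda>n. \<Sum>i<n. z i) \<longlonglongrightarrow> zeta gasket_dim"
    unfolding zeta_def z_def by (rule summable_LIMSEQ)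
  have p3: "2 powr (- gasket_dim) = 1/3" by (simp only: powr_minus_divide two_powr_gasket_dim)
  \<comment> \<open>\<open>z\<close> is indexed from 0: \<open>z (2 * K)\<close> belongs to the odd
    number 2 K + 1 and \<open>z (Suc (2 * K))\<close> to the even number 2 K + 2.\<close>
  have eq: "(\<Sum>k\<in>{- int K..<int K}. half_integer_weight k) = 6 * ((\<Sum>i<2 * K. z i) - (1/3) * (\<Sum>i<K. z i))" for K
  proof (induction K)
    case (Suc K)
    have "{- int (Suc K)..<int (Suc K)} = insert (- int K - 1) (insert (int K) {- int K..<int K})" by auto
    then have "(\<Sum>k\<in>{- int (Suc K)..<int (Suc K)}. half_integer_weight k)
        = half_integer_weight (- int K - 1) + half_integer_weight (int K) + (\<Sum>k\<in>{- int K..<int K}. half_integer_weight k)"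
      by simp
    moreover have "half_integer_weight (- int K - 1) = half_integer_weight (int K)"
    proof -
      have "\<bar>of_int (- int K - 1) + 1/2 :: real\<bar> = \<bar>of_int (int K) + 1/2\<bar>" by simp
      then show ?thesis by (simp only: half_integer_weight_def)
    qed
    moreover have "half_integer_weight (int K) = 3 * z (2 * K)"
    proof -
      have "\<bar>of_int (int K) + 1/2\<bar> = real (Suc (2 * K)) / 2" by simp
      then have "half_integer_weight (int K) = real (Suc (2 * K)) powr (- gasket_dim) / 2 powr (- gasket_dim)"
        by (simp only: half_integer_weight_def powr_divide)
      then show ?thesis unfolding p3 by (simp add: z_def powr_minus_divide)
    qed
    moreover have "z (Suc (2 * K)) = (1/3) * z K"
    proof -
      have "real (Suc (Suc (2 * K))) = 2 * real (Suc K)" by simp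
      then have "z (Suc (2 * K)) = 1 / (2 powr gasket_dim * real (Suc K) powr gasket_dim)"
        by (simp only: z_def powr_mult)
      then show ?thesis by (simp only: two_powr_gasket_dim z_def times_divide_times_eq mult_1)
    qed
    ultimately show ?case using Suc by (simp add: algebra_simps)
  qed simp
  have "(\<lambda>K. \<Sum>i<2 * K. z i) \<longlonglongrightarrow> zeta gasket_dim"
    using LIMSEQ_subseq_LIMSEQ[OF z, of "\<lambda>K. 2 * K"] by (simp add: o_def strict_mono_def)
  then have "(\<lambda>K. 6 * ((\<Sum>i<2 * K. z i) - (1/3) * (\<Sum>i<K. z i))) \<longlonglongrightarrow> 6 * (zeta gasket_dim - (1/3) * zeta gasket_dim)"
    by (intro tendsto_intros z)
  then show ?thesis unfolding eq by simp
qed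

lemma sum_half_integer_weight_le:
  assumes "finite F"
  shows "(\<Sum>k\<in>F. half_integer_weight k) \<le> 4 * zeta gasket_dim"
proof -
  obtain K :: nat where K: "F \<subseteq> {- int K..<int K}"
  proof -
    define b where "b = Max (insert 0 (abs ` F))"
    have "\<bar>k\<bar> \<le> b" if "k \<in> F" for k unfolding b_def using that assms by (intro Max_ge) auto
    then have "F \<subseteq> {- int (nat (b + 1))..<int (nat (b + 1))}" by force
    then show ?thesis by (rule that)
  qed
  have "(\<Sum>k\<in>F. half_integer_weight k) \<le> (\<Sum>k\<in>{- int K..<int K}. half_integer_weight k)"
    using K by (intro sum_mono2) (auto simp: half_integer_weight_nonneg)
  also have "\<dots> \<le> 4 * zeta gasket_dim"
  proof (rule incseq_le[OF _ sum_half_integer_weight_tendsto])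
    show "incseq (\<lambda>K. \<Sum>k\<in>{- int K..<int K}. half_integer_weight k)"
      by (intro incseq_SucI sum_mono2) (auto simp: half_integer_weight_nonneg)
  qed
  finally show ?thesis .
qed

text \<open>A full level of words has weight 1. Multiplied by \<open>4 * zeta gasket_dim\<close>,
  this is the trace of P over the components in \<open>W\<close> up to level
  \<open>j\<close>.\<close>

definition word_weight :: "word set \<Rightarrow> nat \<Rightarrow> real" where
  "word_weight W j = (\<Sum>w\<in>{w \<in> W. length w \<le> j}. (1/3) ^ length w)"

lemma finite_words_le [simp]: "finite {w :: word. length w \<le> j}"
  using finite_lists_length_le[OF finite_UNIV_corner, of j] by simp

lemma finite_words_le' [simp]: "finite {w :: word. w \<in> W \<and> length w \<le> j}"
  by (rule finite_subset[OF _ finite_words_le[of j]]) auto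

lemma card_words_le: "card {w :: word. length w \<le> j} \<le> 3 ^ Suc j"
proof -
  have "card {w :: word. length w \<le> j} = (\<Sum>i\<le>j. 3 ^ i)"
    using card_lists_length_le[OF finite_UNIV_corner, of j] by (simp add: card_UNIV_corner)
  also have "\<dots> \<le> 3 ^ Suc j" by (induction j) auto
  finally show ?thesis .
qed

section \<open>P = |D|^-s and partial traces of its compressions\<close>

definition dirac_power :: "hsg \<Rightarrow> hsg" where
  "dirac_power = diagonal_operator phi dirac_weight"

interpretation dirac_power: bounded_diagonal phi dirac_weight 3
  by standard (use orthonormal_family_phi dirac_weight_nonneg dirac_weight_le_3 in auto)

lemma positive_dirac_power: "positive_operator dirac_power"
  unfolding dirac_power_def by (rule dirac_power.positive_operator_diagonal[OF dirac_weight_nonneg])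

lemma compact_dirac_power: "compact_operator dirac_power"
  unfolding dirac_power_def
proof (rule compact_operator_diagonal[OF orthonormal_family_phi dirac_weight_nonneg _ dirac_weight_le_3])
  fix \<epsilon> :: real assume \<epsilon>: "\<epsilon> > 0"
  obtain j where j: "(1/3) ^ j < \<epsilon> / 3" using real_arch_pow_inv[of "\<epsilon> / 3" "1/3"] \<epsilon> by auto
  \<comment> \<open>The solution of b^-s = \<epsilon>: where |k + 1/2| exceeds it, the weight is
    below \<epsilon>.\<close>
  define b where "b = \<epsilon> powr (- 1 / gasket_dim)"
  have "{i. dirac_weight i > \<epsilon>} \<subseteq> {w. length w \<le> j} \<times> {- \<lceil>b + 1\<rceil>..\<lceil>b + 1\<rceil>}"
  proof
    fix i assume "i \<in> {i. dirac_weight i > \<epsilon>}"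
    then obtain w k where i: "i = (w, k)" "\<epsilon> < dirac_weight (w, k)" by (cases i) auto
    have "\<not> length w > j"
    proof
      assume "length w > j"
      then have "3 * (1/3) ^ length w \<le> 3 * (1/3 :: real) ^ j" by (intro mult_left_mono power_decreasing) auto
      then show False using dirac_weight_le[of w k] i(2) j by linarith
    qed
    moreover have "\<epsilon> < half_integer_weight k"
    proof -
      have "(1/3) ^ length w * half_integer_weight k \<le> 1 * half_integer_weight k"
        by (intro mult_right_mono power_le_one half_integer_weight_nonneg) auto
      then show ?thesis using i(2) by (simp add: dirac_weight_eq)
    qed
    then have "(\<bar>of_int k + 1/2\<bar> powr (- gasket_dim)) powr (- 1 / gasket_dim) \<le> \<epsilon> powr (- 1 / gasket_dim)"
      unfolding half_integer_weight_def using \<epsilon> by (intro powr_mono2') auto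
    then have "\<bar>of_int k + 1/2\<bar> \<le> b"
      by (simp add: powr_powr b_def)
    then have "k \<in> {- \<lceil>b + 1\<rceil>..\<lceil>b + 1\<rceil>}" unfolding atLeastAtMost_iff by linarith
    ultimately show "i \<in> {w. length w \<le> j} \<times> {- \<lceil>b + 1\<rceil>..\<lceil>b + 1\<rceil>}" using i(1) by simp
  qed
  then show "finite {i. dirac_weight i > \<epsilon>}" by (rule finite_subset) simp
qed

text \<open>M_g P M_g^* is positive for every bounded complex \<open>g\<close>, whereas M_g P in
  general is not; polarization leads back to the latter.\<close>

definition sandwich :: "(word \<Rightarrow> real \<Rightarrow> complex) \<Rightarrow> hsg \<Rightarrow> hsg" where
  "sandwich g x = mult_op g (dirac_power (mult_op (\<lambda>w t. cnj (g w t)) x))"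

lemma cinner_sandwich:
  assumes "multiplier g K"
  shows "cinner (sandwich g x) x = cinner (dirac_power (mult_op (\<lambda>w t. cnj (g w t)) x)) (mult_op (\<lambda>w t. cnj (g w t)) x)"
  unfolding sandwich_def by (rule cinner_mult_op[OF assms])

lemma positive_compact_sandwich:
  assumes g: "multiplier g K"
  shows "positive_operator (sandwich g)" "compact_operator (sandwich g)"
proof -
  note Mg = bounded_operator_mult_op[OF g] and Mg' = bounded_operator_mult_op[OF multiplier_cnj[OF g]]
  have bP: "bounded_operator dirac_power" using positive_dirac_power by (simp add: positive_operator_def)
  have "bounded_operator (sandwich g)"
    unfolding sandwich_def[abs_def] by (intro bounded_operator_compose[OF Mg] bounded_operator_compose[OF bP Mg'])
  then show "positive_operator (sandwich g)"
    using positive_dirac_power unfolding positive_operator_def cinner_sandwich[OF g] by blast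
  show "compact_operator (sandwich g)"
    unfolding sandwich_def[abs_def]
    by (intro compact_operator_compose_left[OF Mg] compact_operator_compose_right[OF compact_dirac_power Mg'])
qed

lemma has_sum_finite_sum:
  fixes f :: "'e \<Rightarrow> 'i \<Rightarrow> real"
  assumes "finite E" "\<And>e. e \<in> E \<Longrightarrow> (f e has_sum s e) A"
  shows "((\<lambda>i. \<Sum>e\<in>E. f e i) has_sum (\<Sum>e\<in>E. s e)) A"
  using assms by (induction E rule: finite_induct) (auto intro!: has_sum_add)

lemma cinner_mult_op_phi_outside:
  assumes g: "multiplier g K" and W: "\<And>t. g w t = 0"
  shows "cinner (mult_op g x) (phi (w, k)) = 0"
proof -
  obtain h where h: "l2_sum NL h" "x = abs_hsg h" by (rule hsg_cases)
  show ?thesis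
    unfolding h(2) mult_op_abs[OF g h(1)] phi_def prod.case cinner_phi[OF l2_sum_mult(1)[OF g h(1)]]
    by (simp add: W)
qed

text \<open>Expanded in the basis, the partial trace is the sum of
  \<open>dirac_weight i * c i\<close>. Two bounds are available: each \<open>c i\<close> is at most
  \<open>K\<^sup>2\<close> (Bessel for \<open>E\<close>, after the multiplier is moved to
  \<open>phi i\<close>), and the sum of the \<open>c i\<close> is at most
  \<open>K\<^sup>2 * card E\<close> (Bessel for the exponentials). The former serves words up to
  length \<open>j\<close> and gives the main term; the latter serves longer words, with weights at
  most (1/3)^j, and gives the additional 1.\<close>

lemma sandwich_trace_le:
  assumes g: "multiplier g K" and W: "\<And>w t. w \<notin> W \<Longrightarrow> g w t = 0"
    and E: "finite E" "orthonormal E" "card E \<le> 3 ^ j"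
  shows "(\<Sum>e\<in>E. Re (cinner (sandwich g e) e)) \<le> K\<^sup>2 * (word_weight W j * (4 * zeta gasket_dim) + 1)"
proof -
  let ?C = "4 * zeta gasket_dim"
  have C0: "0 \<le> ?C" using sum_half_integer_weight_le[of "{}"] by simp
  have K0: "0 \<le> K" using g unfolding multiplier_def by (meson norm_ge_zero order_trans)
  define g' where "g' = (\<lambda>w t. cnj (g w t))"
  have g': "multiplier g' K" unfolding g'_def by (rule multiplier_cnj[OF g])
  define M where "M = mult_op g'"
  define c where "c i = (\<Sum>e\<in>E. (cmod (cinner (M e) (phi i)))\<^sup>2)" for i
  have c0: "0 \<le> c i" for i unfolding c_def by (intro sum_nonneg) simp
  have c_le: "c i \<le> K\<^sup>2" for i
  proof -
    have "cmod (cinner (M e) (phi i)) = cmod (cinner (mult_op g (phi i)) e)" for e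
      unfolding M_def cinner_mult_op[OF g'] by (simp add: g'_def cmod_cinner_commute[of e])
    then have "c i = (\<Sum>e\<in>E. (cmod (cinner (mult_op g (phi i)) e))\<^sup>2)" by (simp add: c_def)
    also have "\<dots> \<le> (norm (mult_op g (phi i)))\<^sup>2" by (rule bessel_orthonormal[OF E(1,2)])
    also have "\<dots> \<le> K\<^sup>2"
      using norm_mult_op_le[OF g, of "phi i"] orthonormal_family_norm[OF orthonormal_family_phi, of i]
      by (intro power_mono) auto
    finally show ?thesis .
  qed
  have c_out: "c (w, k) = 0" if "w \<notin> W" for w k
  proof -
    have "cinner (M e) (phi (w, k)) = 0" for e
      unfolding M_def by (rule cinner_mult_op_phi_outside[OF g']) (simp add: g'_def W[OF that])
    then show ?thesis by (simp add: c_def)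
  qed
  have c_sum: "(\<Sum>i\<in>F. c i) \<le> K\<^sup>2 * 3 ^ j" if F: "finite F" for F
  proof -
    have "(\<Sum>i\<in>F. c i) = (\<Sum>e\<in>E. \<Sum>i\<in>F. (cmod (cinner (M e) (phi i)))\<^sup>2)"
      unfolding c_def by (rule sum.swap)
    also have "\<dots> \<le> (\<Sum>e\<in>E. K\<^sup>2)"
    proof (rule sum_mono)
      fix e assume e: "e \<in> E"
      have "(\<Sum>i\<in>F. (cmod (cinner (M e) (phi i)))\<^sup>2) \<le> (norm (M e))\<^sup>2"
        by (rule orthonormal_family_bessel[OF orthonormal_family_phi F])
      also have "\<dots> \<le> K\<^sup>2"
        using norm_mult_op_le[OF g', of e] E(2) e unfolding M_def
        by (intro power_mono) (auto simp: orthonormal_def)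
      finally show "(\<Sum>i\<in>F. (cmod (cinner (M e) (phi i)))\<^sup>2) \<le> K\<^sup>2" .
    qed
    also have "\<dots> = real (card E) * K\<^sup>2" by simp
    also have "\<dots> \<le> 3 ^ j * K\<^sup>2"
      using E(3) by (intro mult_right_mono) (metis of_nat_le_iff of_nat_numeral of_nat_power, simp)
    finally show ?thesis by (simp add: mult.commute)
  qed
  have hs: "((\<lambda>i. \<Sum>e\<in>E. dirac_weight i * (cmod (cinner (M e) (phi i)))\<^sup>2) has_sum
      (\<Sum>e\<in>E. Re (cinner (sandwich g e) e))) UNIV"
    unfolding cinner_sandwich[OF g] dirac_power_def M_def g'_def
    by (intro has_sum_finite_sum E(1) dirac_power.has_sum_quadratic_diagonal)
  show ?thesis
  proof (rule has_sum_le_finite_sums[OF hs])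
    fix F :: "(word \<times> int) set" assume F: "finite F"
    define F1 F2 where "F1 = {i \<in> F. fst i \<in> W \<and> length (fst i) \<le> j}" and "F2 = {i \<in> F. length (fst i) > j}"
    have fin: "finite F1" "finite F2" using F by (auto simp: F1_def F2_def)
    have "(\<Sum>i\<in>F. \<Sum>e\<in>E. dirac_weight i * (cmod (cinner (M e) (phi i)))\<^sup>2) = (\<Sum>i\<in>F. dirac_weight i * c i)"
      by (simp add: c_def sum_distrib_left)
    also have "\<dots> = (\<Sum>i\<in>F1 \<union> F2. dirac_weight i * c i)"
    proof (rule sum.mono_neutral_right)
      show "\<forall>i\<in>F - (F1 \<union> F2). dirac_weight i * c i = 0"
      proof
        fix i assume "i \<in> F - (F1 \<union> F2)"
        then have "fst i \<notin> W" by (auto simp: F1_def F2_def)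
        then show "dirac_weight i * c i = 0" using c_out[of "fst i" "snd i"] by simp
      qed
    qed (use F in \<open>auto simp: F1_def F2_def\<close>)
    also have "\<dots> = (\<Sum>i\<in>F1. dirac_weight i * c i) + (\<Sum>i\<in>F2. dirac_weight i * c i)"
      by (rule sum.union_disjoint) (use fin in \<open>auto simp: F1_def F2_def\<close>)
    also have "(\<Sum>i\<in>F1. dirac_weight i * c i) \<le> K\<^sup>2 * (word_weight W j * ?C)"
    proof -
      have "(\<Sum>i\<in>F1. dirac_weight i * c i) \<le> (\<Sum>i\<in>F1. dirac_weight i * K\<^sup>2)"
        by (intro sum_mono mult_left_mono c_le dirac_weight_nonneg)
      also have "\<dots> = K\<^sup>2 * (\<Sum>i\<in>F1. dirac_weight i)"
        unfolding sum_distrib_right[symmetric] by (rule mult.commute)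
      also have "(\<Sum>i\<in>F1. dirac_weight i) \<le> (\<Sum>i\<in>{w \<in> W. length w \<le> j} \<times> snd ` F. dirac_weight i)"
        by (intro sum_mono2) (use F dirac_weight_nonneg in \<open>force simp: F1_def\<close>)+
      also have "\<dots> = (\<Sum>w\<in>{w \<in> W. length w \<le> j}. \<Sum>k\<in>snd ` F. (1/3) ^ length w * half_integer_weight k)"
        by (simp add: sum.cartesian_product dirac_weight_eq[symmetric] split_beta)
      also have "\<dots> \<le> (\<Sum>w\<in>{w \<in> W. length w \<le> j}. (1/3) ^ length w * ?C)"
        unfolding sum_distrib_left[symmetric]
        by (intro sum_mono mult_left_mono sum_half_integer_weight_le) (use F in auto)
      also have "\<dots> = word_weight W j * ?C" by (simp add: word_weight_def sum_distrib_right)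
      finally show ?thesis by (simp add: mult_left_mono)
    qed
    also have "(\<Sum>i\<in>F2. dirac_weight i * c i) \<le> K\<^sup>2"
    proof -
      have "dirac_weight i \<le> (1/3) ^ j" if "i \<in> F2" for i
      proof -
        obtain w k where i: "i = (w, k)" by (cases i)
        have "dirac_weight i \<le> 3 * (1/3) ^ length w" unfolding i by (rule dirac_weight_le)
        \<comment> \<open>The words here have length at least \<open>j + 1\<close>, and the extra
          factor 1/3 absorbs the constant 3.\<close>
        also have "\<dots> \<le> 3 * (1/3) ^ Suc j"
          using that by (intro mult_left_mono power_decreasing) (auto simp: F2_def i)
        finally show ?thesis by simp
      qed
      then have "(\<Sum>i\<in>F2. dirac_weight i * c i) \<le> (\<Sum>i\<in>F2. (1/3) ^ j * c i)"
        by (intro sum_mono mult_right_mono c0)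
      also have "\<dots> = (1/3) ^ j * (\<Sum>i\<in>F2. c i)" by (simp add: sum_distrib_left)
      also have "\<dots> \<le> (1/3) ^ j * (K\<^sup>2 * 3 ^ j)" by (intro mult_left_mono c_sum fin) simp
      also have "\<dots> = K\<^sup>2" by (simp add: power_one_over)
      finally show ?thesis .
    qed
    finally show "(\<Sum>i\<in>F. \<Sum>e\<in>E. dirac_weight i * (cmod (cinner (M e) (phi i)))\<^sup>2)
        \<le> K\<^sup>2 * (word_weight W j * ?C + 1)"
      by (simp add: algebra_simps)
  qed
qed

definition block :: "word set \<Rightarrow> word \<Rightarrow> real \<Rightarrow> complex" where
  "block W w t = (if w \<in> W then 1 else 0)"

lemma multiplier_block: "multiplier (block W) 1"
  by (auto simp: multiplier_def block_def[abs_def])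

lemma mult_op_block_phi: "mult_op (block W) (phi (w, k)) = (if w \<in> W then phi (w, k) else 0)"
proof -
  have "mult_op (block W) (phi (w, k)) = abs_hsg (\<lambda>w' t. block W w' t * phi_fun w k w' t)"
    unfolding phi_def prod.case phi_SG_eq by (rule mult_op_abs[OF multiplier_block l2_sum_phi_fun])
  also have "(\<lambda>w' t. block W w' t * phi_fun w k w' t) = (if w \<in> W then phi_fun w k else (\<lambda>w t. 0))"
    by (auto simp: block_def phi_fun_def fun_eq_iff)
  finally show ?thesis by (simp add: phi_def phi_SG_eq zero_hsg_def)
qed

text \<open>The test vectors are the exponentials with frequencies in [-K, K) on the words of
  \<open>W\<close> up to length \<open>j\<close>. The projection fixes them and P is diagonal on
  them; the hypothesis on \<open>N\<close> bounds their number.\<close>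

lemma sandwich_block_trace_ge:
  assumes N: "2 * K * 3 ^ Suc j \<le> N"
  shows "word_weight W j * (\<Sum>k\<in>{- int K..<int K}. half_integer_weight k) \<le> (\<Sum>i<N. eigenvalues (sandwich (block W)) i)"
proof -
  define F where "F = {w \<in> W. length w \<le> j} \<times> {- int K..<int K}"
  have fin: "finite F" by (simp add: F_def)
  have cnj_block: "(\<lambda>w t. cnj (block W w t)) = block W" by (auto simp: block_def fun_eq_iff)
  note E = orthonormal_image[OF orthonormal_family_phi, of F]
  have "card {w \<in> W. length w \<le> j} \<le> 3 ^ Suc j"
    by (rule order_trans[OF card_mono card_words_le]) auto
  then have "card F \<le> 3 ^ Suc j * (2 * K)"
    unfolding F_def card_cartesian_product by (intro mult_le_mono) auto
  then have "card (phi ` F) \<le> N"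
    using card_image_le[OF fin, of phi] N by (simp add: mult_ac)
  have "word_weight W j * (\<Sum>k\<in>{- int K..<int K}. half_integer_weight k) = (\<Sum>i\<in>F. dirac_weight i)"
    by (simp add: F_def word_weight_def sum_product sum.cartesian_product dirac_weight_eq[symmetric] split_beta)
  also have "\<dots> = (\<Sum>i\<in>F. Re (cinner (sandwich (block W) (phi i)) (phi i)))"
  proof (rule sum.cong[OF refl])
    fix i assume "i \<in> F"
    then obtain w k where i: "i = (w, k)" "w \<in> W" by (auto simp: F_def)
    have one: "cinner (phi i) (phi i) = 1"
      using orthonormal_family_phi unfolding orthonormal_family_def by metis
    have "cinner (sandwich (block W) (phi i)) (phi i) = cinner (dirac_power (phi i)) (phi i)"
      unfolding cinner_sandwich[OF multiplier_block] cnj_block using i by (simp add: mult_op_block_phi)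
    also have "\<dots> = of_real (dirac_weight i)"
      unfolding dirac_power_def dirac_power.cinner_diagonal one by simp
    finally show "dirac_weight i = Re (cinner (sandwich (block W) (phi i)) (phi i))" by simp
  qed
  also have "\<dots> = (\<Sum>e\<in>phi ` F. Re (cinner (sandwich (block W) e) e))"
    using E(2) by (simp add: sum.reindex)
  also have "\<dots> \<le> (\<Sum>i<N. eigenvalues (sandwich (block W)) i)"
    by (rule ky_fan_le[OF positive_compact_sandwich[OF multiplier_block] _ E(1) \<open>card (phi ` F) \<le> N\<close>])
      (simp add: fin)
  finally show ?thesis .
qed

section \<open>Dixmier traces on the gasket\<close>

lemma word_weight_finite_sets: "word_weight {w. length w < m} j \<le> word_weight {w. length w < m} m"
  unfolding word_weight_def by (rule sum_mono2) auto

lemma word_weight_nonneg: "0 \<le> word_weight W j"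
  unfolding word_weight_def by (rule sum_nonneg) simp

lemma word_weight_UNIV: "word_weight UNIV j = real j + 1"
proof (induction j)
  case 0
  have "{w :: word. w \<in> UNIV \<and> length w \<le> 0} = {[]}" by auto
  then show ?case by (simp add: word_weight_def)
next
  case (Suc j)
  have "{w :: word. w \<in> UNIV \<and> length w \<le> Suc j} = {w. w \<in> UNIV \<and> length w \<le> j} \<union> {w. length w = Suc j}" by auto
  then have "word_weight UNIV (Suc j) = word_weight UNIV j + (\<Sum>w\<in>{w :: word. length w = Suc j}. (1/3) ^ length w)"
    unfolding word_weight_def by (simp only:) (rule sum.union_disjoint, auto)
  also have "(\<Sum>w\<in>{w :: word. length w = Suc j}. (1/3 :: real) ^ length w) = (\<Sum>w\<in>{w :: word. length w = Suc j}. (1/3) ^ Suc j)"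
    by (rule sum.cong) auto
  also have "\<dots> = 1" unfolding sum_constant card_words by (simp add: power_one_over)
  finally show ?case using Suc by simp
qed

lemma word_weight_prefix:
  assumes "length v \<le> j"
  shows "word_weight (range ((@) v)) j = (1/3) ^ length v * (real j - real (length v) + 1)"
proof -
  have "{w \<in> range ((@) v). length w \<le> j} = (@) v ` {u. u \<in> UNIV \<and> length u \<le> j - length v}"
    using assms by auto
  then have "word_weight (range ((@) v)) j = (\<Sum>u\<in>{u. u \<in> UNIV \<and> length u \<le> j - length v}. (1/3) ^ length (v @ u))"
    unfolding word_weight_def by (simp only:) (subst sum.reindex, auto simp: inj_on_def)
  also have "\<dots> = (1/3) ^ length v * word_weight UNIV (j - length v)"
    by (simp add: word_weight_def sum_distrib_left power_add)
  finally show ?thesis using assms by (simp add: word_weight_UNIV of_nat_diff)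
qed

text \<open>A full level has weight 1, so this is the average share of \<open>W\<close> in a
  level.\<close>

definition has_density :: "word set \<Rightarrow> real \<Rightarrow> bool" where
  "has_density W b \<longleftrightarrow> (\<lambda>j. word_weight W j / real j) \<longlonglongrightarrow> b"

lemma has_density_UNIV: "has_density UNIV 1"
  unfolding has_density_def word_weight_UNIV by real_asymp

lemma has_density_prefix: "has_density (range ((@) v)) ((1/3) ^ length v)"
  unfolding has_density_def
proof (rule Lim_transform_eventually)
  define m c where "m = real (length v)" and "c = (1/3 :: real) ^ length v"
  have "(\<lambda>j. c * ((real j - m + 1) / real j)) \<longlonglongrightarrow> c * 1"
    by (intro tendsto_mult_left) real_asymp
  then show "(\<lambda>j. (1/3) ^ length v * (real j - real (length v) + 1) / real j) \<longlonglongrightarrow> (1/3) ^ length v"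
    by (simp add: m_def c_def)
  show "\<forall>\<^sub>F j in sequentially. (1/3) ^ length v * (real j - real (length v) + 1) / real j = word_weight (range ((@) v)) j / real j"
    using eventually_ge_at_top[of "length v"] by eventually_elim (simp only: word_weight_prefix)
qed

lemma has_density_short: "has_density {w. length w < m} 0"
  unfolding has_density_def
proof (rule tendsto_sandwich)
  define c where "c = word_weight {w. length w < m} m"
  show "\<forall>\<^sub>F j in sequentially. 0 \<le> word_weight {w. length w < m} j / real j"
    by (intro always_eventually allI divide_nonneg_nonneg word_weight_nonneg) simp
  show "\<forall>\<^sub>F j in sequentially. word_weight {w. length w < m} j / real j \<le> c / real j"
    unfolding c_def by (intro always_eventually allI divide_right_mono word_weight_finite_sets) simp
  show "(\<lambda>j. c / real j) \<longlonglongrightarrow> 0" by real_asymp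
qed simp

text \<open>\<open>q n\<close> plays the role of the number of levels reached by the first
  \<open>n + 2\<close> eigenvalues; its growth rate 1 / log 3 turns averages over levels into
  averages against the logarithm.\<close>

lemma density_log_limit:
  assumes W: "has_density W b" and q: "(\<lambda>n. real (q n) / ln (real (n + 2))) \<longlonglongrightarrow> 1 / ln 3"
  shows "(\<lambda>n. word_weight W (q n) / ln (real (n + 2))) \<longlonglongrightarrow> b / ln 3"
proof (rule Lim_transform_eventually)
  have lim: "filterlim (\<lambda>n. real (q n) / ln (real (n + 2)) * ln (real (n + 2))) at_top sequentially"
  proof (rule filterlim_tendsto_pos_mult_at_top[OF q])
    show "filterlim (\<lambda>n. ln (real (n + 2))) at_top sequentially" by real_asymp
  qed simp
  have "ln (real (n + 2)) > 0" for n by (rule ln_gt_zero) simp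
  then have ln0: "ln (real (n + 2)) \<noteq> 0" for n by (metis less_irrefl)
  have q_top: "filterlim (\<lambda>n. real (q n)) at_top sequentially"
    using lim by (simp only: nonzero_eq_divide_eq times_divide_eq_left nonzero_mult_div_cancel_right[OF ln0])
  then have "filterlim q at_top sequentially"
    using filterlim_sequentially_iff_filterlim_real by blast
  then have "(\<lambda>n. word_weight W (q n) / real (q n)) \<longlonglongrightarrow> b"
    using W unfolding has_density_def by (rule filterlim_compose[rotated])
  from tendsto_mult[OF this q]
  show "(\<lambda>n. word_weight W (q n) / real (q n) * (real (q n) / ln (real (n + 2)))) \<longlonglongrightarrow> b / ln 3" by simp
  have "\<forall>\<^sub>F n in sequentially. real (q n) > 0" using q_top unfolding filterlim_at_top_dense by blast
  then show "\<forall>\<^sub>F n in sequentially. word_weight W (q n) / real (q n) * (real (q n) / ln (real (n + 2)))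
      = word_weight W (q n) / ln (real (n + 2))"
    by eventually_elim simp
qed

text \<open>Covers both roundings in use: up, for the upper bound, and down after division by a
  constant, for the lower bound. The constant only shifts the logarithm.\<close>

lemma nat_rounding_log_limit:
  fixes q :: "nat \<Rightarrow> nat"
  assumes "\<forall>\<^sub>F n in sequentially. log 3 (real (n + 2)) - c \<le> real (q n) \<and> real (q n) \<le> log 3 (real (n + 2)) + 1"
  shows "(\<lambda>n. real (q n) / ln (real (n + 2))) \<longlonglongrightarrow> 1 / ln 3"
proof (rule tendsto_sandwich)
  have lnpos: "0 < ln (real (n + 2))" for n by (rule ln_gt_zero) simp
  show "\<forall>\<^sub>F n in sequentially. (log 3 (real (n + 2)) - c) / ln (real (n + 2)) \<le> real (q n) / ln (real (n + 2))"
    using assms by eventually_elim (auto intro!: divide_right_mono less_imp_le[OF lnpos])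
  show "\<forall>\<^sub>F n in sequentially. real (q n) / ln (real (n + 2)) \<le> (log 3 (real (n + 2)) + 1) / ln (real (n + 2))"
    using assms by eventually_elim (auto intro!: divide_right_mono less_imp_le[OF lnpos])
  show "(\<lambda>n. (log 3 (real (n + 2)) - c) / ln (real (n + 2))) \<longlonglongrightarrow> 1 / ln 3"
    unfolding log_def inverse_eq_divide[symmetric] by real_asymp
  show "(\<lambda>n. (log 3 (real (n + 2)) + 1) / ln (real (n + 2))) \<longlonglongrightarrow> 1 / ln 3"
    unfolding log_def inverse_eq_divide[symmetric] by real_asymp
qed

section \<open>Logarithmic means of compressions\<close>

abbreviation (input) gasket_trace :: real where
  "gasket_trace \<equiv> 4 * zeta gasket_dim / ln 3"

text \<open>The sequence \<open>u\<close> is chosen before \<open>g\<close>, so the bound is uniform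
  in \<open>g\<close> and quadratic in \<open>K\<close>; this makes the trace small for small
  multipliers.\<close>

lemma log_means_sandwich_le:
  assumes W: "has_density W b"
  obtains u where "u \<longlonglongrightarrow> b * gasket_trace"
    "\<And>g K n. multiplier g K \<Longrightarrow> (\<And>w t. w \<notin> W \<Longrightarrow> g w t = 0) \<Longrightarrow> log_means (sandwich g) n \<le> K\<^sup>2 * u n"
proof -
  \<comment> \<open>The least level with \<open>n + 2 \<le> 3 ^ q n\<close>, as the estimate of
    partial traces requires.\<close>
  define q where "q n = nat \<lceil>log 3 (real (n + 2))\<rceil>" for n
  have log0: "0 \<le> log 3 (real (n + 2))" for n by simp
  have q: "log 3 (real (n + 2)) \<le> real (q n)" "real (q n) \<le> log 3 (real (n + 2)) + 1" for n
    using log0[of n] unfolding q_def by linarith+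
  have "(\<lambda>n. real (q n) / ln (real (n + 2))) \<longlonglongrightarrow> 1 / ln 3"
    by (rule nat_rounding_log_limit[where c = 0]) (use q in auto)
  note lim = density_log_limit[OF W this]
  define u where "u n = (word_weight W (q n) * (4 * zeta gasket_dim) + 1) / ln (real (n + 2))" for n
  show ?thesis
  proof (rule that)
    have "(\<lambda>n. 1 / ln (real (n + 2))) \<longlonglongrightarrow> 0" by real_asymp
    from tendsto_add[OF tendsto_mult_right[OF lim, of "4 * zeta gasket_dim"] this]
    show "u \<longlonglongrightarrow> b * gasket_trace" by (simp add: u_def[abs_def] add_divide_distrib)
    fix g K n assume g: "multiplier g K" "\<And>w t. w \<notin> W \<Longrightarrow> g w t = 0"
    have "(\<Sum>j<n + 2. eigenvalues (sandwich g) j) \<le> K\<^sup>2 * (word_weight W (q n) * (4 * zeta gasket_dim) + 1)"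
    proof (rule sum_eigenvalues_le[OF positive_compact_sandwich[OF g(1)]])
      fix E :: "hsg set" assume E: "finite E" "orthonormal E" "card E \<le> n + 2"
      have "real (n + 2) \<le> 3 powr real (q n)" using q(1)[of n] by (subst (asm) log_le_iff) auto
      then have "real (n + 2) \<le> real (3 ^ q n)" by (simp add: powr_realpow)
      then have "n + 2 \<le> 3 ^ q n" by (simp only: of_nat_le_iff)
      with E(3) have "card E \<le> 3 ^ q n" by linarith
      then show "(\<Sum>e\<in>E. Re (cinner (sandwich g e) e)) \<le> K\<^sup>2 * (word_weight W (q n) * (4 * zeta gasket_dim) + 1)"
        using E by (intro sandwich_trace_le g) auto
    qed
    then show "log_means (sandwich g) n \<le> K\<^sup>2 * u n"
      unfolding log_means_def u_def times_divide_eq_right by (intro divide_right_mono) auto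
  qed
qed

text \<open>For the lower bound the frequency cutoff \<open>K\<close> is fixed before
  \<open>n\<close> grows: it multiplies the number of test vectors by a constant, which the
  logarithm does not see, and costs only the difference between \<open>C K\<close> and its
  limit.\<close>

lemma log_means_block_tendsto:
  assumes W: "has_density W b"
  shows "log_means (sandwich (block W)) \<longlonglongrightarrow> b * gasket_trace"
proof (rule order_tendstoI)
  obtain u where u: "u \<longlonglongrightarrow> b * gasket_trace"
    "\<And>g K n. multiplier g K \<Longrightarrow> (\<And>w t. w \<notin> W \<Longrightarrow> g w t = 0) \<Longrightarrow> log_means (sandwich g) n \<le> K\<^sup>2 * u n"
    by (rule log_means_sandwich_le[OF W]) blast
  have le: "log_means (sandwich (block W)) n \<le> u n" for n
    using u(2)[OF multiplier_block[of W]] by (simp add: block_def)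
  show "\<forall>\<^sub>F n in sequentially. log_means (sandwich (block W)) n < a" if "b * gasket_trace < a" for a
    using order_tendstoD(2)[OF u(1) that] by eventually_elim (rule le_less_trans[OF le])
  fix a assume a: "a < b * gasket_trace"
  define C where "C K = (\<Sum>k\<in>{- int K..<int K}. half_integer_weight k)" for K
  have "(\<lambda>K. b * (C K / ln 3)) \<longlonglongrightarrow> b * gasket_trace"
    unfolding C_def by (intro tendsto_intros sum_half_integer_weight_tendsto) simp
  from order_tendstoD(1)[OF this a] obtain K where K: "a < b * (C K / ln 3)" "K \<ge> 1"
    using eventually_ge_at_top[of 1] eventually_happens'[OF sequentially_bot] eventually_conj by smt
  \<comment> \<open>The lower estimate needs 2 K * 3^(q n + 1) = 6 K * 3^(q n) to be at most
    \<open>n + 2\<close>.\<close>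
  define q where "q n = nat \<lfloor>log 3 (real (n + 2) / (6 * real K))\<rfloor>" for n
  have big: "\<forall>\<^sub>F n in sequentially. real (n + 2) \<ge> 6 * real K" by real_asymp
  have log_eq: "log 3 (real (n + 2) / (6 * real K)) = log 3 (real (n + 2)) - log 3 (6 * real K)" for n
    using K(2) by (simp add: log_divide)
  have q: "\<forall>\<^sub>F n in sequentially. real (q n) \<le> log 3 (real (n + 2) / (6 * real K)) \<and> log 3 (real (n + 2) / (6 * real K)) \<le> real (q n) + 1"
    using big
  proof eventually_elim
    case (elim n)
    then have "0 \<le> log 3 (real (n + 2) / (6 * real K))" using K(2) by simp
    then show ?case unfolding q_def by linarith
  qed
  have log6: "0 \<le> log 3 (6 * real K)" using K(2) by simp
  have "(\<lambda>n. real (q n) / ln (real (n + 2))) \<longlonglongrightarrow> 1 / ln 3"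
  proof (rule nat_rounding_log_limit[where c = "log 3 (6 * real K) + 1"])
    show "\<forall>\<^sub>F n in sequentially. log 3 (real (n + 2)) - (log 3 (6 * real K) + 1) \<le> real (q n)
        \<and> real (q n) \<le> log 3 (real (n + 2)) + 1"
      using q unfolding log_eq by eventually_elim (use log6 in linarith)
  qed
  from tendsto_mult_right[OF density_log_limit[OF W this], of "C K"]
  have "(\<lambda>n. word_weight W (q n) / ln (real (n + 2)) * C K) \<longlonglongrightarrow> b * (C K / ln 3)" by simp
  from order_tendstoD(1)[OF this K(1)] q
  show "\<forall>\<^sub>F n in sequentially. a < log_means (sandwich (block W)) n"
  proof eventually_elim
    case (elim n)
    have "2 * K * 3 ^ Suc (q n) \<le> n + 2"
    proof -
      have "3 powr real (q n) \<le> real (n + 2) / (6 * real K)"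
        using elim(2) K(2) by (subst powr_le_iff) auto
      then have "real (2 * K * 3 ^ Suc (q n)) \<le> real (n + 2)"
        using K(2) by (simp add: powr_realpow field_simps)
      then show ?thesis by (simp only: of_nat_le_iff)
    qed
    from sandwich_block_trace_ge[OF this, of W]
    have "word_weight W (q n) * C K / ln (real (n + 2)) \<le> log_means (sandwich (block W)) n"
      unfolding log_means_def C_def by (intro divide_right_mono) auto
    with elim(1) show ?case by simp
  qed
qed

section \<open>Commutation and polarization\<close>

lemma dirac_power_block_commute:
  "dirac_power (mult_op (block W) x) = mult_op (block W) (dirac_power x)"
proof -
  have cnj_block: "(\<lambda>w t. cnj (block W w t)) = block W" by (auto simp: block_def fun_eq_iff)
  have coeff: "cinner (mult_op (block W) y) (phi i) = (if fst i \<in> W then cinner y (phi i) else 0)" for y i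
    unfolding cinner_mult_op[OF multiplier_block] cnj_block
    by (cases i) (simp add: mult_op_block_phi)
  have "dirac_power (mult_op (block W) x) - mult_op (block W) (dirac_power x) = 0"
    by (rule phi_total) (simp add: cinner_diff_left coeff dirac_power_def dirac_power.cinner_diagonal)
  then show ?thesis by simp
qed

lemma sandwich_add:
  assumes a: "multiplier a K" and b: "multiplier b L"
  defines "X \<equiv> \<lambda>f g x. mult_op f (dirac_power (mult_op (\<lambda>w t. cnj (g w t)) x))"
  shows "sandwich (\<lambda>w t. a w t + c * b w t) x
    = X a a x + cnj c *\<^sub>C X a b x + c *\<^sub>C X b a x + (c * cnj c) *\<^sub>C X b b x"
proof -
  note ca = multiplier_cnj[OF a] and cb = multiplier_cnj[OF b]
  have bP: "bounded_operator dirac_power" using positive_dirac_power by (simp add: positive_operator_def)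
  note Ma = bounded_operator_mult_op[OF a] and Mb = bounded_operator_mult_op[OF b]
  have inner: "mult_op (\<lambda>w t. cnj (a w t + c * b w t)) x
      = mult_op (\<lambda>w t. cnj (a w t)) x + cnj c *\<^sub>C mult_op (\<lambda>w t. cnj (b w t)) x"
    using mult_op_add[OF ca multiplier_scale[OF cb, of "cnj c"], of x] mult_op_scale[OF cb, of "cnj c" x] by simp
  have outer: "mult_op (\<lambda>w t. a w t + c * b w t) y = mult_op a y + c *\<^sub>C mult_op b y" for y
    using mult_op_add[OF a multiplier_scale[OF b, of c], of y] mult_op_scale[OF b, of c y] by simp
  show ?thesis
    unfolding sandwich_def inner outer X_def
    by (simp add: bounded_operator_add_vec[OF bP] bounded_operator_scaleC[OF bP]
        bounded_operator_add_vec[OF Ma] bounded_operator_scaleC[OF Ma]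
        bounded_operator_add_vec[OF Mb] bounded_operator_scaleC[OF Mb] scaleC_add_right scaleC_scaleC add_ac)
qed

text \<open>The sesquilinear expression M_a P M_b^* is recovered from its diagonal values, in
  exactly the shape A - B + \<i> (C - D) with positive operators that the linear extension of the
  trace requires.\<close>

lemma sandwich_polarization:
  assumes a: "multiplier a K" and b: "multiplier b L"
  shows "mult_op a (dirac_power (mult_op (\<lambda>w t. cnj (b w t)) x)) =
    of_real (1/4) *\<^sub>C sandwich (\<lambda>w t. a w t + 1 * b w t) x - of_real (1/4) *\<^sub>C sandwich (\<lambda>w t. a w t + (-1) * b w t) x
    + \<i> *\<^sub>C (of_real (1/4) *\<^sub>C sandwich (\<lambda>w t. a w t + \<i> * b w t) x - of_real (1/4) *\<^sub>C sandwich (\<lambda>w t. a w t + (-\<i>) * b w t) x)"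
proof -
  have alg: "x2 = of_real (1/4) *\<^sub>C (x1 + cnj 1 *\<^sub>C x2 + 1 *\<^sub>C x3 + (1 * cnj 1) *\<^sub>C x4)
      - of_real (1/4) *\<^sub>C (x1 + cnj (-1) *\<^sub>C x2 + (-1) *\<^sub>C x3 + ((-1) * cnj (-1)) *\<^sub>C x4)
      + \<i> *\<^sub>C (of_real (1/4) *\<^sub>C (x1 + cnj \<i> *\<^sub>C x2 + \<i> *\<^sub>C x3 + (\<i> * cnj \<i>) *\<^sub>C x4)
        - of_real (1/4) *\<^sub>C (x1 + cnj (-\<i>) *\<^sub>C x2 + (-\<i>) *\<^sub>C x3 + ((-\<i>) * cnj (-\<i>)) *\<^sub>C x4))"
    (is "_ = ?r") for x1 x2 x3 x4 :: hsg
  proof -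
    have "?r = (1/4) *\<^sub>C x2 + ((1/4) *\<^sub>C x2 + ((1/4) *\<^sub>C x2 + (1/4) *\<^sub>C x2))"
      by (simp add: scaleC_add_right complex_vs.scale_right_diff_distrib scaleC_scaleC algebra_simps)
    also have "\<dots> = x2" by (simp flip: scaleC_add_left)
    finally show ?thesis by simp
  qed
  show ?thesis unfolding sandwich_add[OF a b] by (rule alg)
qed

context dixmier
begin

lemma dixmier_positive_sandwich:
  assumes g: "multiplier g K" "\<And>w t. w \<notin> W \<Longrightarrow> g w t = 0" and W: "has_density W b"
  shows "dixmier_positive (sandwich g)" "cmod (trace_of (sandwich g)) \<le> K\<^sup>2 * (b * gasket_trace)"
proof -
  obtain u where u: "u \<longlonglongrightarrow> b * gasket_trace"
    "\<And>g K n. multiplier g K \<Longrightarrow> (\<And>w t. w \<notin> W \<Longrightarrow> g w t = 0) \<Longrightarrow> log_means (sandwich g) n \<le> K\<^sup>2 * u n"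
    by (rule log_means_sandwich_le[OF W]) blast
  note pc = positive_compact_sandwich[OF g(1)]
  have le: "log_means (sandwich g) n \<le> K\<^sup>2 * u n" for n using u(2)[OF g] .
  have lim: "(\<lambda>n. K\<^sup>2 * u n) \<longlonglongrightarrow> K\<^sup>2 * (b * gasket_trace)" by (intro tendsto_intros u(1))
  have "Bseq (\<lambda>n. K\<^sup>2 * u n)" by (rule convergent_imp_Bseq[OF convergentI[OF lim]])
  then have "Bseq (log_means (sandwich g))" by (rule Bseq_dominated[OF _ log_means_nonneg[OF pc] le])
  with pc show dp: "dixmier_positive (sandwich g)" by (simp add: dixmier_positive_def)
  show "cmod (trace_of (sandwich g)) \<le> K\<^sup>2 * (b * gasket_trace)" by (rule trace_of_le[OF dp le lim])
qed

text \<open>The projection commutes with P and is idempotent, so its product with P is a compression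
  of P; the logarithmic means of the latter converge, whence a value independent of
  \<omega>.\<close>

lemma has_trace_block:
  assumes W: "has_density W b"
  shows "has_trace (\<lambda>x. mult_op (block W) (dirac_power x)) (of_real (b * gasket_trace))"
proof -
  have cnj_block: "(\<lambda>w t. cnj (block W w t)) = block W" by (auto simp: block_def fun_eq_iff)
  have sq: "(\<lambda>w t. block W w t * block W w t) = block W" by (auto simp: block_def fun_eq_iff)
  have eq: "sandwich (block W) x = mult_op (block W) (dirac_power x)" for x
    unfolding sandwich_def cnj_block dirac_power_block_commute mult_op_mult[OF multiplier_block multiplier_block] sq ..
  have dp: "dixmier_positive (sandwich (block W))"
    by (rule dixmier_positive_sandwich(1)[OF multiplier_block _ W]) (simp add: block_def)
  note zero = dixmier_positive_scale[OF dp, of 0, simplified]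
  show ?thesis
    by (rule has_traceI[OF dp zero(1) zero(1) zero(1)])
      (simp_all add: eq zero(2) trace_of_lim[OF log_means_block_tendsto[OF W]])
qed

text \<open>\<open>h\<close> is the product of \<open>a\<close>, which is h / sqrt \<epsilon>, and
  \<open>d\<close>, which is sqrt \<epsilon> times the projection onto \<open>W\<close>, both
  bounded by sqrt \<epsilon>. As M_d is symmetric and commutes with P, the operator M_h P equals M_a
  P M_d and can be polarized. Pairing \<open>h\<close> with the bare projection would leave a bound
  that does not tend to 0 with \<epsilon>.\<close>

lemma has_trace_small:
  assumes h: "multiplier h \<epsilon>" "\<And>w t. w \<notin> W \<Longrightarrow> h w t = 0" and \<epsilon>: "0 < \<epsilon>" and W: "has_density W b"
  obtains c where "has_trace (\<lambda>x. mult_op h (dirac_power x)) c" "cmod c \<le> 4 * \<epsilon> * (b * gasket_trace)"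
proof -
  define r where "r = complex_of_real (sqrt \<epsilon>)"
  have r: "r \<noteq> 0" "cmod r = sqrt \<epsilon>" "cnj r = r" "sqrt \<epsilon> * sqrt \<epsilon> = \<epsilon>" using \<epsilon> by (auto simp: r_def)
  define a where "a = (\<lambda>w t. (1 / r) * h w t)"
  define d where "d = (\<lambda>w t. r * block W w t)"
  have "cmod (1 / r) * \<epsilon> = sqrt \<epsilon>" using r \<epsilon> by (simp add: norm_divide real_div_sqrt)
  then have a: "multiplier a (sqrt \<epsilon>)" using multiplier_scale[OF h(1), of "1 / r"] by (simp add: a_def)
  have d: "multiplier d (sqrt \<epsilon>)" using multiplier_scale[OF multiplier_block, of r W] r by (simp add: d_def)
  \<comment> \<open>Each of the four multipliers is bounded by 2 sqrt \<epsilon>; the square 4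
    \<epsilon> and the factor 1/4 leave \<epsilon> for each of the four traces.\<close>
  have g: "multiplier (\<lambda>w t. a w t + c * d w t) (2 * sqrt \<epsilon>)" if "cmod c = 1" for c
    using multiplier_add[OF a multiplier_scale[OF d, of c]] that by simp
  have supp: "a w t + c * d w t = 0" if "w \<notin> W" for w t c
    using that h(2) by (simp add: a_def d_def block_def)
  have dp: "dixmier_positive (sandwich (\<lambda>w t. a w t + c * d w t))"
     "cmod (trace_of (sandwich (\<lambda>w t. a w t + c * d w t))) \<le> 4 * \<epsilon> * (b * gasket_trace)" if "cmod c = 1" for c
    using dixmier_positive_sandwich[OF g[OF that] supp W] \<epsilon> by (simp_all add: power_mult_distrib)
  define Q where "Q c = (\<lambda>x. of_real (1/4) *\<^sub>C sandwich (\<lambda>w t. a w t + c * d w t) x)" for c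
  have Q: "dixmier_positive (Q c)" "cmod (trace_of (Q c)) \<le> \<epsilon> * (b * gasket_trace)" if "cmod c = 1" for c
  proof -
    note s = dixmier_positive_scale[OF dp(1)[OF that], of "1/4"]
    show "dixmier_positive (Q c)" unfolding Q_def by (rule s(1)) simp
    have "trace_of (Q c) = of_real (1/4) * trace_of (sandwich (\<lambda>w t. a w t + c * d w t))"
      unfolding Q_def by (rule s(2)) simp
    then have "cmod (trace_of (Q c)) = \<bar>1/4\<bar> * cmod (trace_of (sandwich (\<lambda>w t. a w t + c * d w t)))"
      by (simp only: norm_mult norm_of_real)
    also have "\<dots> \<le> \<bar>1/4\<bar> * (4 * \<epsilon> * (b * gasket_trace))" by (rule mult_left_mono[OF dp(2)[OF that]]) simp
    also have "\<bar>1/4\<bar> * (4 * x * y) = x * y" for x y :: real by simp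
    note this[of \<epsilon> "b * gasket_trace"]
    finally show "cmod (trace_of (Q c)) \<le> \<epsilon> * (b * gasket_trace)" .
  qed
  have h_eq: "(\<lambda>w t. a w t * d w t) = h" using h(2) r(1) by (auto simp: a_def d_def block_def fun_eq_iff)
  have cnj_d: "(\<lambda>w t. cnj (d w t)) = d" by (auto simp: d_def block_def fun_eq_iff r(3))
  have bP: "bounded_operator dirac_power" using positive_dirac_power by (simp add: positive_operator_def)
  have d_op: "mult_op d y = r *\<^sub>C mult_op (block W) y" for y
    unfolding d_def by (rule mult_op_scale[OF multiplier_block])
  have d_commute: "dirac_power (mult_op d x) = mult_op d (dirac_power x)" for x
    by (simp add: d_op bounded_operator_scaleC[OF bP] dirac_power_block_commute)
  have decomp: "mult_op h (dirac_power x) = Q 1 x - Q (-1) x + \<i> *\<^sub>C (Q \<i> x - Q (-\<i>) x)" for x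
  proof -
    have "mult_op h (dirac_power x) = mult_op a (dirac_power (mult_op (\<lambda>w t. cnj (d w t)) x))"
      unfolding cnj_d d_commute mult_op_mult[OF a d] h_eq ..
    then show ?thesis unfolding Q_def sandwich_polarization[OF a d] .
  qed
  let ?c = "trace_of (Q 1) - trace_of (Q (-1)) + \<i> * (trace_of (Q \<i>) - trace_of (Q (-\<i>)))"
  have "has_trace (\<lambda>x. mult_op h (dirac_power x)) ?c"
    by (rule has_traceI[of "Q 1" "Q (-1)" "Q \<i>" "Q (-\<i>)"]) (simp_all add: Q decomp)
  moreover have "cmod ?c \<le> 4 * \<epsilon> * (b * gasket_trace)"
  proof -
    have "cmod ?c \<le> cmod (trace_of (Q 1)) + cmod (trace_of (Q (-1))) + (cmod (trace_of (Q \<i>)) + cmod (trace_of (Q (-\<i>))))"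
      by (rule order_trans[OF norm_triangle_ineq add_mono[OF norm_triangle_ineq4]])
        (simp add: norm_mult norm_triangle_ineq4)
    also have "\<dots> \<le> 4 * \<epsilon> * (b * gasket_trace)"
      using Q(2)[of 1] Q(2)[of "-1"] Q(2)[of \<i>] Q(2)[of "-\<i>"] by simp
    finally show ?thesis .
  qed
  ultimately show ?thesis by (rule that)
qed

end

section \<open>Step functions on the words\<close>

lemma mult_op_block_sum:
  assumes "finite V"
  shows "\<exists>K. multiplier (\<lambda>w t. \<Sum>v\<in>V. a v * block (S v) w t) K \<and>
    (\<forall>x. mult_op (\<lambda>w t. \<Sum>v\<in>V. a v * block (S v) w t) x = (\<Sum>v\<in>V. a v *\<^sub>C mult_op (block (S v)) x))"
  using assms
proof (induction V rule: finite_induct)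
  case empty
  have z: "multiplier (\<lambda>w t. 0 * block {} w t) 0" using multiplier_scale[OF multiplier_block, of 0 "{}"] by simp
  have "mult_op (\<lambda>w t. 0 * block {} w t) x = 0" for x
    using mult_op_scale[OF multiplier_block, of 0 "{}" x] by simp
  then show ?case using z by (intro exI[of _ 0]) simp
next
  case (insert v V)
  then obtain K where K: "multiplier (\<lambda>w t. \<Sum>v\<in>V. a v * block (S v) w t) K"
    "\<And>x. mult_op (\<lambda>w t. \<Sum>v\<in>V. a v * block (S v) w t) x = (\<Sum>v\<in>V. a v *\<^sub>C mult_op (block (S v)) x)" by blast
  note m = multiplier_scale[OF multiplier_block, of "a v" "S v"]
  have eq: "(\<lambda>w t. \<Sum>v\<in>insert v V. a v * block (S v) w t)
      = (\<lambda>w t. a v * block (S v) w t + (\<Sum>v\<in>V. a v * block (S v) w t))"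
    using insert.hyps by simp
  show ?case
    unfolding eq
    using multiplier_add[OF m K(1)] mult_op_add[OF m K(1)] mult_op_scale[OF multiplier_block, of "a v" "S v"]
      insert.hyps K(2) by auto
qed

text \<open>A word of length at least \<open>m\<close> has exactly one prefix of length
  \<open>m\<close>, and a shorter one has none, so that every summand vanishes.\<close>

lemma block_prefix_sum:
  assumes "finite V" "V = {v :: word. length v = m}"
  shows "(\<Sum>v\<in>V. a v * block (range ((@) v)) w t) = (if length w < m then 0 else a (take m w))"
proof (cases "length w < m")
  case True
  then have "block (range ((@) v)) w t = 0" if "v \<in> V" for v
    using that assms(2) by (auto simp: block_def)
  then show ?thesis using True by simp
next
  case False
  have mem: "w \<in> range ((@) v) \<longleftrightarrow> v = take m w" if "length v = m" for v
    using that by (metis append_eq_conv_conj rangeE rangeI append_take_drop_id)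
  have "(\<Sum>v\<in>V. a v * block (range ((@) v)) w t) = (\<Sum>v\<in>V. if v = take m w then a v else 0)"
    using mem assms(2) by (intro sum.cong) (auto simp: block_def)
  then show ?thesis using False assms by simp
qed

theorem theorem8p7:
  fixes p :: "real^2" and \<omega> :: "(nat \<Rightarrow> complex) \<Rightarrow> complex" and f :: "real^2 \<Rightarrow> complex"
  assumes "dixmier_form \<omega>"
    and "continuous_on (SG p) f"
  shows "tau_SG \<omega> p f
        = of_real (4 / ln 3 * zeta (ln 3 / ln 2)) * (\<integral>x. f x \<partial>mu_SG p)
    \<and> of_real (4 / ln 3 * zeta (ln 3 / ln 2)) * (\<integral>x. f x \<partial>mu_SG p)
        = of_real (4 / ln 3 * zeta (ln 3 / ln 2)) * psi_SG p f"
proof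
  interpret dixmier \<omega> by standard (rule assms(1))
  define F where "F = (\<lambda>w t. f (r_param p w t))"
  have "compact (f ` SG p)" by (rule compact_continuous_image[OF assms(2) compact_SG])
  then obtain K where K: "K > 0" "\<And>x. x \<in> SG p \<Longrightarrow> cmod (f x) \<le> K"
    using compact_imp_bounded[THEN bounded_pos[THEN iffD1]] by (metis imageI)
  have F: "multiplier F K"
    unfolding multiplier_def F_def
    using measurable_on_cell[OF assms(2)] K(2) r_param_in_cell F_word_SG_subset by blast
  \<comment> \<open>Used with \<epsilon> = \<open>K\<close>, the estimate provides the existence of
    a trace.\<close>
  obtain c where c: "has_trace (\<lambda>x. mult_op F (dirac_power x)) c"
    using has_trace_small[OF F _ K(1) has_density_UNIV] by auto
  have tau: "tau_SG \<omega> p f = c"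
  proof -
    have "abs_D_SG_power (- gasket_dim) = dirac_power"
      by (subst abs_D_SG_power_eq) (simp_all add: dirac_power_def dirac_weight_def[abs_def])
    moreover have "pi_SG p f = mult_op F" by (simp add: fun_eq_iff pi_SG_def mult_op_def F_def)
    ultimately have "pi_SG p f \<circ> abs_D_SG_power (- gasket_dim) = (\<lambda>x. mult_op F (dirac_power x))"
      by (simp add: o_def)
    then show ?thesis unfolding tau_SG_def using dixmier_trace_eq[OF c] by simp
  qed
  let ?t = gasket_trace and ?I = "\<integral>x. f x \<partial>mu_SG p"
  have t0: "0 \<le> ?t" using sum_half_integer_weight_le[of "{}"] by simp
  \<comment> \<open>Of the 5 \<epsilon>, four come from polarizing the error multiplier and one from
    approximating the integral.\<close>
  have "cmod (c - of_real ?t * ?I) \<le> 5 * \<epsilon> * ?t" if \<epsilon>: "\<epsilon> > 0" for \<epsilon>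
  proof -
    have "uniformly_continuous_on (SG p) f" by (rule compact_uniformly_continuous[OF assms(2) compact_SG])
    then obtain \<delta> where \<delta>: "\<delta> > 0" "\<And>x y. x \<in> SG p \<Longrightarrow> y \<in> SG p \<Longrightarrow> dist x y < \<delta> \<Longrightarrow> dist (f x) (f y) < \<epsilon>"
      unfolding uniformly_continuous_on_def using \<epsilon> by metis
    have D0: "0 \<le> diameter (SG p)" by (rule diameter_ge_0[OF compact_imp_bounded[OF compact_SG]])
    obtain m where m: "(1/2) ^ m < \<delta> / (diameter (SG p) + 1)"
      using real_arch_pow_inv[of "\<delta> / (diameter (SG p) + 1)" "1/2"] \<delta>(1) D0 by auto
    have mD: "(1/2) ^ m * diameter (SG p) < \<delta>"
    proof -
      have "(1/2) ^ m * diameter (SG p) \<le> (1/2) ^ m * (diameter (SG p) + 1)" by (intro mult_left_mono) auto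
      also have "\<dots> < \<delta>" using m D0 by (simp add: field_simps)
      finally show ?thesis .
    qed
    define a where "a v = f (F_word p v (vertex p Upper))" for v
    have near: "cmod (f x - a v) \<le> \<epsilon>" if v: "length v = m" "x \<in> F_word p v ` SG p" for v x
    proof -
      have y: "F_word p v (vertex p Upper) \<in> F_word p v ` SG p" by (intro imageI vertex_in_SG)
      have "dist x (F_word p v (vertex p Upper)) < \<delta>"
        using dist_F_word_SG[OF v(2) y] mD v(1) by simp
      then have "dist (f x) (a v) < \<epsilon>"
        unfolding a_def using v(2) y F_word_SG_subset by (intro \<delta>(2)) blast+
      then show ?thesis by (simp add: dist_norm)
    qed
    let ?V = "{v :: word. length v = m}"
    \<comment> \<open>\<open>h0\<close> is constant on the words with a common prefix of length
      \<open>m\<close>, \<open>h1\<close> collects the finitely many words too short to have one,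
      and \<open>h2\<close> is the remainder, bounded by \<epsilon> because each triangle lies in
      the cell of its prefix.\<close>
    define h0 where "h0 = (\<lambda>w t. \<Sum>v\<in>?V. a v * block (range ((@) v)) w t)"
    define h1 where "h1 = (\<lambda>w t. if length w < m then F w t else 0)"
    define h2 where "h2 = (\<lambda>w t. if length w < m then 0 else F w t - a (take m w))"
    have h0_eq: "h0 w t = (if length w < m then 0 else a (take m w))" for w t
      unfolding h0_def by (rule block_prefix_sum) auto
    obtain K0 where K0: "multiplier h0 K0"
      "\<And>x. mult_op h0 x = (\<Sum>v\<in>?V. a v *\<^sub>C mult_op (block (range ((@) v))) x)"
      using mult_op_block_sum[OF finite_words[of m], of a "\<lambda>v. range ((@) v)"] unfolding h0_def by blast
    have h1: "multiplier h1 K"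
      unfolding multiplier_def h1_def
    proof (intro conjI allI)
      show "(\<lambda>t. if length w < m then F w t else 0) \<in> borel_measurable borel" for w
        using F by (cases "length w < m") (simp_all add: multiplier_def)
      show "cmod (if length w < m then F w t else 0) \<le> K" for w t
        using F K(1) by (simp add: multiplier_def)
    qed
    have h2: "multiplier h2 \<epsilon>"
      unfolding multiplier_def h2_def
    proof (intro conjI allI)
      show "(\<lambda>t. if length w < m then 0 else F w t - a (take m w)) \<in> borel_measurable borel" for w
      proof -
        have [measurable]: "F w \<in> borel_measurable borel" using F by (simp add: multiplier_def)
        show ?thesis by measurable
      qed
      show "cmod (if length w < m then 0 else F w t - a (take m w)) \<le> \<epsilon>" for w t
      proof (cases "length w < m")
        case False
        have "F_word p w ` SG p = F_word p (take m w) ` F_word p (drop m w) ` SG p"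
          using F_word_append[of p "take m w" "drop m w"] by (simp add: image_comp)
        also have "\<dots> \<subseteq> F_word p (take m w) ` SG p" by (intro image_mono F_word_SG_subset)
        finally have "r_param p w t \<in> F_word p (take m w) ` SG p" using r_param_in_cell by blast
        then show ?thesis using False near[of "take m w"] by (simp add: F_def)
      qed (use \<epsilon> in simp)
    qed
    \<comment> \<open>\<open>h1\<close> is not small, but it lives on a set of words of density
      0.\<close>
    obtain c1 where c1: "has_trace (\<lambda>x. mult_op h1 (dirac_power x)) c1" "cmod c1 \<le> 4 * K * (0 * ?t)"
      by (rule has_trace_small[OF h1 _ K(1) has_density_short[of m]]) (auto simp: h1_def)
    obtain c2 where c2: "has_trace (\<lambda>x. mult_op h2 (dirac_power x)) c2" "cmod c2 \<le> 4 * \<epsilon> * (1 * ?t)"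
      by (rule has_trace_small[OF h2 _ \<epsilon> has_density_UNIV]) auto
    let ?s = "\<Sum>v\<in>?V. a v * of_real ((1/3) ^ m * ?t)"
    have s: "has_trace (\<lambda>x. mult_op h0 (dirac_power x)) ?s"
      unfolding K0(2)
    proof (rule has_trace_sum)
      show "?V \<noteq> {}" using length_replicate[of m Upper] by blast
      fix v assume "v \<in> ?V"
      then show "has_trace (\<lambda>x. a v *\<^sub>C mult_op (block (range ((@) v))) (dirac_power x)) (a v * of_real ((1/3) ^ m * ?t))"
        using has_trace_scale[OF has_trace_block[OF has_density_prefix[of v]], of "a v"] by simp
    qed simp
    have F_eq: "F = (\<lambda>w t. h0 w t + (h1 w t + h2 w t))"
      by (auto simp: fun_eq_iff h0_eq h1_def h2_def)
    have "mult_op F x = mult_op h0 x + (mult_op h1 x + mult_op h2 x)" for x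
      unfolding F_eq mult_op_add[OF K0(1) multiplier_add[OF h1 h2]] mult_op_add[OF h1 h2] ..
    then have "has_trace (\<lambda>x. mult_op F (dirac_power x)) (?s + (c1 + c2))"
      using has_trace_add[OF s has_trace_add[OF c1(1) c2(1)]] by simp
    then have c_eq: "c = ?s + (c1 + c2)" using has_trace_unique[OF c] by blast
    \<comment> \<open>The approximating sum of \<open>integral_mu_SG_approx\<close>: trace and
      integral are compared through the same samples \<open>a v\<close>.\<close>
    let ?A = "\<Sum>v\<in>?V. of_real ((1/3) ^ m) * a v"
    have s_eq: "?s = of_real ?t * ?A"
      unfolding sum_distrib_left by (intro sum.cong) (simp_all add: mult_ac)
    have "c - of_real ?t * ?I = (c1 + c2) - of_real ?t * (?I - ?A)"
      unfolding c_eq s_eq by (simp add: algebra_simps)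
    also have "cmod \<dots> \<le> (cmod c1 + cmod c2) + cmod (of_real ?t * (?I - ?A))"
      by (intro order_trans[OF norm_triangle_ineq4] add_right_mono norm_triangle_ineq)
    also have "cmod (of_real ?t * (?I - ?A)) = ?t * cmod (?I - ?A)"
      unfolding norm_mult using t0 by (simp only: norm_of_real abs_of_nonneg)
    also have "?t * cmod (?I - ?A) \<le> ?t * \<epsilon>"
      by (intro mult_left_mono t0 integral_mu_SG_approx[OF assms(2)] near)
    also have "cmod c1 + cmod c2 + ?t * \<epsilon> \<le> 5 * \<epsilon> * ?t"
    proof -
      have "cmod c1 \<le> 0" using c1(2) by simp
      moreover have "cmod c2 \<le> 4 * (\<epsilon> * ?t)" using c2(2) by (simp only: mult_1 mult.assoc)
      moreover have "?t * \<epsilon> = \<epsilon> * ?t" "5 * \<epsilon> * ?t = 5 * (\<epsilon> * ?t)" by (simp_all only: mult_ac)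
      ultimately show ?thesis by linarith
    qed
    finally show ?thesis by simp
  qed
  then have "cmod (c - of_real ?t * ?I) \<le> 5 * 0 * ?t"
    by (intro tendsto_lowerbound[where F = "at_right 0" and f = "\<lambda>\<epsilon>. 5 * \<epsilon> * ?t"])
      (auto intro!: tendsto_eq_intros simp: eventually_at_filter)
  then have "c = of_real ?t * ?I" by simp
  then show "tau_SG \<omega> p f = of_real (4 / ln 3 * zeta (ln 3 / ln 2)) * (\<integral>x. f x \<partial>mu_SG p)"
    unfolding tau by (simp add: mult.commute)
  show "of_real (4 / ln 3 * zeta (ln 3 / ln 2)) * (\<integral>x. f x \<partial>mu_SG p)
        = of_real (4 / ln 3 * zeta (ln 3 / ln 2)) * psi_SG p f"
    by (simp add: psi_SG_def)
qed

end
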